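(* Let $\gamma\ge 0$, $p\in(1,\infty)$ and $m\ge 1$ an integer. Let $\sigma:\mathbb{R}\to\mathbb{R}$ be a function which is not identically zero and satisfies $\sigma\in H_p^{\gamma}(\mathbb{R})$. Let $S$ be the set of all functions $F:\mathbb{R}^m\to\mathbb{R}$ of the form \[ F(x)=\sum_{j=1}^{n}\alpha_j\prod_{i=1}^{m}\sigma\!\left(w_{ij}^{T}x+b_{ij}\right), \] where $n\in\{1,2,\dots\}$, $\alpha_j\in\mathbb{R}$, $w_{ij}\in\mathbb{R}^m$, $b_{ij}\in\mathbb{R}$, and for each $j$ the $m\times m$ matrix whose rows are $w_{1j}^T,w_{2j}^T,\dots,w_{mj}^T$ (i.e. $\begin{bmatrix} w_{1j} & w_{2j} & \cdots & w_{mj}\end{bmatrix}^{T}$) is invertible. Then $S$ is dense in $H_p^{\gamma}(\mathbb{R}^m)$: for every $f\in H_p^{\gamma}(\mathbb{R}^m)$ and every $\varepsilon>0$ there exists $F\in S$ with \[ \|F-f\|_{H_p^{\gamma}(\mathbb{R}^m)}\le\varepsilon . \] In particular, if $\gamma-\frac{m}{p}>0$, then every $f\in H_p^{\gamma}(\mathbb{R}^m)$ (identified with its continuous representative) belongs to the Zygmund space $\mathcal{C}^{\gamma-\frac{m}{p}}(\mathbb{R}^m)$, and for every $\varepsilon>0$ there exists $F\in S$ with \[ \|F-f\|_{\mathcal{C}^{\gamma-\frac{m}{p}}(\mathbb{R}^m)}\le\varepsilon . \]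
   Context: For $p>1$ and $\gamma\in\mathbb{R}$, the Bessel potential space $H_p^{\gamma}(\mathbb{R}^m)$ is the class of tempered distributions $f$ on $\mathbb{R}^m$ with \[ \|f\|_{H_p^{\gamma}(\mathbb{R}^m)}:=\|(1-\Delta)^{\gamma/2}f\|_{L_p(\mathbb{R}^m)}=\left\|\mathcal{F}^{-1}\!\left[(1+|\cdot|^2)^{\gamma/2}\mathcal{F}[f]\right]\right\|_{L_p(\mathbb{R}^m)}<\infty, \] where $\mathcal{F}$, $\mathcal{F}^{-1}$ denote the $m$-dimensional Fourier transform and its inverse. Zygmund spaces: write a number $s>0$ as $s=k+\alpha$ with $k\in\{0,1,2,\dots\}$ and $\alpha\in(0,1]$. For a function $f$ on $\mathbb{R}^m$ set \[ |f|_{\mathcal{C}^{k}(\mathbb{R}^m)}:=\sum_{j=0}^{k}\sup_{|\beta|=j}\sup_{x\in\mathbb{R}^m}|D^{\beta}f(x)|,\qquad [f]_{\mathcal{C}^{k+\alpha}(\mathbb{R}^m)}:=\sup_{|\beta|=k}\ \sup_{x\in\mathbb{R}^m,\,h\in\mathbb{R}^m\setminus\{0\}}\frac{|D^{\beta}f(x+h)+D^{\beta}f(x-h)-2D^{\beta}f(x)|}{|h|^{\alpha}}, \] with $\beta$ ranging over multi-indices, and $\|f\|_{\mathcal{C}^{k+\alpha}(\mathbb{R}^m)}:=|f|_{\mathcal{C}^{k}(\mathbb{R}^m)}+[f]_{\mathcal{C}^{k+\alpha}(\mathbb{R}^m)}$. The Zygmund space $\mathcal{C}^{k+\alpha}(\mathbb{R}^m)$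 is the set of bounded continuous functions on $\mathbb{R}^m$ (with continuous derivatives up to order $k$) for which this norm is finite.
   Formalization: "Not identically zero" is read as "not zero almost everywhere", since a σ vanishing a.e. but nonzero at one point makes every F zero a.e.; the Fourier transform is normalized with exp(-2πi x·ξ), so the norm is the stated one up to the dilation x ↦ 2πx. *)

theory Defs
  imports "HOL-Analysis.Analysis"
begin

text \<open>Directional (partial) derivative in direction v and iterated partial derivatives
  along a list of basis directions (a list of basis vectors encodes a multi-index).\<close>
definition pdiff :: "'a::euclidean_space \<Rightarrow> ('a \<Rightarrow> 'b::real_normed_vector) \<Rightarrow> 'a \<Rightarrow> 'b" where
  "pdiff v f x = frechet_derivative f (at x) v"

fun iter_pdiff :: "'a::euclidean_space list \<Rightarrow> ('a \<Rightarrow> 'b::real_normed_vector) \<Rightarrow> 'a \<Rightarrow> 'b" where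
  "iter_pdiff [] f = f"
| "iter_pdiff (v # vs) f = pdiff v (iter_pdiff vs f)"

definition schwartz :: "('a::euclidean_space \<Rightarrow> complex) \<Rightarrow> bool" where
  "schwartz \<phi> \<longleftrightarrow>
     (\<forall>bs. set bs \<subseteq> Basis \<longrightarrow> (\<forall>x. iter_pdiff bs \<phi> differentiable (at x))) \<and>
     (\<forall>bs (N::nat). set bs \<subseteq> Basis \<longrightarrow>
        bounded (range (\<lambda>x. (1 + norm x) ^ N * norm (iter_pdiff bs \<phi> x))))"

definition fourier :: "('a::euclidean_space \<Rightarrow> complex) \<Rightarrow> 'a \<Rightarrow> complex" where
  "fourier \<phi> \<xi> = (LINT x|lborel. \<phi> x * exp (- (2 * of_real pi * \<i> * of_real (x \<bullet> \<xi>))))"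

definition inv_fourier :: "('a::euclidean_space \<Rightarrow> complex) \<Rightarrow> 'a \<Rightarrow> complex" where
  "inv_fourier \<psi> x = (LINT \<xi>|lborel. \<psi> \<xi> * exp (2 * of_real pi * \<i> * of_real (x \<bullet> \<xi>)))"

definition bessel_op :: "real \<Rightarrow> ('a::euclidean_space \<Rightarrow> complex) \<Rightarrow> 'a \<Rightarrow> complex" where
  "bessel_op \<gamma> \<phi> = inv_fourier (\<lambda>\<xi>. of_real ((1 + (norm \<xi>)\<^sup>2) powr (\<gamma> / 2)) * fourier \<phi> \<xi>)"

definition Lp_fun :: "real \<Rightarrow> ('a::euclidean_space \<Rightarrow> real) \<Rightarrow> bool" where
  "Lp_fun p f \<longleftrightarrow> f \<in> borel_measurable lborel \<and> integrable lborel (\<lambda>x. \<bar>f x\<bar> powr p)"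

definition Lp_norm :: "real \<Rightarrow> ('a::euclidean_space \<Rightarrow> real) \<Rightarrow> real" where
  "Lp_norm p g = (LINT x|lborel. \<bar>g x\<bar> powr p) powr (1 / p)"

text \<open>g = (1-Laplacian)^(gamma/2) f in the sense of tempered distributions, with f, g in L_p.\<close>
definition bessel_rep :: "real \<Rightarrow> real \<Rightarrow> ('a::euclidean_space \<Rightarrow> real) \<Rightarrow> ('a \<Rightarrow> real) \<Rightarrow> bool" where
  "bessel_rep \<gamma> p f g \<longleftrightarrow> Lp_fun p f \<and> Lp_fun p g \<and>
     (\<forall>\<phi>. schwartz \<phi> \<longrightarrow>
        (LINT x|lborel. complex_of_real (f x) * bessel_op \<gamma> \<phi> x)
          = (LINT x|lborel. complex_of_real (g x) * \<phi> x))"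

definition bessel_space :: "real \<Rightarrow> real \<Rightarrow> ('a::euclidean_space \<Rightarrow> real) \<Rightarrow> bool" where
  "bessel_space \<gamma> p f \<longleftrightarrow> (\<exists>g. bessel_rep \<gamma> p f g)"

text \<open>Zygmund spaces: s = k + alpha, k natural, alpha in (0,1].\<close>
definition zyg_k :: "real \<Rightarrow> nat" where
  "zyg_k s = nat (\<lceil>s\<rceil> - 1)"

definition zyg_alpha :: "real \<Rightarrow> real" where
  "zyg_alpha s = s - real (zyg_k s)"

definition multi_idx :: "nat \<Rightarrow> 'a::euclidean_space list set" where
  "multi_idx j = {bs. length bs = j \<and> set bs \<subseteq> Basis}"

definition zyg_diff2 :: "real \<Rightarrow> ('a::euclidean_space \<Rightarrow> real) \<Rightarrow> 'a list \<Rightarrow> 'a \<Rightarrow> 'a \<Rightarrow> real" where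
  "zyg_diff2 s f bs x h =
     \<bar>iter_pdiff bs f (x + h) + iter_pdiff bs f (x - h) - 2 * iter_pdiff bs f x\<bar> / norm h powr zyg_alpha s"

definition zygmund :: "real \<Rightarrow> ('a::euclidean_space \<Rightarrow> real) \<Rightarrow> bool" where
  "zygmund s f \<longleftrightarrow>
     (\<forall>bs. length bs < zyg_k s \<longrightarrow> set bs \<subseteq> Basis \<longrightarrow> (\<forall>x. iter_pdiff bs f differentiable (at x))) \<and>
     (\<forall>bs. length bs \<le> zyg_k s \<longrightarrow> set bs \<subseteq> Basis \<longrightarrow>
        continuous_on UNIV (iter_pdiff bs f) \<and> bounded (range (iter_pdiff bs f))) \<and>
     bdd_above {zyg_diff2 s f bs x h | bs x h. bs \<in> multi_idx (zyg_k s) \<and> h \<noteq> 0}"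

definition zyg_norm :: "real \<Rightarrow> ('a::euclidean_space \<Rightarrow> real) \<Rightarrow> real" where
  "zyg_norm s f =
     (\<Sum>j\<le>zyg_k s. Sup {\<bar>iter_pdiff bs f x\<bar> | bs x. bs \<in> multi_idx j})
     + Sup {zyg_diff2 s f bs x h | bs x h. bs \<in> multi_idx (zyg_k s) \<and> h \<noteq> 0}"

definition nn_class :: "(real \<Rightarrow> real) \<Rightarrow> ((real^'m) \<Rightarrow> real) set" where
  "nn_class \<sigma> = {F. \<exists>(n::nat) (\<alpha>::nat \<Rightarrow> real) (w::'m \<Rightarrow> nat \<Rightarrow> real^'m) (b::'m \<Rightarrow> nat \<Rightarrow> real).
      n \<ge> 1 \<and> (\<forall>j\<in>{1..n}. invertible (\<chi> i. w i j)) \<and>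
      F = (\<lambda>x. \<Sum>j=1..n. \<alpha> j * (\<Prod>i\<in>UNIV. \<sigma> (w i j \<bullet> x + b i j)))}"

end

theory Submission
  imports Defs "HOL-Probability.Probability"
begin

text \<open>Call \<open>m\<close> a symbol if it is the Fourier transform of a finite signed measure; convolution with the measure
  then acts on \<open>L\<^sub>p\<close>. Writing powers of \<open>1 + |\<xi>|\<^sup>2\<close> as Gaussian mixtures shows that \<open>(1 + |\<xi>|\<^sup>2)\<^sup>-\<^sup>s\<close>, the dilation
  quotients \<open>((1 + c|\<xi>|\<^sup>2)/(1 + |\<xi>|\<^sup>2))\<^sup>s\<close> and the tensor quotient \<open>(1 + |\<xi>|\<^sup>2)\<^sup>s / (\<Prod>i. (1 + \<xi>\<^sub>i\<^sup>2)\<^sup>s)\<close> are symbols. So it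
  suffices to show that the \<open>L\<^sub>p\<close>-closure of \<open>{(1 - \<Delta>)\<^sup>\<gamma>\<^sup>/\<^sup>2 F}\<close> is everything.

  In dimension one this closure contains all \<open>g (l x + b)\<close> with \<open>l \<noteq> 0\<close>, where \<open>g = (1 - \<Delta>)\<^sup>\<gamma>\<^sup>/\<^sup>2 \<sigma>\<close>, and integrating
  these against \<open>Re (|l| + s - i b)\<^sup>-\<^sup>2\<close> over \<open>(l, b)\<close> gives a multiple of \<open>1 / (1 + x\<^sup>2)\<close>, the multiple being a
  Poisson integral of \<open>g\<close> and thus nonzero for some translate and some \<open>s\<close>. The dilates of this kernel
  form an approximate identity. In dimension \<open>m\<close>, the tensor symbol bounds the norm of a product of functions
  of single coordinates by the product of their norms, so Gaussians are limits of products of one-dimensional sums.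

  For the Zygmund estimate, \<open>f\<close> is the integral over \<open>t\<close> of \<open>t\<^sup>\<gamma>\<^sup>/\<^sup>2\<^sup>-\<^sup>1 e\<^sup>-\<^sup>t\<close> times the heat semigroup applied to
  \<open>(1 - \<Delta>)\<^sup>\<gamma>\<^sup>/\<^sup>2 f\<close>, whose \<open>j\<close>-th derivatives are \<open>O(t\<^sup>-\<^sup>j\<^sup>/\<^sup>2\<^sup>-\<^sup>m\<^sup>/\<^sup>2\<^sup>p)\<close>.\<close>

section \<open>Functions in $L_p$\<close>

lemma integrable_dominated:
  fixes f :: "'w \<Rightarrow> 'b::{banach, second_countable_topology}"
  assumes "integrable M B" "f \<in> borel_measurable M" "\<And>x. x \<in> space M \<Longrightarrow> norm (f x) \<le> B x"
  shows "integrable M f"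
  by (rule Bochner_Integration.integrable_bound[OF assms(1,2)])
     (auto intro!: AE_I2 order.trans[OF assms(3) abs_ge_self])

lemma tendsto_integral_dominated:
  fixes f :: "nat \<Rightarrow> 'w \<Rightarrow> 'b::{banach, second_countable_topology}"
  assumes "integrable M B" and f: "\<And>n. f n \<in> borel_measurable M"
    and lim: "\<And>x. x \<in> space M \<Longrightarrow> (\<lambda>n. f n x) \<longlonglongrightarrow> g x" and "\<And>n x. x \<in> space M \<Longrightarrow> norm (f n x) \<le> B x"
  shows "(\<lambda>n. \<integral>x. f n x \<partial>M) \<longlonglongrightarrow> (\<integral>x. g x \<partial>M)"
  by (rule integral_dominated_convergence[OF borel_measurable_LIMSEQ_metric[OF f lim] f assms(1)])
     (use assms in auto)

definition Lp_pow :: "real \<Rightarrow> ('a::euclidean_space \<Rightarrow> real) \<Rightarrow> real" where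
  "Lp_pow p g = (LINT x|lborel. \<bar>g x\<bar> powr p)"

lemma abs_add_powr_le:
  fixes a b p :: real assumes "p \<ge> 0"
  shows "\<bar>a + b\<bar> powr p \<le> 2 powr p * (\<bar>a\<bar> powr p + \<bar>b\<bar> powr p)"
proof -
  have "\<bar>a + b\<bar> powr p \<le> (2 * max \<bar>a\<bar> \<bar>b\<bar>) powr p"
    using assms by (intro powr_mono2) auto
  also have "\<dots> = 2 powr p * max \<bar>a\<bar> \<bar>b\<bar> powr p"
    by (simp add: powr_mult)
  also have "max \<bar>a\<bar> \<bar>b\<bar> powr p \<le> \<bar>a\<bar> powr p + \<bar>b\<bar> powr p"
    by (auto simp: max_def)
  finally show ?thesis by simp
qed

lemma abs_powr_le_mult:
  fixes a b c p :: real assumes "p > 1" "\<bar>a\<bar> \<le> c" "\<bar>a\<bar> \<le> b"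
  shows "\<bar>a\<bar> powr p \<le> c powr (p - 1) * b"
proof -
  have "\<bar>a\<bar> powr p = \<bar>a\<bar> powr (p - 1) * \<bar>a\<bar>" by (simp add: powr_diff)
  also have "\<dots> \<le> c powr (p - 1) * b" using assms by (intro mult_mono powr_mono2) auto
  finally show ?thesis .
qed

lemma Lp_pow_nonneg [simp]: "Lp_pow p g \<ge> 0"
  by (simp add: Lp_pow_def)

lemma Lp_pow_cong_AE:
  "f \<in> borel_measurable lborel \<Longrightarrow> g \<in> borel_measurable lborel \<Longrightarrow> AE x in lborel. f x = g x \<Longrightarrow> Lp_pow p f = Lp_pow p g"
  unfolding Lp_pow_def by (intro integral_cong_AE) auto

lemma Lp_fun_dominated:
  assumes "g \<in> borel_measurable borel" "integrable lborel B" "AE x in lborel. \<bar>g x\<bar> powr p \<le> B x"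
  shows "Lp_fun p g" "Lp_pow p g \<le> integral\<^sup>L lborel B"
proof -
  have [measurable]: "g \<in> borel_measurable borel" by fact
  show Lp: "Lp_fun p g"
    unfolding Lp_fun_def using assms
    by (auto intro!: Bochner_Integration.integrable_bound[OF assms(2)] elim!: eventually_mono)
  show "Lp_pow p g \<le> integral\<^sup>L lborel B"
    unfolding Lp_pow_def using assms Lp by (intro integral_mono_AE) (auto simp: Lp_fun_def)
qed

lemma Lp_fun_cong_AE:
  assumes "Lp_fun p f" "g \<in> borel_measurable borel" "AE x in lborel. f x = g x"
  shows "Lp_fun p g"
  by (rule Lp_fun_dominated[where B="\<lambda>x. \<bar>f x\<bar> powr p"])
     (use assms in \<open>auto simp: Lp_fun_def elim!: eventually_mono\<close>)

lemma Lp_fun_zero [simp]: "Lp_fun p (\<lambda>_. 0)"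
  by (simp add: Lp_fun_def)

lemma Lp_pow_zero [simp]: "Lp_pow p (\<lambda>_. 0) = 0"
  by (simp add: Lp_pow_def)

lemma
  assumes "Lp_fun p f"
  shows Lp_fun_cmult: "Lp_fun p (\<lambda>x. c * f x)"
    and Lp_pow_cmult: "Lp_pow p (\<lambda>x. c * f x) = \<bar>c\<bar> powr p * Lp_pow p f"
  using assms by (auto simp: Lp_fun_def Lp_pow_def abs_mult powr_mult)

lemma
  assumes f: "Lp_fun p f" and g: "Lp_fun p g" and p: "p \<ge> 0"
  shows Lp_fun_add: "Lp_fun p (\<lambda>x. f x + g x)"
    and Lp_pow_add_le: "Lp_pow p (\<lambda>x. f x + g x) \<le> 2 powr p * (Lp_pow p f + Lp_pow p g)"
proof -
  have [measurable]: "f \<in> borel_measurable borel" "g \<in> borel_measurable borel"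
    using f g by (auto simp: Lp_fun_def)
  have dominating: "integrable lborel (\<lambda>x. 2 powr p * (\<bar>f x\<bar> powr p + \<bar>g x\<bar> powr p))"
    using f g by (auto simp: Lp_fun_def)
  have pointwise: "AE x in lborel. \<bar>f x + g x\<bar> powr p \<le> 2 powr p * (\<bar>f x\<bar> powr p + \<bar>g x\<bar> powr p)"
    using abs_add_powr_le[OF p] by auto
  show "Lp_fun p (\<lambda>x. f x + g x)"
    by (rule Lp_fun_dominated(1)[OF _ dominating pointwise]) simp
  have "Lp_pow p (\<lambda>x. f x + g x) \<le> (\<integral>x. 2 powr p * (\<bar>f x\<bar> powr p + \<bar>g x\<bar> powr p) \<partial>lborel)"
    by (rule Lp_fun_dominated(2)[OF _ dominating pointwise]) simp
  also have "\<dots> = 2 powr p * (Lp_pow p f + Lp_pow p g)"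
    using f g by (simp add: Lp_pow_def Lp_fun_def)
  finally show "Lp_pow p (\<lambda>x. f x + g x) \<le> 2 powr p * (Lp_pow p f + Lp_pow p g)" .
qed

lemma
  assumes f: "Lp_fun p f" and g: "Lp_fun p g" and p: "p \<ge> 0"
  shows Lp_fun_diff: "Lp_fun p (\<lambda>x. f x - g x)"
    and Lp_pow_diff_le: "Lp_pow p (\<lambda>x. f x - g x) \<le> 2 powr p * (Lp_pow p f + Lp_pow p g)"
  using Lp_fun_add[OF f Lp_fun_cmult[OF g, of "-1"] p] Lp_pow_add_le[OF f Lp_fun_cmult[OF g, of "-1"] p]
    Lp_pow_cmult[OF g, of "-1"] by simp_all

lemma Lp_pow_triangle_less:
  assumes "Lp_fun p f" "Lp_fun p g" "Lp_fun p h" and p: "p \<ge> 0"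
    and less: "Lp_pow p (\<lambda>x. f x - g x) < e / (2 * 2 powr p)" "Lp_pow p (\<lambda>x. g x - h x) < e / (2 * 2 powr p)"
  shows "Lp_pow p (\<lambda>x. f x - h x) < e"
proof -
  have "Lp_pow p (\<lambda>x. (f x - g x) + (g x - h x)) \<le> 2 powr p * (Lp_pow p (\<lambda>x. f x - g x) + Lp_pow p (\<lambda>x. g x - h x))"
    by (intro Lp_pow_add_le Lp_fun_diff assms)
  also have "\<dots> < 2 powr p * (e / (2 * 2 powr p) + e / (2 * 2 powr p))"
    using less by (intro mult_strict_left_mono add_strict_mono) auto
  finally show ?thesis by simp
qed

lemma Lp_pow_minus_commute: "Lp_pow p (\<lambda>x. f x - g x) = Lp_pow p (\<lambda>x. g x - f x)"
  by (simp add: Lp_pow_def abs_minus_commute)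

lemma Lp_pow_eq_0D:
  assumes "Lp_fun p f" "Lp_pow p f = 0" shows "AE x in lborel. f x = 0"
proof -
  have "AE x in lborel. \<bar>f x\<bar> powr p = 0"
    using assms by (subst (asm) Lp_pow_def) (subst (asm) integral_nonneg_eq_0_iff_AE, auto simp: Lp_fun_def)
  then show ?thesis by auto
qed

lemma Lp_norm_Lp_pow: "Lp_norm p g = Lp_pow p g powr (1/p)"
  by (simp add: Lp_norm_def Lp_pow_def)

lemma
  fixes f :: "'a::euclidean_space \<Rightarrow> 'b::{banach, second_countable_topology}"
  assumes c: "c \<noteq> 0" and [measurable]: "f \<in> borel_measurable borel"
  shows integral_affine: "(LINT x|lborel. f (c *\<^sub>R x + t)) = (1 / \<bar>c\<bar> ^ DIM('a)) *\<^sub>R (LINT x|lborel. f x)"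
    and integrable_affine_iff: "integrable lborel (\<lambda>x. f (c *\<^sub>R x + t)) \<longleftrightarrow> integrable lborel f"
proof -
  have "(LINT x|lborel. f x) = \<bar>c\<bar> ^ DIM('a) *\<^sub>R (LINT x|lborel. f (t + c *\<^sub>R x))"
    by (subst lborel_affine[OF c, of t], subst integral_density) (auto simp: integral_distr)
  then show "(LINT x|lborel. f (c *\<^sub>R x + t)) = (1 / \<bar>c\<bar> ^ DIM('a)) *\<^sub>R (LINT x|lborel. f x)"
    using c by (simp add: add.commute)
  have "integrable lborel f \<longleftrightarrow> integrable lborel (\<lambda>x. \<bar>c\<bar> ^ DIM('a) *\<^sub>R f (t + c *\<^sub>R x))"
    by (subst lborel_affine[OF c, of t], subst integrable_density) (auto simp: integrable_distr_eq)
  also have "\<dots> \<longleftrightarrow> integrable lborel (\<lambda>x. f (t + c *\<^sub>R x))"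
    using c integrable_scaleR_right[of "1 / \<bar>c\<bar> ^ DIM('a)" lborel "\<lambda>x. \<bar>c\<bar> ^ DIM('a) *\<^sub>R f (t + c *\<^sub>R x)"]
    by auto
  finally have "integrable lborel f \<longleftrightarrow> integrable lborel (\<lambda>x. f (t + c *\<^sub>R x))" .
  then show "integrable lborel (\<lambda>x. f (c *\<^sub>R x + t)) \<longleftrightarrow> integrable lborel f"
    by (simp add: add.commute)
qed

lemma AE_affine:
  fixes t :: "'a::euclidean_space"
  assumes c: "c \<noteq> 0" and P: "AE x in lborel. P x"
  shows "AE x in lborel. P (c *\<^sub>R x + t)"
proof -
  from P obtain N where N: "{x. \<not> P x} \<subseteq> N" "emeasure lborel N = 0" "N \<in> sets lborel"
    by (auto elim!: AE_E)
  have "AE x in lborel. x \<notin> N" using N by (intro AE_not_in) auto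
  then have "AE x in density (distr lborel borel (\<lambda>x. t + c *\<^sub>R x)) (\<lambda>_. \<bar>c\<bar>^DIM('a)). x \<notin> N"
    by (subst (asm) lborel_affine[OF c, of t])
  then have "AE x in distr lborel borel (\<lambda>x. t + c *\<^sub>R x). x \<notin> N"
    using c by (subst (asm) AE_density) auto
  then have "AE x in lborel. t + c *\<^sub>R x \<notin> N"
    using N(3) by (subst (asm) AE_distr_iff) auto
  then show ?thesis using N(1) by (auto elim!: eventually_mono simp: add.commute)
qed

lemma
  fixes g :: "'a::euclidean_space \<Rightarrow> real"
  assumes c: "c \<noteq> 0" and g: "Lp_fun p g"
  shows Lp_fun_affine: "Lp_fun p (\<lambda>x. g (c *\<^sub>R x + t))"
    and Lp_pow_affine: "Lp_pow p (\<lambda>x. g (c *\<^sub>R x + t)) = Lp_pow p g / \<bar>c\<bar> ^ DIM('a)"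
proof -
  have [measurable]: "g \<in> borel_measurable borel" using g by (auto simp: Lp_fun_def)
  show "Lp_fun p (\<lambda>x. g (c *\<^sub>R x + t))"
    using g integrable_affine_iff[OF c, of "\<lambda>x. \<bar>g x\<bar> powr p" t] by (simp add: Lp_fun_def)
  show "Lp_pow p (\<lambda>x. g (c *\<^sub>R x + t)) = Lp_pow p g / \<bar>c\<bar> ^ DIM('a)"
    using integral_affine[OF c, of "\<lambda>x. \<bar>g x\<bar> powr p" t] by (simp add: Lp_pow_def)
qed

lemma
  fixes g :: "'a::euclidean_space \<Rightarrow> real"
  assumes g: "Lp_fun p g"
  shows Lp_fun_translate: "Lp_fun p (\<lambda>x. g (x + t))"
    and Lp_pow_translate: "Lp_pow p (\<lambda>x. g (x + t)) = Lp_pow p g"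
  using Lp_fun_affine[OF _ g, of 1 t] Lp_pow_affine[OF _ g, of 1 t] by auto

lemma powr_above_tangent:
  fixes p c G :: real assumes p: "p > 1" and "c \<ge> 0" "G \<ge> 0"
  shows "G powr p \<ge> c powr p + p * c powr (p - 1) * (G - c)"
proof -
  consider "c = 0" | "c > 0" "G = 0" | "c > 0" "G > 0" using assms by linarith
  then show ?thesis
  proof cases
    case 1 then show ?thesis using p by simp
  next
    case 2
    have "c powr (p - 1) * c = c powr p"
      using 2 by (simp add: powr_diff)
    then have "c powr p + p * c powr (p - 1) * (0 - c) = (1 - p) * c powr p"
      by (simp add: algebra_simps)
    also have "\<dots> \<le> 0" using p by (intro mult_nonpos_nonneg) auto
    finally show ?thesis using 2 p by simp
  next
    case 3
    have "G powr p - c powr p \<ge> (p * c powr (p - 1)) * (G - c)"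
    proof (rule convex_on_imp_above_tangent[where A="{0<..}"])
      show "convex_on {0<..} (\<lambda>x. x powr p)" using p by (intro powr_convex) simp
      show "((\<lambda>x. x powr p) has_real_derivative p * c powr (p - 1)) (at c within {0<..})"
        using 3 by (auto intro!: derivative_eq_intros)
    qed (use 3 in \<open>auto simp: interior_open\<close>)
    then show ?thesis by simp
  qed
qed

lemma le_1_plus_powr:
  fixes p y :: real assumes "p > 1" "y \<ge> 0" shows "y \<le> 1 + y powr p"
proof (cases "y \<le> 1")
  case False
  then have "y powr 1 \<le> y powr p" using assms by (intro powr_mono) auto
  then show ?thesis using False by simp
qed (use powr_ge_zero[of y p] in linarith)

lemma integrable_mult_if_powr:
  fixes k h :: "'w \<Rightarrow> real"
  assumes p: "p > 1" and k: "integrable M k" and h[measurable]: "h \<in> borel_measurable M"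
    and kh: "integrable M (\<lambda>w. \<bar>k w\<bar> * \<bar>h w\<bar> powr p)"
  shows "integrable M (\<lambda>w. k w * h w)"
proof (rule integrable_dominated)
  show "integrable M (\<lambda>w. \<bar>k w\<bar> + \<bar>k w\<bar> * \<bar>h w\<bar> powr p)" using k kh by simp
  show "(\<lambda>w. k w * h w) \<in> borel_measurable M" using k by measurable
  show "norm (k w * h w) \<le> \<bar>k w\<bar> + \<bar>k w\<bar> * \<bar>h w\<bar> powr p" for w
    using mult_left_mono[OF le_1_plus_powr[OF p abs_ge_zero[of "h w"]] abs_ge_zero[of "k w"]]
    by (simp add: abs_mult distrib_left)
qed

lemma jensen_powr:
  fixes k G :: "'w \<Rightarrow> real"
  assumes p: "p > 1" and k: "integrable M k" "\<And>w. k w \<ge> 0"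
    and kG: "integrable M (\<lambda>w. k w * G w)" "integrable M (\<lambda>w. k w * G w powr p)" and G: "\<And>w. G w \<ge> 0"
  shows "(\<integral>w. k w * G w \<partial>M) powr p \<le> (\<integral>w. k w \<partial>M) powr (p - 1) * (\<integral>w. k w * G w powr p \<partial>M)"
proof -
  define K where "K = (\<integral>w. k w \<partial>M)"
  define c where "c = (\<integral>w. k w * G w \<partial>M) / K"
  have "K \<ge> 0" using k(2) by (simp add: K_def)
  then consider "K = 0" | "K > 0" by linarith
  then show ?thesis
  proof cases
    case 1
    then have "AE w in M. k w = 0"
      using k integral_nonneg_eq_0_iff_AE[of M k] by (auto simp: K_def)
    then have "(\<integral>w. k w * G w \<partial>M) = (\<integral>w. 0 \<partial>M)"
      using kG(1) by (intro integral_cong_AE) auto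
    then show ?thesis using p k(2) by simp
  next
    case 2
    have c_nonneg: "c \<ge> 0" using 2 k(2) G by (auto simp: c_def)
    define A where "A = c powr p - p * c powr (p - 1) * c"
    define B where "B = p * c powr (p - 1)"
    have tangent: "A * k w + B * (k w * G w) \<le> k w * G w powr p" for w
      using mult_left_mono[OF powr_above_tangent[OF p c_nonneg G] k(2), of w w] by (simp add: A_def B_def algebra_simps)
    have "A * K + B * (c * K) = (\<integral>w. A * k w + B * (k w * G w) \<partial>M)"
      using k kG 2 by (simp add: K_def c_def)
    also have "\<dots> \<le> (\<integral>w. k w * G w powr p \<partial>M)"
      using k kG tangent by (intro integral_mono) auto
    finally have "c powr p * K \<le> (\<integral>w. k w * G w powr p \<partial>M)" by (simp add: A_def B_def algebra_simps)
    then have "K powr (p - 1) * (c powr p * K) \<le> K powr (p - 1) * (\<integral>w. k w * G w powr p \<partial>M)"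
      by (intro mult_left_mono) auto
    also have "K powr (p - 1) * (c powr p * K) = (c * K) powr p"
      using 2 c_nonneg by (simp add: powr_mult powr_diff)
    also have "c * K = (\<integral>w. k w * G w \<partial>M)" using 2 by (simp add: c_def)
    finally show ?thesis by (simp add: K_def)
  qed
qed

lemma abs_integral_powr_le:
  fixes k h :: "'w \<Rightarrow> real"
  assumes p: "p > 1" and k: "integrable M k" and h: "h \<in> borel_measurable M"
    and kh: "integrable M (\<lambda>w. \<bar>k w\<bar> * \<bar>h w\<bar> powr p)"
  shows "\<bar>\<integral>w. k w * h w \<partial>M\<bar> powr p \<le> (\<integral>w. \<bar>k w\<bar> \<partial>M) powr (p - 1) * (\<integral>w. \<bar>k w\<bar> * \<bar>h w\<bar> powr p \<partial>M)"
proof -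
  have "\<bar>\<integral>w. k w * h w \<partial>M\<bar> powr p \<le> (\<integral>w. \<bar>k w\<bar> * \<bar>h w\<bar> \<partial>M) powr p"
    using p integral_abs_bound[of M "\<lambda>w. k w * h w"] by (intro powr_mono2) (auto simp: abs_mult)
  also have "\<dots> \<le> (\<integral>w. \<bar>k w\<bar> \<partial>M) powr (p - 1) * (\<integral>w. \<bar>k w\<bar> * \<bar>h w\<bar> powr p \<partial>M)"
    using k integrable_abs[OF integrable_mult_if_powr[OF p k h kh]] kh by (intro jensen_powr p) (auto simp: abs_mult)
  finally show ?thesis .
qed

context
  fixes h :: "'w \<Rightarrow> 'a::euclidean_space \<Rightarrow> real" and k :: "'w \<Rightarrow> real" and N :: "'w measure" and p :: real
  assumes p: "p > 1" and N: "sigma_finite_measure N"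
    and h: "(\<lambda>(w, x). h w x) \<in> borel_measurable (N \<Otimes>\<^sub>M borel)"
    and k: "integrable N k"
    and Lp_h: "\<And>w. w \<in> space N \<Longrightarrow> Lp_fun p (h w)"
    and int: "integrable N (\<lambda>w. \<bar>k w\<bar> * Lp_pow p (h w))"
begin

interpretation sigma_finite_measure N by (rule N)

interpretation pair_sigma_finite N "lborel :: 'a measure" ..

lemma measurable_mixture: "(\<lambda>w. h w x) \<in> borel_measurable N"
  using h by measurable

lemma integrable_mixture_powr: "integrable (N \<Otimes>\<^sub>M lborel) (\<lambda>(w, x). \<bar>k w\<bar> * \<bar>h w x\<bar> powr p)" (is "integrable _ ?f")
proof (rule Fubini_integrable)
  have [measurable]: "k \<in> borel_measurable N" "(\<lambda>(w, x). h w x) \<in> borel_measurable (N \<Otimes>\<^sub>M (lborel :: 'a measure))"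
    using k h by (auto cong: measurable_cong_sets)
  show "?f \<in> borel_measurable (N \<Otimes>\<^sub>M lborel)" by measurable
  show "integrable N (\<lambda>w. \<integral>x. norm (?f (w, x)) \<partial>lborel)"
    using int by (simp add: Lp_pow_def abs_mult)
  show "AE w in N. integrable lborel (\<lambda>x. ?f (w, x))"
    using Lp_h by (auto simp: Lp_fun_def)
qed

lemma AE_integrable_mixture_powr: "AE x in lborel. integrable N (\<lambda>w. \<bar>k w\<bar> * \<bar>h w x\<bar> powr p)"
  using AE_integrable_snd[OF integrable_mixture_powr] by simp

lemma AE_integrable_mixture: "AE x in lborel. integrable N (\<lambda>w. k w * h w x)"
  using AE_integrable_mixture_powr by eventually_elim (rule integrable_mult_if_powr[OF p k measurable_mixture])

lemma
  shows Lp_fun_mixture: "Lp_fun p (\<lambda>x. \<integral>w. k w * h w x \<partial>N)"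
    and Lp_pow_mixture_le: "Lp_pow p (\<lambda>x. \<integral>w. k w * h w x \<partial>N)
      \<le> (\<integral>w. \<bar>k w\<bar> \<partial>N) powr (p - 1) * (\<integral>w. \<bar>k w\<bar> * Lp_pow p (h w) \<partial>N)"
proof -
  let ?C = "(\<integral>w. \<bar>k w\<bar> \<partial>N) powr (p - 1)"
  have [measurable]: "k \<in> borel_measurable N" "(\<lambda>(w, x). h w x) \<in> borel_measurable (N \<Otimes>\<^sub>M borel)"
    using k h by auto
  have meas: "(\<lambda>x. \<integral>w. k w * h w x \<partial>N) \<in> borel_measurable borel"
    by measurable
  have int: "integrable lborel (\<lambda>x. ?C * (\<integral>w. \<bar>k w\<bar> * \<bar>h w x\<bar> powr p \<partial>N))"
    using integrable_snd[OF integrable_mixture_powr] by simp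
  have bound: "AE x in lborel. \<bar>\<integral>w. k w * h w x \<partial>N\<bar> powr p \<le> ?C * (\<integral>w. \<bar>k w\<bar> * \<bar>h w x\<bar> powr p \<partial>N)"
    using AE_integrable_mixture_powr by eventually_elim (rule abs_integral_powr_le[OF p k measurable_mixture])
  show "Lp_fun p (\<lambda>x. \<integral>w. k w * h w x \<partial>N)"
    by (rule Lp_fun_dominated(1)[OF meas int bound])
  have "Lp_pow p (\<lambda>x. \<integral>w. k w * h w x \<partial>N) \<le> (\<integral>x. ?C * (\<integral>w. \<bar>k w\<bar> * \<bar>h w x\<bar> powr p \<partial>N) \<partial>lborel)"
    by (rule Lp_fun_dominated(2)[OF meas int bound])
  also have "\<dots> = ?C * (\<integral>w. \<integral>x. \<bar>k w\<bar> * \<bar>h w x\<bar> powr p \<partial>lborel \<partial>N)"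
    using Fubini_integral[OF integrable_mixture_powr] by simp
  finally show "Lp_pow p (\<lambda>x. \<integral>w. k w * h w x \<partial>N) \<le> ?C * (\<integral>w. \<bar>k w\<bar> * Lp_pow p (h w) \<partial>N)"
    by (simp add: Lp_pow_def)
qed

end

section \<open>Continuous functions with compact support\<close>

definition cont_compact_supp :: "('a::euclidean_space \<Rightarrow> real) \<Rightarrow> bool" where
  "cont_compact_supp \<theta> \<longleftrightarrow> continuous_on UNIV \<theta> \<and> (\<exists>R. \<forall>x. R < norm x \<longrightarrow> \<theta> x = 0)"

lemma cont_compact_supp_measurable: "cont_compact_supp \<theta> \<Longrightarrow> \<theta> \<in> borel_measurable borel"
  by (auto simp: cont_compact_supp_def intro: borel_measurable_continuous_onI)

lemma cont_compact_supp_integrable: assumes "cont_compact_supp \<theta>" shows "integrable lborel \<theta>"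
proof -
  obtain R where R: "\<And>x. R < norm x \<Longrightarrow> \<theta> x = 0" and cont: "continuous_on UNIV \<theta>"
    using assms by (auto simp: cont_compact_supp_def)
  have "integrable lborel (\<lambda>x. indicator (cball 0 R) x *\<^sub>R \<theta> x)"
    using cont by (intro borel_integrable_compact) (auto intro: continuous_on_subset)
  also have "(\<lambda>x. indicator (cball 0 R) x *\<^sub>R \<theta> x) = \<theta>"
    using R by (auto simp: fun_eq_iff indicator_def)
  finally show ?thesis .
qed

lemma cont_compact_supp_bounded: assumes "cont_compact_supp \<theta>" obtains M where "M > 0" "\<And>x. \<bar>\<theta> x\<bar> \<le> M"
proof -
  obtain R where R: "\<And>x. R < norm x \<Longrightarrow> \<theta> x = 0" and cont: "continuous_on UNIV \<theta>"
    using assms by (auto simp: cont_compact_supp_def)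
  have "bounded (\<theta> ` cball 0 R)"
    using cont by (intro compact_imp_bounded compact_continuous_image) (auto intro: continuous_on_subset)
  then obtain M where M: "M > 0" "\<And>x. norm x \<le> R \<Longrightarrow> \<bar>\<theta> x\<bar> \<le> M"
    by (auto simp: bounded_pos)
  show thesis
  proof (rule that[OF M(1)])
    fix x show "\<bar>\<theta> x\<bar> \<le> M" using M R[of x] by (cases "norm x \<le> R") auto
  qed
qed

lemma cont_compact_supp_Lp:
  assumes \<theta>: "cont_compact_supp \<theta>" and p: "p > 1" shows "Lp_fun p \<theta>"
proof -
  obtain M where M: "M > 0" "\<And>x. \<bar>\<theta> x\<bar> \<le> M" using cont_compact_supp_bounded[OF \<theta>] by blast
  show ?thesis
  proof (rule Lp_fun_dominated)
    show "integrable lborel (\<lambda>x. M powr (p - 1) * \<bar>\<theta> x\<bar>)" using cont_compact_supp_integrable[OF \<theta>] by simp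
    show "AE x in lborel. \<bar>\<theta> x\<bar> powr p \<le> M powr (p - 1) * \<bar>\<theta> x\<bar>"
      by (intro AE_I2 abs_powr_le_mult p M(2)) simp
  qed (rule cont_compact_supp_measurable[OF \<theta>])
qed

lemma open_closed_sandwich:
  assumes A: "A \<in> sets borel" "emeasure lborel A < \<infinity>" and d: "d > 0"
  obtains T U :: "'a::euclidean_space set" where "closed T" "T \<subseteq> A" "open U" "A \<subseteq> U"
    "emeasure lborel U < \<infinity>" "emeasure lborel (U - T) < ennreal d"
proof -
  have A_lebesgue: "A \<in> sets lebesgue" and [measurable]: "A \<in> sets borel" using A by simp_all
  have half_pos: "d / 2 > 0" using d by simp
  obtain U where U: "open U" "A \<subseteq> U" "emeasure lebesgue (U - A) < ennreal (d / 2)"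
    using sets_lebesgue_outer_open[OF A_lebesgue half_pos] by metis
  obtain T where T: "closed T" "T \<subseteq> A" "emeasure lebesgue (A - T) < ennreal (d / 2)"
    using sets_lebesgue_inner_closed[OF A_lebesgue half_pos] by metis
  have [measurable]: "U \<in> sets borel" "T \<in> sets borel" using U T by auto
  have "U - T = (U - A) \<union> (A - T)" using U T by auto
  then have "emeasure lborel (U - T) \<le> emeasure lborel (U - A) + emeasure lborel (A - T)"
    by (simp add: emeasure_subadditive)
  also have "\<dots> < ennreal (d / 2) + ennreal (d / 2)" using U T by (intro add_strict_mono) simp_all
  also have "\<dots> = ennreal d" using d by (subst ennreal_plus[symmetric]) auto
  finally have small: "emeasure lborel (U - T) < ennreal d" .
  have "U = A \<union> (U - A)" using U by auto
  then have "emeasure lborel U \<le> emeasure lborel A + emeasure lborel (U - A)"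
    using emeasure_subadditive[of A lborel "U - A"] by simp
  also have "\<dots> < \<infinity>" using A(2) U(3) order.strict_trans[OF _ ennreal_less_top] by fastforce
  finally show thesis using that U T small by blast
qed

lemma L1_approx_indicator:
  fixes A :: "'a::euclidean_space set" and e :: real
  assumes A: "A \<in> sets borel" "emeasure lborel A < \<infinity>" and e: "e > 0"
  shows "\<exists>\<theta>. continuous_on UNIV \<theta> \<and> integrable lborel \<theta> \<and> (LINT x|lborel. \<bar>indicator A x - \<theta> x\<bar>) < e"
proof -
  obtain T U where T: "closed T" "T \<subseteq> A" and U: "open U" "A \<subseteq> U" "emeasure lborel U < \<infinity>"
    and small: "emeasure lborel (U - T) < ennreal e"
    using open_closed_sandwich[OF A e] by metis
  have [measurable]: "U \<in> sets borel" "T \<in> sets borel" using U T by auto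
  obtain f :: "'a \<Rightarrow> real" where f: "continuous_on UNIV f" "\<And>x. f x \<in> closed_segment 1 0"
      "\<And>x. x \<in> T \<Longrightarrow> f x = 1" "\<And>x. x \<in> - U \<Longrightarrow> f x = 0"
    using Urysohn[of T "-U" 1 0] U T by (auto simp: closed_Compl)
  have f_bounds: "0 \<le> f x" "f x \<le> 1" for x
    using f(2)[of x] by (auto simp: closed_segment_eq_real_ivl)
  have f_integrable: "integrable lborel f"
  proof (rule integrable_dominated)
    show "integrable lborel (indicator U :: 'a \<Rightarrow> real)" using U by simp
    show "f \<in> borel_measurable lborel" using borel_measurable_continuous_onI[OF f(1)] by simp
    show "norm (f x) \<le> indicator U x" for x using f_bounds f(4) by (auto simp: indicator_def)
  qed
  have indicator_integrable: "integrable lborel (indicator (U - T) :: 'a \<Rightarrow> real)"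
    using order.strict_trans[OF small ennreal_less_top] by (intro integrable_real_indicator) auto
  have "(LINT x|lborel. \<bar>indicator A x - f x\<bar>) \<le> (LINT x|lborel. indicator (U - T) x)"
  proof (rule integral_mono[OF _ indicator_integrable])
    show "integrable lborel (\<lambda>x. \<bar>indicator A x - f x\<bar>)" using A f_integrable by auto
    show "\<bar>indicator A x - f x\<bar> \<le> indicator (U - T) x" for x
      using f_bounds[of x] f(3,4)[of x] U(2) T(2) by (auto simp: indicator_def)
  qed
  also have "\<dots> < e"
    using small e order.strict_trans[OF small ennreal_less_top] by (simp add: emeasure_eq_ennreal_measure ennreal_less_iff)
  finally show ?thesis using f(1) f_integrable by blast
qed

lemma L1_approx_continuous:
  fixes g :: "'a::euclidean_space \<Rightarrow> real"
  assumes "integrable lborel g" "e > 0"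
  shows "\<exists>\<theta>. continuous_on UNIV \<theta> \<and> integrable lborel \<theta> \<and> (LINT x|lborel. \<bar>g x - \<theta> x\<bar>) < e"
  using assms
proof (induction arbitrary: e rule: integrable_induct)
  case (base A c)
  have "e / (\<bar>c\<bar> + 1) > 0" using base.prems by simp
  then obtain \<theta> where \<theta>: "continuous_on UNIV \<theta>" "integrable lborel \<theta>"
    "(LINT x|lborel. \<bar>indicator A x - \<theta> x\<bar>) < e / (\<bar>c\<bar> + 1)"
    using L1_approx_indicator[of A] base.hyps by auto
  have "(LINT x|lborel. \<bar>indicator A x *\<^sub>R c - c * \<theta> x\<bar>) = \<bar>c\<bar> * (LINT x|lborel. \<bar>indicator A x - \<theta> x\<bar>)"
    by (simp add: abs_mult[symmetric] algebra_simps flip: integral_mult_right_zero)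
  also have "\<dots> \<le> \<bar>c\<bar> * (e / (\<bar>c\<bar> + 1))" using \<theta>(3) by (intro mult_left_mono) auto
  also have "\<dots> < e" using base.prems by (simp add: field_simps)
  finally show ?case using \<theta> by (intro exI[of _ "\<lambda>x. c * \<theta> x"]) (auto intro!: continuous_intros)
next
  case (add f g)
  have half_pos: "e / 2 > 0" using add.prems by simp
  obtain s t where s: "continuous_on UNIV s" "integrable lborel s" "(LINT x|lborel. \<bar>f x - s x\<bar>) < e / 2"
    and t: "continuous_on UNIV t" "integrable lborel t" "(LINT x|lborel. \<bar>g x - t x\<bar>) < e / 2"
    using add.IH(1)[OF half_pos] add.IH(2)[OF half_pos] by blast
  have "(LINT x|lborel. \<bar>(f x + g x) - (s x + t x)\<bar>) \<le> (LINT x|lborel. \<bar>f x - s x\<bar> + \<bar>g x - t x\<bar>)"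
    using add(1,2) s t by (intro integral_mono) auto
  also have "\<dots> < e" using add(1,2) s t by simp
  finally show ?case using s t by (intro exI[of _ "\<lambda>x. s x + t x"]) (auto intro!: continuous_intros)
next
  case (lim f s)
  have half_pos: "e / 2 > 0" using lim.prems by simp
  have "(\<lambda>i. LINT x|lborel. \<bar>f x - s i x\<bar>) \<longlonglongrightarrow> (LINT x|lborel. \<bar>f x - f x\<bar>)"
  proof (rule tendsto_integral_dominated)
    show "(\<lambda>i. \<bar>f x - s i x\<bar>) \<longlonglongrightarrow> \<bar>f x - f x\<bar>" if "x \<in> space lborel" for x
      using lim.hyps(2)[OF that] by (intro tendsto_intros)
    show "norm \<bar>f x - s i x\<bar> \<le> 3 * \<bar>f x\<bar>" if "x \<in> space lborel" for i x
      using lim.hyps(3)[OF that, of i] by auto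
  qed (use lim in auto)
  then obtain i where i: "(LINT x|lborel. \<bar>f x - s i x\<bar>) < e / 2"
    using order_tendstoD(2)[OF _ half_pos] by (force simp: eventually_sequentially)
  obtain t where t: "continuous_on UNIV t" "integrable lborel t" "(LINT x|lborel. \<bar>s i x - t x\<bar>) < e / 2"
    using lim.IH[OF half_pos] by blast
  have "(LINT x|lborel. \<bar>f x - t x\<bar>) \<le> (LINT x|lborel. \<bar>f x - s i x\<bar> + \<bar>s i x - t x\<bar>)"
    using lim.hyps(1,4) t by (intro integral_mono) auto
  also have "\<dots> < e" using lim.hyps(1,4) t i by simp
  finally show ?case using t by auto
qed

lemma L1_approx_cont_compact_supp:
  fixes g :: "'a::euclidean_space \<Rightarrow> real"
  assumes g: "integrable lborel g" and e: "e > 0"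
  shows "\<exists>\<theta>. cont_compact_supp \<theta> \<and> (LINT x|lborel. \<bar>g x - \<theta> x\<bar>) < e"
proof -
  obtain t where t: "continuous_on UNIV t" "integrable lborel t" "(LINT x|lborel. \<bar>g x - t x\<bar>) < e/2"
    using L1_approx_continuous[OF g, of "e / 2"] e by auto
  define cutoff where "cutoff = (\<lambda>n (x::'a). max 0 (min 1 (real n + 1 - norm x)))"
  have cont: "continuous_on UNIV (cutoff n)" for n unfolding cutoff_def by (intro continuous_intros)
  have [measurable]: "t \<in> borel_measurable borel" "\<And>n. cutoff n \<in> borel_measurable borel"
    using t cont by (auto intro: borel_measurable_continuous_onI)
  have "(\<lambda>n. LINT x|lborel. \<bar>t x - cutoff n x * t x\<bar>) \<longlonglongrightarrow> (LINT x|(lborel :: 'a measure). 0)"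
  proof (rule tendsto_integral_dominated)
    show "(\<lambda>n. \<bar>t x - cutoff n x * t x\<bar>) \<longlonglongrightarrow> 0" for x
    proof (rule tendsto_eventually)
      obtain k :: nat where "norm x \<le> k" using real_arch_simple by blast
      then show "\<forall>\<^sub>F n in sequentially. \<bar>t x - cutoff n x * t x\<bar> = 0"
        by (intro eventually_sequentiallyI[of k]) (auto simp: cutoff_def)
    qed
    have "\<bar>1 - cutoff n x\<bar> * \<bar>t x\<bar> \<le> 1 * \<bar>t x\<bar>" for n x
      by (intro mult_right_mono) (auto simp: cutoff_def)
    then show "norm \<bar>t x - cutoff n x * t x\<bar> \<le> \<bar>t x\<bar>" for n x
      by (simp add: abs_mult[symmetric] algebra_simps)
  qed (use t in auto)
  then obtain n where n: "(LINT x|lborel. \<bar>t x - cutoff n x * t x\<bar>) < e/2"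
    using order_tendstoD(2)[of _ 0 sequentially "e/2"] e by (auto simp: eventually_sequentially)
  have supp: "cont_compact_supp (\<lambda>x. cutoff n x * t x)"
    unfolding cont_compact_supp_def using t cont
    by (auto intro!: continuous_intros exI[of _ "real n + 1"] simp: cutoff_def)
  have "(LINT x|lborel. \<bar>g x - cutoff n x * t x\<bar>) \<le> (LINT x|lborel. \<bar>g x - t x\<bar> + \<bar>t x - cutoff n x * t x\<bar>)"
    using g t cont_compact_supp_integrable[OF supp] by (intro integral_mono) auto
  also have "\<dots> < e" using g t n cont_compact_supp_integrable[OF supp] by simp
  finally show ?thesis using supp by blast
qed

definition truncate :: "nat \<Rightarrow> ('a::euclidean_space \<Rightarrow> real) \<Rightarrow> 'a \<Rightarrow> real" where
  "truncate n g x = indicator (cball 0 (real n)) x * max (- real n) (min (real n) (g x))"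

lemma abs_truncate_le: "\<bar>truncate n g x\<bar> \<le> real n" "\<bar>truncate n g x\<bar> \<le> \<bar>g x\<bar>" "\<bar>g x - truncate n g x\<bar> \<le> \<bar>g x\<bar>"
  by (auto simp: truncate_def indicator_def)

lemma truncate_measurable:
  assumes [measurable]: "g \<in> borel_measurable borel" shows "truncate n g \<in> borel_measurable borel"
proof -
  have [measurable]: "cball (0::'a) (real n) \<in> sets borel" by simp
  show ?thesis unfolding truncate_def by measurable
qed

lemma integrable_cball: "integrable lborel (\<lambda>x::'a::euclidean_space. c * indicator (cball a r) x :: real)"
  by (intro integrable_mult_right integrable_real_indicator)
     (auto simp: emeasure_bounded_finite[unfolded infinity_ennreal_def])

lemma integrable_truncate:
  assumes "g \<in> borel_measurable borel" shows "integrable lborel (truncate n g)"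
  by (rule integrable_dominated[OF integrable_cball[of "real n" 0 "real n"]])
     (use truncate_measurable[OF assms] in \<open>auto simp: truncate_def indicator_def\<close>)

lemma Lp_pow_truncate_tendsto:
  assumes g: "Lp_fun p g" and p: "p > 1"
  shows "(\<lambda>n. Lp_pow p (\<lambda>x. g x - truncate n g x)) \<longlonglongrightarrow> 0"
proof -
  have [measurable]: "g \<in> borel_measurable borel" "\<And>n. truncate n g \<in> borel_measurable borel"
    using g truncate_measurable by (auto simp: Lp_fun_def)
  have "(\<lambda>n. LINT x|lborel. \<bar>g x - truncate n g x\<bar> powr p) \<longlonglongrightarrow> (LINT x|(lborel :: 'a measure). 0)"
  proof (rule tendsto_integral_dominated)
    show "(\<lambda>n. \<bar>g x - truncate n g x\<bar> powr p) \<longlonglongrightarrow> 0" for x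
    proof (rule tendsto_eventually)
      obtain k :: nat where k: "max (norm x) \<bar>g x\<bar> \<le> k" using real_arch_simple by blast
      show "\<forall>\<^sub>F n in sequentially. \<bar>g x - truncate n g x\<bar> powr p = 0"
      proof (rule eventually_sequentiallyI[of k])
        fix n assume "k \<le> n" then have "real k \<le> real n" by simp
        with k show "\<bar>g x - truncate n g x\<bar> powr p = 0" using p by (auto simp: truncate_def)
      qed
    qed
    show "norm (\<bar>g x - truncate n g x\<bar> powr p) \<le> \<bar>g x\<bar> powr p" for n x
      using abs_truncate_le p by (auto intro!: powr_mono2)
  qed (use g in \<open>auto simp: Lp_fun_def\<close>)
  then show ?thesis by (simp add: Lp_pow_def)
qed

lemma Lp_approx_bounded:
  fixes t :: "'a::euclidean_space \<Rightarrow> real"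
  assumes t: "integrable lborel t" "\<And>x. \<bar>t x\<bar> \<le> c" and p: "p > 1" and e: "e > 0"
  shows "\<exists>\<theta>. cont_compact_supp \<theta> \<and> Lp_pow p (\<lambda>x. t x - \<theta> x) < e"
proof -
  have [measurable]: "t \<in> borel_measurable borel" using t by auto
  have c: "c \<ge> 0" using order_trans[OF abs_ge_zero t(2)] .
  define b where "b = (2 * c) powr (p - 1)"
  have b: "b \<ge> 0" by (simp add: b_def)
  have "e / (b + 1) > 0" using e b by simp
  then obtain \<psi> where \<psi>: "cont_compact_supp \<psi>" "(LINT x|lborel. \<bar>t x - \<psi> x\<bar>) < e / (b + 1)"
    using L1_approx_cont_compact_supp[OF t(1)] by blast
  define \<theta> where "\<theta> = (\<lambda>x. max (- c) (min c (\<psi> x)))"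
  have \<theta>: "cont_compact_supp \<theta>"
  proof -
    obtain R where "continuous_on UNIV \<psi>" "\<And>x. R < norm x \<Longrightarrow> \<psi> x = 0"
      using \<psi>(1) by (auto simp: cont_compact_supp_def)
    then show ?thesis
      unfolding cont_compact_supp_def \<theta>_def using c by (intro conjI exI[of _ R] continuous_intros) auto
  qed
  have [measurable]: "\<theta> \<in> borel_measurable borel" by (rule cont_compact_supp_measurable[OF \<theta>])
  have pointwise: "\<bar>t x - \<theta> x\<bar> powr p \<le> b * \<bar>t x - \<psi> x\<bar>" for x
    unfolding b_def using t(2)[of x] by (intro abs_powr_le_mult p) (auto simp: \<theta>_def)
  have "Lp_pow p (\<lambda>x. t x - \<theta> x) \<le> (LINT x|lborel. b * \<bar>t x - \<psi> x\<bar>)"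
    using t(1) cont_compact_supp_integrable[OF \<psi>(1)] pointwise by (intro Lp_fun_dominated(2)) auto
  also have "\<dots> \<le> (b + 1) * (LINT x|lborel. \<bar>t x - \<psi> x\<bar>)"
    by (simp add: algebra_simps)
  also have "\<dots> < (b + 1) * (e / (b + 1))" using \<psi>(2) b by (intro mult_strict_left_mono) auto
  also have "\<dots> = e" using b by simp
  finally show ?thesis using \<theta> by blast
qed

lemma Lp_approx_cont_compact_supp:
  fixes g :: "'a::euclidean_space \<Rightarrow> real"
  assumes g: "Lp_fun p g" and p: "p > 1" and e: "e > 0"
  shows "\<exists>\<theta>. cont_compact_supp \<theta> \<and> Lp_pow p (\<lambda>x. g x - \<theta> x) < e"
proof -
  have [measurable]: "g \<in> borel_measurable borel" using g by (simp add: Lp_fun_def)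
  have d: "e / (2 * 2 powr p) > 0" using e by simp
  obtain n where n: "Lp_pow p (\<lambda>x. g x - truncate n g x) < e / (2 * 2 powr p)"
    using order_tendstoD(2)[OF Lp_pow_truncate_tendsto[OF g p] d] by (auto simp: eventually_sequentially)
  obtain \<theta> where \<theta>: "cont_compact_supp \<theta>" "Lp_pow p (\<lambda>x. truncate n g x - \<theta> x) < e / (2 * 2 powr p)"
    using Lp_approx_bounded[OF integrable_truncate abs_truncate_le(1) p d] \<open>g \<in> borel_measurable borel\<close> by blast
  have "Lp_fun p (truncate n g)"
    by (rule Lp_fun_dominated(1)[OF truncate_measurable, where B="\<lambda>x. \<bar>g x\<bar> powr p"])
       (use g p abs_truncate_le(2) in \<open>auto simp: Lp_fun_def intro!: powr_mono2 AE_I2\<close>)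
  from Lp_pow_triangle_less[OF g this cont_compact_supp_Lp[OF \<theta>(1) p] _ n \<theta>(2)] p show ?thesis
    using \<theta>(1) by auto
qed

lemma cont_compact_supp_affine_support:
  fixes \<theta> :: "'a::euclidean_space \<Rightarrow> real"
  assumes \<theta>: "cont_compact_supp \<theta>" and L: "L \<longlonglongrightarrow> l" "l \<noteq> 0" and B: "B \<longlonglongrightarrow> b"
  shows "\<exists>R. \<forall>\<^sub>F n in sequentially. \<forall>x::'a. R < norm x \<longrightarrow> \<theta> (L n *\<^sub>R x + B n) = 0"
proof -
  obtain R where R: "\<And>x. R < norm x \<Longrightarrow> \<theta> x = 0" using \<theta> by (auto simp: cont_compact_supp_def)
  define R' where "R' = (\<bar>R\<bar> + norm b + 1) * 2 / \<bar>l\<bar>"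
  have "\<forall>\<^sub>F n in sequentially. \<bar>L n\<bar> > \<bar>l\<bar> / 2"
    using tendsto_rabs[OF L(1)] L(2) by (intro order_tendstoD) auto
  moreover have "\<forall>\<^sub>F n in sequentially. norm (B n) < norm b + 1"
    using tendsto_norm[OF B] by (intro order_tendstoD) auto
  ultimately have "\<forall>\<^sub>F n in sequentially. \<forall>x::'a. R' < norm x \<longrightarrow> \<theta> (L n *\<^sub>R x + B n) = 0"
  proof eventually_elim
    case (elim n)
    show ?case
    proof (intro allI impI R)
      fix x :: 'a assume x: "R' < norm x"
      have "\<bar>R\<bar> + norm b + 1 = \<bar>l\<bar> / 2 * R'" using L(2) by (simp add: R'_def)
      also have "\<dots> \<le> \<bar>L n\<bar> * norm x" using elim x L(2) by (intro mult_mono) (auto simp: R'_def)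
      finally have "\<bar>R\<bar> + norm b + 1 \<le> norm (L n *\<^sub>R x)" by simp
      also have "norm (L n *\<^sub>R x) \<le> norm (L n *\<^sub>R x + B n) + norm (B n)"
        using norm_triangle_ineq4[of "L n *\<^sub>R x + B n" "B n"] by simp
      finally show "R < norm (L n *\<^sub>R x + B n)" using elim(2) by linarith
    qed
  qed
  then show ?thesis by blast
qed

lemma cont_compact_supp_affine_tendsto:
  fixes \<theta> :: "'a::euclidean_space \<Rightarrow> real"
  assumes \<theta>: "cont_compact_supp \<theta>" and p: "p > 1" and L: "L \<longlonglongrightarrow> l" "l \<noteq> 0" and B: "B \<longlonglongrightarrow> b"
  shows "(\<lambda>n. Lp_pow p (\<lambda>x. \<theta> (L n *\<^sub>R x + B n) - \<theta> (l *\<^sub>R x + b))) \<longlonglongrightarrow> 0"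
proof -
  have cont: "continuous_on UNIV \<theta>" using \<theta> by (simp add: cont_compact_supp_def)
  obtain M where M: "M > 0" "\<And>x. \<bar>\<theta> x\<bar> \<le> M" using cont_compact_supp_bounded[OF \<theta>] by blast
  have [measurable]: "\<theta> \<in> borel_measurable borel" using \<theta> by (rule cont_compact_supp_measurable)
  obtain R r where "\<forall>\<^sub>F n in sequentially. \<forall>x. R < norm x \<longrightarrow> \<theta> (L n *\<^sub>R x + B n) = 0"
    and r: "\<And>x. r < norm x \<Longrightarrow> \<theta> (l *\<^sub>R x + b) = 0"
    using cont_compact_supp_affine_support[OF \<theta> L B]
      cont_compact_supp_affine_support[OF \<theta> tendsto_const L(2) tendsto_const, of b] by auto
  then obtain k where k: "\<And>n x :: 'a. n \<ge> k \<Longrightarrow> R < norm x \<Longrightarrow> \<theta> (L n *\<^sub>R x + B n) = 0"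
    by (auto simp: eventually_sequentially)
  let ?d = "\<lambda>n x. \<bar>\<theta> (L (n + k) *\<^sub>R x + B (n + k)) - \<theta> (l *\<^sub>R x + b)\<bar>"
  have "(\<lambda>n. LINT x|lborel. ?d n x powr p) \<longlonglongrightarrow> (LINT x|(lborel :: 'a measure). 0)"
  proof (rule tendsto_integral_dominated[OF integrable_cball[of "(2 * M) powr p" 0 "max R r"]])
    show "(\<lambda>n. ?d n x powr p) \<longlonglongrightarrow> 0" for x
    proof -
      have "(\<lambda>n. L (n + k) *\<^sub>R x + B (n + k)) \<longlonglongrightarrow> l *\<^sub>R x + b"
        using LIMSEQ_ignore_initial_segment[OF L(1), of k] LIMSEQ_ignore_initial_segment[OF B, of k]
        by (intro tendsto_intros)
      then have "(\<lambda>n. \<theta> (L (n + k) *\<^sub>R x + B (n + k))) \<longlonglongrightarrow> \<theta> (l *\<^sub>R x + b)"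
        using cont by (auto simp: continuous_on_eq_continuous_at intro: isCont_tendsto_compose)
      then have "(\<lambda>n. ?d n x powr p) \<longlonglongrightarrow> \<bar>\<theta> (l *\<^sub>R x + b) - \<theta> (l *\<^sub>R x + b)\<bar> powr p"
        using p by (intro tendsto_powr' tendsto_intros) auto
      then show ?thesis using p by simp
    qed
    show "norm (?d n x powr p) \<le> (2 * M) powr p * indicator (cball 0 (max R r)) x" for n x
    proof (cases "norm x \<le> max R r")
      case True
      have "?d n x \<le> 2 * M"
        using M(2)[of "L (n + k) *\<^sub>R x + B (n + k)"] M(2)[of "l *\<^sub>R x + b"] by linarith
      then show ?thesis using True p by (auto intro!: powr_mono2)
    next
      case False
      then show ?thesis using k[of "n + k" x] r[of x] p by auto
    qed
  qed measurable
  then have "(\<lambda>n. Lp_pow p (\<lambda>x. \<theta> (L (n + k) *\<^sub>R x + B (n + k)) - \<theta> (l *\<^sub>R x + b))) \<longlonglongrightarrow> 0"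
    by (simp add: Lp_pow_def)
  then show ?thesis by (rule LIMSEQ_offset)
qed

lemma Lp_pow_affine_less:
  fixes g :: "'a::euclidean_space \<Rightarrow> real"
  assumes g: "Lp_fun p g" and small: "Lp_pow p g < d * c ^ DIM('a)" and c: "0 < c" "c \<le> \<bar>s\<bar>"
  shows "Lp_pow p (\<lambda>x. g (s *\<^sub>R x + t)) < d"
proof -
  have s: "s \<noteq> 0" using c by auto
  have "Lp_pow p g / \<bar>s\<bar> ^ DIM('a) \<le> Lp_pow p g / c ^ DIM('a)"
    using c s by (intro divide_left_mono power_mono mult_pos_pos) auto
  also have "\<dots> < d" using small c(1) by (simp add: divide_less_eq)
  finally show ?thesis by (simp add: Lp_pow_affine[OF s g])
qed

lemma Lp_pow_affine_tendsto:
  fixes g :: "'a::euclidean_space \<Rightarrow> real"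
  assumes g: "Lp_fun p g" and p: "p > 1" and L: "L \<longlonglongrightarrow> l" "l \<noteq> 0" and B: "B \<longlonglongrightarrow> b"
  shows "(\<lambda>n. Lp_pow p (\<lambda>x. g (L n *\<^sub>R x + B n) - g (l *\<^sub>R x + b))) \<longlonglongrightarrow> 0"
proof (rule order_tendstoI)
  fix e :: real assume e: "e > 0"
  define c where "c = 2 * 2 powr p"
  have c: "c \<ge> 1" using p ge_one_powr_ge_zero[of 2 p] by (simp add: c_def)
  define d where "d = e / c / c"
  have "d > 0" using e c by (simp add: d_def)
  then have d: "d > 0" "d \<le> e / c" using c e by (auto simp: d_def divide_le_eq mult_le_cancel_left1)
  have "d * (\<bar>l\<bar> / 2) ^ DIM('a) > 0" using d L(2) by simp
  then obtain \<theta> where \<theta>: "cont_compact_supp \<theta>" "Lp_pow p (\<lambda>x. g x - \<theta> x) < d * (\<bar>l\<bar> / 2) ^ DIM('a)"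
    using Lp_approx_cont_compact_supp[OF g p] by blast
  note Lp\<theta> = cont_compact_supp_Lp[OF \<theta>(1) p]
  have diff: "Lp_fun p (\<lambda>x. g x - \<theta> x)" using p by (intro Lp_fun_diff g Lp\<theta>) auto
  have near: "Lp_pow p (\<lambda>x. g (s *\<^sub>R x + t) - \<theta> (s *\<^sub>R x + t)) < d" if "\<bar>l\<bar> / 2 < \<bar>s\<bar>" for s t
    using that L(2) by (intro Lp_pow_affine_less[OF diff \<theta>(2)]) auto
  have "\<forall>\<^sub>F n in sequentially. Lp_pow p (\<lambda>x. \<theta> (L n *\<^sub>R x + B n) - \<theta> (l *\<^sub>R x + b)) < d"
    using cont_compact_supp_affine_tendsto[OF \<theta>(1) p L B] d(1) by (rule order_tendstoD)
  moreover have "\<forall>\<^sub>F n in sequentially. \<bar>L n\<bar> > \<bar>l\<bar> / 2"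
    using tendsto_rabs[OF L(1)] L(2) by (intro order_tendstoD) auto
  ultimately show "\<forall>\<^sub>F n in sequentially. Lp_pow p (\<lambda>x. g (L n *\<^sub>R x + B n) - g (l *\<^sub>R x + b)) < e"
  proof eventually_elim
    case (elim n)
    have L_n_nonzero: "L n \<noteq> 0" using elim(2) by auto
    have "Lp_pow p (\<lambda>x. \<theta> (L n *\<^sub>R x + B n) - g (l *\<^sub>R x + b)) < e / c"
    proof (rule Lp_pow_triangle_less[OF Lp_fun_affine[OF L_n_nonzero Lp\<theta>] Lp_fun_affine[OF L(2) Lp\<theta>] Lp_fun_affine[OF L(2) g], folded c_def])
      have "Lp_pow p (\<lambda>x. \<theta> (l *\<^sub>R x + b) - g (l *\<^sub>R x + b)) < d"
        using near[of l b] L(2) by (subst Lp_pow_minus_commute) simp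
      then show "Lp_pow p (\<lambda>x. \<theta> (l *\<^sub>R x + b) - g (l *\<^sub>R x + b)) < e / c / c" by (simp only: d_def)
    qed (use elim(1) p in \<open>auto simp: d_def\<close>)
    moreover have "Lp_pow p (\<lambda>x. g (L n *\<^sub>R x + B n) - \<theta> (L n *\<^sub>R x + B n)) < e / c"
      using near[OF elim(2)] d(2) by (rule less_le_trans)
    ultimately show ?case
      using p by (intro Lp_pow_triangle_less[OF Lp_fun_affine[OF L_n_nonzero g] Lp_fun_affine[OF L_n_nonzero Lp\<theta>] Lp_fun_affine[OF L(2) g], folded c_def]) auto
  qed
next
  show "\<forall>\<^sub>F n in sequentially. a < Lp_pow p (\<lambda>x. g (L n *\<^sub>R x + B n) - g (l *\<^sub>R x + b))" if "a < 0" for a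
    by (intro always_eventually allI less_le_trans[OF that Lp_pow_nonneg])
qed

section \<open>Approximate identities\<close>

lemma AE_integrable_kernel:
  fixes g K :: "'a::euclidean_space \<Rightarrow> real"
  assumes g: "Lp_fun p g" and p: "p > 1" and K: "integrable lborel K"
  shows "AE x in lborel. integrable lborel (\<lambda>z. K z * g (x + c *\<^sub>R z))"
proof (rule AE_integrable_mixture[OF p sigma_finite_lborel _ K Lp_fun_translate[OF g]])
  have [measurable]: "g \<in> borel_measurable borel" using g by (simp add: Lp_fun_def)
  show "(\<lambda>(z, x). g (x + c *\<^sub>R z)) \<in> borel_measurable (lborel \<Otimes>\<^sub>M borel)" by measurable
  show "integrable lborel (\<lambda>z. \<bar>K z\<bar> * Lp_pow p (\<lambda>x. g (x + c *\<^sub>R z)))"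
    using K by (simp add: Lp_pow_translate[OF g])
qed

lemma
  fixes g :: "'a::euclidean_space \<Rightarrow> real"
  assumes g: "Lp_fun p g" and p: "p > 1"
  shows Lp_pow_translate_diff_le: "Lp_pow p (\<lambda>x. g (x + t) - g x) \<le> 2 powr p * (2 * Lp_pow p g)"
    and Lp_pow_translate_diff_measurable: "(\<lambda>z. Lp_pow p (\<lambda>x. g (x + c *\<^sub>R z) - g x)) \<in> borel_measurable borel"
    and Lp_fun_translate_diff: "Lp_fun p (\<lambda>x. g (x + t) - g x)"
proof -
  have [measurable]: "g \<in> borel_measurable borel" using g by (simp add: Lp_fun_def)
  show "Lp_pow p (\<lambda>x. g (x + t) - g x) \<le> 2 powr p * (2 * Lp_pow p g)"
    using Lp_pow_diff_le[OF Lp_fun_translate[OF g, of t] g] p by (simp add: Lp_pow_translate[OF g])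
  show "(\<lambda>z. Lp_pow p (\<lambda>x. g (x + c *\<^sub>R z) - g x)) \<in> borel_measurable borel"
    unfolding Lp_pow_def by measurable
  show "Lp_fun p (\<lambda>x. g (x + t) - g x)" using p by (intro Lp_fun_diff Lp_fun_translate g) auto
qed

lemma Lp_pow_kernel_diff_le:
  fixes g K :: "'a::euclidean_space \<Rightarrow> real"
  assumes g: "Lp_fun p g" and p: "p > 1" and K: "integrable lborel K" "(LINT z|lborel. K z) = 1"
  shows "Lp_pow p (\<lambda>x. (LINT z|lborel. K z * g (x + c *\<^sub>R z)) - g x)
    \<le> (LINT z|lborel. \<bar>K z\<bar>) powr (p - 1) * (LINT z|lborel. \<bar>K z\<bar> * Lp_pow p (\<lambda>x. g (x + c *\<^sub>R z) - g x))"
proof -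
  have [measurable]: "g \<in> borel_measurable borel" "K \<in> borel_measurable borel"
    using g K(1) by (auto simp: Lp_fun_def)
  have "Lp_pow p (\<lambda>x. (LINT z|lborel. K z * g (x + c *\<^sub>R z)) - g x)
      = Lp_pow p (\<lambda>x. LINT z|lborel. K z * (g (x + c *\<^sub>R z) - g x))"
  proof (rule Lp_pow_cong_AE)
    show "AE x in lborel. (LINT z|lborel. K z * g (x + c *\<^sub>R z)) - g x = (LINT z|lborel. K z * (g (x + c *\<^sub>R z) - g x))"
      using AE_integrable_kernel[OF g p K(1), of c] by eventually_elim (simp add: K right_diff_distrib)
  qed measurable
  also have "\<dots> \<le> (LINT z|lborel. \<bar>K z\<bar>) powr (p - 1) * (LINT z|lborel. \<bar>K z\<bar> * Lp_pow p (\<lambda>x. g (x + c *\<^sub>R z) - g x))"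
  proof (rule Lp_pow_mixture_le[OF p sigma_finite_lborel _ K(1) Lp_fun_translate_diff[OF g p]])
    show "(\<lambda>(z, x). g (x + c *\<^sub>R z) - g x) \<in> borel_measurable (lborel \<Otimes>\<^sub>M borel)" by measurable
    show "integrable lborel (\<lambda>z. \<bar>K z\<bar> * Lp_pow p (\<lambda>x. g (x + c *\<^sub>R z) - g x))"
      by (rule integrable_dominated[where B="\<lambda>z. \<bar>K z\<bar> * (2 powr p * (2 * Lp_pow p g))"])
         (use K Lp_pow_translate_diff_le[OF g p] Lp_pow_translate_diff_measurable[OF g p, of c]
           in \<open>auto simp: abs_mult intro!: mult_left_mono\<close>)
  qed
  finally show ?thesis .
qed

lemma approx_identity:
  fixes g K :: "'a::euclidean_space \<Rightarrow> real"
  assumes g: "Lp_fun p g" and p: "p > 1" and K: "integrable lborel K" "(LINT z|lborel. K z) = 1"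
    and e: "e \<longlonglongrightarrow> (0::real)"
  shows "(\<lambda>n. Lp_pow p (\<lambda>x. (LINT z|lborel. K z * g (x + e n *\<^sub>R z)) - g x)) \<longlonglongrightarrow> 0"
proof -
  let ?D = "\<lambda>n z. Lp_pow p (\<lambda>x. g (x + e n *\<^sub>R z) - g x)"
  have "(\<lambda>n. LINT z|lborel. \<bar>K z\<bar> * ?D n z) \<longlonglongrightarrow> (LINT z|(lborel :: 'a measure). 0)"
  proof (rule tendsto_integral_dominated)
    show "integrable lborel (\<lambda>z. \<bar>K z\<bar> * (2 powr p * (2 * Lp_pow p g)))" using K by simp
    show "(\<lambda>z. \<bar>K z\<bar> * ?D n z) \<in> borel_measurable lborel" for n
      using K(1) Lp_pow_translate_diff_measurable[OF g p, of "e n"] by measurable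
    show "norm (\<bar>K z\<bar> * ?D n z) \<le> \<bar>K z\<bar> * (2 powr p * (2 * Lp_pow p g))" for n z
      using Lp_pow_translate_diff_le[OF g p] by (auto simp: abs_mult intro!: mult_left_mono)
    fix z :: 'a
    have "(\<lambda>n. e n *\<^sub>R z) \<longlonglongrightarrow> 0" using tendsto_scaleR[OF e tendsto_const, of z] by simp
    then have "(\<lambda>n. ?D n z) \<longlonglongrightarrow> 0"
      using Lp_pow_affine_tendsto[OF g p, of "\<lambda>_. 1" 1 "\<lambda>n. e n *\<^sub>R z" 0] by simp
    from tendsto_mult_left[OF this] show "(\<lambda>n. \<bar>K z\<bar> * ?D n z) \<longlonglongrightarrow> 0" by simp
  qed
  then have bound_tendsto: "(\<lambda>n. (LINT z|lborel. \<bar>K z\<bar>) powr (p - 1) * (LINT z|lborel. \<bar>K z\<bar> * ?D n z)) \<longlonglongrightarrow> 0"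
    using tendsto_mult_left[of _ 0 sequentially "(LINT z|lborel. \<bar>K z\<bar>) powr (p - 1)"] by simp
  show ?thesis
    by (rule tendsto_sandwich[OF _ _ tendsto_const bound_tendsto]) (auto intro!: always_eventually Lp_pow_kernel_diff_le[OF g p K])
qed

lemma AE_eq_0_if_kernels_vanish:
  fixes F K :: "'a::euclidean_space \<Rightarrow> real"
  assumes F: "Lp_fun p F" and p: "p > 1" and K: "integrable lborel K" "(LINT z|lborel. K z) = 1"
    and vanish: "\<And>c. c > 0 \<Longrightarrow> AE x in lborel. (LINT z|lborel. K z * F (x + c *\<^sub>R z)) = 0"
  shows "AE x in lborel. F x = 0"
proof -
  have [measurable]: "F \<in> borel_measurable borel" "K \<in> borel_measurable borel"
    using F K by (auto simp: Lp_fun_def)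
  let ?e = "\<lambda>n. inverse (real (Suc n))"
  have "Lp_pow p (\<lambda>x. (LINT z|lborel. K z * F (x + ?e n *\<^sub>R z)) - F x) = Lp_pow p (\<lambda>x. - 1 * F x)" for n
    using vanish[of "?e n"] by (intro Lp_pow_cong_AE) (auto elim!: eventually_mono)
  then have "(\<lambda>n::nat. Lp_pow p F) \<longlonglongrightarrow> 0"
    using approx_identity[OF F p K LIMSEQ_inverse_real_of_nat] Lp_pow_cmult[OF F, of "-1"] by simp
  then have "Lp_pow p F = 0" by (rule LIMSEQ_unique[OF tendsto_const])
  then show ?thesis by (rule Lp_pow_eq_0D[OF F])
qed

section \<open>Closed subspaces of $L_p$\<close>

definition function_subspace :: "('a \<Rightarrow> real) set \<Rightarrow> bool" where
  "function_subspace X \<longleftrightarrow> (\<lambda>_. 0) \<in> X \<and> (\<forall>g\<in>X. \<forall>h\<in>X. (\<lambda>x. g x + h x) \<in> X) \<and> (\<forall>c. \<forall>g\<in>X. (\<lambda>x. c * g x) \<in> X)"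

definition Lp_subspace :: "real \<Rightarrow> ('a::euclidean_space \<Rightarrow> real) set \<Rightarrow> bool" where
  "Lp_subspace p X \<longleftrightarrow> function_subspace X \<and> (\<forall>g\<in>X. Lp_fun p g)"

definition Lp_closure :: "real \<Rightarrow> ('a::euclidean_space \<Rightarrow> real) set \<Rightarrow> ('a \<Rightarrow> real) set" where
  "Lp_closure p X = {g. Lp_fun p g \<and> (\<forall>e>0. \<exists>h\<in>X. Lp_pow p (\<lambda>x. g x - h x) < e)}"

definition translation_invariant :: "('a::euclidean_space \<Rightarrow> real) set \<Rightarrow> bool" where
  "translation_invariant X \<longleftrightarrow> (\<forall>g\<in>X. \<forall>t. (\<lambda>x. g (x + t)) \<in> X)"

lemma
  assumes "function_subspace X"
  shows function_subspace_zero: "(\<lambda>_. 0) \<in> X"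
    and function_subspace_add: "g \<in> X \<Longrightarrow> h \<in> X \<Longrightarrow> (\<lambda>x. g x + h x) \<in> X"
    and function_subspace_cmult: "g \<in> X \<Longrightarrow> (\<lambda>x. c * g x) \<in> X"
  using assms by (auto simp: function_subspace_def)

lemma function_subspace_sum:
  assumes "function_subspace X" "finite I" "\<And>i. i \<in> I \<Longrightarrow> g i \<in> X"
  shows "(\<lambda>x. \<Sum>i\<in>I. g i x) \<in> X"
  using assms(2,3) by (induction rule: finite_induct) (use assms(1) in \<open>auto simp: function_subspace_def\<close>)

lemma Lp_subspace_Lp: "Lp_subspace p X \<Longrightarrow> g \<in> X \<Longrightarrow> Lp_fun p g"
  by (simp add: Lp_subspace_def)

lemma Lp_subspace_function_subspace: "Lp_subspace p X \<Longrightarrow> function_subspace X"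
  by (simp add: Lp_subspace_def)

lemma Lp_closure_Lp: "g \<in> Lp_closure p X \<Longrightarrow> Lp_fun p g"
  by (simp add: Lp_closure_def)

lemma subset_Lp_closure: "g \<in> X \<Longrightarrow> Lp_fun p g \<Longrightarrow> g \<in> Lp_closure p X"
  unfolding Lp_closure_def by (auto intro!: bexI[of _ g])

lemma Lp_closure_trans:
  assumes p: "p > 1" and X: "Lp_subspace p X" and g: "Lp_fun p g"
    and approx: "\<And>e. e > 0 \<Longrightarrow> \<exists>h\<in>Lp_closure p X. Lp_pow p (\<lambda>x. g x - h x) < e"
  shows "g \<in> Lp_closure p X"
  unfolding Lp_closure_def
proof (intro CollectI conjI g allI impI)
  fix e :: real assume "e > 0"
  then have d: "e / (2 * 2 powr p) > 0" by simp
  obtain h where h: "h \<in> Lp_closure p X" "Lp_pow p (\<lambda>x. g x - h x) < e / (2 * 2 powr p)" using approx[OF d] by blast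
  obtain k where k: "k \<in> X" "Lp_pow p (\<lambda>x. h x - k x) < e / (2 * 2 powr p)" using h(1) d by (auto simp: Lp_closure_def)
  have "Lp_pow p (\<lambda>x. g x - k x) < e"
    using Lp_pow_triangle_less[OF g Lp_closure_Lp[OF h(1)] Lp_subspace_Lp[OF X k(1)] _ h(2) k(2)] p by simp
  then show "\<exists>h\<in>X. Lp_pow p (\<lambda>x. g x - h x) < e" using k(1) by blast
qed

lemma Lp_closure_cong_AE:
  assumes X: "Lp_subspace p X" and g: "g \<in> Lp_closure p X"
    and eq: "AE x in lborel. g x = h x" and h: "h \<in> borel_measurable borel"
  shows "h \<in> Lp_closure p X"
proof -
  have Lp_g: "Lp_fun p g" by (rule Lp_closure_Lp[OF g])
  have Lp_h: "Lp_fun p h" by (rule Lp_fun_cong_AE[OF Lp_g h eq])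
  have "Lp_pow p (\<lambda>x. h x - k x) = Lp_pow p (\<lambda>x. g x - k x)" if "k \<in> X" for k
    using Lp_g h eq Lp_subspace_Lp[OF X that]
    by (intro Lp_pow_cong_AE) (auto simp: Lp_fun_def elim!: eventually_mono)
  then show ?thesis using g Lp_h by (auto simp: Lp_closure_def)
qed

lemma Lp_closure_add:
  assumes p: "p > 1" and X: "Lp_subspace p X" and g: "g \<in> Lp_closure p X" and h: "h \<in> Lp_closure p X"
  shows "(\<lambda>x. g x + h x) \<in> Lp_closure p X"
  unfolding Lp_closure_def
proof (intro CollectI conjI allI impI)
  note Lp_gh = Lp_closure_Lp[OF g] Lp_closure_Lp[OF h]
  show "Lp_fun p (\<lambda>x. g x + h x)" using Lp_gh p by (intro Lp_fun_add) auto
  fix e :: real assume "e > 0"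
  then have d: "e / (2 * 2 powr p) > 0" by simp
  obtain g' h' where g': "g' \<in> X" "Lp_pow p (\<lambda>x. g x - g' x) < e / (2 * 2 powr p)"
    and h': "h' \<in> X" "Lp_pow p (\<lambda>x. h x - h' x) < e / (2 * 2 powr p)"
    using g h d unfolding Lp_closure_def by blast
  note Lp_approx = Lp_subspace_Lp[OF X g'(1)] Lp_subspace_Lp[OF X h'(1)]
  have "Lp_pow p (\<lambda>x. (g x + h x) - (g' x + h' x)) < e"
  proof (rule Lp_pow_triangle_less)
    show "Lp_fun p (\<lambda>x. g x + h x)" "Lp_fun p (\<lambda>x. g' x + h x)" "Lp_fun p (\<lambda>x. g' x + h' x)"
      using Lp_gh Lp_approx p by (simp_all add: Lp_fun_add)
  qed (use g'(2) h'(2) p in simp_all)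
  then show "\<exists>k\<in>X. Lp_pow p (\<lambda>x. (g x + h x) - k x) < e"
    using function_subspace_add[OF Lp_subspace_function_subspace[OF X] g'(1) h'(1)] by (rule bexI)
qed

lemma Lp_closure_cmult:
  assumes p: "p > 1" and X: "Lp_subspace p X" and g: "g \<in> Lp_closure p X"
  shows "(\<lambda>x. c * g x) \<in> Lp_closure p X"
  unfolding Lp_closure_def
proof (intro CollectI conjI allI impI)
  show "Lp_fun p (\<lambda>x. c * g x)" by (intro Lp_fun_cmult Lp_closure_Lp[OF g])
  fix e :: real assume e: "e > 0"
  have pos: "\<bar>c\<bar> powr p + 1 > 0" using powr_ge_zero[of "\<bar>c\<bar>" p] by linarith
  then have "e / (\<bar>c\<bar> powr p + 1) > 0" using e by simp
  then obtain h where h: "h \<in> X" "Lp_pow p (\<lambda>x. g x - h x) < e / (\<bar>c\<bar> powr p + 1)"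
    using g unfolding Lp_closure_def by blast
  have "Lp_fun p (\<lambda>x. g x - h x)"
    using p by (intro Lp_fun_diff Lp_closure_Lp[OF g] Lp_subspace_Lp[OF X h(1)]) auto
  then have "Lp_pow p (\<lambda>x. c * g x - c * h x) = \<bar>c\<bar> powr p * Lp_pow p (\<lambda>x. g x - h x)"
    by (simp add: Lp_pow_cmult flip: right_diff_distrib)
  also have "\<dots> \<le> (\<bar>c\<bar> powr p + 1) * Lp_pow p (\<lambda>x. g x - h x)" by (simp add: algebra_simps)
  also have "\<dots> < e" using h(2) pos by (simp add: field_simps)
  finally show "\<exists>k\<in>X. Lp_pow p (\<lambda>x. c * g x - k x) < e"
    using function_subspace_cmult[OF Lp_subspace_function_subspace[OF X] h(1)] by (rule bexI)
qed

lemma Lp_subspace_closure: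
  assumes p: "p > 1" and X: "Lp_subspace p X"
  shows "Lp_subspace p (Lp_closure p X)"
proof -
  have "(\<lambda>_. 0) \<in> Lp_closure p X"
    using X by (intro subset_Lp_closure function_subspace_zero Lp_subspace_function_subspace) auto
  then show ?thesis
    unfolding Lp_subspace_def function_subspace_def
    using Lp_closure_Lp Lp_closure_add[OF p X] Lp_closure_cmult[OF p X] by blast
qed

lemma Lp_closure_idem:
  assumes p: "p > 1" and X: "Lp_subspace p X"
  shows "Lp_closure p (Lp_closure p X) = Lp_closure p X"
proof
  show "Lp_closure p (Lp_closure p X) \<subseteq> Lp_closure p X"
  proof
    fix g assume "g \<in> Lp_closure p (Lp_closure p X)"
    then show "g \<in> Lp_closure p X"
      by (intro Lp_closure_trans[OF p X]) (auto simp: Lp_closure_def[of p "Lp_closure p X"])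
  qed
qed (auto intro: subset_Lp_closure Lp_closure_Lp)

lemma translation_invariant_closure:
  assumes X: "Lp_subspace p X" "translation_invariant X" and p: "p > 1"
  shows "translation_invariant (Lp_closure p X)"
  unfolding translation_invariant_def
proof (intro ballI allI)
  fix g and t :: 'a assume g: "g \<in> Lp_closure p X"
  show "(\<lambda>x. g (x + t)) \<in> Lp_closure p X"
    unfolding Lp_closure_def
  proof (intro CollectI conjI allI impI)
    show "Lp_fun p (\<lambda>x. g (x + t))" by (rule Lp_fun_translate[OF Lp_closure_Lp[OF g]])
    fix e :: real assume "e > 0"
    then obtain h where h: "h \<in> X" "Lp_pow p (\<lambda>x. g x - h x) < e" using g by (auto simp: Lp_closure_def)
    have "Lp_fun p (\<lambda>x. g x - h x)" using p by (intro Lp_fun_diff Lp_closure_Lp[OF g] Lp_subspace_Lp[OF X(1) h(1)]) auto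
    from Lp_pow_translate[OF this, of t] show "\<exists>k\<in>X. Lp_pow p (\<lambda>x. g (x + t) - k x) < e"
      using h X(2) by (intro bexI[of _ "\<lambda>x. h (x + t)"]) (auto simp: translation_invariant_def)
  qed
qed

section \<open>Mixtures in closed subspaces\<close>

lemma integrable_mult_Lp_pow:
  fixes h :: "'w \<Rightarrow> 'a::euclidean_space \<Rightarrow> real"
  assumes [measurable]: "(\<lambda>(w, x). h w x) \<in> borel_measurable (N \<Otimes>\<^sub>M borel)" and k: "integrable N k"
    and bound: "\<And>w. w \<in> space N \<Longrightarrow> Lp_pow p (h w) \<le> C"
  shows "integrable N (\<lambda>w. \<bar>k w\<bar> * Lp_pow p (h w))"
proof (rule integrable_dominated)
  show "integrable N (\<lambda>w. \<bar>k w\<bar> * C)" using k by simp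
  show "(\<lambda>w. \<bar>k w\<bar> * Lp_pow p (h w)) \<in> borel_measurable N" using k unfolding Lp_pow_def by measurable
qed (simp add: abs_mult mult_left_mono bound)

text \<open>\<open>I w\<close> is the index of the cell of \<open>w\<close> in a countable measurable partition; only the cells with
  index below \<open>m\<close> enter the approximating sum.\<close>

lemma Lp_pow_mixture_minus_sum_le:
  fixes h :: "'w \<Rightarrow> 'a::euclidean_space \<Rightarrow> real" and H :: "nat \<Rightarrow> 'a \<Rightarrow> real"
  assumes p: "p > 1" and N: "sigma_finite_measure N"
    and h: "(\<lambda>(w, x). h w x) \<in> borel_measurable (N \<Otimes>\<^sub>M borel)" and k: "integrable N k"
    and Lp_h: "\<And>w. w \<in> space N \<Longrightarrow> Lp_fun p (h w)" "\<And>w. w \<in> space N \<Longrightarrow> Lp_pow p (h w) \<le> C"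
    and H: "\<And>n. Lp_fun p (H n)" and I: "I \<in> measurable N (count_space UNIV)"
    and near: "\<And>w. w \<in> space N \<Longrightarrow> Lp_pow p (\<lambda>x. h w x - H (I w) x) \<le> \<delta>" and \<delta>: "\<delta> \<ge> 0" and C: "C \<ge> 0"
  shows "Lp_pow p (\<lambda>x. (\<integral>w. k w * h w x \<partial>N) - (\<Sum>n<m. (\<integral>w. k w * of_bool (I w = n) \<partial>N) * H n x))
    \<le> (\<integral>w. \<bar>k w\<bar> \<partial>N) powr (p - 1) * (\<integral>w. \<bar>k w\<bar> * (\<delta> + C * of_bool (m \<le> I w)) \<partial>N)"
proof -
  have [measurable]: "k \<in> borel_measurable N" "I \<in> measurable N (count_space UNIV)" "\<And>n. H n \<in> borel_measurable borel"
    "(\<lambda>(w, x). h w x) \<in> borel_measurable (N \<Otimes>\<^sub>M borel)"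
    using k I H h by (auto simp: Lp_fun_def)
  interpret N: sigma_finite_measure N by (rule N)
  define a where "a = (\<lambda>w x. \<Sum>n<m. of_bool (I w = n) * H n x)"
  have a_eq: "a w = (if I w < m then H (I w) else (\<lambda>_. 0))" for w
    by (auto simp: a_def fun_eq_iff of_bool_def if_distrib[of "\<lambda>c. c * _"] cong: if_cong)
  have [measurable]: "(\<lambda>(w, x). a w x) \<in> borel_measurable (N \<Otimes>\<^sub>M borel)" unfolding a_def by measurable
  have Lp_diff: "Lp_fun p (\<lambda>x. h w x - a w x)" if "w \<in> space N" for w
    using p by (intro Lp_fun_diff Lp_h that) (simp_all add: a_eq H)
  have diff_le: "Lp_pow p (\<lambda>x. h w x - a w x) \<le> \<delta> + C * of_bool (m \<le> I w)" if "w \<in> space N" for w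
    using near[OF that] Lp_h(2)[OF that] \<delta> by (cases "I w < m") (simp_all add: a_eq)
  have int_bound: "integrable N (\<lambda>w. \<bar>k w\<bar> * (\<delta> + C * of_bool (m \<le> I w)))"
    by (rule integrable_dominated[where B="\<lambda>w. \<bar>k w\<bar> * (\<delta> + C)"])
       (use k C \<delta> in \<open>auto simp: abs_mult intro!: mult_left_mono\<close>)
  have int_diff: "integrable N (\<lambda>w. \<bar>k w\<bar> * Lp_pow p (\<lambda>x. h w x - a w x))"
  proof (rule integrable_dominated[OF int_bound])
    show "(\<lambda>w. \<bar>k w\<bar> * Lp_pow p (\<lambda>x. h w x - a w x)) \<in> borel_measurable N" unfolding Lp_pow_def by measurable
  qed (simp add: abs_mult mult_left_mono diff_le)
  have int_cell: "integrable N (\<lambda>w. k w * of_bool (I w = n))" for n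
    by (rule Bochner_Integration.integrable_bound[OF k]) (auto simp: abs_mult)
  have mult_a_eq: "k w * a w x = (\<Sum>n<m. k w * of_bool (I w = n) * H n x)" for w x
    by (simp only: a_def sum_distrib_left mult.assoc)
  have int_mult_a: "integrable N (\<lambda>w. k w * a w x)" for x
    unfolding mult_a_eq using int_cell by (intro Bochner_Integration.integrable_sum integrable_mult_left) auto
  have sum_eq: "(\<Sum>n<m. (\<integral>w. k w * of_bool (I w = n) \<partial>N) * H n x) = (\<integral>w. k w * a w x \<partial>N)" for x
    unfolding mult_a_eq using int_cell by (subst Bochner_Integration.integral_sum) (auto intro!: integrable_mult_left)
  have "AE x in lborel. integrable N (\<lambda>w. k w * h w x)"
    by (rule AE_integrable_mixture[OF p N h k Lp_h(1) integrable_mult_Lp_pow[OF h k Lp_h(2)]])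
  then have "AE x in lborel. (\<integral>w. k w * h w x \<partial>N) - (\<integral>w. k w * a w x \<partial>N) = (\<integral>w. k w * (h w x - a w x) \<partial>N)"
    by eventually_elim (simp add: int_mult_a right_diff_distrib)
  then have "Lp_pow p (\<lambda>x. (\<integral>w. k w * h w x \<partial>N) - (\<integral>w. k w * a w x \<partial>N)) = Lp_pow p (\<lambda>x. \<integral>w. k w * (h w x - a w x) \<partial>N)"
    by (intro Lp_pow_cong_AE) measurable
  also have "\<dots> \<le> (\<integral>w. \<bar>k w\<bar> \<partial>N) powr (p - 1) * (\<integral>w. \<bar>k w\<bar> * Lp_pow p (\<lambda>x. h w x - a w x) \<partial>N)"
    by (rule Lp_pow_mixture_le[OF p N _ k Lp_diff int_diff]) measurable
  also have "\<dots> \<le> (\<integral>w. \<bar>k w\<bar> \<partial>N) powr (p - 1) * (\<integral>w. \<bar>k w\<bar> * (\<delta> + C * of_bool (m \<le> I w)) \<partial>N)"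
    by (intro mult_left_mono integral_mono int_diff int_bound diff_le) auto
  finally show ?thesis unfolding sum_eq .
qed

lemma mixture_in_Lp_closure:
  fixes h :: "'w \<Rightarrow> 'a::euclidean_space \<Rightarrow> real" and H :: "nat \<Rightarrow> 'a \<Rightarrow> real"
  assumes p: "p > 1" and X: "Lp_subspace p X" and N: "sigma_finite_measure N"
    and h[measurable]: "(\<lambda>(w, x). h w x) \<in> borel_measurable (N \<Otimes>\<^sub>M borel)" and k: "integrable N k"
    and Lp_h: "\<And>w. w \<in> space N \<Longrightarrow> Lp_fun p (h w)" "\<And>w. w \<in> space N \<Longrightarrow> Lp_pow p (h w) \<le> C" and C: "C \<ge> 0"
    and H: "\<And>n. H n \<in> X" and dense: "\<And>w \<delta>. w \<in> space N \<Longrightarrow> \<delta> > 0 \<Longrightarrow> \<exists>n. Lp_pow p (\<lambda>x. h w x - H n x) < \<delta>"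
  shows "(\<lambda>x. \<integral>w. k w * h w x \<partial>N) \<in> Lp_closure p X"
  unfolding Lp_closure_def
proof (intro CollectI conjI allI impI)
  interpret N: sigma_finite_measure N by (rule N)
  have [measurable]: "\<And>n. H n \<in> borel_measurable borel" "k \<in> borel_measurable N"
    using Lp_subspace_Lp[OF X H] k by (auto simp: Lp_fun_def)
  have [measurable]: "\<And>n. (\<lambda>w. Lp_pow p (\<lambda>x. h w x - H n x)) \<in> borel_measurable N"
    unfolding Lp_pow_def by measurable
  show "Lp_fun p (\<lambda>x. \<integral>w. k w * h w x \<partial>N)"
    by (rule Lp_fun_mixture[OF p N h k Lp_h(1) integrable_mult_Lp_pow[OF h k Lp_h(2)]])
  fix e :: real assume e: "e > 0"
  define K where "K = (\<integral>w. \<bar>k w\<bar> \<partial>N)"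
  have K: "K \<ge> 0" by (simp add: K_def)
  define \<delta> where "\<delta> = e / (K powr (p - 1) * (K + 1) + 1)"
  have denom: "K powr (p - 1) * (K + 1) + 1 > 0" using K by (intro add_nonneg_pos mult_nonneg_nonneg) auto
  then have \<delta>: "\<delta> > 0" using e by (simp add: \<delta>_def)
  define I where "I = (\<lambda>w. LEAST n. Lp_pow p (\<lambda>x. h w x - H n x) < \<delta>)"
  have near: "Lp_pow p (\<lambda>x. h w x - H (I w) x) < \<delta>" if "w \<in> space N" for w
    unfolding I_def using dense[OF that \<delta>] by (rule LeastI_ex)
  have I[measurable]: "I \<in> measurable N (count_space UNIV)" unfolding I_def by measurable
  have "(\<lambda>m. \<integral>w. \<bar>k w\<bar> * (\<delta> + C * of_bool (m \<le> I w)) \<partial>N) \<longlonglongrightarrow> (\<integral>w. \<bar>k w\<bar> * \<delta> \<partial>N)"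
  proof (rule tendsto_integral_dominated[where B="\<lambda>w. \<bar>k w\<bar> * (\<delta> + C)"])
    show "(\<lambda>m. \<bar>k w\<bar> * (\<delta> + C * of_bool (m \<le> I w))) \<longlonglongrightarrow> \<bar>k w\<bar> * \<delta>" for w
      by (rule tendsto_eventually, rule eventually_sequentiallyI[of "Suc (I w)"]) auto
  qed (use k \<delta> C in \<open>auto simp: abs_mult intro!: mult_left_mono\<close>)
  moreover have "(\<integral>w. \<bar>k w\<bar> * \<delta> \<partial>N) < (K + 1) * \<delta>" using \<delta> by (simp add: K_def)
  ultimately obtain m where m: "(\<integral>w. \<bar>k w\<bar> * (\<delta> + C * of_bool (m \<le> I w)) \<partial>N) < (K + 1) * \<delta>"
    using order_tendstoD(2) by (fastforce simp: eventually_sequentially)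
  let ?S = "\<lambda>x. \<Sum>n<m. (\<integral>w. k w * of_bool (I w = n) \<partial>N) * H n x"
  have "Lp_pow p (\<lambda>x. (\<integral>w. k w * h w x \<partial>N) - ?S x) \<le> K powr (p - 1) * (\<integral>w. \<bar>k w\<bar> * (\<delta> + C * of_bool (m \<le> I w)) \<partial>N)"
    unfolding K_def using near \<delta>
    by (intro Lp_pow_mixture_minus_sum_le[OF p N h k Lp_h Lp_subspace_Lp[OF X H] I] C) (auto intro: less_imp_le)
  also have "\<dots> \<le> K powr (p - 1) * ((K + 1) * \<delta>)" using m by (intro mult_left_mono) auto
  also have "\<dots> < (K powr (p - 1) * (K + 1) + 1) * \<delta>" using \<delta> by (simp add: algebra_simps)
  also have "\<dots> = e" using denom by (simp add: \<delta>_def)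
  finally show "\<exists>h'\<in>X. Lp_pow p (\<lambda>x. (\<integral>w. k w * h w x \<partial>N) - h' x) < e"
    by (rule bexI[of _ ?S]) (intro function_subspace_sum function_subspace_cmult Lp_subspace_function_subspace[OF X] finite_lessThan H)
qed

definition normalized_affine :: "real \<Rightarrow> ('a::euclidean_space \<Rightarrow> real) \<Rightarrow> real \<Rightarrow> 'a \<Rightarrow> 'a \<Rightarrow> real" where
  "normalized_affine p g l b x = \<bar>l\<bar> powr (DIM('a) / p) * g (l *\<^sub>R x + b)"

lemma
  fixes g :: "'a::euclidean_space \<Rightarrow> real"
  assumes g: "Lp_fun p g" and p: "p > 1" and l: "l \<noteq> 0"
  shows Lp_fun_normalized_affine: "Lp_fun p (normalized_affine p g l b)"
    and Lp_pow_normalized_affine: "Lp_pow p (normalized_affine p g l b) = Lp_pow p g"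
proof -
  have Lp: "Lp_fun p (\<lambda>x. g (l *\<^sub>R x + b))" by (rule Lp_fun_affine[OF l g])
  show "Lp_fun p (normalized_affine p g l b)" unfolding normalized_affine_def by (rule Lp_fun_cmult[OF Lp])
  have "Lp_pow p (normalized_affine p g l b) = (\<bar>l\<bar> powr (DIM('a) / p)) powr p * (Lp_pow p g / \<bar>l\<bar> ^ DIM('a))"
    unfolding normalized_affine_def by (simp add: Lp_pow_cmult[OF Lp] Lp_pow_affine[OF l g])
  also have "(\<bar>l\<bar> powr (DIM('a) / p)) powr p = \<bar>l\<bar> ^ DIM('a)" using p l by (simp add: powr_powr powr_realpow)
  finally show "Lp_pow p (normalized_affine p g l b) = Lp_pow p g" using l by simp
qed

lemma normalized_affine_tendsto:
  fixes g :: "'a::euclidean_space \<Rightarrow> real"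
  assumes g: "Lp_fun p g" and p: "p > 1" and L: "L \<longlonglongrightarrow> l" "l \<noteq> 0" "\<And>n. L n \<noteq> 0" and B: "B \<longlonglongrightarrow> b"
  shows "(\<lambda>n. Lp_pow p (\<lambda>x. normalized_affine p g l b x - normalized_affine p g (L n) (B n) x)) \<longlonglongrightarrow> 0"
proof -
  let ?a = "\<lambda>n. \<bar>L n\<bar> powr (DIM('a) / p)" and ?c = "\<bar>l\<bar> powr (DIM('a) / p)"
  let ?g = "\<lambda>x. g (l *\<^sub>R x + b)" and ?h = "\<lambda>n x. g (L n *\<^sub>R x + B n)"
  have a: "?a \<longlonglongrightarrow> ?c" using L by (intro tendsto_powr tendsto_rabs tendsto_const) auto
  have Lp_g: "Lp_fun p ?g" by (rule Lp_fun_affine[OF L(2) g])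
  have Lp_diff: "Lp_fun p (\<lambda>x. ?h n x - ?g x)" for n using p by (intro Lp_fun_diff Lp_g Lp_fun_affine[OF L(3) g]) auto
  let ?R = "\<lambda>n. 2 powr p * (\<bar>?a n\<bar> powr p * Lp_pow p (\<lambda>x. ?h n x - ?g x) + \<bar>?a n - ?c\<bar> powr p * Lp_pow p ?g)"
  have bound: "Lp_pow p (\<lambda>x. normalized_affine p g l b x - normalized_affine p g (L n) (B n) x) \<le> ?R n" for n
  proof -
    have "Lp_pow p (\<lambda>x. normalized_affine p g (L n) (B n) x - normalized_affine p g l b x)
        = Lp_pow p (\<lambda>x. ?a n * (?h n x - ?g x) + (?a n - ?c) * ?g x)"
      by (simp add: normalized_affine_def algebra_simps)
    also have "\<dots> \<le> ?R n"
      using Lp_pow_add_le[OF Lp_fun_cmult[OF Lp_diff, of "?a n"] Lp_fun_cmult[OF Lp_g, of "?a n - ?c"]] p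
      by (simp add: Lp_pow_cmult[OF Lp_diff] Lp_pow_cmult[OF Lp_g])
    finally show ?thesis by (subst Lp_pow_minus_commute)
  qed
  have "?R \<longlonglongrightarrow> 2 powr p * (\<bar>?c\<bar> powr p * 0 + \<bar>?c - ?c\<bar> powr p * Lp_pow p ?g)"
    using p L by (intro tendsto_intros a Lp_pow_affine_tendsto[OF g p L(1,2) B] tendsto_powr') auto
  then have "?R \<longlonglongrightarrow> 0" using p by simp
  from tendsto_sandwich[OF _ _ tendsto_const this] show ?thesis using bound by simp
qed

lemma normalized_affine_dense_sequence:
  fixes g :: "'a::euclidean_space \<Rightarrow> real"
  assumes g: "Lp_fun p g" and p: "p > 1" and Y: "Lp_subspace p Y"
  obtains H where "\<And>n::nat. H n \<in> Y" "\<And>l b \<delta>. l \<noteq> 0 \<Longrightarrow> (\<lambda>x. g (l *\<^sub>R x + b)) \<in> Y \<Longrightarrow> \<delta> > 0 \<Longrightarrow>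
    \<exists>n. Lp_pow p (\<lambda>x. normalized_affine p g l b x - H n x) < \<delta>"
proof -
  define S where "S = {(l, b). l \<noteq> 0 \<and> (\<lambda>x. g (l *\<^sub>R x + b)) \<in> Y}"
  obtain T where T: "countable T" "T \<subseteq> S" "S \<subseteq> closure T" using separable[of S] by blast
  define Z where "Z = insert (\<lambda>_. 0) ((\<lambda>(l, b). normalized_affine p g l b) ` T)"
  have "normalized_affine p g l b \<in> Y" if "(l, b) \<in> S" for l b
    using that function_subspace_cmult[OF Lp_subspace_function_subspace[OF Y], of "\<lambda>x. g (l *\<^sub>R x + b)"]
    by (simp add: S_def normalized_affine_def[abs_def])
  then have Z: "countable Z" "Z \<noteq> {}" "Z \<subseteq> Y"
    using T(1,2) function_subspace_zero[OF Lp_subspace_function_subspace[OF Y]] by (auto simp: Z_def)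
  show thesis
  proof (rule that[of "from_nat_into Z"])
    show "from_nat_into Z n \<in> Y" for n using from_nat_into[OF Z(2)] Z(3) by blast
    fix l b and \<delta> :: real assume l: "l \<noteq> 0" "(\<lambda>x. g (l *\<^sub>R x + b)) \<in> Y" and \<delta>: "\<delta> > 0"
    then have "(l, b) \<in> closure T" using T(3) by (auto simp: S_def)
    then obtain t where t: "\<And>i::nat. t i \<in> T" "t \<longlonglongrightarrow> (l, b)" by (auto simp: closure_sequential)
    have "fst (t i) \<noteq> 0" for i using t(1)[of i] T(2) by (auto simp: S_def)
    then have "(\<lambda>i. Lp_pow p (\<lambda>x. normalized_affine p g l b x - normalized_affine p g (fst (t i)) (snd (t i)) x)) \<longlonglongrightarrow> 0"
      using tendsto_fst[OF t(2)] tendsto_snd[OF t(2)] l(1) by (intro normalized_affine_tendsto[OF g p]) auto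
    then obtain i where i: "Lp_pow p (\<lambda>x. normalized_affine p g l b x - normalized_affine p g (fst (t i)) (snd (t i)) x) < \<delta>"
      using order_tendstoD(2)[OF _ \<delta>] by (force simp: eventually_sequentially)
    have "normalized_affine p g (fst (t i)) (snd (t i)) \<in> Z" using t(1)[of i] by (force simp: Z_def)
    then obtain n where "normalized_affine p g (fst (t i)) (snd (t i)) = from_nat_into Z n"
      using from_nat_into_surj[OF Z(1)] by metis
    then show "\<exists>n. Lp_pow p (\<lambda>x. normalized_affine p g l b x - from_nat_into Z n x) < \<delta>" using i by auto
  qed
qed

lemma normalized_affine_mult:
  fixes g :: "'a::euclidean_space \<Rightarrow> real"
  shows "l \<noteq> 0 \<Longrightarrow> (k * \<bar>l\<bar> powr (- real DIM('a) / p)) * normalized_affine p g l b x = k * g (l *\<^sub>R x + b)"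
  by (simp add: normalized_affine_def powr_minus)

lemma affine_mixture_in_Lp_closure:
  fixes g :: "'a::euclidean_space \<Rightarrow> real" and N :: "'w measure"
  assumes p: "p > 1" and X: "Lp_subspace p X" and g: "Lp_fun p g" and N: "sigma_finite_measure N"
    and [measurable]: "L \<in> borel_measurable N" "B \<in> borel_measurable N" and L: "\<And>w. w \<in> space N \<Longrightarrow> L w \<noteq> 0"
    and g_in: "\<And>w. w \<in> space N \<Longrightarrow> (\<lambda>x. g (L w *\<^sub>R x + B w)) \<in> Lp_closure p X"
    and int: "integrable N (\<lambda>w. k w * \<bar>L w\<bar> powr (- real DIM('a) / p))"
  shows "(\<lambda>x. \<integral>w. k w * g (L w *\<^sub>R x + B w) \<partial>N) \<in> Lp_closure p X"
proof -
  have [measurable]: "g \<in> borel_measurable borel" using g by (simp add: Lp_fun_def)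
  obtain H where H: "\<And>n::nat. H n \<in> Lp_closure p X"
    "\<And>l b \<delta>. l \<noteq> 0 \<Longrightarrow> (\<lambda>x. g (l *\<^sub>R x + b)) \<in> Lp_closure p X \<Longrightarrow> \<delta> > 0 \<Longrightarrow>
      \<exists>n. Lp_pow p (\<lambda>x. normalized_affine p g l b x - H n x) < \<delta>"
    using normalized_affine_dense_sequence[OF g p Lp_subspace_closure[OF p X]] by metis
  have "(\<lambda>x. \<integral>w. (k w * \<bar>L w\<bar> powr (- real DIM('a) / p)) * normalized_affine p g (L w) (B w) x \<partial>N) \<in> Lp_closure p (Lp_closure p X)"
  proof (rule mixture_in_Lp_closure[OF p Lp_subspace_closure[OF p X] N _ int _ _ Lp_pow_nonneg H(1)])
    show "(\<lambda>(w, x). normalized_affine p g (L w) (B w) x) \<in> borel_measurable (N \<Otimes>\<^sub>M borel)"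
      unfolding normalized_affine_def by measurable
  qed (use Lp_fun_normalized_affine[OF g p L] Lp_pow_normalized_affine[OF g p L] H(2)[OF L g_in] in auto)
  also have "(\<lambda>x. \<integral>w. (k w * \<bar>L w\<bar> powr (- real DIM('a) / p)) * normalized_affine p g (L w) (B w) x \<partial>N)
      = (\<lambda>x. \<integral>w. k w * g (L w *\<^sub>R x + B w) \<partial>N)"
    by (intro ext Bochner_Integration.integral_cong refl normalized_affine_mult L)
  finally show ?thesis by (simp add: Lp_closure_idem[OF p X])
qed

lemma AE_integrable_affine_mixture:
  fixes g :: "'a::euclidean_space \<Rightarrow> real"
  assumes p: "p > 1" and g: "Lp_fun p g" and N: "sigma_finite_measure N"
    and [measurable]: "L \<in> borel_measurable N" "B \<in> borel_measurable N" and L: "\<And>w. w \<in> space N \<Longrightarrow> L w \<noteq> 0"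
    and int: "integrable N (\<lambda>w. k w * \<bar>L w\<bar> powr (- real DIM('a) / p))"
  shows "AE x in lborel. integrable N (\<lambda>w. k w * g (L w *\<^sub>R x + B w))"
proof -
  have [measurable]: "g \<in> borel_measurable borel" using g by (simp add: Lp_fun_def)
  have "AE x in lborel. integrable N (\<lambda>w. (k w * \<bar>L w\<bar> powr (- real DIM('a) / p)) * normalized_affine p g (L w) (B w) x)"
  proof (rule AE_integrable_mixture[OF p N _ int Lp_fun_normalized_affine[OF g p L]])
    show "(\<lambda>(w, x). normalized_affine p g (L w) (B w) x) \<in> borel_measurable (N \<Otimes>\<^sub>M borel)"
      unfolding normalized_affine_def by measurable
    have "integrable N (\<lambda>w. \<bar>k w * \<bar>L w\<bar> powr (- real DIM('a) / p)\<bar> * Lp_pow p g)"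
      using int by (intro integrable_mult_left integrable_abs)
    then show "integrable N (\<lambda>w. \<bar>k w * \<bar>L w\<bar> powr (- real DIM('a) / p)\<bar> * Lp_pow p (normalized_affine p g (L w) (B w)))"
      by (rule Bochner_Integration.integrable_cong[THEN iffD1, rotated -1]) (auto simp: Lp_pow_normalized_affine[OF g p L])
  qed
  then show ?thesis
  proof eventually_elim
    case (elim x)
    show ?case
      by (rule Bochner_Integration.integrable_cong[THEN iffD1, OF refl _ elim]) (intro normalized_affine_mult L)
  qed
qed

lemma convolution_in_Lp_closure:
  fixes g k :: "'a::euclidean_space \<Rightarrow> real"
  assumes X: "Lp_subspace p X" "translation_invariant X" and p: "p > 1"
    and k: "integrable lborel k" and g: "g \<in> Lp_closure p X"
  shows "(\<lambda>x. LINT v|lborel. k v * g (x - v)) \<in> Lp_closure p X"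
proof -
  have "(\<lambda>x. \<integral>v. k v * g (1 *\<^sub>R x + (- v)) \<partial>lborel) \<in> Lp_closure p X"
  proof (rule affine_mixture_in_Lp_closure[OF p X(1) Lp_closure_Lp[OF g] sigma_finite_lborel])
    show "(\<lambda>x. g (1 *\<^sub>R x + (- w))) \<in> Lp_closure p X" for w
      using translation_invariant_closure[OF X p] g unfolding translation_invariant_def scaleR_one by blast
  qed (use k in simp_all)
  then show ?thesis by simp
qed

lemma Lp_closure_if_kernels:
  fixes g K :: "'a::euclidean_space \<Rightarrow> real"
  assumes X: "Lp_subspace p X" "translation_invariant X" and p: "p > 1"
    and K: "integrable lborel K" "(LINT z|lborel. K z) = 1" "\<And>z. K (- z) = K z"
    and K_in: "\<And>c. c > 0 \<Longrightarrow> (\<lambda>x. K (x /\<^sub>R c)) \<in> Lp_closure p X" and g: "Lp_fun p g"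
  shows "g \<in> Lp_closure p X"
proof (rule Lp_closure_trans[OF p X(1) g])
  fix e :: real assume "e > 0"
  then have d: "e / (2 * 2 powr p) > 0" by simp
  obtain \<theta> where \<theta>: "cont_compact_supp \<theta>" "Lp_pow p (\<lambda>x. g x - \<theta> x) < e / (2 * 2 powr p)"
    using Lp_approx_cont_compact_supp[OF g p d] by blast
  have Lp\<theta>: "Lp_fun p \<theta>" by (rule cont_compact_supp_Lp[OF \<theta>(1) p])
  have [measurable]: "\<theta> \<in> borel_measurable borel" "K \<in> borel_measurable borel"
    using \<theta>(1) K(1) by (auto intro: cont_compact_supp_measurable)
  obtain n :: nat where n: "Lp_pow p (\<lambda>x. (LINT z|lborel. K z * \<theta> (x + inverse (real (Suc n)) *\<^sub>R z)) - \<theta> x) < e / (2 * 2 powr p)"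
    using order_tendstoD(2)[OF approx_identity[OF Lp\<theta> p K(1,2) LIMSEQ_inverse_real_of_nat] d]
    by (auto simp: eventually_sequentially)
  define c where "c = inverse (real (Suc n))"
  have c: "c > 0" by (simp add: c_def)
  define h where "h = (\<lambda>x. LINT z|lborel. K z * \<theta> (x + c *\<^sub>R z))"
  have "h x = (LINT v|lborel. (1 / c ^ DIM('a) * \<theta> v) * K ((x - v) /\<^sub>R c))" for x
  proof -
    have "(LINT z|lborel. \<theta> (c *\<^sub>R z + x) * K ((x - (c *\<^sub>R z + x)) /\<^sub>R c)) = (1 / \<bar>c\<bar> ^ DIM('a)) *\<^sub>R (LINT v|lborel. \<theta> v * K ((x - v) /\<^sub>R c))"
      using c by (intro integral_affine) auto
    moreover have "K ((x - (c *\<^sub>R z + x)) /\<^sub>R c) = K z" for z using c by (simp add: K(3))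
    ultimately show ?thesis using c by (simp add: h_def add.commute mult.commute mult.assoc)
  qed
  then have h_eq: "h = (\<lambda>x. LINT v|lborel. (1 / c ^ DIM('a) * \<theta> v) * K ((x - v) /\<^sub>R c))" by auto
  have h_in: "h \<in> Lp_closure p X"
    unfolding h_eq by (rule convolution_in_Lp_closure[OF X p _ K_in[OF c]]) (use cont_compact_supp_integrable[OF \<theta>(1)] in simp)
  have "Lp_pow p (\<lambda>x. g x - h x) < e"
    using Lp_pow_triangle_less[OF g Lp\<theta> Lp_closure_Lp[OF h_in]] p \<theta>(2) n
    by (simp add: h_def c_def Lp_pow_minus_commute[of p \<theta>])
  then show "\<exists>h\<in>Lp_closure p X. Lp_pow p (\<lambda>x. g x - h x) < e" using h_in by auto
qed

section \<open>Gaussians\<close>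

lemma
  fixes f :: "'a::euclidean_space \<Rightarrow> real \<Rightarrow> 'b::{real_normed_field,banach,second_countable_topology}"
  assumes f: "\<And>b. b \<in> Basis \<Longrightarrow> integrable lborel (f b)"
  shows integrable_prod_Basis: "integrable lborel (\<lambda>x::'a. \<Prod>b\<in>Basis. f b (x \<bullet> b))"
    and integral_prod_Basis: "(LINT x|lborel. (\<Prod>b\<in>Basis. f b (x \<bullet> b))) = (\<Prod>b\<in>(Basis :: 'a set). (LINT t|lborel. f b t))"
proof -
  interpret product_sigma_finite "\<lambda>_::'a. lborel :: real measure" by standard
  have [measurable]: "f b \<in> borel_measurable borel" if "b \<in> Basis" for b using f[OF that] by auto
  have [measurable]: "(\<lambda>x::'a. \<Prod>b\<in>Basis. f b (x \<bullet> b)) \<in> borel_measurable borel"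
    by (intro borel_measurable_prod) measurable
  have coordinates_measurable[measurable]: "(\<lambda>x. \<Sum>b\<in>Basis. x b *\<^sub>R b) \<in> (\<Pi>\<^sub>M b\<in>(Basis::'a set). lborel) \<rightarrow>\<^sub>M borel"
    by measurable
  have prod_coordinates: "(\<Prod>b\<in>Basis. f b ((\<Sum>c\<in>Basis. x c *\<^sub>R c) \<bullet> b)) = (\<Prod>b\<in>Basis. f b (x b))" for x
    by (intro prod.cong) auto
  show "integrable lborel (\<lambda>x::'a. \<Prod>b\<in>Basis. f b (x \<bullet> b))"
    by (subst lborel_eq, subst integrable_distr_eq) (auto simp: prod_coordinates intro!: product_integrable_prod f)
  show "(LINT x|lborel. (\<Prod>b\<in>Basis. f b (x \<bullet> b))) = (\<Prod>b\<in>(Basis :: 'a set). (LINT t|lborel. f b t))"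
    by (subst lborel_eq, subst integral_distr) (auto simp: prod_coordinates intro!: product_integral_prod f)
qed

lemma power2_norm_Basis: "(norm (x::'a::euclidean_space))\<^sup>2 = (\<Sum>b\<in>Basis. (x \<bullet> b)\<^sup>2)"
  by (simp add: norm_eq_sqrt_inner euclidean_inner[of x x] power2_eq_square sum_nonneg)

definition gauss :: "'a::euclidean_space \<Rightarrow> real" where
  "gauss x = exp (- pi * (norm x)\<^sup>2)"

lemma gauss_measurable [measurable]: "gauss \<in> borel_measurable borel"
  unfolding gauss_def by measurable

lemma gauss_pos: "gauss x > 0" and gauss_le_1: "gauss x \<le> 1"
  by (auto simp: gauss_def)

lemma gauss_minus [simp]: "gauss (- x) = gauss x"
  by (simp add: gauss_def)

lemma gauss_0 [simp]: "gauss 0 = 1"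
  by (simp add: gauss_def)

lemma gauss_prod: "gauss x = (\<Prod>b\<in>Basis. gauss (x \<bullet> b))"
  by (simp add: gauss_def power2_norm_Basis exp_sum[symmetric] sum_distrib_left)

lemma cis_measurable [measurable]: "cis \<in> borel_measurable borel"
  by (intro borel_measurable_continuous_onI continuous_intros)

lemma integrable_mult_cis:
  fixes \<phi> :: "'w \<Rightarrow> complex"
  assumes "integrable M \<phi>" "t \<in> borel_measurable M"
  shows "integrable M (\<lambda>x. \<phi> x * cis (t x))"
  by (rule Bochner_Integration.integrable_bound[OF assms(1)]) (use assms in \<open>auto simp: norm_mult\<close>)

lemma
  fixes \<xi> :: real
  shows integrable_gauss_real: "integrable lborel (gauss :: real \<Rightarrow> real)"
    and fourier_gauss_real: "(LINT x|lborel. complex_of_real (gauss x) * cis (- (2 * pi * (x * \<xi>)))) = of_real (gauss \<xi>)"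
proof -
  define c where "c = sqrt (2 * pi)"
  have c: "c > 0" "c \<noteq> 0" "c * c = 2 * pi" by (auto simp: c_def)
  have density_eq: "std_normal_density (c * x) = gauss x / c" for x
  proof -
    have "(c * x)\<^sup>2 = 2 * pi * x\<^sup>2" using c by (simp add: power2_eq_square algebra_simps)
    then show ?thesis by (simp add: std_normal_density_def gauss_def c_def)
  qed
  have "integrable lborel (\<lambda>x. std_normal_density (c *\<^sub>R x + 0))"
    using c by (subst integrable_affine_iff) auto
  then have "integrable lborel (\<lambda>x::real. c * (gauss x / c))"
    by (intro integrable_mult_right) (simp add: density_eq)
  then show "integrable lborel (gauss :: real \<Rightarrow> real)" using c by simp
  define t where "t = - c * \<xi>"
  have "of_real (exp (- t\<^sup>2 / 2)) = char std_normal_distribution t"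
    by (simp add: char_std_normal_distribution)
  also have "\<dots> = (CLINT x|lborel. std_normal_density x *\<^sub>R iexp (t * x))"
    unfolding char_def by (subst integral_density) auto
  also have "\<dots> = c *\<^sub>R (CLINT x|lborel. std_normal_density (c *\<^sub>R x + 0) *\<^sub>R iexp (t * (c *\<^sub>R x + 0)))"
    using c by (subst integral_affine[of c "\<lambda>x. std_normal_density x *\<^sub>R iexp (t * x)" 0]) auto
  also have "\<dots> = (CLINT x|lborel. of_real (gauss x) * cis (- (2 * pi * (x * \<xi>))))"
  proof -
    have "t * (c * x) = - (2 * pi * (x * \<xi>))" for x
      using c(3) by (simp add: t_def algebra_simps)
    then have "std_normal_density (c *\<^sub>R x + 0) *\<^sub>R iexp (t * (c *\<^sub>R x + 0)) = (1 / c) *\<^sub>R (of_real (gauss x) * cis (- (2 * pi * (x * \<xi>))))" for x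
      by (simp add: density_eq cis_conv_exp scaleR_conv_of_real)
    then show ?thesis using c by simp
  qed
  finally have "(LINT x|lborel. complex_of_real (gauss x) * cis (- (2 * pi * (x * \<xi>)))) = of_real (exp (- t\<^sup>2 / 2))" ..
  moreover have "t\<^sup>2 = c * c * \<xi>\<^sup>2" by (simp add: t_def power2_eq_square)
  ultimately show "(LINT x|lborel. complex_of_real (gauss x) * cis (- (2 * pi * (x * \<xi>)))) = of_real (gauss \<xi>)"
    by (simp add: gauss_def c(3))
qed

lemma cis_inner: "cis (a * (x \<bullet> \<xi>)) = (\<Prod>b\<in>Basis. cis (a * ((x \<bullet> b) * (\<xi> \<bullet> b))))"
  by (simp add: cis_conv_exp exp_sum[symmetric] euclidean_inner[of x \<xi>] sum_distrib_left)

lemma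
  shows integrable_gauss: "integrable lborel (gauss :: 'a::euclidean_space \<Rightarrow> real)"
    and fourier_gauss: "(LINT x|lborel. complex_of_real (gauss x) * cis (- (2 * pi * (x \<bullet> \<xi>)))) = of_real (gauss (\<xi>::'a))"
    and integral_gauss: "(LINT x|lborel. gauss (x::'a)) = 1"
proof -
  have "integrable lborel (\<lambda>x::'a. \<Prod>b\<in>Basis. gauss (x \<bullet> b))"
    by (intro integrable_prod_Basis integrable_gauss_real)
  then show int: "integrable lborel (gauss :: 'a \<Rightarrow> real)" by (simp add: gauss_prod[symmetric])
  have split: "complex_of_real (gauss x) * cis (- (2 * pi * (x \<bullet> \<xi>)))
      = (\<Prod>b\<in>Basis. complex_of_real (gauss (x \<bullet> b)) * cis (- (2 * pi * ((x \<bullet> b) * (\<xi> \<bullet> b)))))" for x \<xi> :: 'a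
    using cis_inner[of "- (2 * pi)" x \<xi>] by (subst gauss_prod) (simp add: prod.distrib)
  have fourier: "(LINT x|lborel. complex_of_real (gauss x) * cis (- (2 * pi * (x \<bullet> \<xi>)))) = of_real (gauss \<xi>)" for \<xi> :: 'a
    unfolding split
  proof (subst integral_prod_Basis)
    show "integrable lborel (\<lambda>t. complex_of_real (gauss t) * cis (- (2 * pi * (t * (\<xi> \<bullet> b)))))" for b :: 'a
      by (intro integrable_mult_cis) (simp_all add: integrable_gauss_real)
    show "(\<Prod>b\<in>Basis. (LINT t|lborel. complex_of_real (gauss t) * cis (- (2 * pi * (t * (\<xi> \<bullet> b)))))) = complex_of_real (gauss \<xi>)"
      by (simp add: fourier_gauss_real gauss_prod[of \<xi>])
  qed
  show "(LINT x|lborel. complex_of_real (gauss x) * cis (- (2 * pi * (x \<bullet> \<xi>)))) = of_real (gauss \<xi>)" by (rule fourier)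
  have "complex_of_real (LINT x|lborel. gauss (x::'a)) = 1"
    using fourier[of 0] by (simp add: int)
  then show "(LINT x|lborel. gauss (x::'a)) = 1" using of_real_eq_1_iff by blast
qed

section \<open>Schwartz functions\<close>

inductive poly_gauss :: "real \<Rightarrow> 'a::euclidean_space \<Rightarrow> ('a \<Rightarrow> real) \<Rightarrow> bool" for \<kappa> a where
  base: "poly_gauss \<kappa> a (\<lambda>x. exp (- \<kappa> * (norm (x - a))\<^sup>2))"
| mult: "poly_gauss \<kappa> a f \<Longrightarrow> poly_gauss \<kappa> a (\<lambda>x. (x \<bullet> b) * f x)"
| scale: "poly_gauss \<kappa> a f \<Longrightarrow> poly_gauss \<kappa> a (\<lambda>x. c * f x)"
| add: "poly_gauss \<kappa> a f \<Longrightarrow> poly_gauss \<kappa> a g \<Longrightarrow> poly_gauss \<kappa> a (\<lambda>x. f x + g x)"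

lemma poly_gauss_derivative:
  assumes "poly_gauss \<kappa> a f"
  shows "\<exists>D. (\<forall>x. (f has_derivative (\<lambda>h. D h x)) (at x)) \<and> (\<forall>h. poly_gauss \<kappa> a (D h))"
  using assms
proof induction
  case base
  let ?e = "\<lambda>x. exp (- \<kappa> * (norm (x - a))\<^sup>2)"
  let ?D = "\<lambda>h x. (- 2 * \<kappa>) * ((x \<bullet> h) * ?e x) + (2 * \<kappa> * (a \<bullet> h)) * ?e x"
  have exp_eq: "?e = (\<lambda>x. exp (- \<kappa> * ((x - a) \<bullet> (x - a))))" by (simp add: power2_norm_eq_inner)
  have "(?e has_derivative (\<lambda>h. ?D h x)) (at x)" for x
    unfolding exp_eq by (auto intro!: derivative_eq_intros simp: power2_norm_eq_inner inner_diff_left inner_diff_right inner_commute algebra_simps)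
  moreover have "poly_gauss \<kappa> a (?D h)" for h
    by (intro poly_gauss.add poly_gauss.scale poly_gauss.mult poly_gauss.base)
  ultimately show ?case by (intro exI[of _ ?D]) blast
next
  case (mult f b)
  then obtain D where D: "\<And>x. (f has_derivative (\<lambda>h. D h x)) (at x)" "\<And>h. poly_gauss \<kappa> a (D h)" by blast
  let ?D = "\<lambda>h x. (h \<bullet> b) * f x + (x \<bullet> b) * D h x"
  have "((\<lambda>x. (x \<bullet> b) * f x) has_derivative (\<lambda>h. ?D h x)) (at x)" for x
    by (auto intro!: derivative_eq_intros D(1) simp: algebra_simps)
  moreover have "poly_gauss \<kappa> a (?D h)" for h
    by (intro poly_gauss.add poly_gauss.scale poly_gauss.mult D mult)
  ultimately show ?case by (intro exI[of _ ?D]) blast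
next
  case (scale f c)
  then obtain D where D: "\<And>x. (f has_derivative (\<lambda>h. D h x)) (at x)" "\<And>h. poly_gauss \<kappa> a (D h)" by blast
  have "((\<lambda>x. c * f x) has_derivative (\<lambda>h. c * D h x)) (at x)" for x
    by (auto intro!: derivative_eq_intros D(1))
  moreover have "poly_gauss \<kappa> a (\<lambda>x. c * D h x)" for h by (intro poly_gauss.scale D)
  ultimately show ?case by (intro exI[of _ "\<lambda>h x. c * D h x"]) blast
next
  case (add f g)
  then obtain D E where D: "\<And>x. (f has_derivative (\<lambda>h. D h x)) (at x)" "\<And>h. poly_gauss \<kappa> a (D h)"
    and E: "\<And>x. (g has_derivative (\<lambda>h. E h x)) (at x)" "\<And>h. poly_gauss \<kappa> a (E h)" by blast
  have "((\<lambda>x. f x + g x) has_derivative (\<lambda>h. D h x + E h x)) (at x)" for x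
    by (auto intro!: derivative_eq_intros D(1) E(1))
  moreover have "poly_gauss \<kappa> a (\<lambda>x. D h x + E h x)" for h by (intro poly_gauss.add D E)
  ultimately show ?case by (intro exI[of _ "\<lambda>h x. D h x + E h x"]) blast
qed

lemma
  assumes "poly_gauss \<kappa> a f"
  shows poly_gauss_differentiable: "f differentiable (at x)"
    and poly_gauss_pdiff: "poly_gauss \<kappa> a (pdiff v f)"
    and poly_gauss_has_derivative: "(f has_derivative (\<lambda>h. pdiff h f x)) (at x)"
proof -
  obtain D where D: "\<And>x. (f has_derivative (\<lambda>h. D h x)) (at x)" "\<And>h. poly_gauss \<kappa> a (D h)"
    using poly_gauss_derivative[OF assms] by blast
  show "f differentiable (at x)" using D(1) by (auto simp: differentiable_def)
  have pdiff_eq: "pdiff v f = D v" for v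
    using frechet_derivative_at[OF D(1)] by (auto simp: pdiff_def fun_eq_iff)
  show "poly_gauss \<kappa> a (pdiff v f)" by (simp add: pdiff_eq D)
  show "(f has_derivative (\<lambda>h. pdiff h f x)) (at x)" using D(1) by (simp add: pdiff_eq)
qed

lemma poly_gauss_iter_pdiff: "poly_gauss \<kappa> a f \<Longrightarrow> poly_gauss \<kappa> a (iter_pdiff bs f)"
  by (induction bs) (auto intro: poly_gauss_pdiff)

lemma power_le_fact_exp: fixes y :: real assumes "y \<ge> 0" shows "y ^ n \<le> fact n * exp y"
proof -
  have "(\<Sum>i\<in>{n}. inverse (fact i) * y ^ i) \<le> (\<Sum>i. inverse (fact i) * y ^ i)"
    using summable_exp[of y] assms by (intro sum_le_suminf) auto
  also have "\<dots> = exp y" by (simp add: exp_def scaleR_conv_of_real)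
  finally show ?thesis by (simp add: field_simps)
qed

lemma one_plus_norm_le:
  fixes x y :: "'a::real_normed_vector"
  shows "1 + norm x \<le> (1 + norm (x - y)) * (1 + norm y)"
proof -
  have "norm x \<le> norm (x - y) + norm y" using norm_triangle_ineq[of "x - y" y] by simp
  moreover have "0 \<le> norm (x - y) * norm y" by simp
  ultimately show ?thesis unfolding distrib_left distrib_right mult_1_left mult_1_right by linarith
qed

lemma gauss_shift_decay:
  fixes a x :: "'a::euclidean_space"
  assumes \<kappa>: "\<kappa> > 0"
  shows "(1 + norm x) ^ N * exp (- \<kappa> * (norm (x - a))\<^sup>2) \<le> (1 + norm a) ^ N * fact N * exp (1 + 1 / (4 * \<kappa>))"
proof -
  define r where "r = norm (x - a)"
  have r: "r \<ge> 0" by (simp add: r_def)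
  have "1 + norm x \<le> (1 + norm a) * (1 + r)"
    using one_plus_norm_le[of x a] by (simp add: r_def mult.commute)
  then have "(1 + norm x) ^ N \<le> ((1 + norm a) * (1 + r)) ^ N" by (intro power_mono) auto
  also have "\<dots> \<le> (1 + norm a) ^ N * (fact N * exp (1 + r))"
    unfolding power_mult_distrib using r by (intro mult_left_mono power_le_fact_exp) auto
  finally have "(1 + norm x) ^ N * exp (- \<kappa> * r\<^sup>2) \<le> (1 + norm a) ^ N * fact N * exp (1 + r) * exp (- \<kappa> * r\<^sup>2)"
    by (simp add: mult.assoc)
  also have "\<dots> = (1 + norm a) ^ N * fact N * exp (1 + (r - \<kappa> * r\<^sup>2))"
    by (simp add: exp_add[symmetric] mult.assoc)
  also have "\<dots> \<le> (1 + norm a) ^ N * fact N * exp (1 + 1 / (4 * \<kappa>))"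
  proof (intro mult_left_mono)
    have "0 \<le> (2 * \<kappa> * r - 1)\<^sup>2" by simp
    then have "r - \<kappa> * r\<^sup>2 \<le> 1 / (4 * \<kappa>)"
      using \<kappa> by (simp add: field_simps power2_eq_square)
    then show "exp (1 + (r - \<kappa> * r\<^sup>2)) \<le> exp (1 + 1 / (4 * \<kappa>))" by simp
  qed auto
  finally show ?thesis by (simp add: r_def)
qed

lemma poly_gauss_decay:
  assumes "poly_gauss \<kappa> a f" and \<kappa>: "\<kappa> > 0"
  shows "\<exists>C. \<forall>x. (1 + norm x) ^ N * \<bar>f x\<bar> \<le> C"
  using assms(1)
proof (induction arbitrary: N)
  case base
  show ?case using gauss_shift_decay[OF \<kappa>] unfolding abs_exp_cancel by blast
next
  case (mult f b)
  obtain C where C: "\<And>x. (1 + norm x) ^ Suc N * \<bar>f x\<bar> \<le> C" using mult.IH[of "Suc N"] by blast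
  show ?case
  proof (intro exI allI)
    fix x
    have "\<bar>x \<bullet> b\<bar> \<le> norm x * norm b" by (rule Cauchy_Schwarz_ineq2)
    also have "\<dots> \<le> (1 + norm x) * norm b" by (intro mult_right_mono) auto
    finally have "(1 + norm x) ^ N * (\<bar>x \<bullet> b\<bar> * \<bar>f x\<bar>) \<le> (1 + norm x) ^ N * (((1 + norm x) * norm b) * \<bar>f x\<bar>)"
      by (intro mult_left_mono mult_right_mono) auto
    also have "\<dots> = norm b * ((1 + norm x) ^ Suc N * \<bar>f x\<bar>)" by simp
    also have "\<dots> \<le> norm b * C" using C by (intro mult_left_mono) auto
    finally show "(1 + norm x) ^ N * \<bar>(x \<bullet> b) * f x\<bar> \<le> norm b * C" by (simp add: abs_mult)
  qed
next
  case (scale f c)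
  obtain C where C: "\<And>x. (1 + norm x) ^ N * \<bar>f x\<bar> \<le> C" using scale.IH[of N] by blast
  have "(1 + norm x) ^ N * \<bar>c * f x\<bar> \<le> \<bar>c\<bar> * C" for x
    using mult_left_mono[OF C[of x], of "\<bar>c\<bar>"] by (simp add: abs_mult algebra_simps)
  then show ?case by blast
next
  case (add f g)
  obtain C D where C: "\<And>x. (1 + norm x) ^ N * \<bar>f x\<bar> \<le> C" and D: "\<And>x. (1 + norm x) ^ N * \<bar>g x\<bar> \<le> D"
    using add.IH[of N] by blast
  have "(1 + norm x) ^ N * \<bar>f x + g x\<bar> \<le> C + D" for x
  proof -
    have "(1 + norm x) ^ N * \<bar>f x + g x\<bar> \<le> (1 + norm x) ^ N * (\<bar>f x\<bar> + \<bar>g x\<bar>)" by (intro mult_left_mono) auto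
    then show ?thesis using C[of x] D[of x] by (simp add: algebra_simps)
  qed
  then show ?case by blast
qed

lemma iter_pdiff_of_real:
  assumes "poly_gauss \<kappa> a f"
  shows "iter_pdiff bs (\<lambda>x. complex_of_real (f x)) = (\<lambda>x. complex_of_real (iter_pdiff bs f x))"
proof (induction bs)
  case (Cons v bs)
  have "((\<lambda>x. complex_of_real (iter_pdiff bs f x)) has_derivative (\<lambda>h. complex_of_real (pdiff h (iter_pdiff bs f) x))) (at x)" for x
    by (intro has_derivative_of_real poly_gauss_has_derivative[OF poly_gauss_iter_pdiff[OF assms]])
  from frechet_derivative_at[OF this] show ?case
    unfolding iter_pdiff.simps Cons by (auto simp: pdiff_def fun_eq_iff)
qed simp

lemma schwartz_poly_gauss:
  assumes "poly_gauss \<kappa> a f" "\<kappa> > 0"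
  shows "schwartz (\<lambda>x. complex_of_real (f x))"
  unfolding schwartz_def iter_pdiff_of_real[OF assms(1)]
proof (intro conjI allI impI)
  fix bs x
  show "(\<lambda>x. complex_of_real (iter_pdiff bs f x)) differentiable at x"
    using has_derivative_of_real[OF poly_gauss_has_derivative[OF poly_gauss_iter_pdiff[OF assms(1)]]]
    by (auto simp: differentiable_def)
next
  fix bs and N :: nat
  obtain C where "\<And>x. (1 + norm x) ^ N * \<bar>iter_pdiff bs f x\<bar> \<le> C"
    using poly_gauss_decay[OF poly_gauss_iter_pdiff[OF assms(1)] assms(2)] by blast
  then show "bounded (range (\<lambda>x. (1 + norm x) ^ N * norm (complex_of_real (iter_pdiff bs f x))))"
    by (auto simp: bounded_iff abs_mult intro!: exI[of _ C])
qed

lemma poly_gauss_gauss: "poly_gauss pi 0 gauss"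
  using poly_gauss.base[of pi 0] by (simp add: gauss_def[abs_def])

lemma schwartz_gauss_shift:
  assumes "c > 0"
  shows "schwartz (\<lambda>x. complex_of_real (gauss ((x - a) /\<^sub>R c)))"
proof -
  have "(\<lambda>x. gauss ((x - a) /\<^sub>R c)) = (\<lambda>x. exp (- (pi / c\<^sup>2) * (norm (x - a))\<^sup>2))"
    using assms by (auto simp: gauss_def fun_eq_iff power_mult_distrib divide_simps)
  moreover have "poly_gauss (pi / c\<^sup>2) a (\<lambda>x. exp (- (pi / c\<^sup>2) * (norm (x - a))\<^sup>2))" by (rule poly_gauss.base)
  ultimately show ?thesis using assms by (intro schwartz_poly_gauss[of "pi / c\<^sup>2" a]) auto
qed

lemma iter_pdiff_snoc: "iter_pdiff (bs @ [b]) \<phi> = iter_pdiff bs (pdiff b \<phi>)"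
  by (induction bs) auto

lemma schwartz_pdiff: assumes "schwartz \<phi>" "b \<in> Basis" shows "schwartz (pdiff b \<phi>)"
  unfolding schwartz_def iter_pdiff_snoc[symmetric] using assms by (auto simp: schwartz_def)

lemma schwartz_differentiable: "schwartz \<phi> \<Longrightarrow> \<phi> differentiable (at x)"
  unfolding schwartz_def by (metis iter_pdiff.simps(1) empty_subsetI list.set(1))

lemma schwartz_decay: assumes "schwartz \<phi>" obtains C where "C > 0" "\<And>x. (1 + norm x) ^ N * norm (\<phi> x) \<le> C"
proof -
  have "bounded (range (\<lambda>x. (1 + norm x) ^ N * norm (\<phi> x)))"
    using assms unfolding schwartz_def by (metis iter_pdiff.simps(1) empty_subsetI list.set(1))
  then obtain C where "C > 0" "\<And>x. norm ((1 + norm x) ^ N * norm (\<phi> x)) \<le> C" by (auto simp: bounded_pos)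
  then show thesis by (intro that[of C]) auto
qed

lemma pdiff_add:
  assumes "\<phi> differentiable (at x)" "\<psi> differentiable (at x)"
  shows "pdiff v (\<lambda>x. \<phi> x + \<psi> x) x = pdiff v \<phi> x + pdiff v \<psi> x"
  unfolding pdiff_def
  by (subst frechet_derivative_at[OF has_derivative_add, symmetric]) (use assms in \<open>simp_all flip: frechet_derivative_works\<close>)

lemma pdiff_cmult:
  fixes \<phi> :: "'a::euclidean_space \<Rightarrow> 'b::real_normed_algebra"
  assumes "\<phi> differentiable (at x)"
  shows "pdiff v (\<lambda>x. c * \<phi> x) x = c * pdiff v \<phi> x"
  unfolding pdiff_def
  by (subst frechet_derivative_at[OF has_derivative_mult_right, symmetric]) (use assms in \<open>simp_all flip: frechet_derivative_works\<close>)

lemma iter_pdiff_add: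
  assumes "schwartz \<phi>" "schwartz \<psi>" "set bs \<subseteq> Basis"
  shows "iter_pdiff bs (\<lambda>x. \<phi> x + \<psi> x) = (\<lambda>x. iter_pdiff bs \<phi> x + iter_pdiff bs \<psi> x)"
  using assms(3)
proof (induction bs)
  case (Cons v bs)
  then have "iter_pdiff bs (\<lambda>x. \<phi> x + \<psi> x) = (\<lambda>x. iter_pdiff bs \<phi> x + iter_pdiff bs \<psi> x)" by simp
  then show ?case using Cons.prems assms(1,2) by (intro ext) (simp add: schwartz_def pdiff_add)
qed simp

lemma iter_pdiff_cmult:
  assumes "schwartz \<phi>" "set bs \<subseteq> Basis"
  shows "iter_pdiff bs (\<lambda>x. c * \<phi> x) = (\<lambda>x. c * iter_pdiff bs \<phi> x)"
  using assms(2)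
proof (induction bs)
  case (Cons v bs)
  then have "iter_pdiff bs (\<lambda>x. c * \<phi> x) = (\<lambda>x. c * iter_pdiff bs \<phi> x)" by simp
  then show ?case using Cons.prems assms(1) by (intro ext) (simp add: schwartz_def pdiff_cmult)
qed simp

lemma schwartz_add: assumes "schwartz \<phi>" "schwartz \<psi>" shows "schwartz (\<lambda>x. \<phi> x + \<psi> x)"
  unfolding schwartz_def
proof (intro conjI allI impI)
  fix bs x assume bs: "set bs \<subseteq> (Basis :: 'a set)"
  show "iter_pdiff bs (\<lambda>x. \<phi> x + \<psi> x) differentiable at x"
    using assms bs by (simp add: iter_pdiff_add schwartz_def)
next
  fix bs and N :: nat assume bs: "set bs \<subseteq> (Basis :: 'a set)"
  obtain C D where C: "\<And>x. norm ((1 + norm x) ^ N * norm (iter_pdiff bs \<phi> x)) \<le> C"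
     and D: "\<And>x. norm ((1 + norm x) ^ N * norm (iter_pdiff bs \<psi> x)) \<le> D"
    using assms bs unfolding schwartz_def bounded_iff by (metis (no_types, lifting) rangeI)
  have "norm ((1 + norm x) ^ N * norm (iter_pdiff bs \<phi> x + iter_pdiff bs \<psi> x)) \<le> C + D" for x
  proof -
    have "(1 + norm x) ^ N * norm (iter_pdiff bs \<phi> x + iter_pdiff bs \<psi> x) \<le> (1 + norm x) ^ N * (norm (iter_pdiff bs \<phi> x) + norm (iter_pdiff bs \<psi> x))"
      by (intro mult_left_mono norm_triangle_ineq) auto
    then show ?thesis using C[of x] D[of x] by (simp add: algebra_simps)
  qed
  then show "bounded (range (\<lambda>x. (1 + norm x) ^ N * norm (iter_pdiff bs (\<lambda>x. \<phi> x + \<psi> x) x)))"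
    using assms bs by (auto simp: iter_pdiff_add bounded_iff)
qed

lemma schwartz_cmult: assumes "schwartz \<phi>" shows "schwartz (\<lambda>x. c * \<phi> x)"
  unfolding schwartz_def
proof (intro conjI allI impI)
  fix bs x assume bs: "set bs \<subseteq> (Basis :: 'a set)"
  show "iter_pdiff bs (\<lambda>x. c * \<phi> x) differentiable at x"
    using assms bs by (auto simp: iter_pdiff_cmult schwartz_def intro!: differentiable_mult)
next
  fix bs and N :: nat assume bs: "set bs \<subseteq> (Basis :: 'a set)"
  obtain C where C: "\<And>x. norm ((1 + norm x) ^ N * norm (iter_pdiff bs \<phi> x)) \<le> C"
    using assms bs unfolding schwartz_def bounded_iff by (metis (no_types, lifting) rangeI)
  have "norm ((1 + norm x) ^ N * norm (c * iter_pdiff bs \<phi> x)) \<le> norm c * C" for x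
    using mult_left_mono[OF C[of x], of "norm c"] by (simp add: norm_mult algebra_simps)
  then show "bounded (range (\<lambda>x. (1 + norm x) ^ N * norm (iter_pdiff bs (\<lambda>x. c * \<phi> x) x)))"
    using assms bs by (auto simp: iter_pdiff_cmult bounded_iff)
qed

lemma schwartz_zero: "schwartz (\<lambda>_. 0)"
  using schwartz_cmult[OF schwartz_poly_gauss[OF poly_gauss_gauss pi_gt_zero], of 0] by simp

lemma schwartz_sum: "finite I \<Longrightarrow> (\<And>i. i \<in> I \<Longrightarrow> schwartz (\<phi> i)) \<Longrightarrow> schwartz (\<lambda>x. \<Sum>i\<in>I. \<phi> i x)"
  by (induction rule: finite_induct) (auto intro: schwartz_zero schwartz_add)

lemma schwartz_continuous: "schwartz \<phi> \<Longrightarrow> continuous_on UNIV \<phi>"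
  using differentiable_imp_continuous_within[OF schwartz_differentiable]
  by (auto simp: continuous_on_eq_continuous_at)

lemma schwartz_measurable: "schwartz \<phi> \<Longrightarrow> \<phi> \<in> borel_measurable borel"
  by (intro borel_measurable_continuous_onI schwartz_continuous)

section \<open>Polynomial decay\<close>

lemma integrable_inverse_1_plus_square_real: "integrable lborel (\<lambda>t::real. 1 / (1 + t\<^sup>2))"
  using integrable_inverse_1_plus_square by (simp add: set_integrable_def inverse_eq_divide)

lemma integrable_inverse_1_plus_norm2: "integrable lborel (\<lambda>x::'a::euclidean_space. 1 / (1 + (norm x)\<^sup>2) ^ DIM('a))"
proof (rule integrable_dominated)
  show "integrable lborel (\<lambda>x::'a. \<Prod>b\<in>Basis. 1 / (1 + (x \<bullet> b)\<^sup>2))"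
    by (intro integrable_prod_Basis integrable_inverse_1_plus_square_real)
  fix x :: 'a
  have "(\<Prod>b\<in>(Basis::'a set). 1 / (1 + (norm x)\<^sup>2)) \<le> (\<Prod>b\<in>Basis. 1 / (1 + (x \<bullet> b)\<^sup>2))"
    by (intro prod_mono conjI divide_left_mono)
       (auto simp: abs_le_square_iff[symmetric] Basis_le_norm add_pos_nonneg intro!: mult_pos_pos)
  then show "norm (1 / (1 + (norm x)\<^sup>2) ^ DIM('a)) \<le> (\<Prod>b\<in>Basis. 1 / (1 + (x \<bullet> b)\<^sup>2))"
    by (simp add: power_one_over)
qed measurable

definition decay :: "'a::euclidean_space \<Rightarrow> real" where
  "decay x = 1 / (1 + norm x) ^ (2 * DIM('a))"

lemma decay_measurable [measurable]: "decay \<in> borel_measurable borel"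
  unfolding decay_def by measurable

lemma decay_pos: "decay x > 0"
  unfolding decay_def by (intro divide_pos_pos zero_less_power add_pos_nonneg) auto

lemma decay_le_1: "decay x \<le> 1"
  unfolding decay_def by (simp add: divide_le_eq one_le_power)

lemma le_decay_iff: "a \<le> C * decay (x::'a::euclidean_space) \<longleftrightarrow> (1 + norm x) ^ (2 * DIM('a)) * a \<le> C"
proof -
  have "(1 + norm x) ^ (2 * DIM('a)) > 0" by (intro zero_less_power add_pos_nonneg) auto
  then show ?thesis by (simp add: decay_def field_simps)
qed

lemma integrable_decay: "integrable lborel (decay :: 'a::euclidean_space \<Rightarrow> real)"
proof (rule integrable_dominated[OF integrable_inverse_1_plus_norm2])
  fix x :: 'a
  have "(1 + (norm x)\<^sup>2) ^ DIM('a) \<le> ((1 + norm x)\<^sup>2) ^ DIM('a)"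
    by (intro power_mono) (auto simp: power2_eq_square algebra_simps)
  then show "norm (decay x) \<le> 1 / (1 + (norm x)\<^sup>2) ^ DIM('a)"
    by (auto simp: decay_def power_mult intro!: divide_left_mono mult_pos_pos zero_less_power add_pos_nonneg)
qed simp

lemma decay_translate_le: "decay y \<le> (1 + norm (x - y)) ^ (2 * DIM('a)) * decay (x::'a::euclidean_space)"
  unfolding le_decay_iff
proof -
  have one_plus_norm_nonzero: "(1 + norm y) ^ (2 * DIM('a)) \<noteq> 0"
    using norm_ge_zero[of y] by (simp add: add_nonneg_eq_0_iff)
  have "(1 + norm x) ^ (2 * DIM('a)) \<le> (1 + norm (x - y)) ^ (2 * DIM('a)) * (1 + norm y) ^ (2 * DIM('a))"
    unfolding power_mult_distrib[symmetric] by (intro power_mono one_plus_norm_le) auto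
  then have "(1 + norm x) ^ (2 * DIM('a)) * decay y
      \<le> (1 + norm (x - y)) ^ (2 * DIM('a)) * (1 + norm y) ^ (2 * DIM('a)) * decay y"
    using decay_pos[of y] by (intro mult_right_mono) auto
  also have "\<dots> = (1 + norm (x - y)) ^ (2 * DIM('a))"
    using one_plus_norm_nonzero by (simp add: decay_def)
  finally show "(1 + norm x) ^ (2 * DIM('a)) * decay y \<le> (1 + norm (x - y)) ^ (2 * DIM('a))" .
qed

lemma schwartz_le_decay:
  fixes \<phi> :: "'a::euclidean_space \<Rightarrow> complex"
  assumes "schwartz \<phi>" obtains C where "C > 0" "\<And>x. norm (\<phi> x) \<le> C * decay x"
  using schwartz_decay[OF assms, of "2 * DIM('a)"] unfolding le_decay_iff by metis

lemma schwartz_integrable: assumes "schwartz \<phi>" shows "integrable lborel \<phi>"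
proof -
  obtain C where C: "\<And>x. norm (\<phi> x) \<le> C * decay x" using schwartz_le_decay[OF assms] by blast
  show ?thesis
    using schwartz_measurable[OF assms]
    by (intro integrable_dominated[OF integrable_mult_right[OF integrable_decay, of C]] C) simp
qed

lemma schwartz_bounded: assumes "schwartz \<phi>" obtains C where "C > 0" "\<And>x. norm (\<phi> x) \<le> C"
  using schwartz_decay[OF assms, of 0] by auto

section \<open>The Fourier transform on Schwartz functions\<close>

lemma fourier_cis: "fourier \<phi> \<xi> = (LINT x|lborel. \<phi> x * cis (- (2 * pi * (x \<bullet> \<xi>))))"
  by (simp add: fourier_def cis_conv_exp algebra_simps)

lemma inv_fourier_cis: "inv_fourier \<psi> x = (LINT \<xi>|lborel. \<psi> \<xi> * cis (2 * pi * (x \<bullet> \<xi>)))"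
  by (simp add: inv_fourier_def cis_conv_exp algebra_simps)

lemma fourier_measurable [measurable]:
  assumes [measurable]: "\<phi> \<in> borel_measurable borel"
  shows "fourier \<phi> \<in> borel_measurable borel"
  unfolding fourier_cis[abs_def] by measurable

lemma norm_fourier_le: "norm (fourier \<phi> \<xi>) \<le> (LINT x|lborel. norm (\<phi> x))"
  unfolding fourier_cis
  using integral_norm_bound[of lborel "\<lambda>x. \<phi> x * cis (- (2 * pi * (x \<bullet> \<xi>)))"] by (simp add: norm_mult)

lemma fourier_add:
  assumes "integrable lborel \<phi>" "integrable lborel \<psi>"
  shows "fourier (\<lambda>x. \<phi> x + \<psi> x) \<xi> = fourier \<phi> \<xi> + fourier \<psi> \<xi>"
proof -
  have "integrable lborel (\<lambda>x. \<phi> x * cis (- (2 * pi * (x \<bullet> \<xi>))))" "integrable lborel (\<lambda>x. \<psi> x * cis (- (2 * pi * (x \<bullet> \<xi>))))"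
    using assms by (intro integrable_mult_cis; measurable)+
  then show ?thesis unfolding fourier_cis by (simp add: distrib_right)
qed

lemma fourier_cmult: "fourier (\<lambda>x. c * \<phi> x) \<xi> = c * fourier \<phi> \<xi>"
  unfolding fourier_cis by (simp add: mult.assoc)

lemma fourier_sum:
  assumes "finite I" "\<And>i. i \<in> I \<Longrightarrow> integrable lborel (\<phi> i)"
  shows "fourier (\<lambda>x. \<Sum>i\<in>I. \<phi> i x) \<xi> = (\<Sum>i\<in>I. fourier (\<phi> i) \<xi>)"
  using assms
proof (induction rule: finite_induct)
  case empty show ?case by (simp add: fourier_cis)
next
  case (insert i I)
  then have "fourier (\<lambda>x. \<phi> i x + (\<Sum>i\<in>I. \<phi> i x)) \<xi> = fourier (\<phi> i) \<xi> + fourier (\<lambda>x. \<Sum>i\<in>I. \<phi> i x) \<xi>"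
    by (intro fourier_add) auto
  then show ?case using insert by simp
qed

lemma fourier_translate:
  fixes \<phi> :: "'a::euclidean_space \<Rightarrow> complex"
  assumes [measurable]: "\<phi> \<in> borel_measurable borel"
  shows "fourier (\<lambda>x. \<phi> (x + c)) \<xi> = cis (2 * pi * (c \<bullet> \<xi>)) * fourier \<phi> \<xi>"
proof -
  have phase: "cis (2 * pi * (c \<bullet> \<xi>)) * cis (- (2 * pi * ((x + c) \<bullet> \<xi>))) = cis (- (2 * pi * (x \<bullet> \<xi>)))" for x
    by (simp add: cis_mult inner_add_left algebra_simps)
  have "fourier (\<lambda>x. \<phi> (x + c)) \<xi> = (LINT x|lborel. cis (2 * pi * (c \<bullet> \<xi>)) * (\<phi> (x + c) * cis (- (2 * pi * ((x + c) \<bullet> \<xi>)))))"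
    unfolding fourier_cis mult.left_commute[of "cis (2 * pi * (c \<bullet> \<xi>))"] phase ..
  also have "\<dots> = cis (2 * pi * (c \<bullet> \<xi>)) * (LINT x|lborel. \<phi> (x + c) * cis (- (2 * pi * ((x + c) \<bullet> \<xi>))))"
    by (rule integral_mult_right_zero)
  also have "(LINT x|lborel. \<phi> (x + c) * cis (- (2 * pi * ((x + c) \<bullet> \<xi>)))) = fourier \<phi> \<xi>"
    using integral_affine[of 1 "\<lambda>x. \<phi> x * cis (- (2 * pi * (x \<bullet> \<xi>)))" c] by (simp add: fourier_cis)
  finally show ?thesis .
qed

lemma fourier_tendsto:
  fixes \<phi> :: "nat \<Rightarrow> 'a::euclidean_space \<Rightarrow> complex"
  assumes "integrable lborel B" and [measurable]: "\<And>n. \<phi> n \<in> borel_measurable borel"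
    and "\<And>x. (\<lambda>n. \<phi> n x) \<longlonglongrightarrow> \<psi> x" "\<And>n x. norm (\<phi> n x) \<le> B x"
  shows "(\<lambda>n. fourier (\<phi> n) \<xi>) \<longlonglongrightarrow> fourier \<psi> \<xi>"
  unfolding fourier_cis
  by (rule tendsto_integral_dominated[OF assms(1)]) (auto intro!: tendsto_mult assms(3) simp: norm_mult assms(4))

lemma schwartz_line_derivative:
  assumes "schwartz \<phi>"
  shows "((\<lambda>t. \<phi> (x + t *\<^sub>R b)) has_vector_derivative pdiff b \<phi> (x + t *\<^sub>R b)) (at t within S)"
proof -
  have diff: "\<phi> differentiable at (x + t *\<^sub>R b)" by (rule schwartz_differentiable[OF assms])
  have "((\<lambda>t. \<phi> (x + t *\<^sub>R b)) has_derivative (\<lambda>s. frechet_derivative \<phi> (at (x + t *\<^sub>R b)) (s *\<^sub>R b))) (at t within S)"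
    using diff unfolding frechet_derivative_works
    by (intro has_derivative_compose[of "\<lambda>t. x + t *\<^sub>R b" "\<lambda>s. s *\<^sub>R b" _ _ \<phi>]) (auto intro!: derivative_eq_intros)
  then show ?thesis
    using linear_frechet_derivative[OF diff] by (simp add: has_vector_derivative_def pdiff_def linear_cmul)
qed

lemma schwartz_diff_quotient:
  fixes \<phi> :: "'a::euclidean_space \<Rightarrow> complex"
  assumes \<phi>: "schwartz \<phi>" and b: "b \<in> Basis"
  obtains C where "C > 0" "\<And>x h. 0 < h \<Longrightarrow> h \<le> 1 \<Longrightarrow> norm ((\<phi> (x + h *\<^sub>R b) - \<phi> x) / of_real h) \<le> C * decay x"
proof -
  obtain C where C: "C > 0" "\<And>x. norm (pdiff b \<phi> x) \<le> C * decay x"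
    using schwartz_le_decay[OF schwartz_pdiff[OF \<phi> b]] by blast
  show thesis
  proof (rule that[of "C * 2 ^ (2 * DIM('a))"])
    fix x :: 'a and h :: real assume h: "0 < h" "h \<le> 1"
    have bound: "norm (pdiff b \<phi> (x + t *\<^sub>R b)) \<le> C * 2 ^ (2 * DIM('a)) * decay x" if "t \<in> {0..h}" for t
    proof -
      have "decay (x + t *\<^sub>R b) \<le> (1 + norm (x - (x + t *\<^sub>R b))) ^ (2 * DIM('a)) * decay x" by (rule decay_translate_le)
      also have "\<dots> \<le> 2 ^ (2 * DIM('a)) * decay x"
        using that h b decay_pos[of x] by (intro mult_right_mono power_mono) auto
      finally have "C * decay (x + t *\<^sub>R b) \<le> C * (2 ^ (2 * DIM('a)) * decay x)" using C(1) by (intro mult_left_mono) auto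
      then show ?thesis using C(2)[of "x + t *\<^sub>R b"] by (simp add: mult.assoc)
    qed
    have "norm (\<phi> (x + h *\<^sub>R b) - \<phi> (x + 0 *\<^sub>R b)) \<le> C * 2 ^ (2 * DIM('a)) * decay x * norm (h - 0)"
    proof (rule differentiable_bound[where S="{0..h}" and f'="\<lambda>t s. s *\<^sub>R pdiff b \<phi> (x + t *\<^sub>R b)"])
      show "onorm (\<lambda>s. s *\<^sub>R pdiff b \<phi> (x + t *\<^sub>R b)) \<le> C * 2 ^ (2 * DIM('a)) * decay x" if "t \<in> {0..h}" for t
        by (rule onorm_le) (use mult_right_mono[OF bound[OF that] abs_ge_zero] in \<open>simp add: mult.commute\<close>)
    qed (use h schwartz_line_derivative[OF \<phi>] in \<open>auto simp: has_vector_derivative_def\<close>)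
    then show "norm ((\<phi> (x + h *\<^sub>R b) - \<phi> x) / of_real h) \<le> C * 2 ^ (2 * DIM('a)) * decay x"
      using h by (simp add: norm_divide divide_le_eq)
  qed (use C in simp)
qed

lemma has_vector_derivative_tendsto_quotient:
  fixes f :: "real \<Rightarrow> complex"
  assumes f: "(f has_vector_derivative d) (at 0)" and h: "h \<longlonglongrightarrow> 0" "\<And>n. h n \<noteq> 0"
  shows "(\<lambda>n. (f (h n) - f 0) / of_real (h n)) \<longlonglongrightarrow> d"
proof -
  have lim: "((\<lambda>t. (f t - f 0 - t *\<^sub>R d) /\<^sub>R norm t) \<longlongrightarrow> 0) (at 0)"
    using f unfolding has_vector_derivative_def has_derivative_at_within by simp
  have "filterlim h (at 0) sequentially" using h by (simp add: filterlim_at)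
  from tendsto_norm_zero[OF filterlim_compose[OF lim this]]
  have "(\<lambda>n. norm ((f (h n) - f 0 - h n *\<^sub>R d) /\<^sub>R norm (h n))) \<longlonglongrightarrow> 0" .
  moreover have "norm ((f (h n) - f 0 - h n *\<^sub>R d) /\<^sub>R norm (h n)) = norm ((f (h n) - f 0) / of_real (h n) - d)" for n
  proof -
    have "f (h n) - f 0 - h n *\<^sub>R d = of_real (h n) * ((f (h n) - f 0) / of_real (h n) - d)"
      using h(2)[of n] by (simp add: scaleR_conv_of_real field_simps)
    then show ?thesis using h(2)[of n] by (simp add: norm_mult)
  qed
  ultimately show ?thesis by (simp add: tendsto_norm_zero_iff LIM_zero_iff)
qed

lemma fourier_diff_quotient:
  fixes \<phi> :: "'a::euclidean_space \<Rightarrow> complex"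
  assumes \<phi>: "schwartz \<phi>"
  shows "fourier (\<lambda>x. (\<phi> (x + h *\<^sub>R b) - \<phi> x) / of_real h) \<xi> = (cis (2 * pi * (b \<bullet> \<xi>) * h) - 1) / of_real h * fourier \<phi> \<xi>"
proof -
  have [measurable]: "\<phi> \<in> borel_measurable borel" by (rule schwartz_measurable[OF \<phi>])
  have int: "integrable lborel (\<lambda>x. \<phi> (x + h *\<^sub>R b))"
    using integrable_affine_iff[of 1 \<phi> "h *\<^sub>R b"] schwartz_integrable[OF \<phi>] by simp
  have "fourier (\<lambda>x. (1 / of_real h) * (\<phi> (x + h *\<^sub>R b) + (- 1) * \<phi> x)) \<xi>
      = (1 / of_real h) * (fourier (\<lambda>x. \<phi> (x + h *\<^sub>R b)) \<xi> + (- 1) * fourier \<phi> \<xi>)"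
    using schwartz_integrable[OF \<phi>] int by (simp only: fourier_cmult fourier_add integrable_mult_right)
  then show ?thesis by (simp add: fourier_translate field_simps)
qed

lemma fourier_pdiff:
  fixes \<phi> :: "'a::euclidean_space \<Rightarrow> complex"
  assumes \<phi>: "schwartz \<phi>" and b: "b \<in> Basis"
  shows "fourier (pdiff b \<phi>) \<xi> = 2 * of_real pi * \<i> * of_real (b \<bullet> \<xi>) * fourier \<phi> \<xi>"
proof -
  obtain C where "C > 0" and C: "\<And>x h. 0 < h \<Longrightarrow> h \<le> 1 \<Longrightarrow> norm ((\<phi> (x + h *\<^sub>R b) - \<phi> x) / of_real h) \<le> C * decay x"
    by (rule schwartz_diff_quotient[OF \<phi> b]) blast
  define h where "h = (\<lambda>n. inverse (real (Suc n)))"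
  have h: "h n > 0" "h n \<le> 1" "h n \<noteq> 0" for n by (auto simp: h_def inverse_le_1_iff)
  have h_tendsto: "h \<longlonglongrightarrow> 0" unfolding h_def by (rule LIMSEQ_inverse_real_of_nat)
  have "(\<lambda>n. fourier (\<lambda>x. (\<phi> (x + h n *\<^sub>R b) - \<phi> x) / of_real (h n)) \<xi>) \<longlonglongrightarrow> fourier (pdiff b \<phi>) \<xi>"
  proof (rule fourier_tendsto)
    show "integrable lborel (\<lambda>x::'a. C * decay x)" by (intro integrable_mult_right integrable_decay)
    show "(\<lambda>n. (\<phi> (x + h n *\<^sub>R b) - \<phi> x) / of_real (h n)) \<longlonglongrightarrow> pdiff b \<phi> x" for x
      using has_vector_derivative_tendsto_quotient[OF _ h_tendsto h(3), of "\<lambda>t. \<phi> (x + t *\<^sub>R b)"] schwartz_line_derivative[OF \<phi>, of x b 0]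
      by simp
    have [measurable]: "\<phi> \<in> borel_measurable borel" by (rule schwartz_measurable[OF \<phi>])
    show "(\<lambda>x. (\<phi> (x + h n *\<^sub>R b) - \<phi> x) / of_real (h n)) \<in> borel_measurable borel" for n by measurable
  qed (rule C[OF h(1,2)])
  moreover have "((\<lambda>t. cis (2 * pi * (b \<bullet> \<xi>) * t)) has_vector_derivative (2 * of_real pi * \<i> * of_real (b \<bullet> \<xi>))) (at 0)"
  proof -
    have "((\<lambda>z. exp (2 * of_real pi * \<i> * of_real (b \<bullet> \<xi>) * z)) has_field_derivative (2 * of_real pi * \<i> * of_real (b \<bullet> \<xi>))) (at (of_real 0))"
      by (auto intro!: derivative_eq_intros)
    from has_vector_derivative_real_field[OF this, of UNIV] show ?thesis
      by (simp add: cis_conv_exp algebra_simps)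
  qed
  from tendsto_mult_right[OF has_vector_derivative_tendsto_quotient[OF this h_tendsto h(3)], of "fourier \<phi> \<xi>"]
  have "(\<lambda>n. fourier (\<lambda>x. (\<phi> (x + h n *\<^sub>R b) - \<phi> x) / of_real (h n)) \<xi>) \<longlonglongrightarrow> 2 * of_real pi * \<i> * of_real (b \<bullet> \<xi>) * fourier \<phi> \<xi>"
    by (simp add: fourier_diff_quotient[OF \<phi>])
  ultimately show ?thesis by (rule LIMSEQ_unique)
qed

definition helmholtz :: "('a::euclidean_space \<Rightarrow> complex) \<Rightarrow> 'a \<Rightarrow> complex" where
  "helmholtz \<phi> = (\<lambda>x. \<phi> x + (- 1 / (4 * of_real pi ^ 2)) * (\<Sum>b\<in>Basis. pdiff b (pdiff b \<phi>) x))"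

lemma schwartz_helmholtz: "schwartz \<phi> \<Longrightarrow> schwartz (helmholtz \<phi>)"
  unfolding helmholtz_def by (intro schwartz_add schwartz_cmult schwartz_sum schwartz_pdiff) auto

lemma fourier_helmholtz:
  assumes \<phi>: "schwartz \<phi>"
  shows "fourier (helmholtz \<phi>) \<xi> = of_real (1 + (norm \<xi>)\<^sup>2) * fourier \<phi> \<xi>"
proof -
  have schwartz2: "schwartz (pdiff b (pdiff b \<phi>))" if "b \<in> Basis" for b using \<phi> that by (intro schwartz_pdiff)
  have fourier2: "fourier (pdiff b (pdiff b \<phi>)) \<xi> = - 4 * of_real pi ^ 2 * of_real ((\<xi> \<bullet> b)\<^sup>2) * fourier \<phi> \<xi>" if b: "b \<in> Basis" for b
    by (simp add: fourier_pdiff[OF schwartz_pdiff[OF \<phi> b] b] fourier_pdiff[OF \<phi> b] power2_eq_square inner_commute algebra_simps)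
  have int: "integrable lborel (\<lambda>x. (- 1 / (4 * of_real pi ^ 2)) * (\<Sum>b\<in>Basis. pdiff b (pdiff b \<phi>) x))"
    by (intro schwartz_integrable schwartz_cmult schwartz_sum schwartz2 finite_Basis)
  have "fourier (helmholtz \<phi>) \<xi> = fourier \<phi> \<xi> + (- 1 / (4 * of_real pi ^ 2)) * (\<Sum>b\<in>Basis. fourier (pdiff b (pdiff b \<phi>)) \<xi>)"
    unfolding helmholtz_def fourier_add[OF schwartz_integrable[OF \<phi>] int] fourier_cmult
    using fourier_sum[of Basis "\<lambda>b. pdiff b (pdiff b \<phi>)" \<xi>] schwartz_integrable[OF schwartz2] by simp
  also have "(\<Sum>b\<in>Basis. fourier (pdiff b (pdiff b \<phi>)) \<xi>) = - 4 * of_real pi ^ 2 * of_real ((norm \<xi>)\<^sup>2) * fourier \<phi> \<xi>"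
    by (simp add: fourier2 power2_norm_Basis sum_distrib_left sum_distrib_right sum_negf)
  finally show ?thesis by (simp add: field_simps)
qed

lemma schwartz_helmholtz_funpow: "schwartz \<phi> \<Longrightarrow> schwartz ((helmholtz ^^ k) \<phi>)"
  by (induction k) (auto intro: schwartz_helmholtz)

lemma fourier_helmholtz_funpow:
  "schwartz \<phi> \<Longrightarrow> fourier ((helmholtz ^^ k) \<phi>) \<xi> = of_real ((1 + (norm \<xi>)\<^sup>2) ^ k) * fourier \<phi> \<xi>"
  by (induction k) (auto simp: fourier_helmholtz schwartz_helmholtz_funpow)

lemma integrable_fourier_schwartz:
  fixes \<phi> :: "'a::euclidean_space \<Rightarrow> complex"
  assumes \<phi>: "schwartz \<phi>"
  shows "integrable lborel (\<lambda>\<xi>. of_real ((1 + (norm \<xi>)\<^sup>2) powr s) * fourier \<phi> \<xi>)"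
proof -
  define k where "k = nat \<lceil>s\<rceil>"
  define C where "C = (LINT x|lborel. norm ((helmholtz ^^ (k + DIM('a))) \<phi> x))"
  have decay: "(1 + (norm \<xi>)\<^sup>2) ^ (k + DIM('a)) * norm (fourier \<phi> \<xi>) \<le> C" for \<xi>
    using norm_fourier_le[of "(helmholtz ^^ (k + DIM('a))) \<phi>" \<xi>]
    by (simp add: C_def fourier_helmholtz_funpow[OF \<phi>] norm_mult norm_power del: of_real_power of_real_add)
  have [measurable]: "\<phi> \<in> borel_measurable borel" by (rule schwartz_measurable[OF \<phi>])
  show ?thesis
  proof (rule integrable_dominated[OF integrable_mult_right[OF integrable_inverse_1_plus_norm2, of C]])
    fix \<xi> :: 'a
    define w where "w = 1 + (norm \<xi>)\<^sup>2"
    have w: "w \<ge> 1" "w > 0" by (auto simp: w_def add_pos_nonneg)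
    have "w powr s \<le> w powr real k" using w real_nat_ceiling_ge[of s] by (intro powr_mono) (auto simp: k_def)
    then have "w powr s * norm (fourier \<phi> \<xi>) \<le> w ^ k * norm (fourier \<phi> \<xi>)"
      using w by (intro mult_right_mono) (auto simp: powr_realpow)
    also have "\<dots> = (w ^ (k + DIM('a)) * norm (fourier \<phi> \<xi>)) * (1 / w ^ DIM('a))"
      using w by (simp add: power_add)
    also have "\<dots> \<le> C * (1 / w ^ DIM('a))" using decay[of \<xi>] w by (intro mult_right_mono) (auto simp: w_def)
    finally show "norm (of_real ((1 + (norm \<xi>)\<^sup>2) powr s) * fourier \<phi> \<xi>) \<le> C * (1 / (1 + (norm \<xi>)\<^sup>2) ^ DIM('a))"
      using w by (simp add: norm_mult w_def)
  qed measurable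
qed

lemma integrable_fourier: "schwartz \<phi> \<Longrightarrow> integrable lborel (fourier \<phi>)"
  using integrable_fourier_schwartz[of \<phi> 0] by (simp add: add_nonneg_eq_0_iff)

lemma isCont_gauss: "isCont gauss x"
  unfolding gauss_def by (intro continuous_intros)

lemma fourier_gauss_scaled:
  fixes x :: "'a::euclidean_space"
  assumes e: "e > 0"
  shows "(LINT \<xi>|lborel. complex_of_real (gauss (e *\<^sub>R \<xi>)) * cis (2 * pi * (x \<bullet> \<xi>))) = (1 / e ^ DIM('a)) *\<^sub>R of_real (gauss (x /\<^sub>R e))"
proof -
  have phase: "2 * pi * (x \<bullet> \<xi>) = - (2 * pi * ((e *\<^sub>R \<xi> + 0) \<bullet> ((- x) /\<^sub>R e)))" for \<xi>
    using e by (simp add: inner_commute)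
  have "(LINT \<xi>|lborel. complex_of_real (gauss (e *\<^sub>R \<xi> + 0)) * cis (- (2 * pi * ((e *\<^sub>R \<xi> + 0) \<bullet> ((- x) /\<^sub>R e)))))
      = (1 / \<bar>e\<bar> ^ DIM('a)) *\<^sub>R (LINT \<xi>|lborel. complex_of_real (gauss \<xi>) * cis (- (2 * pi * (\<xi> \<bullet> ((- x) /\<^sub>R e)))))"
    using e by (intro integral_affine) auto
  then show ?thesis unfolding phase using e by (simp add: fourier_gauss del: inner_scaleR_right inner_minus_right inner_scaleR_left)
qed

lemma fourier_gauss_damped:
  fixes \<phi> :: "'a::euclidean_space \<Rightarrow> complex"
  assumes \<phi>: "integrable lborel \<phi>" and e: "e > 0"
  shows "(LINT \<xi>|lborel. fourier \<phi> \<xi> * of_real (gauss (e *\<^sub>R \<xi>)) * cis (2 * pi * (x \<bullet> \<xi>))) = (LINT z|lborel. \<phi> (e *\<^sub>R z + x) * of_real (gauss z))"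
proof -
  have [measurable]: "\<phi> \<in> borel_measurable borel" using \<phi> by auto
  let ?F = "\<lambda>(y, \<xi>). \<phi> y * (of_real (gauss (e *\<^sub>R \<xi>)) * cis (2 * pi * ((x - y) \<bullet> \<xi>)))"
  have int_gauss: "integrable lborel (\<lambda>\<xi>::'a. gauss (e *\<^sub>R \<xi>))"
    using integrable_affine_iff[of e "gauss :: 'a \<Rightarrow> real" 0] e integrable_gauss[where 'a='a] by simp
  have int_F: "integrable (lborel \<Otimes>\<^sub>M lborel) ?F"
  proof (rule lborel_pair.Fubini_integrable)
    show "integrable lborel (\<lambda>y. \<integral>\<xi>. norm (?F (y, \<xi>)) \<partial>lborel)"
      using \<phi> by (simp add: norm_mult abs_of_pos gauss_pos)
    show "AE y in lborel. integrable lborel (\<lambda>\<xi>. ?F (y, \<xi>))"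
      using int_gauss by (auto intro!: integrable_mult_right integrable_mult_cis)
  qed measurable
  have "fourier \<phi> \<xi> * of_real (gauss (e *\<^sub>R \<xi>)) * cis (2 * pi * (x \<bullet> \<xi>)) = (LINT y|lborel. ?F (y, \<xi>))" for \<xi>
  proof -
    have "cis (- (2 * pi * (y \<bullet> \<xi>))) * cis (2 * pi * (x \<bullet> \<xi>)) = cis (2 * pi * ((x - y) \<bullet> \<xi>))" for y
      by (simp add: cis_mult inner_diff_left algebra_simps)
    then have F_eq: "?F (y, \<xi>) = (\<phi> y * cis (- (2 * pi * (y \<bullet> \<xi>)))) * (of_real (gauss (e *\<^sub>R \<xi>)) * cis (2 * pi * (x \<bullet> \<xi>)))" for y
      by (simp add: mult_ac)
    show ?thesis unfolding F_eq fourier_cis integral_mult_left_zero by (simp only: mult.assoc)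
  qed
  then have "(LINT \<xi>|lborel. fourier \<phi> \<xi> * of_real (gauss (e *\<^sub>R \<xi>)) * cis (2 * pi * (x \<bullet> \<xi>))) = (LINT \<xi>|lborel. (LINT y|lborel. ?F (y, \<xi>)))"
    by simp
  also have "\<dots> = (LINT y|lborel. (LINT \<xi>|lborel. ?F (y, \<xi>)))"
    using lborel_pair.Fubini_integral[OF int_F] by simp
  also have "\<dots> = (LINT y|lborel. (1 / e ^ DIM('a)) *\<^sub>R (\<phi> y * of_real (gauss ((x - y) /\<^sub>R e))))"
    by (simp add: fourier_gauss_scaled[OF e])
  also have "\<dots> = (1 / \<bar>e\<bar> ^ DIM('a)) *\<^sub>R (LINT y|lborel. \<phi> y * of_real (gauss ((x - y) /\<^sub>R e)))" using e by simp
  also have "\<dots> = (LINT z|lborel. \<phi> (e *\<^sub>R z + x) * of_real (gauss ((x - (e *\<^sub>R z + x)) /\<^sub>R e)))"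
    using e by (intro integral_affine[symmetric]) auto
  also have "\<dots> = (LINT z|lborel. \<phi> (e *\<^sub>R z + x) * of_real (gauss z))" using e by simp
  finally show ?thesis .
qed

lemma gauss_approx_identity:
  fixes \<phi> :: "'a::euclidean_space \<Rightarrow> complex"
  assumes cont: "continuous_on UNIV \<phi>" and bound: "\<And>x. norm (\<phi> x) \<le> C" and e: "e \<longlonglongrightarrow> (0::real)"
  shows "(\<lambda>n. LINT z|lborel. \<phi> (e n *\<^sub>R z + x) * of_real (gauss z)) \<longlonglongrightarrow> \<phi> x"
proof -
  have [measurable]: "\<phi> \<in> borel_measurable borel" using cont by (rule borel_measurable_continuous_onI)
  have "(\<lambda>n. LINT z|lborel. \<phi> (e n *\<^sub>R z + x) * of_real (gauss z)) \<longlonglongrightarrow> (LINT z|lborel. \<phi> x * of_real (gauss (z::'a)))"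
  proof (rule tendsto_integral_dominated)
    show "integrable lborel (\<lambda>z::'a. C * gauss z)" by (intro integrable_mult_right integrable_gauss)
    fix z :: 'a
    have "(\<lambda>n. e n *\<^sub>R z + x) \<longlonglongrightarrow> 0 *\<^sub>R z + x" using e by (intro tendsto_intros)
    then have "(\<lambda>n. \<phi> (e n *\<^sub>R z + x)) \<longlonglongrightarrow> \<phi> (0 *\<^sub>R z + x)"
      using cont by (auto simp: continuous_on_eq_continuous_at intro: isCont_tendsto_compose)
    then show "(\<lambda>n. \<phi> (e n *\<^sub>R z + x) * of_real (gauss z)) \<longlonglongrightarrow> \<phi> x * of_real (gauss z)"
      by (intro tendsto_intros) simp
    show "norm (\<phi> (e n *\<^sub>R z + x) * of_real (gauss z)) \<le> C * gauss z" for n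
      by (simp add: norm_mult abs_of_pos gauss_pos mult_right_mono bound less_imp_le)
  qed measurable
  also have "(LINT z|lborel. \<phi> x * of_real (gauss (z::'a))) = \<phi> x * complex_of_real (LINT z|lborel. gauss (z::'a))"
    by (subst integral_mult_right_zero) simp
  finally show ?thesis by (simp only: integral_gauss of_real_1 mult_1_right)
qed

theorem fourier_inversion:
  fixes \<phi> :: "'a::euclidean_space \<Rightarrow> complex"
  assumes \<phi>: "schwartz \<phi>"
  shows "inv_fourier (fourier \<phi>) x = \<phi> x"
proof -
  have [measurable]: "\<phi> \<in> borel_measurable borel" by (rule schwartz_measurable[OF \<phi>])
  define e where "e = (\<lambda>n. inverse (real (Suc n)))"
  have e: "e n > 0" "e \<longlonglongrightarrow> 0" for n using LIMSEQ_inverse_real_of_nat by (auto simp: e_def)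
  have "(\<lambda>n. LINT \<xi>|lborel. fourier \<phi> \<xi> * of_real (gauss (e n *\<^sub>R \<xi>)) * cis (2 * pi * (x \<bullet> \<xi>))) \<longlonglongrightarrow> (LINT \<xi>|lborel. fourier \<phi> \<xi> * cis (2 * pi * (x \<bullet> \<xi>)))"
  proof (rule tendsto_integral_dominated[OF integrable_norm[OF integrable_fourier[OF \<phi>]]])
    fix \<xi> :: 'a
    have "(\<lambda>n. e n *\<^sub>R \<xi>) \<longlonglongrightarrow> 0" using tendsto_scaleR[OF e(2) tendsto_const, of \<xi>] by simp
    then have "(\<lambda>n. gauss (e n *\<^sub>R \<xi>)) \<longlonglongrightarrow> gauss (0::'a)" by (rule isCont_tendsto_compose[OF isCont_gauss])
    then have "(\<lambda>n. complex_of_real (gauss (e n *\<^sub>R \<xi>))) \<longlonglongrightarrow> of_real 1" unfolding gauss_0 by (rule tendsto_of_real)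
    from tendsto_mult[OF tendsto_mult[OF tendsto_const this] tendsto_const]
    show "(\<lambda>n. fourier \<phi> \<xi> * of_real (gauss (e n *\<^sub>R \<xi>)) * cis (2 * pi * (x \<bullet> \<xi>))) \<longlonglongrightarrow> fourier \<phi> \<xi> * cis (2 * pi * (x \<bullet> \<xi>))"
      by simp
    show "norm (fourier \<phi> \<xi> * of_real (gauss (e n *\<^sub>R \<xi>)) * cis (2 * pi * (x \<bullet> \<xi>))) \<le> norm (fourier \<phi> \<xi>)" for n
      by (simp add: norm_mult abs_of_pos gauss_pos gauss_le_1 mult_left_le)
  qed measurable
  moreover obtain C where "\<And>x. norm (\<phi> x) \<le> C" using schwartz_bounded[OF \<phi>] by blast
  from gauss_approx_identity[OF schwartz_continuous[OF \<phi>] this e(2)]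
  have "(\<lambda>n. LINT \<xi>|lborel. fourier \<phi> \<xi> * of_real (gauss (e n *\<^sub>R \<xi>)) * cis (2 * pi * (x \<bullet> \<xi>))) \<longlonglongrightarrow> \<phi> x"
    by (simp only: fourier_gauss_damped[OF schwartz_integrable[OF \<phi>] e(1)])
  ultimately show ?thesis unfolding inv_fourier_cis by (rule LIMSEQ_unique)
qed

lemma fourier_inv_fourier_pairing:
  fixes \<phi> \<psi> :: "'a::euclidean_space \<Rightarrow> complex"
  assumes \<phi>: "integrable lborel \<phi>" and \<psi>: "integrable lborel \<psi>"
  shows "(LINT x|lborel. \<phi> x * inv_fourier \<psi> x) = (LINT \<xi>|lborel. \<psi> \<xi> * fourier \<phi> (- \<xi>))"
proof -
  have [measurable]: "\<phi> \<in> borel_measurable borel" "\<psi> \<in> borel_measurable borel" using \<phi> \<psi> by auto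
  let ?F = "\<lambda>(x, \<xi>). \<phi> x * (\<psi> \<xi> * cis (2 * pi * (x \<bullet> \<xi>)))"
  have int_F: "integrable (lborel \<Otimes>\<^sub>M lborel) ?F"
  proof (rule lborel_pair.Fubini_integrable)
    show "integrable lborel (\<lambda>x. \<integral>\<xi>. norm (?F (x, \<xi>)) \<partial>lborel)" using \<phi> by (simp add: norm_mult)
    show "AE x in lborel. integrable lborel (\<lambda>\<xi>. ?F (x, \<xi>))"
      using \<psi> by (auto intro!: integrable_mult_right integrable_mult_cis)
  qed measurable
  have "(LINT x|lborel. \<phi> x * inv_fourier \<psi> x) = (LINT x|lborel. (LINT \<xi>|lborel. ?F (x, \<xi>)))"
    unfolding inv_fourier_cis by simp
  also have "\<dots> = (LINT \<xi>|lborel. (LINT x|lborel. ?F (x, \<xi>)))"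
    using lborel_pair.Fubini_integral[OF int_F] by simp
  also have "\<dots> = (LINT \<xi>|lborel. (LINT x|lborel. \<psi> \<xi> * (\<phi> x * cis (- (2 * pi * (x \<bullet> (- \<xi>)))))))"
    by (simp add: mult_ac)
  finally show ?thesis by (simp only: integral_mult_right_zero fourier_cis)
qed

section \<open>Multipliers given by finite signed measures\<close>

text \<open>A finite signed measure on \<open>'a\<close> is represented by a probability measure on pairs (point, weight).
  This avoids Hahn decompositions; sums and mixtures are again images of product measures.\<close>

definition weighted_measure :: "('a::euclidean_space \<times> real) measure \<Rightarrow> bool" where
  "weighted_measure N \<longleftrightarrow> prob_space N \<and> sets N = sets borel \<and> integrable N snd"

abbreviation character :: "'a::euclidean_space \<Rightarrow> 'a \<Rightarrow> complex" where
  "character \<xi> y \<equiv> cis (- (2 * pi * (y \<bullet> \<xi>)))"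

definition weighted_fourier :: "('a::euclidean_space \<times> real) measure \<Rightarrow> 'a \<Rightarrow> complex" where
  "weighted_fourier N \<xi> = (\<integral>w. of_real (snd w) * character \<xi> (fst w) \<partial>N)"

definition weighted_conv :: "('a::euclidean_space \<times> real) measure \<Rightarrow> ('a \<Rightarrow> real) \<Rightarrow> 'a \<Rightarrow> real" where
  "weighted_conv N g x = (\<integral>w. snd w * g (x + fst w) \<partial>N)"

definition weighted_adj :: "('a::euclidean_space \<times> real) measure \<Rightarrow> ('a \<Rightarrow> complex) \<Rightarrow> 'a \<Rightarrow> complex" where
  "weighted_adj N \<psi> x = (\<integral>w. of_real (snd w) * \<psi> (x - fst w) \<partial>N)"

lemma weighted_measure_sets: "weighted_measure N \<Longrightarrow> sets N = sets (borel \<Otimes>\<^sub>M borel)"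
  by (metis weighted_measure_def borel_prod)

lemma weighted_measure_prob_space: "weighted_measure N \<Longrightarrow> prob_space N"
  by (simp add: weighted_measure_def)

lemma weighted_measure_sigma_finite: "weighted_measure N \<Longrightarrow> sigma_finite_measure N"
  by (simp add: weighted_measure_def prob_space_imp_sigma_finite)

lemma weighted_measure_integrable: "weighted_measure N \<Longrightarrow> integrable N snd"
  by (simp add: weighted_measure_def)

lemma character_add: "character \<xi> (y + z) = character \<xi> y * character \<xi> z"
  by (simp add: cis_mult inner_add_left algebra_simps)

lemma
  fixes h :: "'w \<Rightarrow> 'v \<Rightarrow> 'b::{real_normed_field, banach, second_countable_topology}"
  assumes N: "sigma_finite_measure N" and M: "sigma_finite_measure M"
    and [measurable]: "(\<lambda>(w, x). h w x) \<in> borel_measurable (N \<Otimes>\<^sub>M M)" and k: "integrable N k"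
    and h: "\<And>w. w \<in> space N \<Longrightarrow> integrable M (h w)"
    and bound: "\<And>w. w \<in> space N \<Longrightarrow> (\<integral>x. norm (h w x) \<partial>M) \<le> C"
  shows integrable_weighted_kernel: "integrable (N \<Otimes>\<^sub>M M) (\<lambda>(w, x). of_real (k w) * h w x)"
    and integrable_weighted_mixture: "integrable M (\<lambda>x. \<integral>w. of_real (k w) * h w x \<partial>N)"
    and integral_weighted_kernel:
      "(\<integral>(w, x). of_real (k w) * h w x \<partial>(N \<Otimes>\<^sub>M M)) = (\<integral>w. of_real (k w) * (\<integral>x. h w x \<partial>M) \<partial>N)"
    and integral_weighted_mixture:
      "(\<integral>x. (\<integral>w. of_real (k w) * h w x \<partial>N) \<partial>M) = (\<integral>w. of_real (k w) * (\<integral>x. h w x \<partial>M) \<partial>N)"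
proof -
  interpret N: sigma_finite_measure N by fact
  interpret M: sigma_finite_measure M by fact
  interpret P: pair_sigma_finite N M by standard
  let ?F = "\<lambda>(w, x). of_real (k w) * h w x"
  have [measurable]: "k \<in> borel_measurable N" using k by auto
  show int: "integrable (N \<Otimes>\<^sub>M M) ?F"
  proof (rule P.Fubini_integrable)
    show "integrable N (\<lambda>w. \<integral>x. norm (?F (w, x)) \<partial>M)"
    proof (rule integrable_dominated)
      show "integrable N (\<lambda>w. \<bar>k w\<bar> * C)" using k by simp
      show "norm (\<integral>x. norm (?F (w, x)) \<partial>M) \<le> \<bar>k w\<bar> * C" if "w \<in> space N" for w
        using bound[OF that] by (simp add: norm_mult abs_mult mult_left_mono)
    qed measurable
    show "AE w in N. integrable M (\<lambda>x. ?F (w, x))" using h by (auto intro!: AE_I2)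
  qed measurable
  show "integrable M (\<lambda>x. \<integral>w. of_real (k w) * h w x \<partial>N)" using P.integrable_snd[OF int] by simp
  show kernel: "integral\<^sup>L (N \<Otimes>\<^sub>M M) ?F = (\<integral>w. of_real (k w) * (\<integral>x. h w x \<partial>M) \<partial>N)"
    using P.integral_fst'[OF int] by simp
  show "(\<integral>x. (\<integral>w. of_real (k w) * h w x \<partial>N) \<partial>M) = (\<integral>w. of_real (k w) * (\<integral>x. h w x \<partial>M) \<partial>N)"
    unfolding kernel[symmetric] using P.integral_snd[OF int] by simp
qed

lemma
  assumes p: "p > 1" and N: "weighted_measure N" and g: "Lp_fun p g"
  shows weighted_conv_Lp: "Lp_fun p (weighted_conv N g)"
    and weighted_conv_AE: "AE x in lborel. integrable N (\<lambda>w. snd w * g (x + fst w))"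
    and weighted_conv_Lp_pow: "Lp_pow p (weighted_conv N g) \<le> (\<integral>w. \<bar>snd w\<bar> \<partial>N) powr p * Lp_pow p g"
proof -
  have [measurable_cong]: "sets N = sets (borel \<Otimes>\<^sub>M borel)" by (rule weighted_measure_sets[OF N])
  have [measurable]: "g \<in> borel_measurable borel" using g by (simp add: Lp_fun_def)
  have meas: "(\<lambda>(w, x). g (x + fst w)) \<in> borel_measurable (N \<Otimes>\<^sub>M borel)" by measurable
  have int: "integrable N (\<lambda>w. \<bar>snd w\<bar> * Lp_pow p (\<lambda>x. g (x + fst w)))"
    using weighted_measure_integrable[OF N] by (simp add: Lp_pow_translate[OF g])
  note mix = p weighted_measure_sigma_finite[OF N] meas weighted_measure_integrable[OF N] Lp_fun_translate[OF g] int
  show "Lp_fun p (weighted_conv N g)" unfolding weighted_conv_def[abs_def] by (rule Lp_fun_mixture[OF mix])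
  show "AE x in lborel. integrable N (\<lambda>w. snd w * g (x + fst w))" by (rule AE_integrable_mixture[OF mix])
  have "Lp_pow p (weighted_conv N g) \<le> (\<integral>w. \<bar>snd w\<bar> \<partial>N) powr (p - 1) * (\<integral>w. \<bar>snd w\<bar> * Lp_pow p (\<lambda>x. g (x + fst w)) \<partial>N)"
    unfolding weighted_conv_def[abs_def] by (rule Lp_pow_mixture_le[OF mix])
  also have "(\<integral>w. \<bar>snd w\<bar> * Lp_pow p (\<lambda>x. g (x + fst w)) \<partial>N) = (\<integral>w. \<bar>snd w\<bar> \<partial>N) * Lp_pow p g"
    by (simp add: Lp_pow_translate[OF g])
  also have "(\<integral>w. \<bar>snd w\<bar> \<partial>N) powr (p - 1) * ((\<integral>w. \<bar>snd w\<bar> \<partial>N) * Lp_pow p g) = (\<integral>w. \<bar>snd w\<bar> \<partial>N) powr p * Lp_pow p g"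
  proof -
    have "(\<integral>w. \<bar>snd w\<bar> \<partial>N) powr (p - 1) * (\<integral>w. \<bar>snd w\<bar> \<partial>N) powr 1 = (\<integral>w. \<bar>snd w\<bar> \<partial>N) powr (p - 1 + 1)"
      by (rule powr_add[symmetric])
    then show ?thesis by simp
  qed
  finally show "Lp_pow p (weighted_conv N g) \<le> (\<integral>w. \<bar>snd w\<bar> \<partial>N) powr p * Lp_pow p g" .
qed

lemma weighted_conv_cong_AE:
  fixes g h :: "'a::euclidean_space \<Rightarrow> real"
  assumes p: "p > 1" and N: "weighted_measure N" and g: "Lp_fun p g" and h: "Lp_fun p h" and eq: "AE x in lborel. g x = h x"
  shows "AE x in lborel. weighted_conv N g x = weighted_conv N h x"
proof -
  have diff: "Lp_fun p (\<lambda>x. g x - h x)" using p by (intro Lp_fun_diff g h) auto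
  have "Lp_pow p (\<lambda>x. g x - h x) = Lp_pow p (\<lambda>_::'a. 0)"
    by (rule Lp_pow_cong_AE) (use diff eq in \<open>auto simp: Lp_fun_def\<close>)
  then have "Lp_pow p (weighted_conv N (\<lambda>x. g x - h x)) \<le> 0" using weighted_conv_Lp_pow[OF p N diff] by simp
  then have "Lp_pow p (weighted_conv N (\<lambda>x. g x - h x)) = 0" by (simp add: order_antisym)
  then have "AE x in lborel. weighted_conv N (\<lambda>x. g x - h x) x = 0" by (rule Lp_pow_eq_0D[OF weighted_conv_Lp[OF p N diff]])
  with weighted_conv_AE[OF p N g] weighted_conv_AE[OF p N h] show ?thesis
    by eventually_elim (simp add: weighted_conv_def right_diff_distrib)
qed

lemma weighted_conv_in_Lp_closure:
  fixes g :: "'a::euclidean_space \<Rightarrow> real"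
  assumes X: "Lp_subspace p X" "translation_invariant X" and p: "p > 1" and N: "weighted_measure N" and g: "g \<in> Lp_closure p X"
  shows "weighted_conv N g \<in> Lp_closure p X"
proof -
  have [measurable_cong]: "sets N = sets (borel \<Otimes>\<^sub>M borel)" by (rule weighted_measure_sets[OF N])
  have "(\<lambda>x. \<integral>w. snd w * g (1 *\<^sub>R x + fst w) \<partial>N) \<in> Lp_closure p X"
  proof (rule affine_mixture_in_Lp_closure[OF p X(1) Lp_closure_Lp[OF g] weighted_measure_sigma_finite[OF N]])
    show "(\<lambda>x. g (1 *\<^sub>R x + fst w)) \<in> Lp_closure p X" for w
      using translation_invariant_closure[OF X p] g by (simp add: translation_invariant_def)
    show "integrable N (\<lambda>w. snd w * \<bar>1::real\<bar> powr (- real DIM('a) / p))" using weighted_measure_integrable[OF N] by simp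
  qed simp_all
  then show ?thesis by (simp add: weighted_conv_def[abs_def])
qed

definition bounded_integrable :: "('a::euclidean_space \<Rightarrow> complex) \<Rightarrow> bool" where
  "bounded_integrable \<psi> \<longleftrightarrow> integrable lborel \<psi> \<and> bounded (range \<psi>)"

lemma bounded_integrable_schwartz: "schwartz \<phi> \<Longrightarrow> bounded_integrable \<phi>"
  unfolding bounded_integrable_def using schwartz_integrable schwartz_bounded[of \<phi>] by (metis boundedI rangeE)

lemma
  fixes g :: "'a::euclidean_space \<Rightarrow> real"
  assumes g: "Lp_fun p g" and p: "p > 1" and \<psi>: "integrable lborel \<psi>" and C: "\<And>x. norm (\<psi> x) \<le> C"
  shows integrable_Lp_mult: "integrable lborel (\<lambda>x. of_real (g x) * (\<psi> x :: complex))"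
    and integral_Lp_mult_le: "(LINT x|lborel. norm (of_real (g x) * \<psi> x)) \<le> (LINT x|lborel. norm (\<psi> x)) + C * Lp_pow p g"
proof -
  have [measurable]: "g \<in> borel_measurable borel" "\<psi> \<in> borel_measurable borel" using g \<psi> by (auto simp: Lp_fun_def)
  have int: "integrable lborel (\<lambda>x. norm (\<psi> x) + C * \<bar>g x\<bar> powr p)"
    using \<psi> g by (auto simp: Lp_fun_def)
  have bound: "norm (of_real (g x) * \<psi> x) \<le> norm (\<psi> x) + C * \<bar>g x\<bar> powr p" for x
  proof -
    have "\<bar>g x\<bar> * norm (\<psi> x) \<le> (1 + \<bar>g x\<bar> powr p) * norm (\<psi> x)"
      using le_1_plus_powr[OF p, of "\<bar>g x\<bar>"] by (intro mult_right_mono) auto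
    also have "\<dots> \<le> norm (\<psi> x) + C * \<bar>g x\<bar> powr p"
      using C[of x] by (simp add: distrib_right mult.commute[of C] mult_left_mono)
    finally show ?thesis by (simp add: norm_mult)
  qed
  show int_mult: "integrable lborel (\<lambda>x. of_real (g x) * \<psi> x)"
    by (rule integrable_dominated[OF int _ bound]) measurable
  have "(LINT x|lborel. norm (of_real (g x) * \<psi> x)) \<le> (LINT x|lborel. norm (\<psi> x) + C * \<bar>g x\<bar> powr p)"
    using int_mult int bound by (intro integral_mono integrable_norm) auto
  also have "\<dots> = (LINT x|lborel. norm (\<psi> x)) + C * Lp_pow p g"
    using \<psi> g by (simp add: Lp_pow_def Lp_fun_def)
  finally show "(LINT x|lborel. norm (of_real (g x) * \<psi> x)) \<le> (LINT x|lborel. norm (\<psi> x)) + C * Lp_pow p g" .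
qed

lemma integrable_Lp_bounded_integrable:
  assumes "Lp_fun p g" "p > 1" "bounded_integrable \<psi>"
  shows "integrable lborel (\<lambda>x. of_real (g x) * (\<psi> x :: complex))"
  using assms integrable_Lp_mult[OF assms(1,2)] unfolding bounded_integrable_def bounded_iff by blast

lemma integral_Lp_mult_linear:
  assumes "Lp_fun p f" "Lp_fun p g" "p > 1" "bounded_integrable \<psi>"
  shows "(LINT x|lborel. complex_of_real (c * f x + d * g x) * \<psi> x)
    = of_real c * (LINT x|lborel. complex_of_real (f x) * \<psi> x) + of_real d * (LINT x|lborel. complex_of_real (g x) * \<psi> x)"
  using integrable_Lp_bounded_integrable[OF assms(1,3,4)] integrable_Lp_bounded_integrable[OF assms(2,3,4)]
  by (simp add: distrib_right mult.assoc)

lemma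
  fixes \<psi> :: "'a::euclidean_space \<Rightarrow> complex"
  assumes "integrable lborel \<psi>"
  shows integrable_translate_minus: "integrable lborel (\<lambda>x. \<psi> (x - y))"
    and integral_norm_translate_minus: "(LINT x|lborel. norm (\<psi> (x - y))) = (LINT x|lborel. norm (\<psi> x))"
  using integrable_affine_iff[of 1 \<psi> "- y"] assms integral_affine[of 1 "\<lambda>x. norm (\<psi> x)" "- y"] by auto

lemma
  fixes g :: "'a::euclidean_space \<Rightarrow> real"
  assumes g: "Lp_fun p g" and p: "p > 1" and N: "weighted_measure N" and \<psi>: "bounded_integrable \<psi>"
  shows weighted_conv_adjoint: "(LINT x|lborel. of_real (weighted_conv N g x) * \<psi> x) = (LINT z|lborel. of_real (g z) * weighted_adj N \<psi> z)"
    and weighted_adj_pairing: "(LINT z|lborel. of_real (g z) * weighted_adj N \<psi> z) = (\<integral>w. of_real (snd w) * (LINT z|lborel. of_real (g z) * \<psi> (z - fst w)) \<partial>N)"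
proof -
  have [measurable_cong]: "sets N = sets (borel \<Otimes>\<^sub>M borel)" by (rule weighted_measure_sets[OF N])
  have int_\<psi>: "integrable lborel \<psi>" using \<psi> by (simp add: bounded_integrable_def)
  obtain C where C: "\<And>x. norm (\<psi> x) \<le> C" using \<psi> by (auto simp: bounded_integrable_def bounded_iff)
  have [measurable]: "g \<in> borel_measurable borel" "\<psi> \<in> borel_measurable borel" using g int_\<psi> by (auto simp: Lp_fun_def)
  note swap = integral_weighted_mixture[OF weighted_measure_sigma_finite[OF N] sigma_finite_lborel _ weighted_measure_integrable[OF N]]
  have "(LINT x|lborel. of_real (weighted_conv N g x) * \<psi> x) = (LINT x|lborel. (\<integral>w. of_real (snd w) * (of_real (g (x + fst w)) * \<psi> x) \<partial>N))"
  proof (rule Bochner_Integration.integral_cong[OF refl])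
    fix x
    have "complex_of_real (weighted_conv N g x) * \<psi> x = (\<integral>w. of_real (snd w * g (x + fst w)) * \<psi> x \<partial>N)"
      unfolding weighted_conv_def by (simp only: integral_complex_of_real[symmetric] integral_mult_left_zero)
    then show "complex_of_real (weighted_conv N g x) * \<psi> x = (\<integral>w. of_real (snd w) * (of_real (g (x + fst w)) * \<psi> x) \<partial>N)"
      by (simp add: mult.assoc)
  qed
  also have "\<dots> = (\<integral>w. of_real (snd w) * (LINT x|lborel. of_real (g (x + fst w)) * \<psi> x) \<partial>N)"
    using integrable_Lp_mult[OF Lp_fun_translate[OF g] p int_\<psi> C] integral_Lp_mult_le[OF Lp_fun_translate[OF g] p int_\<psi> C]
    by (intro swap) (auto simp: Lp_pow_translate[OF g])
  also have "\<dots> = (\<integral>w. of_real (snd w) * (LINT z|lborel. of_real (g z) * \<psi> (z - fst w)) \<partial>N)"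
    using integral_affine[of 1 "\<lambda>z. of_real (g z) * \<psi> (z - y)" y for y] by simp
  finally have conv: "(LINT x|lborel. of_real (weighted_conv N g x) * \<psi> x)
    = (\<integral>w. of_real (snd w) * (LINT z|lborel. of_real (g z) * \<psi> (z - fst w)) \<partial>N)" .
  have "weighted_adj N \<psi> z * of_real (g z) = (\<integral>w. of_real (snd w) * (of_real (g z) * \<psi> (z - fst w)) \<partial>N)" for z
    unfolding weighted_adj_def integral_mult_left_zero[symmetric] by (simp add: mult_ac)
  then have "(LINT z|lborel. of_real (g z) * weighted_adj N \<psi> z) = (LINT z|lborel. (\<integral>w. of_real (snd w) * (of_real (g z) * \<psi> (z - fst w)) \<partial>N))"
    by (simp add: mult.commute[of "weighted_adj N \<psi> _"])
  also have "\<dots> = (\<integral>w. of_real (snd w) * (LINT z|lborel. of_real (g z) * \<psi> (z - fst w)) \<partial>N)"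
    using integrable_Lp_mult[OF g p integrable_translate_minus[OF int_\<psi>] C] integral_Lp_mult_le[OF g p integrable_translate_minus[OF int_\<psi>] C]
    by (intro swap) (auto simp: integral_norm_translate_minus[OF int_\<psi>])
  finally show adj: "(LINT z|lborel. of_real (g z) * weighted_adj N \<psi> z) = (\<integral>w. of_real (snd w) * (LINT z|lborel. of_real (g z) * \<psi> (z - fst w)) \<partial>N)" .
  show "(LINT x|lborel. of_real (weighted_conv N g x) * \<psi> x) = (LINT z|lborel. of_real (g z) * weighted_adj N \<psi> z)"
    by (simp only: conv adj)
qed

lemma weighted_adj_bounded_integrable:
  assumes N: "weighted_measure N" and \<psi>: "bounded_integrable \<psi>"
  shows "bounded_integrable (weighted_adj N \<psi>)"
proof -
  have [measurable_cong]: "sets N = sets (borel \<Otimes>\<^sub>M borel)" by (rule weighted_measure_sets[OF N])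
  have int_\<psi>: "integrable lborel \<psi>" using \<psi> by (simp add: bounded_integrable_def)
  obtain C where C: "\<And>x. norm (\<psi> x) \<le> C" using \<psi> by (auto simp: bounded_integrable_def bounded_iff)
  have [measurable]: "\<psi> \<in> borel_measurable borel" using int_\<psi> by auto
  have "integrable lborel (weighted_adj N \<psi>)"
    unfolding weighted_adj_def[abs_def]
    by (rule integrable_weighted_mixture[OF weighted_measure_sigma_finite[OF N] sigma_finite_lborel _ weighted_measure_integrable[OF N]])
       (use int_\<psi> in \<open>auto simp: integrable_translate_minus integral_norm_translate_minus\<close>)
  moreover have "norm (weighted_adj N \<psi> x) \<le> (\<integral>w. \<bar>snd w\<bar> * C \<partial>N)" for x
  proof -
    have int: "integrable N (\<lambda>w. \<bar>snd w\<bar> * C)" using weighted_measure_integrable[OF N] by simp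
    show ?thesis
      unfolding weighted_adj_def
      by (rule Bochner_Integration.integral_norm_bound_integral[OF integrable_dominated[OF int] int])
         (auto simp: norm_mult intro!: mult_left_mono C)
  qed
  ultimately show ?thesis by (auto simp: bounded_integrable_def intro!: boundedI)
qed

lemma norm_weighted_fourier_le: "norm (weighted_fourier N \<xi>) \<le> (\<integral>w. \<bar>snd w\<bar> \<partial>N)"
  unfolding weighted_fourier_def
  using integral_norm_bound[of N "\<lambda>w. of_real (snd w) * character \<xi> (fst w)"] by (simp add: norm_mult)

lemma weighted_fourier_measurable:
  assumes N: "weighted_measure N" shows "weighted_fourier N \<in> borel_measurable borel"
proof -
  interpret prob_space N by (rule weighted_measure_prob_space[OF N])
  have [measurable_cong]: "sets N = sets (borel \<Otimes>\<^sub>M borel)" by (rule weighted_measure_sets[OF N])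
  show ?thesis unfolding weighted_fourier_def[abs_def] by measurable
qed

lemma integrable_weighted_fourier_mult:
  fixes \<Psi> :: "'a::euclidean_space \<Rightarrow> complex"
  assumes N: "weighted_measure N" and \<Psi>: "integrable lborel \<Psi>"
  shows "integrable lborel (\<lambda>\<xi>. weighted_fourier N \<xi> * \<Psi> \<xi>)"
proof (rule integrable_dominated)
  have [measurable]: "weighted_fourier N \<in> borel_measurable borel" by (rule weighted_fourier_measurable[OF N])
  show "integrable lborel (\<lambda>\<xi>. (\<integral>w. \<bar>snd w\<bar> \<partial>N) * norm (\<Psi> \<xi>))" using \<Psi> by simp
  show "(\<lambda>\<xi>. weighted_fourier N \<xi> * \<Psi> \<xi>) \<in> borel_measurable lborel" using \<Psi> by measurable
qed (simp add: norm_mult mult_right_mono norm_weighted_fourier_le)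

lemma weighted_adj_inv_fourier:
  fixes \<Psi> :: "'a::euclidean_space \<Rightarrow> complex"
  assumes N: "weighted_measure N" and \<Psi>: "integrable lborel \<Psi>"
  shows "weighted_adj N (inv_fourier \<Psi>) z = inv_fourier (\<lambda>\<xi>. weighted_fourier N \<xi> * \<Psi> \<xi>) z"
proof -
  have [measurable_cong]: "sets N = sets (borel \<Otimes>\<^sub>M borel)" by (rule weighted_measure_sets[OF N])
  have [measurable]: "\<Psi> \<in> borel_measurable borel" using \<Psi> by auto
  have "weighted_adj N (inv_fourier \<Psi>) z = (LINT \<xi>|lborel. (\<integral>w. of_real (snd w) * (\<Psi> \<xi> * cis (2 * pi * ((z - fst w) \<bullet> \<xi>))) \<partial>N))"
    unfolding weighted_adj_def inv_fourier_cis
    by (rule integral_weighted_mixture[OF weighted_measure_sigma_finite[OF N] sigma_finite_lborel _ weighted_measure_integrable[OF N], symmetric])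
       (use \<Psi> in \<open>auto simp: norm_mult intro!: integrable_mult_cis\<close>)
  also have "\<dots> = (LINT \<xi>|lborel. (weighted_fourier N \<xi> * \<Psi> \<xi>) * cis (2 * pi * (z \<bullet> \<xi>)))"
  proof (rule Bochner_Integration.integral_cong[OF refl])
    fix \<xi>
    have "cis (2 * pi * ((z - y) \<bullet> \<xi>)) = character \<xi> y * cis (2 * pi * (z \<bullet> \<xi>))" for y
      by (simp add: cis_mult inner_diff_left algebra_simps)
    then have "(\<integral>w. of_real (snd w) * (\<Psi> \<xi> * cis (2 * pi * ((z - fst w) \<bullet> \<xi>))) \<partial>N)
        = (\<integral>w. (of_real (snd w) * character \<xi> (fst w)) * (\<Psi> \<xi> * cis (2 * pi * (z \<bullet> \<xi>))) \<partial>N)"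
      by (simp add: mult_ac)
    also have "\<dots> = weighted_fourier N \<xi> * (\<Psi> \<xi> * cis (2 * pi * (z \<bullet> \<xi>)))"
      unfolding weighted_fourier_def by (rule integral_mult_left_zero)
    finally show "(\<integral>w. of_real (snd w) * (\<Psi> \<xi> * cis (2 * pi * ((z - fst w) \<bullet> \<xi>))) \<partial>N)
        = (weighted_fourier N \<xi> * \<Psi> \<xi>) * cis (2 * pi * (z \<bullet> \<xi>))"
      by (simp only: mult.assoc)
  qed
  finally show ?thesis by (simp add: inv_fourier_cis)
qed

lemma weighted_measure_return: "weighted_measure (return borel (y::'a::euclidean_space, c))"
proof -
  have [measurable]: "snd \<in> (borel :: ('a \<times> real) measure) \<rightarrow>\<^sub>M borel"
    unfolding borel_prod[symmetric] by measurable
  show ?thesis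
    unfolding weighted_measure_def by (auto intro!: prob_space_return simp: integrable_iff_bounded nn_integral_return)
qed

lemma prob_space_normalized_abs:
  fixes k :: "'w \<Rightarrow> real"
  assumes k: "integrable M k" and pos: "(\<integral>w. \<bar>k w\<bar> \<partial>M) > 0"
  shows "prob_space (density M (\<lambda>w. ennreal (\<bar>k w\<bar> / (\<integral>w. \<bar>k w\<bar> \<partial>M))))" (is "prob_space ?D")
proof (rule prob_spaceI)
  have [measurable]: "k \<in> borel_measurable M" using k by auto
  have "emeasure ?D (space ?D) = (\<integral>\<^sup>+w. ennreal (\<bar>k w\<bar> / (\<integral>w. \<bar>k w\<bar> \<partial>M)) \<partial>M)"
    by (subst emeasure_density) (auto intro!: nn_integral_cong simp: indicator_def)
  also have "\<dots> = ennreal (\<integral>w. \<bar>k w\<bar> / (\<integral>w. \<bar>k w\<bar> \<partial>M) \<partial>M)"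
    using k by (intro nn_integral_eq_integral) auto
  finally show "emeasure ?D (space ?D) = 1" using pos by simp
qed

lemma weighted_measure_image_nonzero:
  fixes Y :: "'w \<Rightarrow> 'a::euclidean_space"
  assumes k: "integrable M k" and pos: "(\<integral>w. \<bar>k w\<bar> \<partial>M) > 0" and Y[measurable]: "Y \<in> borel_measurable M"
  obtains N where "weighted_measure N"
    "\<And>h :: 'a \<Rightarrow> complex. h \<in> borel_measurable borel \<Longrightarrow> (\<integral>w. of_real (snd w) * h (fst w) \<partial>N) = (\<integral>w. of_real (k w) * h (Y w) \<partial>M)"
proof -
  have [measurable]: "k \<in> borel_measurable M" using k by auto
  have [measurable]: "fst \<in> (borel :: ('a \<times> real) measure) \<rightarrow>\<^sub>M borel" "snd \<in> (borel :: ('a \<times> real) measure) \<rightarrow>\<^sub>M borel"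
    unfolding borel_prod[symmetric] by measurable
  define C where "C = (\<integral>w. \<bar>k w\<bar> \<partial>M)"
  have C: "C > 0" using pos by (simp add: C_def)
  define D where "D = density M (\<lambda>w. ennreal (\<bar>k w\<bar> / C))"
  define Z where "Z = (\<lambda>w. (Y w, C * sgn (k w)))"
  have [measurable]: "Z \<in> M \<rightarrow>\<^sub>M borel" unfolding Z_def borel_prod[symmetric] by measurable
  have Z_measurable [measurable]: "Z \<in> D \<rightarrow>\<^sub>M borel" unfolding D_def by measurable
  have density_weight: "\<bar>k w\<bar> / C * snd (Z w) = k w" for w using C by (simp add: Z_def sgn_if)
  have "weighted_measure (distr D borel Z)"
    unfolding weighted_measure_def
  proof (intro conjI)
    have "prob_space D" unfolding D_def C_def by (rule prob_space_normalized_abs[OF k pos])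
    then show "prob_space (distr D borel Z)" by (rule prob_space.prob_space_distr[OF _ Z_measurable])
    have "integrable D (\<lambda>w. snd (Z w))"
      unfolding D_def using C k by (subst integrable_density) (simp_all only: density_weight real_scaleR_def, auto)
    then show "integrable (distr D borel Z) snd" by (subst integrable_distr_eq) auto
  qed simp
  moreover have "(\<integral>w. of_real (snd w) * h (fst w) \<partial>distr D borel Z) = (\<integral>w. of_real (k w) * h (Y w) \<partial>M)"
    if [measurable]: "h \<in> borel_measurable borel" for h :: "'a \<Rightarrow> complex"
  proof -
    have "(\<integral>w. of_real (snd w) * h (fst w) \<partial>distr D borel Z) = (\<integral>w. of_real (snd (Z w)) * h (fst (Z w)) \<partial>D)"
      by (subst integral_distr) auto
    also have "\<dots> = (\<integral>w. (\<bar>k w\<bar> / C) *\<^sub>R (of_real (snd (Z w)) * h (fst (Z w))) \<partial>M)"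
      unfolding D_def using C by (subst integral_density) auto
    also have "\<dots> = (\<integral>w. of_real (\<bar>k w\<bar> / C * snd (Z w)) * h (Y w) \<partial>M)"
      by (simp only: Z_def fst_conv snd_conv scaleR_conv_of_real mult.assoc of_real_mult)
    finally show ?thesis by (simp only: density_weight)
  qed
  ultimately show thesis by (rule that)
qed

lemma weighted_measure_image:
  fixes Y :: "'w \<Rightarrow> 'a::euclidean_space"
  assumes k: "integrable M k" and Y: "Y \<in> borel_measurable M"
  obtains N where "weighted_measure N"
    "\<And>h :: 'a \<Rightarrow> complex. h \<in> borel_measurable borel \<Longrightarrow> (\<integral>w. of_real (snd w) * h (fst w) \<partial>N) = (\<integral>w. of_real (k w) * h (Y w) \<partial>M)"
proof (cases "(\<integral>w. \<bar>k w\<bar> \<partial>M) = 0")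
  case True
  have [measurable]: "k \<in> borel_measurable M" using k by auto
  have [measurable]: "fst \<in> (borel :: ('a \<times> real) measure) \<rightarrow>\<^sub>M borel" "snd \<in> (borel :: ('a \<times> real) measure) \<rightarrow>\<^sub>M borel"
    unfolding borel_prod[symmetric] by measurable
  have "AE w in M. k w = 0"
    using True integral_nonneg_eq_0_iff_AE[of M "\<lambda>w. \<bar>k w\<bar>"] k by auto
  then have "(\<integral>w. complex_of_real (k w) * h (Y w) \<partial>M) = 0" for h
    by (intro integral_eq_zero_AE) auto
  then show thesis
    by (intro that[of "return borel (0, 0)"]) (auto simp: weighted_measure_return integral_return)
next
  case False
  have "0 \<le> (\<integral>w. \<bar>k w\<bar> \<partial>M)" by simp
  with False have "(\<integral>w. \<bar>k w\<bar> \<partial>M) > 0" by linarith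
  then show thesis by (rule weighted_measure_image_nonzero[OF k _ Y]) (rule that)
qed

lemma weighted_measure_exists:
  fixes Y :: "'w \<Rightarrow> 'a::euclidean_space"
  assumes k: "integrable M k" and Y: "Y \<in> borel_measurable M"
  obtains N where "weighted_measure N" "\<And>\<xi>. weighted_fourier N \<xi> = (\<integral>w. of_real (k w) * character \<xi> (Y w) \<partial>M)"
    "\<And>g x. g \<in> borel_measurable borel \<Longrightarrow> weighted_conv N g x = (\<integral>w. k w * g (x + Y w) \<partial>M)"
proof -
  obtain N where N: "weighted_measure N"
    and int: "\<And>h :: 'a \<Rightarrow> complex. h \<in> borel_measurable borel \<Longrightarrow> (\<integral>w. of_real (snd w) * h (fst w) \<partial>N) = (\<integral>w. of_real (k w) * h (Y w) \<partial>M)"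
    by (rule weighted_measure_image[OF assms]) blast
  have "weighted_fourier N \<xi> = (\<integral>w. of_real (k w) * character \<xi> (Y w) \<partial>M)" for \<xi>
    unfolding weighted_fourier_def by (rule int) measurable
  moreover have "weighted_conv N g x = (\<integral>w. k w * g (x + Y w) \<partial>M)" if [measurable]: "g \<in> borel_measurable borel" for g x
  proof -
    have "complex_of_real (weighted_conv N g x) = of_real (\<integral>w. k w * g (x + Y w) \<partial>M)"
      using int[of "\<lambda>y. of_real (g (x + y))"]
      by (simp add: weighted_conv_def flip: integral_complex_of_real)
    then show ?thesis by simp
  qed
  ultimately show thesis by (rule that[OF N])
qed

definition symbol :: "('a::euclidean_space \<Rightarrow> real) \<Rightarrow> bool" where
  "symbol m \<longleftrightarrow> (\<exists>N. weighted_measure N \<and> (\<forall>\<xi>. weighted_fourier N \<xi> = of_real (m \<xi>)))"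

lemma symbolI:
  fixes Y :: "'w \<Rightarrow> 'a::euclidean_space"
  assumes "integrable M k" "Y \<in> borel_measurable M"
    "\<And>\<xi>. (\<integral>w. of_real (k w) * character \<xi> (Y w) \<partial>M) = of_real (m \<xi>)"
  shows "symbol m"
  by (rule weighted_measure_exists[OF assms(1,2)]) (use assms(3) in \<open>auto simp: symbol_def\<close>)

lemma symbolE:
  assumes "symbol m" obtains N where "weighted_measure N" "\<And>\<xi>. weighted_fourier N \<xi> = of_real (m \<xi>)"
  using assms by (auto simp: symbol_def)

lemma symbol_const: "symbol (\<lambda>_::'a::euclidean_space. c)"
  by (rule symbolI[of "count_space {()}" "\<lambda>_. c" "\<lambda>_. 0 :: 'a"])
     (auto simp: lebesgue_integral_count_space_finite integrable_count_space)

lemma symbol_cmult: assumes "symbol m" shows "symbol (\<lambda>\<xi>. c * m \<xi>)"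
proof -
  obtain N where N: "weighted_measure N" and fourier_N: "\<And>\<xi>. weighted_fourier N \<xi> = of_real (m \<xi>)"
    using symbolE[OF assms] by blast
  have [measurable_cong]: "sets N = sets (borel \<Otimes>\<^sub>M borel)" by (rule weighted_measure_sets[OF N])
  show ?thesis
  proof (rule symbolI[of N "\<lambda>w. c * snd w" fst])
    show "integrable N (\<lambda>w. c * snd w)" using weighted_measure_integrable[OF N] by simp
    show "(\<integral>w. of_real (c * snd w) * character \<xi> (fst w) \<partial>N) = of_real (c * m \<xi>)" for \<xi>
      using fourier_N[of \<xi>] by (simp add: weighted_fourier_def mult.assoc)
  qed measurable
qed

lemma symbol_mult:
  fixes m\<^sub>1 m\<^sub>2 :: "'a::euclidean_space \<Rightarrow> real"
  assumes "symbol m\<^sub>1" "symbol m\<^sub>2" shows "symbol (\<lambda>\<xi>. m\<^sub>1 \<xi> * m\<^sub>2 \<xi>)"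
proof -
  obtain N\<^sub>1 where N\<^sub>1: "weighted_measure N\<^sub>1" and fourier_N\<^sub>1: "\<And>\<xi>. weighted_fourier N\<^sub>1 \<xi> = of_real (m\<^sub>1 \<xi>)"
    using symbolE[OF assms(1)] by blast
  obtain N\<^sub>2 where N\<^sub>2: "weighted_measure N\<^sub>2" and fourier_N\<^sub>2: "\<And>\<xi>. weighted_fourier N\<^sub>2 \<xi> = of_real (m\<^sub>2 \<xi>)"
    using symbolE[OF assms(2)] by blast
  have [measurable_cong]: "sets N\<^sub>1 = sets (borel \<Otimes>\<^sub>M borel)" "sets N\<^sub>2 = sets (borel \<Otimes>\<^sub>M borel)"
    by (rule weighted_measure_sets[OF N\<^sub>1] weighted_measure_sets[OF N\<^sub>2])+
  note sigma_finite = weighted_measure_sigma_finite[OF N\<^sub>1] weighted_measure_sigma_finite[OF N\<^sub>2]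
  note int = weighted_measure_integrable[OF N\<^sub>1] weighted_measure_integrable[OF N\<^sub>2]
  show ?thesis
  proof (rule symbolI[of "N\<^sub>1 \<Otimes>\<^sub>M N\<^sub>2" "\<lambda>(v, w). snd v * snd w" "\<lambda>(v, w). fst v + fst w"])
    have "integrable (N\<^sub>1 \<Otimes>\<^sub>M N\<^sub>2) (\<lambda>(v, w). complex_of_real (snd v) * of_real (snd w))"
      by (rule integrable_weighted_kernel[OF sigma_finite _ int(1)]) (use int(2) in auto)
    then have "integrable (N\<^sub>1 \<Otimes>\<^sub>M N\<^sub>2) (\<lambda>x. complex_of_real (snd (fst x) * snd (snd x)))"
      by (simp add: case_prod_unfold)
    then show "integrable (N\<^sub>1 \<Otimes>\<^sub>M N\<^sub>2) (\<lambda>(v, w). snd v * snd w)"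
      unfolding case_prod_unfold by (simp only: complex_of_real_integrable_eq)
    fix \<xi>
    have "(\<integral>x. of_real (case x of (v, w) \<Rightarrow> snd v * snd w) * character \<xi> (case x of (v, w) \<Rightarrow> fst v + fst w) \<partial>(N\<^sub>1 \<Otimes>\<^sub>M N\<^sub>2))
        = (\<integral>(v, w). of_real (snd v) * (character \<xi> (fst v) * (of_real (snd w) * character \<xi> (fst w))) \<partial>(N\<^sub>1 \<Otimes>\<^sub>M N\<^sub>2))"
      unfolding case_prod_unfold character_add by (simp add: mult_ac)
    also have "\<dots> = (\<integral>v. of_real (snd v) * (\<integral>w. character \<xi> (fst v) * (of_real (snd w) * character \<xi> (fst w)) \<partial>N\<^sub>2) \<partial>N\<^sub>1)"
      by (rule integral_weighted_kernel[OF sigma_finite _ int(1)])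
         (use int(2) in \<open>auto simp: norm_mult intro!: integrable_mult_right integrable_mult_cis\<close>)
    also have "\<dots> = (\<integral>v. (of_real (snd v) * character \<xi> (fst v)) * weighted_fourier N\<^sub>2 \<xi> \<partial>N\<^sub>1)"
      by (simp only: weighted_fourier_def integral_mult_right_zero mult.assoc)
    also have "\<dots> = weighted_fourier N\<^sub>1 \<xi> * weighted_fourier N\<^sub>2 \<xi>"
      unfolding weighted_fourier_def[of N\<^sub>1] by (rule integral_mult_left_zero)
    finally show "(\<integral>x. of_real (case x of (v, w) \<Rightarrow> snd v * snd w) * character \<xi> (case x of (v, w) \<Rightarrow> fst v + fst w) \<partial>(N\<^sub>1 \<Otimes>\<^sub>M N\<^sub>2))
        = of_real (m\<^sub>1 \<xi> * m\<^sub>2 \<xi>)"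
      by (simp add: fourier_N\<^sub>1 fourier_N\<^sub>2)
  qed measurable
qed

lemma
  fixes f :: "_ \<Rightarrow> complex"
  assumes "prob_space N" "prob_space M"
  shows integrable_pair_fst: "integrable N f \<Longrightarrow> integrable (N \<Otimes>\<^sub>M M) (\<lambda>x. f (fst x))"
    and integral_pair_fst: "integrable N f \<Longrightarrow> (\<integral>x. f (fst x) \<partial>(N \<Otimes>\<^sub>M M)) = (\<integral>v. f v \<partial>N)"
    and integrable_pair_snd: "integrable M f \<Longrightarrow> integrable (N \<Otimes>\<^sub>M M) (\<lambda>x. f (snd x))"
    and integral_pair_snd: "integrable M f \<Longrightarrow> (\<integral>x. f (snd x) \<partial>(N \<Otimes>\<^sub>M M)) = (\<integral>w. f w \<partial>M)"
proof -
  interpret N: prob_space N by fact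
  interpret M: prob_space M by fact
  show "integrable N f \<Longrightarrow> integrable (N \<Otimes>\<^sub>M M) (\<lambda>x. f (fst x))"
    using integrable_distr_eq[of fst "N \<Otimes>\<^sub>M M" N f] by (simp add: M.distr_pair_fst)
  show "integrable N f \<Longrightarrow> (\<integral>x. f (fst x) \<partial>(N \<Otimes>\<^sub>M M)) = (\<integral>v. f v \<partial>N)"
    using integral_distr[of fst "N \<Otimes>\<^sub>M M" N f] by (simp add: M.distr_pair_fst)
  note kernel = N.sigma_finite_measure_axioms M.sigma_finite_measure_axioms
  show "integrable M f \<Longrightarrow> integrable (N \<Otimes>\<^sub>M M) (\<lambda>x. f (snd x))"
    using integrable_weighted_kernel[OF kernel, of "\<lambda>_. f" "\<lambda>_. 1" "\<integral>w. norm (f w) \<partial>M"] by (simp add: case_prod_unfold)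
  show "integrable M f \<Longrightarrow> (\<integral>x. f (snd x) \<partial>(N \<Otimes>\<^sub>M M)) = (\<integral>w. f w \<partial>M)"
    using integral_weighted_kernel[OF kernel, of "\<lambda>_. f" "\<lambda>_. 1" "\<integral>w. norm (f w) \<partial>M"] by (simp add: case_prod_unfold N.prob_space)
qed

lemma
  fixes f :: "'w \<Rightarrow> complex" and N M K :: "'w measure"
  assumes prob: "prob_space N" "prob_space M" and [measurable_cong]: "sets N = sets K" "sets M = sets K"
    and f: "integrable N f" "integrable M f" and [measurable]: "f \<in> borel_measurable K"
  defines "choice \<equiv> \<lambda>(b, v, w). if b then v else w"
  shows integrable_choice: "integrable (count_space UNIV \<Otimes>\<^sub>M (N \<Otimes>\<^sub>M M)) (\<lambda>x. f (choice x))"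
    and integral_choice: "(\<integral>x. f (choice x) \<partial>(count_space UNIV \<Otimes>\<^sub>M (N \<Otimes>\<^sub>M M))) = (\<integral>v. f v \<partial>N) + (\<integral>v. f v \<partial>M)"
proof -
  let ?B = "count_space (UNIV :: bool set)"
  let ?h = "\<lambda>b x. f (choice (b, x))"
  define C where "C = max (\<integral>x. norm (?h True x) \<partial>(N \<Otimes>\<^sub>M M)) (\<integral>x. norm (?h False x) \<partial>(N \<Otimes>\<^sub>M M))"
  have sigma_finite: "sigma_finite_measure ?B" "sigma_finite_measure (N \<Otimes>\<^sub>M M)"
    using prob by (simp_all add: sigma_finite_measure_count_space_countable prob_space_imp_sigma_finite prob_space_pair)
  have meas: "(\<lambda>(b, x). ?h b x) \<in> borel_measurable (?B \<Otimes>\<^sub>M (N \<Otimes>\<^sub>M M))" unfolding choice_def by measurable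
  have int_1: "integrable ?B (\<lambda>_. 1 :: real)" by (rule integrable_count_space) simp
  have branch: "?h b = (if b then (\<lambda>x. f (fst x)) else (\<lambda>x. f (snd x)))" for b
    by (auto simp: choice_def fun_eq_iff)
  have int_h: "integrable (N \<Otimes>\<^sub>M M) (?h b)" for b
    using f unfolding branch by (auto simp: integrable_pair_fst[OF prob] integrable_pair_snd[OF prob])
  have bound: "(\<integral>x. norm (?h b x) \<partial>(N \<Otimes>\<^sub>M M)) \<le> C" for b by (cases b) (auto simp: C_def)
  note kernel = sigma_finite meas int_1 int_h bound
  show "integrable (?B \<Otimes>\<^sub>M (N \<Otimes>\<^sub>M M)) (\<lambda>x. f (choice x))"
    using integrable_weighted_kernel[OF kernel] by (simp add: case_prod_unfold)
  have "(\<integral>x. f (choice x) \<partial>(?B \<Otimes>\<^sub>M (N \<Otimes>\<^sub>M M))) = (\<integral>b. (\<integral>x. ?h b x \<partial>(N \<Otimes>\<^sub>M M)) \<partial>?B)"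
    using integral_weighted_kernel[OF kernel] by (simp add: case_prod_unfold)
  also have "\<dots> = (\<integral>x. f (fst x) \<partial>(N \<Otimes>\<^sub>M M)) + (\<integral>x. f (snd x) \<partial>(N \<Otimes>\<^sub>M M))"
    by (subst lebesgue_integral_count_space_finite) (simp_all add: UNIV_bool branch)
  finally show "(\<integral>x. f (choice x) \<partial>(?B \<Otimes>\<^sub>M (N \<Otimes>\<^sub>M M))) = (\<integral>v. f v \<partial>N) + (\<integral>v. f v \<partial>M)"
    using f by (simp add: integral_pair_fst[OF prob] integral_pair_snd[OF prob])
qed

lemma symbol_add:
  fixes m\<^sub>1 m\<^sub>2 :: "'a::euclidean_space \<Rightarrow> real"
  assumes "symbol m\<^sub>1" "symbol m\<^sub>2" shows "symbol (\<lambda>\<xi>. m\<^sub>1 \<xi> + m\<^sub>2 \<xi>)"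
proof -
  obtain N\<^sub>1 where N\<^sub>1: "weighted_measure N\<^sub>1" and fourier_N\<^sub>1: "\<And>\<xi>. weighted_fourier N\<^sub>1 \<xi> = of_real (m\<^sub>1 \<xi>)"
    using symbolE[OF assms(1)] by blast
  obtain N\<^sub>2 where N\<^sub>2: "weighted_measure N\<^sub>2" and fourier_N\<^sub>2: "\<And>\<xi>. weighted_fourier N\<^sub>2 \<xi> = of_real (m\<^sub>2 \<xi>)"
    using symbolE[OF assms(2)] by blast
  note sets = weighted_measure_sets[OF N\<^sub>1] weighted_measure_sets[OF N\<^sub>2]
  note [measurable_cong] = sets
  note choice = weighted_measure_prob_space[OF N\<^sub>1] weighted_measure_prob_space[OF N\<^sub>2] sets
  note int = weighted_measure_integrable[OF N\<^sub>1] weighted_measure_integrable[OF N\<^sub>2]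
  let ?M = "count_space UNIV \<Otimes>\<^sub>M (N\<^sub>1 \<Otimes>\<^sub>M N\<^sub>2)" and ?v = "\<lambda>(b, v, w). if b then v else w :: 'a \<times> real"
  have [measurable]: "?v \<in> ?M \<rightarrow>\<^sub>M (borel \<Otimes>\<^sub>M borel)" by measurable
  show ?thesis
  proof (rule symbolI[of ?M "\<lambda>x. snd (?v x)" "\<lambda>x. fst (?v x)"])
    have "integrable ?M (\<lambda>x. complex_of_real (snd (?v x)))"
      using int by (intro integrable_choice[OF choice, where f = "\<lambda>v. complex_of_real (snd v)"]) auto
    then show "integrable ?M (\<lambda>x. snd (?v x))"
      by (simp only: complex_of_real_integrable_eq)
    show "(\<integral>x. of_real (snd (?v x)) * character \<xi> (fst (?v x)) \<partial>?M) = of_real (m\<^sub>1 \<xi> + m\<^sub>2 \<xi>)" for \<xi>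
      using integral_choice[OF choice, of "\<lambda>v. complex_of_real (snd v) * character \<xi> (fst v)"] fourier_N\<^sub>1[of \<xi>] fourier_N\<^sub>2[of \<xi>] int
      by (simp add: weighted_fourier_def integrable_mult_cis)
  qed measurable
qed

lemma symbol_diff: "symbol m\<^sub>1 \<Longrightarrow> symbol m\<^sub>2 \<Longrightarrow> symbol (\<lambda>\<xi>. m\<^sub>1 \<xi> - m\<^sub>2 \<xi>)"
  using symbol_add[OF _ symbol_cmult[of m\<^sub>2 "-1"], of m\<^sub>1] by simp

lemma symbol_power: "symbol m \<Longrightarrow> symbol (\<lambda>\<xi>. m \<xi> ^ n)"
  by (induction n) (auto intro: symbol_const symbol_mult)

section \<open>Gaussian mixtures\<close>

definition diag_form :: "('a::euclidean_space \<Rightarrow> real) \<Rightarrow> 'a \<Rightarrow> real" where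
  "diag_form c \<xi> = (\<Sum>b\<in>Basis. c b * (\<xi> \<bullet> b)\<^sup>2)"

lemma diag_form_nonneg: "(\<And>b. b \<in> Basis \<Longrightarrow> c b \<ge> 0) \<Longrightarrow> diag_form c \<xi> \<ge> 0"
  unfolding diag_form_def by (intro sum_nonneg mult_nonneg_nonneg) auto

lemma diag_form_const: "diag_form (\<lambda>_. c) \<xi> = c * (norm \<xi>)\<^sup>2"
  by (simp add: diag_form_def power2_norm_Basis sum_distrib_left)

lemma diag_form_scale: "diag_form (\<lambda>b. c b * r) \<xi> = diag_form c \<xi> * r"
  unfolding diag_form_def sum_distrib_right by (simp add: mult_ac)

lemma diag_form_add: "diag_form (\<lambda>b. c b + d b) \<xi> = diag_form c \<xi> + diag_form d \<xi>"
  by (simp add: diag_form_def distrib_right sum.distrib)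

lemma diag_form_indicator:
  "I \<subseteq> Basis \<Longrightarrow> diag_form (indicator I) \<xi> = (\<Sum>b\<in>I. (\<xi> \<bullet> b)\<^sup>2)"
  by (simp add: diag_form_def indicator_def if_distrib[of "\<lambda>c. c * _"] sum.inter_restrict[symmetric] Int_absorb1 cong: if_cong)

definition diag_scale :: "('a::euclidean_space \<Rightarrow> real) \<Rightarrow> 'a \<Rightarrow> 'a" where
  "diag_scale c z = (\<Sum>b\<in>Basis. (sqrt (c b / pi) * (z \<bullet> b)) *\<^sub>R b)"

lemma diag_scale_const: "diag_scale (\<lambda>_. c) z = sqrt (c / pi) *\<^sub>R z"
  unfolding diag_scale_def scaleR_scaleR[symmetric] scaleR_sum_right[symmetric] euclidean_representation ..

lemma fourier_gauss_diag_scale: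
  fixes \<xi> :: "'a::euclidean_space"
  assumes c: "\<And>b. b \<in> Basis \<Longrightarrow> c b \<ge> 0"
  shows "(LINT z|lborel. complex_of_real (gauss z) * character \<xi> (diag_scale c z)) = of_real (exp (- diag_form c \<xi>))"
proof -
  define \<eta> where "\<eta> = diag_scale c \<xi>"
  have \<eta>_inner: "\<eta> \<bullet> b = sqrt (c b / pi) * (\<xi> \<bullet> b)" if "b \<in> Basis" for b
    using that by (simp add: \<eta>_def diag_scale_def)
  have "diag_scale c z \<bullet> \<xi> = z \<bullet> \<eta>" for z
    by (simp add: diag_scale_def inner_sum_left euclidean_inner[of z \<eta>] \<eta>_inner inner_commute[of \<xi>] mult_ac)
  then have "(LINT z|lborel. complex_of_real (gauss z) * character \<xi> (diag_scale c z)) = of_real (gauss \<eta>)"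
    by (simp add: fourier_gauss)
  also have "pi * (norm \<eta>)\<^sup>2 = diag_form c \<xi>"
    using c by (simp add: power2_norm_Basis \<eta>_inner power_mult_distrib diag_form_def sum_distrib_left)
  then have "gauss \<eta> = exp (- diag_form c \<xi>)" by (simp add: gauss_def)
  finally show ?thesis .
qed

lemma
  fixes c :: "'w \<Rightarrow> 'a::euclidean_space \<Rightarrow> real"
  assumes M: "sigma_finite_measure M" and k: "integrable M k"
    and c[measurable]: "\<And>b. b \<in> Basis \<Longrightarrow> (\<lambda>w. c w b) \<in> borel_measurable M" and c_nonneg: "\<And>w b. b \<in> Basis \<Longrightarrow> c w b \<ge> 0"
  shows integrable_gauss_mixture: "integrable (M \<Otimes>\<^sub>M lborel) (\<lambda>(w, z::'a). k w * gauss z)"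
    and diag_scale_measurable: "(\<lambda>(w, z). diag_scale (c w) z) \<in> borel_measurable (M \<Otimes>\<^sub>M lborel)"
    and fourier_gauss_mixture: "(\<integral>x. of_real (case x of (w, z) \<Rightarrow> k w * gauss z) * character \<xi> (case x of (w, z) \<Rightarrow> diag_scale (c w) z) \<partial>(M \<Otimes>\<^sub>M lborel))
      = of_real (\<integral>w. k w * exp (- diag_form (c w) \<xi>) \<partial>M)"
proof -
  show [measurable]: "(\<lambda>(w, z). diag_scale (c w) z) \<in> borel_measurable (M \<Otimes>\<^sub>M lborel)" unfolding diag_scale_def by measurable
  have "integrable (M \<Otimes>\<^sub>M lborel) (\<lambda>(w, z::'a). of_real (k w) * gauss z)"
    by (rule integrable_weighted_kernel[OF M sigma_finite_lborel _ k, where C = "LINT z|lborel. \<bar>gauss (z::'a)\<bar>"])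
       (auto simp: integrable_gauss)
  then show "integrable (M \<Otimes>\<^sub>M lborel) (\<lambda>(w, z::'a). k w * gauss z)" by simp
  have "(\<integral>x. of_real (case x of (w, z) \<Rightarrow> k w * gauss z) * character \<xi> (case x of (w, z) \<Rightarrow> diag_scale (c w) z) \<partial>(M \<Otimes>\<^sub>M lborel))
      = (\<integral>(w, z). of_real (k w) * (of_real (gauss z) * character \<xi> (diag_scale (c w) z)) \<partial>(M \<Otimes>\<^sub>M lborel))"
    by (simp add: case_prod_unfold mult.assoc)
  also have "\<dots> = (\<integral>w. of_real (k w) * (LINT z|lborel. of_real (gauss z) * character \<xi> (diag_scale (c w) z)) \<partial>M)"
    by (rule integral_weighted_kernel[OF M sigma_finite_lborel _ k, where C = "LINT z|lborel. \<bar>gauss (z::'a)\<bar>"])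
       (auto simp: norm_mult integrable_gauss diag_scale_def intro!: integrable_mult_cis)
  also have "\<dots> = of_real (\<integral>w. k w * exp (- diag_form (c w) \<xi>) \<partial>M)"
    by (simp add: fourier_gauss_diag_scale[OF c_nonneg] flip: of_real_mult)
  finally show "(\<integral>x. of_real (case x of (w, z) \<Rightarrow> k w * gauss z) * character \<xi> (case x of (w, z) \<Rightarrow> diag_scale (c w) z) \<partial>(M \<Otimes>\<^sub>M lborel))
      = of_real (\<integral>w. k w * exp (- diag_form (c w) \<xi>) \<partial>M)" .
qed

lemma symbol_gauss_mixture:
  fixes c :: "'w \<Rightarrow> 'a::euclidean_space \<Rightarrow> real"
  assumes "sigma_finite_measure M" "integrable M k"
    "\<And>b. b \<in> Basis \<Longrightarrow> (\<lambda>w. c w b) \<in> borel_measurable M" "\<And>w b. b \<in> Basis \<Longrightarrow> c w b \<ge> 0"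
  shows "symbol (\<lambda>\<xi>::'a. \<integral>w. k w * exp (- diag_form (c w) \<xi>) \<partial>M)"
  by (rule symbolI[OF integrable_gauss_mixture[OF assms] diag_scale_measurable[OF assms] fourier_gauss_mixture[OF assms]])

lemma
  fixes f :: "real \<Rightarrow> real"
  assumes "\<And>x. x \<in> S \<Longrightarrow> 0 \<le> f x" "(f has_integral I) S" and [measurable]: "(\<lambda>x. indicator S x * f x) \<in> borel_measurable borel"
  shows integrable_has_integral_nonneg: "integrable lborel (\<lambda>x. indicator S x * f x)"
    and integral_has_integral_nonneg: "(LINT x|lborel. indicator S x * f x) = I"
proof -
  have nn_integral: "(\<integral>\<^sup>+x. ennreal (indicator S x * f x) \<partial>lborel) = ennreal I"
    by (rule nn_integral_has_integral_lebesgue[OF assms(1,2)])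
  have nonneg: "0 \<le> indicator S x * f x" for x using assms(1) by (auto simp: indicator_def)
  show int: "integrable lborel (\<lambda>x. indicator S x * f x)"
    by (rule integrableI_nonneg) (use nn_integral nonneg in auto)
  have "ennreal (LINT x|lborel. indicator S x * f x) = ennreal I"
    using nn_integral_eq_integral[OF int] nn_integral nonneg by simp
  moreover have "I \<ge> 0" by (rule has_integral_nonneg[OF assms(2,1)])
  ultimately show "(LINT x|lborel. indicator S x * f x) = I" using nonneg by (simp add: integral_nonneg)
qed

lemma
  fixes a c :: real assumes "a > -1" "c \<ge> 0"
  shows integrable_powr_from_0: "integrable lborel (\<lambda>x. indicator {0..c} x * x powr a)"
    and integral_powr_from_0: "(LINT x|lborel. indicator {0..c} x * x powr a) = c powr (a + 1) / (a + 1)"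
  by (rule integrable_has_integral_nonneg[OF _ has_integral_powr_from_0[OF assms]]
        integral_has_integral_nonneg[OF _ has_integral_powr_from_0[OF assms]]; simp)+

lemma integrable_powr_to_inf:
  fixes a c :: real assumes "a < -1" "c > 0"
  shows "integrable lborel (\<lambda>x. indicator {c..} x * x powr a)"
  by (rule integrable_has_integral_nonneg[OF _ has_integral_powr_to_inf[OF assms]]) auto

definition powr_plus :: "real \<Rightarrow> real \<Rightarrow> real" where
  "powr_plus a t = (if t > 0 then t powr a else 0)"

lemma powr_plus_measurable [measurable]: "powr_plus a \<in> borel_measurable borel"
  unfolding powr_plus_def by measurable

lemma powr_plus_nonneg [simp]: "powr_plus a t \<ge> 0"
  by (simp add: powr_plus_def)

lemma powr_plus_mult_exp: "powr_plus a t * exp (- (A * t)) * exp (- (D * max 0 t)) = powr_plus a t * exp (- ((A + D) * t))"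
  by (simp add: powr_plus_def mult.assoc exp_add[symmetric] algebra_simps)

lemma
  fixes g :: "real \<Rightarrow> real"
  assumes A: "A > 0" and [measurable]: "g \<in> borel_measurable borel"
  shows integrable_powr_plus_scale: "integrable lborel (\<lambda>t. powr_plus a t * g t) \<Longrightarrow> integrable lborel (\<lambda>t. powr_plus a t * g (A * t))"
    and integral_powr_plus_scale: "(LINT t|lborel. powr_plus a t * g (A * t)) = A powr (- a - 1) * (LINT t|lborel. powr_plus a t * g t)"
proof -
  let ?f = "\<lambda>t. powr_plus a t * g t"
  have "powr_plus a (A * t) = A powr a * powr_plus a t" for t
    using A by (auto simp: powr_plus_def powr_mult zero_less_mult_iff)
  then have scale: "powr_plus a t * g (A * t) = A powr (- a) * ?f (A *\<^sub>R t + 0)" for t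
    using A by (simp add: powr_minus)
  have [measurable]: "?f \<in> borel_measurable borel" by measurable
  show "integrable lborel ?f \<Longrightarrow> integrable lborel (\<lambda>t. powr_plus a t * g (A * t))"
    using integrable_affine_iff[of A ?f 0] A unfolding scale by (intro integrable_mult_right) simp
  have "(LINT t|lborel. powr_plus a t * g (A * t)) = A powr (- a) * ((1 / \<bar>A\<bar> ^ DIM(real)) *\<^sub>R integral\<^sup>L lborel ?f)"
    unfolding scale integral_mult_right_zero using A by (subst integral_affine) auto
  then show "(LINT t|lborel. powr_plus a t * g (A * t)) = A powr (- a - 1) * integral\<^sup>L lborel ?f"
    using A by (simp add: powr_diff)
qed

lemma
  assumes s: "s > 0" and A: "A > 0"
  shows integrable_gamma: "integrable lborel (\<lambda>t. powr_plus (s - 1) t * exp (- (A * t)))"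
    and integral_gamma: "(LINT t|lborel. powr_plus (s - 1) t * exp (- (A * t))) = Gamma s * A powr (- s)"
proof -
  have gamma: "(\<lambda>t. indicator {0..} t * (t powr (s - 1) / exp t)) = (\<lambda>t. powr_plus (s - 1) t * exp (- t))"
    by (auto simp: powr_plus_def indicator_def fun_eq_iff exp_minus field_simps)
  have meas: "(\<lambda>t. indicator {0..} t * (t powr (s - 1) / exp t)) \<in> borel_measurable borel"
    unfolding gamma by measurable
  have "integrable lborel (\<lambda>t. powr_plus (s - 1) t * exp (- t))"
    unfolding gamma[symmetric] by (rule integrable_has_integral_nonneg[OF _ Gamma_integral_real[OF s] meas]) simp
  then show "integrable lborel (\<lambda>t. powr_plus (s - 1) t * exp (- (A * t)))"
    by (intro integrable_powr_plus_scale[OF A, of "\<lambda>t. exp (- t)"]) auto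
  have "(LINT t|lborel. powr_plus (s - 1) t * exp (- t)) = Gamma s"
    unfolding gamma[symmetric] by (rule integral_has_integral_nonneg[OF _ Gamma_integral_real[OF s] meas]) simp
  then show "(LINT t|lborel. powr_plus (s - 1) t * exp (- (A * t))) = Gamma s * A powr (- s)"
    using integral_powr_plus_scale[OF A, of "\<lambda>t. exp (- t)" "s - 1"] by simp
qed

lemma integral_gauss_mixture_gamma:
  fixes c :: "'a::euclidean_space \<Rightarrow> real"
  assumes s: "s > 0" and c: "\<And>b. b \<in> Basis \<Longrightarrow> c b \<ge> 0"
  shows "(LINT t|lborel. 1 / Gamma s * (powr_plus (s - 1) t * exp (- (1 * t))) * exp (- diag_form (\<lambda>b. c b * max 0 t) \<xi>)) = (1 + diag_form c \<xi>) powr (- s)"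
proof -
  have pos: "1 + diag_form c \<xi> > 0" using diag_form_nonneg[of c \<xi>] c by simp
  have "(LINT t|lborel. 1 / Gamma s * (powr_plus (s - 1) t * exp (- (1 * t))) * exp (- diag_form (\<lambda>b. c b * max 0 t) \<xi>))
      = 1 / Gamma s * (Gamma s * (1 + diag_form c \<xi>) powr (- s))"
    unfolding diag_form_scale mult.assoc[of "1 / Gamma s"] powr_plus_mult_exp integral_mult_right_zero integral_gamma[OF s pos] ..
  then show ?thesis using Gamma_real_pos[OF s] by simp
qed

lemma symbol_bessel:
  fixes c :: "'a::euclidean_space \<Rightarrow> real"
  assumes s: "s \<ge> 0" and c: "\<And>b. b \<in> Basis \<Longrightarrow> c b \<ge> 0"
  shows "symbol (\<lambda>\<xi>. (1 + diag_form c \<xi>) powr (- s))"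
proof -
  have pos: "1 + diag_form c \<xi> > 0" for \<xi> using diag_form_nonneg[of c \<xi>] c by simp
  show ?thesis
  proof (cases "s = 0")
    case True
    then show ?thesis using pos by (simp add: symbol_const less_imp_neq[THEN not_sym])
  next
    case False
    then have s: "s > 0" using s by simp
    let ?k = "\<lambda>t. 1 / Gamma s * (powr_plus (s - 1) t * exp (- (1 * t)))"
    have k: "integrable lborel ?k" by (intro integrable_mult_right integrable_gamma s zero_less_one)
    have "(LINT t|lborel. ?k t * exp (- diag_form (\<lambda>b. c b * max 0 t) \<xi>)) = (1 + diag_form c \<xi>) powr (- s)" for \<xi>
      by (rule integral_gauss_mixture_gamma[OF s c])
    moreover have "symbol (\<lambda>\<xi>::'a. LINT t|lborel. ?k t * exp (- diag_form (\<lambda>b. c b * max 0 t) \<xi>))"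
      by (rule symbol_gauss_mixture[OF sigma_finite_lborel k]) (use c in auto)
    ultimately show ?thesis by simp
  qed
qed

lemma symbol_bessel_norm:
  assumes "s \<ge> 0" "c \<ge> 0"
  shows "symbol (\<lambda>\<xi>::'a::euclidean_space. (1 + c * (norm \<xi>)\<^sup>2) powr (- s))"
  using symbol_bessel[where 'a='a, OF assms(1), of "\<lambda>_. c"] assms(2) by (simp add: diag_form_const)

section \<open>Quotients of Bessel symbols\<close>

definition levy_kernel :: "real \<Rightarrow> real \<Rightarrow> real \<Rightarrow> real" where
  "levy_kernel s A \<tau> = powr_plus (- 1 - s) \<tau> * (1 - exp (- (A * \<tau>)))"

definition frac_powr_const :: "real \<Rightarrow> real" where
  "frac_powr_const s = (LINT \<tau>|lborel. levy_kernel s 1 \<tau>)"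

lemma levy_kernel_nonneg: "A \<ge> 0 \<Longrightarrow> levy_kernel s A \<tau> \<ge> 0"
  by (simp add: levy_kernel_def powr_plus_def)

lemma levy_kernel_1_le:
  "levy_kernel s 1 \<tau> \<le> indicator {0..1} \<tau> * \<tau> powr (- s) + indicator {1..} \<tau> * \<tau> powr (- 1 - s)"
proof -
  consider "\<tau> \<le> 0" | "0 < \<tau>" "\<tau> < 1" | "\<tau> \<ge> 1" by linarith
  then show ?thesis
  proof cases
    case 2
    have "1 - exp (- \<tau>) \<le> \<tau>" using exp_ge_add_one_self[of "- \<tau>"] by linarith
    then have "\<tau> powr (- 1 - s) * (1 - exp (- \<tau>)) \<le> \<tau> powr (- 1 - s) * \<tau>" by (intro mult_left_mono) auto
    also have "\<dots> = \<tau> powr (- s)" using 2 by (simp add: powr_diff powr_minus field_simps)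
    finally show ?thesis using 2 by (simp add: levy_kernel_def powr_plus_def)
  next
    case 3
    have "\<tau> powr (- 1 - s) * (1 - exp (- \<tau>)) \<le> \<tau> powr (- 1 - s) * 1" by (intro mult_left_mono) auto
    moreover have "0 \<le> indicator {0..1} \<tau> * \<tau> powr (- s)" by simp
    ultimately have "\<tau> powr (- 1 - s) * (1 - exp (- \<tau>)) \<le> indicator {0..1} \<tau> * \<tau> powr (- s) + \<tau> powr (- 1 - s)" by linarith
    then show ?thesis using 3 by (simp add: levy_kernel_def powr_plus_def)
  qed (auto simp: levy_kernel_def powr_plus_def indicator_def)
qed

lemma
  assumes s: "0 < s" "s < 1" and A: "A > 0"
  shows integrable_levy_kernel: "integrable lborel (levy_kernel s A)"
    and integral_levy_kernel: "(LINT \<tau>|lborel. levy_kernel s A \<tau>) = frac_powr_const s * A powr s"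
proof -
  have "integrable lborel (levy_kernel s 1)"
  proof (rule integrable_dominated)
    show "integrable lborel (\<lambda>\<tau>. indicator {0..1} \<tau> * \<tau> powr (- s) + indicator {1..} \<tau> * \<tau> powr (- 1 - s))"
      using s by (intro Bochner_Integration.integrable_add integrable_powr_from_0 integrable_powr_to_inf) auto
    show "levy_kernel s 1 \<in> borel_measurable lborel" unfolding levy_kernel_def[abs_def] by measurable
  qed (simp add: levy_kernel_nonneg levy_kernel_1_le)
  then show "integrable lborel (levy_kernel s A)"
    using integrable_powr_plus_scale[OF A, of "\<lambda>t. 1 - exp (- t)"] by (simp add: levy_kernel_def[abs_def])
  show "(LINT \<tau>|lborel. levy_kernel s A \<tau>) = frac_powr_const s * A powr s"
    using integral_powr_plus_scale[OF A, of "\<lambda>t. 1 - exp (- t)" "- 1 - s"] by (simp add: levy_kernel_def frac_powr_const_def)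
qed

lemma frac_powr_const_pos:
  assumes s: "0 < s" "s < 1" shows "frac_powr_const s > 0"
proof -
  have int: "integrable lborel (levy_kernel s 1)" using integrable_levy_kernel[OF s, of 1] by simp
  have "frac_powr_const s \<noteq> 0"
  proof
    assume "frac_powr_const s = 0"
    then have "AE \<tau> in lborel. levy_kernel s 1 \<tau> = 0"
      using integral_nonneg_eq_0_iff_AE[OF int] by (auto simp: frac_powr_const_def levy_kernel_nonneg)
    then have "AE \<tau> in lborel. \<tau> \<notin> {0<..<1::real}" by eventually_elim (auto simp: levy_kernel_def powr_plus_def)
    then have "emeasure lborel {0<..<1::real} = 0" by (subst (asm) AE_iff_measurable[of "{0<..<1}"]) auto
    then show False by simp
  qed
  moreover have "frac_powr_const s \<ge> 0" by (simp add: frac_powr_const_def levy_kernel_nonneg)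
  ultimately show ?thesis by simp
qed

lemma levy_kernel_diff_mult_exp:
  "(levy_kernel s A \<tau> - levy_kernel s B \<tau>) * exp (- (D * max 0 \<tau>)) = levy_kernel s (A + D) \<tau> - levy_kernel s (B + D) \<tau>"
proof (cases "\<tau> > 0")
  case True
  then show ?thesis
    by (simp add: levy_kernel_def right_diff_distrib left_diff_distrib distrib_right mult.assoc exp_add[symmetric])
qed (simp add: levy_kernel_def powr_plus_def)

text \<open>Both powers are integrals of \<open>1 - exp\<close> with the same singularity at \<open>0\<close>, so their difference is an
  absolutely convergent Gaussian mixture.\<close>

lemma symbol_powr_diff:
  fixes c :: "'a::euclidean_space \<Rightarrow> real"
  assumes s: "0 < s" "s < 1" and A: "A > 0" and B: "B > 0" and c: "\<And>b. b \<in> Basis \<Longrightarrow> c b \<ge> 0"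
  shows "symbol (\<lambda>\<xi>. (A + diag_form c \<xi>) powr s - (B + diag_form c \<xi>) powr s)"
proof -
  let ?k = "\<lambda>\<tau>. 1 / frac_powr_const s * (levy_kernel s A \<tau> - levy_kernel s B \<tau>)"
  have k: "integrable lborel ?k"
    by (intro integrable_mult_right Bochner_Integration.integrable_diff integrable_levy_kernel s A B)
  have "(LINT \<tau>|lborel. ?k \<tau> * exp (- diag_form (\<lambda>b. c b * max 0 \<tau>) \<xi>)) = (A + diag_form c \<xi>) powr s - (B + diag_form c \<xi>) powr s" for \<xi>
  proof -
    have pos: "A + diag_form c \<xi> > 0" "B + diag_form c \<xi> > 0" using A B diag_form_nonneg[of c \<xi>] c by auto
    have "(LINT \<tau>|lborel. ?k \<tau> * exp (- diag_form (\<lambda>b. c b * max 0 \<tau>) \<xi>))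
        = 1 / frac_powr_const s * (LINT \<tau>|lborel. levy_kernel s (A + diag_form c \<xi>) \<tau> - levy_kernel s (B + diag_form c \<xi>) \<tau>)"
      unfolding diag_form_scale mult.assoc[of "1 / frac_powr_const s"] levy_kernel_diff_mult_exp integral_mult_right_zero ..
    also have "\<dots> = (A + diag_form c \<xi>) powr s - (B + diag_form c \<xi>) powr s"
      using frac_powr_const_pos[OF s]
      by (simp add: Bochner_Integration.integral_diff integrable_levy_kernel integral_levy_kernel s pos diff_divide_distrib)
    finally show ?thesis .
  qed
  moreover have "symbol (\<lambda>\<xi>::'a. LINT \<tau>|lborel. ?k \<tau> * exp (- diag_form (\<lambda>b. c b * max 0 \<tau>) \<xi>))"
    by (rule symbol_gauss_mixture[OF sigma_finite_lborel k]) (use c in auto)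
  ultimately show ?thesis by simp
qed

lemma symbol_powr:
  assumes s: "s \<ge> 0" and pos: "\<And>\<xi>. m \<xi> > 0" and m: "symbol m"
    and frac: "\<And>f. 0 < f \<Longrightarrow> f < 1 \<Longrightarrow> symbol (\<lambda>\<xi>. m \<xi> powr f)"
  shows "symbol (\<lambda>\<xi>. m \<xi> powr s)"
proof -
  have "symbol (\<lambda>\<xi>. m \<xi> powr frac s)"
  proof (cases "frac s = 0")
    case True
    show ?thesis using pos unfolding True by (simp add: symbol_const less_imp_neq[THEN not_sym])
  next
    case False
    then show ?thesis using frac_ge_0[of s] frac_lt_1[of s] by (intro frac) auto
  qed
  moreover have "m \<xi> powr s = m \<xi> ^ nat \<lfloor>s\<rfloor> * m \<xi> powr frac s" for \<xi>
  proof -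
    have "s = real (nat \<lfloor>s\<rfloor>) + frac s" using s by (simp add: frac_def)
    then have "m \<xi> powr s = m \<xi> powr real (nat \<lfloor>s\<rfloor>) * m \<xi> powr frac s" by (metis powr_add)
    then show ?thesis using pos by (simp only: powr_realpow)
  qed
  ultimately show ?thesis by (simp add: symbol_mult symbol_power m)
qed

lemma symbol_ratio_frac:
  assumes s: "0 < s" "s < 1" and c: "c > 0" and d: "d > 0"
  shows "symbol (\<lambda>\<xi>::'a::euclidean_space. ((1 + c * (norm \<xi>)\<^sup>2) / (1 + d * (norm \<xi>)\<^sup>2)) powr s)"
proof -
  let ?u = "\<lambda>\<xi>::'a. 1 + c * (norm \<xi>)\<^sup>2" and ?v = "\<lambda>\<xi>::'a. 1 + d * (norm \<xi>)\<^sup>2"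
  have "symbol (\<lambda>\<xi>::'a. ?u \<xi> powr s - (c / d + c * (norm \<xi>)\<^sup>2) powr s)"
    using symbol_powr_diff[where 'a='a, OF s, of 1 "c / d" "\<lambda>_. c"] c d by (simp add: diag_form_const)
  then have "symbol (\<lambda>\<xi>::'a. (?u \<xi> powr s - (c / d + c * (norm \<xi>)\<^sup>2) powr s) * ?v \<xi> powr (- s) + (c / d) powr s)"
    using s d by (intro symbol_add symbol_mult symbol_bessel_norm symbol_const) auto
  also have "(\<lambda>\<xi>::'a. (?u \<xi> powr s - (c / d + c * (norm \<xi>)\<^sup>2) powr s) * ?v \<xi> powr (- s) + (c / d) powr s) = (\<lambda>\<xi>. (?u \<xi> / ?v \<xi>) powr s)"
  proof
    fix \<xi> :: 'a
    have "?v \<xi> > 0" using d by (intro add_pos_nonneg) auto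
    then have nonzero: "?v \<xi> powr s \<noteq> 0" by simp
    have "c / d + c * (norm \<xi>)\<^sup>2 = c / d * ?v \<xi>" using d by (simp add: field_simps)
    then have "(c / d + c * (norm \<xi>)\<^sup>2) powr s = (c / d) powr s * ?v \<xi> powr s" by (simp only: powr_mult)
    then show "(?u \<xi> powr s - (c / d + c * (norm \<xi>)\<^sup>2) powr s) * ?v \<xi> powr (- s) + (c / d) powr s = (?u \<xi> / ?v \<xi>) powr s"
      using nonzero by (simp add: powr_minus_divide powr_divide diff_divide_distrib)
  qed
  finally show ?thesis .
qed

lemma symbol_ratio:
  assumes s: "s \<ge> 0" and c: "c > 0" and d: "d > 0"
  shows "symbol (\<lambda>\<xi>::'a::euclidean_space. ((1 + c * (norm \<xi>)\<^sup>2) / (1 + d * (norm \<xi>)\<^sup>2)) powr s)"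
proof (rule symbol_powr[OF s _ _ symbol_ratio_frac[OF _ _ c d]])
  have pos: "1 + d * (norm \<xi>)\<^sup>2 > 0" for \<xi> :: 'a using d by (intro add_pos_nonneg) auto
  have "symbol (\<lambda>\<xi>::'a. (1 - c / d) * (1 + d * (norm \<xi>)\<^sup>2) powr (- 1) + c / d)"
    using d by (intro symbol_add symbol_cmult symbol_const symbol_bessel_norm) auto
  also have "(\<lambda>\<xi>::'a. (1 - c / d) * (1 + d * (norm \<xi>)\<^sup>2) powr (- 1) + c / d) = (\<lambda>\<xi>. (1 + c * (norm \<xi>)\<^sup>2) / (1 + d * (norm \<xi>)\<^sup>2))"
  proof
    fix \<xi> :: 'a
    have "1 + c * (norm \<xi>)\<^sup>2 = (1 - c / d) + c / d * (1 + d * (norm \<xi>)\<^sup>2)" using d by (simp add: field_simps)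
    then show "(1 - c / d) * (1 + d * (norm \<xi>)\<^sup>2) powr (- 1) + c / d = (1 + c * (norm \<xi>)\<^sup>2) / (1 + d * (norm \<xi>)\<^sup>2)"
      using pos[of \<xi>] by (simp only: add_divide_distrib) (simp add: powr_minus_divide)
  qed
  finally show "symbol (\<lambda>\<xi>::'a. (1 + c * (norm \<xi>)\<^sup>2) / (1 + d * (norm \<xi>)\<^sup>2))" .
  show "(1 + c * (norm \<xi>)\<^sup>2) / (1 + d * (norm \<xi>)\<^sup>2) > 0" for \<xi> :: 'a
    using c d by (intro divide_pos_pos add_pos_nonneg) auto
qed auto

section \<open>The tensor symbol\<close>

definition laplace :: "(real \<Rightarrow> real) \<Rightarrow> real \<Rightarrow> real" where
  "laplace f a = (LINT t|lborel. f t * exp (- (t * a)))"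

lemma
  fixes f :: "real \<Rightarrow> real"
  assumes f: "integrable lborel f" and supp: "\<And>t. t \<le> 0 \<Longrightarrow> f t = 0" and a: "a \<ge> 0"
  shows abs_laplace_integrand_le: "\<bar>f t * exp (- (t * a))\<bar> \<le> \<bar>f t\<bar>"
    and integrable_laplace: "integrable lborel (\<lambda>t. f t * exp (- (t * a)))"
proof -
  have [measurable]: "f \<in> borel_measurable borel" using f by auto
  show bound: "\<bar>f t * exp (- (t * a))\<bar> \<le> \<bar>f t\<bar>" for t
    using supp[of t] a by (cases "t \<le> 0") (auto simp: abs_mult mult_left_le)
  show "integrable lborel (\<lambda>t. f t * exp (- (t * a)))"
    by (rule integrable_dominated[OF integrable_abs[OF f]]) (use bound in auto)
qed

lemma
  fixes u v :: "real \<Rightarrow> real"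
  assumes u: "integrable lborel u" and v: "integrable lborel v"
  shows integrable_prod_real: "integrable lborel (\<lambda>x. u (fst x) * v (snd x))"
    and integral_prod_real: "(LINT x|lborel. u (fst x) * v (snd x)) = (LINT t|lborel. u t) * (LINT t|lborel. v t)"
proof -
  have meas: "(\<lambda>(t, x). v x) \<in> borel_measurable (lborel \<Otimes>\<^sub>M lborel)" using v by measurable
  note kernel = sigma_finite_lborel sigma_finite_lborel meas u v order_refl
  show "integrable lborel (\<lambda>x. u (fst x) * v (snd x))"
    using integrable_weighted_kernel[OF kernel] by (simp add: lborel_prod case_prod_unfold)
  show "(LINT x|lborel. u (fst x) * v (snd x)) = (LINT t|lborel. u t) * (LINT t|lborel. v t)"
    using integral_weighted_kernel[OF kernel] by (simp add: lborel_prod case_prod_unfold)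
qed

lemma measurable_case_prod_compose:
  assumes "case_prod f \<in> A \<Otimes>\<^sub>M B \<rightarrow>\<^sub>M C" "u \<in> M \<rightarrow>\<^sub>M A" "v \<in> M \<rightarrow>\<^sub>M B"
  shows "(\<lambda>x. f (u x) (v x)) \<in> M \<rightarrow>\<^sub>M C"
  using measurable_compose[OF measurable_Pair[OF assms(2,3)] assms(1)] by simp

lemma
  fixes f g :: "real \<Rightarrow> real \<Rightarrow> real"
  assumes meas: "case_prod f \<in> borel_measurable (borel \<Otimes>\<^sub>M borel)" "case_prod g \<in> borel_measurable (borel \<Otimes>\<^sub>M borel)"
    and f: "\<And>\<tau>. integrable lborel (f \<tau>)" and g: "\<And>\<tau>. integrable lborel (g \<tau>)" and w[measurable]: "w \<in> borel_measurable borel"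
    and int: "integrable lborel (\<lambda>\<tau>. \<bar>w \<tau>\<bar> * ((LINT t|lborel. \<bar>f \<tau> t\<bar>) * (LINT t|lborel. \<bar>g \<tau> t\<bar>)))"
  shows integrable_triple: "integrable lborel (\<lambda>(\<tau>, t, u). w \<tau> * (f \<tau> t * g \<tau> u))"
    and integral_triple: "(LINT (\<tau>, t, u)|lborel. w \<tau> * (f \<tau> t * g \<tau> u))
      = (LINT \<tau>|lborel. w \<tau> * ((LINT t|lborel. f \<tau> t) * (LINT u|lborel. g \<tau> u)))"
proof -
  note [measurable] = measurable_case_prod_compose[OF meas(1)] measurable_case_prod_compose[OF meas(2)]
  let ?k = "\<lambda>(\<tau>, x). w \<tau> * (f \<tau> (fst x) * g \<tau> (snd x))"
  have triple: "(\<lambda>(\<tau>, t, u). w \<tau> * (f \<tau> t * g \<tau> u)) = ?k" by auto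
  have kernel: "integrable (lborel \<Otimes>\<^sub>M lborel) ?k"
  proof (rule lborel_pair.Fubini_integrable)
    show "?k \<in> borel_measurable (lborel \<Otimes>\<^sub>M lborel)" unfolding lborel_prod[symmetric] by measurable
    show "integrable lborel (\<lambda>\<tau>. LINT x|lborel. norm (?k (\<tau>, x)))"
      using int by (simp add: abs_mult integral_prod_real[OF integrable_abs[OF f] integrable_abs[OF g]])
    show "AE \<tau> in lborel. integrable lborel (\<lambda>x. ?k (\<tau>, x))" using integrable_prod_real[OF f g] by simp
  qed
  then show "integrable lborel (\<lambda>(\<tau>, t, u). w \<tau> * (f \<tau> t * g \<tau> u))" by (simp add: triple lborel_prod)
  show "(LINT (\<tau>, t, u)|lborel. w \<tau> * (f \<tau> t * g \<tau> u)) = (LINT \<tau>|lborel. w \<tau> * ((LINT t|lborel. f \<tau> t) * (LINT u|lborel. g \<tau> u)))"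
    using lborel_pair.integral_fst'[OF kernel] by (simp add: triple lborel_prod integral_prod_real[OF f g])
qed

lemma integral_laplace_product:
  fixes f :: "real \<Rightarrow> real \<Rightarrow> real"
  assumes meas: "case_prod f \<in> borel_measurable (borel \<Otimes>\<^sub>M borel)" and f: "\<And>\<tau>. integrable lborel (f \<tau>)"
    and supp: "\<And>\<tau> t. t \<le> 0 \<Longrightarrow> f \<tau> t = 0" and w[measurable]: "w \<in> borel_measurable borel"
    and int: "integrable lborel (\<lambda>\<tau>. \<bar>w \<tau>\<bar> * ((LINT t|lborel. \<bar>f \<tau> t\<bar>) * (LINT t|lborel. \<bar>f \<tau> t\<bar>)))"
    and \<alpha>\<beta>: "\<alpha> \<ge> 0" "\<beta> \<ge> 0"
  shows "(LINT (\<tau>, t, u)|lborel. w \<tau> * (f \<tau> t * f \<tau> u) * exp (- (max 0 t * \<alpha> + max 0 u * \<beta>)))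
    = (LINT \<tau>|lborel. w \<tau> * (laplace (f \<tau>) \<alpha> * laplace (f \<tau>) \<beta>))"
proof -
  note [measurable] = measurable_case_prod_compose[OF meas]
  let ?f = "\<lambda>a \<tau> t. f \<tau> t * exp (- (t * a))"
  have meas_damped: "case_prod (?f a) \<in> borel_measurable (borel \<Otimes>\<^sub>M borel)" for a by measurable
  have norm_le: "(LINT t|lborel. \<bar>?f a \<tau> t\<bar>) \<le> (LINT t|lborel. \<bar>f \<tau> t\<bar>)" if "a \<ge> 0" for a \<tau>
    using that f by (intro integral_mono integrable_abs integrable_laplace abs_laplace_integrand_le) (auto simp: supp)
  have int_damped: "integrable lborel (\<lambda>\<tau>. \<bar>w \<tau>\<bar> * ((LINT t|lborel. \<bar>?f \<alpha> \<tau> t\<bar>) * (LINT t|lborel. \<bar>?f \<beta> \<tau> t\<bar>)))"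
    by (rule integrable_dominated[OF int])
       (use norm_le[OF \<alpha>\<beta>(1)] norm_le[OF \<alpha>\<beta>(2)] in \<open>auto simp: abs_mult intro!: mult_left_mono mult_mono\<close>)
  have "w \<tau> * (f \<tau> t * f \<tau> u) * exp (- (max 0 t * \<alpha> + max 0 u * \<beta>)) = w \<tau> * (?f \<alpha> \<tau> t * ?f \<beta> \<tau> u)" for \<tau> t u
    using supp[of t \<tau>] supp[of u \<tau>] by (cases "t \<le> 0 \<or> u \<le> 0") (auto simp: exp_add exp_diff exp_minus field_simps)
  then have "(\<lambda>(\<tau>, t, u). w \<tau> * (f \<tau> t * f \<tau> u) * exp (- (max 0 t * \<alpha> + max 0 u * \<beta>))) = (\<lambda>(\<tau>, t, u). w \<tau> * (?f \<alpha> \<tau> t * ?f \<beta> \<tau> u))"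
    by (simp only: fun_eq_iff split_paired_all case_prod_conv) simp
  then show ?thesis
    using integral_triple[OF meas_damped meas_damped integrable_laplace[OF f supp \<alpha>\<beta>(1)] integrable_laplace[OF f supp \<alpha>\<beta>(2)] w int_damped]
    by (simp add: laplace_def)
qed

lemma symbol_laplace_product:
  fixes f :: "real \<Rightarrow> real \<Rightarrow> real" and I J :: "'a::euclidean_space set"
  assumes I: "I \<subseteq> Basis" and J: "J \<subseteq> Basis"
    and meas: "case_prod f \<in> borel_measurable (borel \<Otimes>\<^sub>M borel)" and f: "\<And>\<tau>. integrable lborel (f \<tau>)"
    and supp: "\<And>\<tau> t. t \<le> 0 \<Longrightarrow> f \<tau> t = 0" and w: "w \<in> borel_measurable borel"
    and int: "integrable lborel (\<lambda>\<tau>. \<bar>w \<tau>\<bar> * ((LINT t|lborel. \<bar>f \<tau> t\<bar>) * (LINT t|lborel. \<bar>f \<tau> t\<bar>)))"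
  shows "symbol (\<lambda>\<xi>::'a. LINT \<tau>|lborel. w \<tau> * (laplace (f \<tau>) (\<Sum>b\<in>I. (\<xi> \<bullet> b)\<^sup>2) * laplace (f \<tau>) (\<Sum>b\<in>J. (\<xi> \<bullet> b)\<^sup>2)))"
proof -
  let ?k = "\<lambda>(\<tau>, t, u). w \<tau> * (f \<tau> t * f \<tau> u)"
  let ?t = "\<lambda>b (x :: real \<times> real \<times> real). indicator I b * max 0 (fst (snd x)) + indicator J b * max 0 (snd (snd x))"
  have "symbol (\<lambda>\<xi>::'a. LINT x|lborel. ?k x * exp (- diag_form (\<lambda>b. ?t b x) \<xi>))"
  proof (rule symbol_gauss_mixture[OF sigma_finite_lborel integrable_triple[OF meas meas f f w int]])
    show "?t b \<in> borel_measurable lborel" for b unfolding lborel_prod[symmetric] by measurable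
  qed simp
  also have "(\<lambda>\<xi>::'a. LINT x|lborel. ?k x * exp (- diag_form (\<lambda>b. ?t b x) \<xi>))
    = (\<lambda>\<xi>. LINT \<tau>|lborel. w \<tau> * (laplace (f \<tau>) (\<Sum>b\<in>I. (\<xi> \<bullet> b)\<^sup>2) * laplace (f \<tau>) (\<Sum>b\<in>J. (\<xi> \<bullet> b)\<^sup>2)))"
    unfolding diag_form_add diag_form_scale diag_form_indicator[OF I] diag_form_indicator[OF J]
    by (subst integral_laplace_product[OF meas f supp w int, symmetric])
       (auto simp: case_prod_unfold mult.commute intro!: sum_nonneg)
  finally show ?thesis .
qed

lemma
  assumes s: "s > 0" and A: "A > 0" and r: "r \<ge> 0"
  shows integrable_gamma_shift: "integrable lborel (\<lambda>t. powr_plus (s - 1) (t - r) * exp (- (A * t)))"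
    and integral_gamma_shift: "(LINT t|lborel. powr_plus (s - 1) (t - r) * exp (- (A * t))) = Gamma s * A powr (- s) * exp (- (A * r))"
proof -
  let ?f = "\<lambda>t. powr_plus (s - 1) t * exp (- (A * t))"
  have shift: "powr_plus (s - 1) (t - r) * exp (- (A * t)) = exp (- (A * r)) * ?f (1 *\<^sub>R t + - r)" for t
    by (simp add: exp_add[symmetric] algebra_simps)
  show "integrable lborel (\<lambda>t. powr_plus (s - 1) (t - r) * exp (- (A * t)))"
    unfolding shift using integrable_affine_iff[of 1 ?f "- r"] integrable_gamma[OF s A] by simp
  show "(LINT t|lborel. powr_plus (s - 1) (t - r) * exp (- (A * t))) = Gamma s * A powr (- s) * exp (- (A * r))"
    unfolding shift using integral_affine[of 1 ?f "- r"] integral_gamma[OF s A] by simp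
qed

definition gamma_diff :: "real \<Rightarrow> real \<Rightarrow> real \<Rightarrow> real" where
  "gamma_diff s \<tau> t = (powr_plus (s - 1) t - powr_plus (s - 1) (t - max 0 \<tau>)) * exp (- t)"

lemma gamma_diff_measurable: "case_prod (gamma_diff s) \<in> borel_measurable (borel \<Otimes>\<^sub>M borel)"
  unfolding gamma_diff_def[abs_def] by measurable

lemma gamma_diff_eq_0: "t \<le> 0 \<Longrightarrow> gamma_diff s \<tau> t = 0"
  by (auto simp: gamma_diff_def powr_plus_def)

lemma gamma_diff_mult_exp:
  "gamma_diff s \<tau> t * exp (- (t * a))
    = powr_plus (s - 1) t * exp (- ((1 + a) * t)) - powr_plus (s - 1) (t - max 0 \<tau>) * exp (- ((1 + a) * t))"
proof -
  have "exp (- ((1 + a) * t)) = exp (- t) * exp (- (t * a))" by (simp add: exp_add[symmetric] algebra_simps)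
  then show ?thesis by (simp only: gamma_diff_def left_diff_distrib mult.assoc)
qed

lemma
  assumes s: "s > 0"
  shows integrable_gamma_diff: "integrable lborel (gamma_diff s \<tau>)"
    and laplace_gamma_diff: "a \<ge> 0 \<Longrightarrow> laplace (gamma_diff s \<tau>) a = Gamma s * (1 + a) powr (- s) * (1 - exp (- ((1 + a) * max 0 \<tau>)))"
proof -
  have "gamma_diff s \<tau> = (\<lambda>t. powr_plus (s - 1) t * exp (- (1 * t)) - powr_plus (s - 1) (t - max 0 \<tau>) * exp (- (1 * t)))"
    using gamma_diff_mult_exp[of s \<tau> _ 0] by (simp add: fun_eq_iff)
  then show "integrable lborel (gamma_diff s \<tau>)"
    using integrable_gamma[OF s zero_less_one] integrable_gamma_shift[OF s zero_less_one, of "max 0 \<tau>"] by simp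
  assume "a \<ge> 0"
  then have pos: "1 + a > 0" by simp
  show "laplace (gamma_diff s \<tau>) a = Gamma s * (1 + a) powr (- s) * (1 - exp (- ((1 + a) * max 0 \<tau>)))"
    unfolding laplace_def gamma_diff_mult_exp
    by (simp add: Bochner_Integration.integral_diff integrable_gamma integral_gamma integrable_gamma_shift integral_gamma_shift s pos right_diff_distrib)
qed

lemma abs_gamma_diff_le:
  assumes s: "s < 1"
  shows "\<bar>gamma_diff s \<tau> t\<bar> \<le> - gamma_diff s \<tau> t + 2 * (indicator {0..max 0 \<tau>} t * t powr (s - 1))"
proof -
  consider "t \<le> 0" | "0 < t" "t \<le> max 0 \<tau>" | "max 0 \<tau> < t" by linarith
  then show ?thesis
  proof cases
    case 1
    then show ?thesis by (auto simp: gamma_diff_eq_0)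
  next
    case 2
    have "t powr (s - 1) * exp (- t) \<le> t powr (s - 1) * 1" using 2 by (intro mult_left_mono) auto
    moreover have "powr_plus (s - 1) (t - max 0 \<tau>) = 0" using 2 by (simp add: powr_plus_def)
    ultimately show ?thesis using 2 by (simp add: gamma_diff_def powr_plus_def abs_mult)
  next
    case 3
    then have "t powr (s - 1) \<le> (t - max 0 \<tau>) powr (s - 1)" using s by (intro powr_mono2') auto
    then have "gamma_diff s \<tau> t \<le> 0" using 3 by (simp add: gamma_diff_def powr_plus_def mult_nonpos_nonneg)
    then show ?thesis by simp
  qed
qed

lemma
  assumes s: "0 < s" "s < 1"
  shows L1_gamma_diff_le_powr: "(LINT t|lborel. \<bar>gamma_diff s \<tau> t\<bar>) \<le> 2 * max 0 \<tau> powr s / s"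
    and L1_gamma_diff_le_Gamma: "(LINT t|lborel. \<bar>gamma_diff s \<tau> t\<bar>) \<le> 2 * Gamma s"
proof -
  have Gamma_pos: "Gamma s > 0" by (rule Gamma_real_pos[OF s(1)])
  have int_diff: "integrable lborel (gamma_diff s \<tau>)" by (rule integrable_gamma_diff[OF s(1)])
  have int_powr: "integrable lborel (\<lambda>t. indicator {0..max 0 \<tau>} t * t powr (s - 1))" using s by (intro integrable_powr_from_0) auto
  have integral_diff: "(LINT t|lborel. gamma_diff s \<tau> t) = Gamma s * (1 - exp (- max 0 \<tau>))"
    using laplace_gamma_diff[OF s(1), of 0 \<tau>] by (simp add: laplace_def)
  have "(LINT t|lborel. \<bar>gamma_diff s \<tau> t\<bar>) \<le> (LINT t|lborel. - gamma_diff s \<tau> t + 2 * (indicator {0..max 0 \<tau>} t * t powr (s - 1)))"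
    using int_diff int_powr abs_gamma_diff_le[OF s(2)] by (intro integral_mono) auto
  also have "\<dots> = - (Gamma s * (1 - exp (- max 0 \<tau>))) + 2 * (max 0 \<tau> powr s / s)"
    using int_diff int_powr integral_powr_from_0[of "s - 1" "max 0 \<tau>"] s by (simp add: integral_diff)
  also have "\<dots> \<le> 2 * max 0 \<tau> powr s / s" using Gamma_pos by simp
  finally show "(LINT t|lborel. \<bar>gamma_diff s \<tau> t\<bar>) \<le> 2 * max 0 \<tau> powr s / s" .
  note gamma = integrable_gamma[OF s(1) zero_less_one] integrable_gamma_shift[OF s(1) zero_less_one, of "max 0 \<tau>"]
    integral_gamma[OF s(1) zero_less_one] integral_gamma_shift[OF s(1) zero_less_one, of "max 0 \<tau>"]
  have "(LINT t|lborel. \<bar>gamma_diff s \<tau> t\<bar>) \<le> (LINT t|lborel. powr_plus (s - 1) t * exp (- t) + powr_plus (s - 1) (t - max 0 \<tau>) * exp (- t))"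
    using int_diff gamma by (intro integral_mono) (auto simp: gamma_diff_def left_diff_distrib intro!: order.trans[OF abs_triangle_ineq4])
  also have "\<dots> = Gamma s + Gamma s * exp (- max 0 \<tau>)" using gamma by simp
  also have "\<dots> \<le> 2 * Gamma s" using Gamma_pos by simp
  finally show "(LINT t|lborel. \<bar>gamma_diff s \<tau> t\<bar>) \<le> 2 * Gamma s" .
qed

lemma integrable_L1_gamma_diff_squared:
  assumes s: "0 < s" "s < 1"
  shows "integrable lborel (\<lambda>\<tau>. \<bar>powr_plus (- 1 - s) \<tau>\<bar> * ((LINT t|lborel. \<bar>gamma_diff s \<tau> t\<bar>) * (LINT t|lborel. \<bar>gamma_diff s \<tau> t\<bar>)))"
proof (rule integrable_dominated)
  let ?N = "\<lambda>\<tau>. LINT t|lborel. \<bar>gamma_diff s \<tau> t\<bar>"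
  let ?B = "\<lambda>\<tau>. 4 / s\<^sup>2 * (indicator {0..1} \<tau> * \<tau> powr (s - 1)) + 4 * (Gamma s)\<^sup>2 * (indicator {1..} \<tau> * \<tau> powr (- 1 - s))"
  note [measurable] = measurable_case_prod_compose[OF gamma_diff_measurable]
  show "integrable lborel ?B"
    using s by (intro Bochner_Integration.integrable_add integrable_mult_right integrable_powr_from_0 integrable_powr_to_inf) auto
  show "(\<lambda>\<tau>. \<bar>powr_plus (- 1 - s) \<tau>\<bar> * (?N \<tau> * ?N \<tau>)) \<in> borel_measurable lborel" by measurable
  fix \<tau> :: real
  have nonneg: "0 \<le> ?N \<tau>" by simp
  consider "\<tau> \<le> 0" | "0 < \<tau>" "\<tau> \<le> 1" | "1 < \<tau>" by linarith
  then have "powr_plus (- 1 - s) \<tau> * (?N \<tau>)\<^sup>2 \<le> ?B \<tau>"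
  proof cases
    case 2
    have "(?N \<tau>)\<^sup>2 \<le> (2 * \<tau> powr s / s)\<^sup>2"
      using L1_gamma_diff_le_powr[OF s, of \<tau>] nonneg 2 by (intro power_mono) auto
    also have "\<dots> = 4 / s\<^sup>2 * (\<tau> powr s * \<tau> powr s)" by (simp add: power2_eq_square)
    finally have "\<tau> powr (- 1 - s) * (?N \<tau>)\<^sup>2 \<le> \<tau> powr (- 1 - s) * (4 / s\<^sup>2 * (\<tau> powr s * \<tau> powr s))"
      by (intro mult_left_mono) auto
    also have "\<dots> = 4 / s\<^sup>2 * \<tau> powr (s - 1)" by (simp add: powr_add[symmetric])
    also have "\<dots> \<le> ?B \<tau>" using 2 by simp
    finally show ?thesis using 2 by (simp add: powr_plus_def)
  next
    case 3
    have "(?N \<tau>)\<^sup>2 \<le> (2 * Gamma s)\<^sup>2" using L1_gamma_diff_le_Gamma[OF s, of \<tau>] nonneg by (intro power_mono) auto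
    then have "\<tau> powr (- 1 - s) * (?N \<tau>)\<^sup>2 \<le> \<tau> powr (- 1 - s) * (2 * Gamma s)\<^sup>2" by (intro mult_left_mono) auto
    also have "\<dots> \<le> ?B \<tau>" using 3 by (simp add: power_mult_distrib)
    finally show ?thesis using 3 by (simp add: powr_plus_def)
  qed (simp add: powr_plus_def)
  then show "norm (\<bar>powr_plus (- 1 - s) \<tau>\<bar> * (?N \<tau> * ?N \<tau>)) \<le> ?B \<tau>" by (simp add: abs_mult power2_eq_square)
qed

text \<open>Multiplied by \<open>A\<^sup>-\<^sup>s B\<^sup>-\<^sup>s\<close>, the integrand of \<open>A\<^sup>s + B\<^sup>s - (A + B)\<^sup>s\<close> factors into \<open>A\<^sup>-\<^sup>s (1 - e\<^sup>-\<^sup>\<tau>\<^sup>A)\<close> and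
  \<open>B\<^sup>-\<^sup>s (1 - e\<^sup>-\<^sup>\<tau>\<^sup>B)\<close>, which are Laplace transforms of \<open>L\<^sub>1\<close> functions of norm \<open>O(min \<tau>\<^sup>s 1)\<close>. Subtracting the two marginal
  terms is what makes the representing measure finite.\<close>

lemma integral_levy_laplace_gamma_diff:
  assumes s: "0 < s" "s < 1" and "\<alpha> \<ge> 0" "\<beta> \<ge> 0"
  shows "(LINT \<tau>|lborel. powr_plus (- 1 - s) \<tau> * (laplace (gamma_diff s \<tau>) \<alpha> * laplace (gamma_diff s \<tau>) \<beta>))
    = (Gamma s)\<^sup>2 * frac_powr_const s * ((1 + \<alpha>) powr (- s) * (1 + \<beta>) powr (- s) * ((1 + \<alpha>) powr s + (1 + \<beta>) powr s - ((1 + \<alpha>) + (1 + \<beta>)) powr s))"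
proof -
  let ?A = "1 + \<alpha>" and ?B = "1 + \<beta>"
  let ?c = "(Gamma s)\<^sup>2 * (?A powr (- s) * ?B powr (- s))"
  have pos: "?A > 0" "?B > 0" "?A + ?B > 0" using assms by auto
  have "powr_plus (- 1 - s) \<tau> * (laplace (gamma_diff s \<tau>) \<alpha> * laplace (gamma_diff s \<tau>) \<beta>)
      = ?c * (levy_kernel s ?A \<tau> + levy_kernel s ?B \<tau> - levy_kernel s (?A + ?B) \<tau>)" for \<tau>
  proof (cases "\<tau> > 0")
    case True
    have "exp (- ((?A + ?B) * \<tau>)) = exp (- (?A * \<tau>)) * exp (- (?B * \<tau>))"
      by (simp add: exp_add[symmetric] algebra_simps)
    moreover have "(1 - x) + (1 - y) - (1 - x * y) = (1 - x) * (1 - y)" for x y :: real by algebra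
    ultimately have "levy_kernel s ?A \<tau> + levy_kernel s ?B \<tau> - levy_kernel s (?A + ?B) \<tau>
        = powr_plus (- 1 - s) \<tau> * ((1 - exp (- (?A * \<tau>))) * (1 - exp (- (?B * \<tau>))))"
      by (simp only: levy_kernel_def distrib_left[symmetric] right_diff_distrib[symmetric])
    moreover have "max 0 \<tau> = \<tau>" using True by simp
    ultimately show ?thesis
      using assms by (simp only: laplace_gamma_diff[OF s(1)] power2_eq_square mult_ac)
  qed (simp add: levy_kernel_def powr_plus_def)
  then have "(LINT \<tau>|lborel. powr_plus (- 1 - s) \<tau> * (laplace (gamma_diff s \<tau>) \<alpha> * laplace (gamma_diff s \<tau>) \<beta>))
      = ?c * (LINT \<tau>|lborel. levy_kernel s ?A \<tau> + levy_kernel s ?B \<tau> - levy_kernel s (?A + ?B) \<tau>)"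
    by (simp only: integral_mult_right_zero)
  also have "\<dots> = ?c * (frac_powr_const s * (?A powr s + ?B powr s - (?A + ?B) powr s))"
    by (simp only: Bochner_Integration.integral_diff Bochner_Integration.integral_add Bochner_Integration.integrable_add
          integrable_levy_kernel integral_levy_kernel s pos right_diff_distrib distrib_left)
  finally show ?thesis by (simp only: mult_ac)
qed

lemma symbol_bessel_subset:
  assumes "s \<ge> 0" "I \<subseteq> (Basis :: 'a::euclidean_space set)"
  shows "symbol (\<lambda>\<xi>::'a. (1 + (\<Sum>b\<in>I. (\<xi> \<bullet> b)\<^sup>2)) powr (- s))"
  using symbol_bessel[OF assms(1), of "indicator I"] by (simp add: diag_form_indicator[OF assms(2)])

lemma symbol_tensor_step_frac:
  fixes I J :: "'a::euclidean_space set"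
  assumes s: "0 < s" "s < 1" and I: "I \<subseteq> Basis" and J: "J \<subseteq> Basis"
  defines "A \<equiv> \<lambda>\<xi>. 1 + (\<Sum>b\<in>I. (\<xi> \<bullet> b)\<^sup>2)" and "B \<equiv> \<lambda>\<xi>. 1 + (\<Sum>b\<in>J. (\<xi> \<bullet> b)\<^sup>2)"
  shows "symbol (\<lambda>\<xi>. ((A \<xi> + B \<xi> - 1) / (A \<xi> * B \<xi>)) powr s)"
proof -
  define c where "c = (Gamma s)\<^sup>2 * frac_powr_const s"
  have c: "c > 0" using Gamma_real_pos[OF s(1)] frac_powr_const_pos[OF s] by (simp add: c_def)
  have symbol_A: "symbol (\<lambda>\<xi>. A \<xi> powr (- s))" and symbol_B: "symbol (\<lambda>\<xi>. B \<xi> powr (- s))"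
    using symbol_bessel_subset[OF _ I, of s] symbol_bessel_subset[OF _ J, of s] s by (simp_all add: A_def B_def)
  have "symbol (\<lambda>\<xi>. c * (A \<xi> powr (- s) * B \<xi> powr (- s) * (A \<xi> powr s + B \<xi> powr s - (A \<xi> + B \<xi>) powr s)))"
    using symbol_laplace_product[OF I J gamma_diff_measurable integrable_gamma_diff[OF s(1)] gamma_diff_eq_0 powr_plus_measurable
        integrable_L1_gamma_diff_squared[OF s]]
    by (simp add: integral_levy_laplace_gamma_diff[OF s] A_def B_def c_def sum_nonneg)
  from symbol_cmult[OF this, of "1 / c"]
  have defect: "symbol (\<lambda>\<xi>. A \<xi> powr (- s) * B \<xi> powr (- s) * (A \<xi> powr s + B \<xi> powr s - (A \<xi> + B \<xi>) powr s))"
    using c by simp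
  have increment: "symbol (\<lambda>\<xi>. (A \<xi> + B \<xi>) powr s - (A \<xi> + B \<xi> - 1) powr s)"
    using symbol_powr_diff[where 'a='a, OF s, of 2 1 "\<lambda>b. indicator I b + indicator J b"]
    by (simp add: A_def B_def diag_form_add diag_form_indicator I J algebra_simps)
  have "((A \<xi> + B \<xi> - 1) / (A \<xi> * B \<xi>)) powr s = A \<xi> powr (- s) + B \<xi> powr (- s)
      - A \<xi> powr (- s) * B \<xi> powr (- s) * (A \<xi> powr s + B \<xi> powr s - (A \<xi> + B \<xi>) powr s)
      - A \<xi> powr (- s) * B \<xi> powr (- s) * ((A \<xi> + B \<xi>) powr s - (A \<xi> + B \<xi> - 1) powr s)" for \<xi>
  proof -
    have "A \<xi> > 0" "B \<xi> > 0" by (auto simp: A_def B_def intro!: add_pos_nonneg sum_nonneg)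
    then show ?thesis
      by (simp add: powr_divide powr_mult powr_minus_divide field_simps)
  qed
  then show ?thesis
    using symbol_diff[OF symbol_diff[OF symbol_add[OF symbol_A symbol_B] defect] symbol_mult[OF symbol_mult[OF symbol_A symbol_B] increment]]
    by simp
qed

lemma symbol_tensor_step:
  fixes I J :: "'a::euclidean_space set"
  assumes s: "s \<ge> 0" and I: "I \<subseteq> Basis" and J: "J \<subseteq> Basis"
  defines "A \<equiv> \<lambda>\<xi>. 1 + (\<Sum>b\<in>I. (\<xi> \<bullet> b)\<^sup>2)" and "B \<equiv> \<lambda>\<xi>. 1 + (\<Sum>b\<in>J. (\<xi> \<bullet> b)\<^sup>2)"
  shows "symbol (\<lambda>\<xi>. ((A \<xi> + B \<xi> - 1) / (A \<xi> * B \<xi>)) powr s)"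
proof (rule symbol_powr[OF s])
  have ge_1: "A \<xi> \<ge> 1" "B \<xi> \<ge> 1" for \<xi> by (auto simp: A_def B_def sum_nonneg)
  then show "(A \<xi> + B \<xi> - 1) / (A \<xi> * B \<xi>) > 0" for \<xi>
    by (smt (verit) divide_pos_pos mult_pos_pos)
  have "symbol (\<lambda>\<xi>. (A \<xi> powr (- 1) + B \<xi> powr (- 1)) - A \<xi> powr (- 1) * B \<xi> powr (- 1))"
    unfolding A_def B_def by (intro symbol_diff symbol_add symbol_mult symbol_bessel_subset I J) auto
  moreover have "A \<xi> powr (- 1) + B \<xi> powr (- 1) - A \<xi> powr (- 1) * B \<xi> powr (- 1) = (A \<xi> + B \<xi> - 1) / (A \<xi> * B \<xi>)" for \<xi>
  proof -
    have "A \<xi> > 0" "B \<xi> > 0" using ge_1[of \<xi>] by auto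
    then show ?thesis by (simp add: powr_minus_divide field_simps)
  qed
  ultimately show "symbol (\<lambda>\<xi>. (A \<xi> + B \<xi> - 1) / (A \<xi> * B \<xi>))" by simp
  show "symbol (\<lambda>\<xi>. ((A \<xi> + B \<xi> - 1) / (A \<xi> * B \<xi>)) powr f)" if "0 < f" "f < 1" for f
    unfolding A_def B_def by (rule symbol_tensor_step_frac[OF that I J])
qed

lemma symbol_tensor_subset:
  fixes I :: "'a::euclidean_space set"
  assumes s: "s \<ge> 0" and I: "I \<subseteq> Basis"
  shows "symbol (\<lambda>\<xi>::'a. (1 + (\<Sum>b\<in>I. (\<xi> \<bullet> b)\<^sup>2)) powr s * (\<Prod>b\<in>I. (1 + (\<xi> \<bullet> b)\<^sup>2) powr (- s)))"
  using finite_subset[OF I finite_Basis] I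
proof (induction rule: finite_induct)
  case empty show ?case by (simp add: symbol_const)
next
  case (insert j I)
  let ?A = "\<lambda>\<xi>::'a. 1 + (\<Sum>b\<in>I. (\<xi> \<bullet> b)\<^sup>2)" and ?B = "\<lambda>\<xi>::'a. 1 + (\<xi> \<bullet> j)\<^sup>2"
  have "symbol (\<lambda>\<xi>. (?A \<xi> powr s * (\<Prod>b\<in>I. (1 + (\<xi> \<bullet> b)\<^sup>2) powr (- s))) * ((?A \<xi> + ?B \<xi> - 1) / (?A \<xi> * ?B \<xi>)) powr s)"
    by (rule symbol_mult) (use insert symbol_tensor_step[OF s, of I "{j}"] in auto)
  moreover have "(?A \<xi> powr s * (\<Prod>b\<in>I. (1 + (\<xi> \<bullet> b)\<^sup>2) powr (- s))) * ((?A \<xi> + ?B \<xi> - 1) / (?A \<xi> * ?B \<xi>)) powr s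
      = (1 + (\<Sum>b\<in>insert j I. (\<xi> \<bullet> b)\<^sup>2)) powr s * (\<Prod>b\<in>insert j I. (1 + (\<xi> \<bullet> b)\<^sup>2) powr (- s))" for \<xi>
  proof -
    have "?A \<xi> > 0" by (intro add_pos_nonneg sum_nonneg) auto
    moreover have "?A \<xi> + ?B \<xi> - 1 = 1 + (\<Sum>b\<in>insert j I. (\<xi> \<bullet> b)\<^sup>2)" using insert.hyps by simp
    ultimately show ?thesis
      using insert.hyps by (simp only: powr_divide powr_mult prod.insert powr_minus_divide) (simp add: field_simps)
  qed
  ultimately show ?case by simp
qed

lemma symbol_tensor:
  assumes "s \<ge> 0"
  shows "symbol (\<lambda>\<xi>::'a::euclidean_space. (1 + (norm \<xi>)\<^sup>2) powr s * (\<Prod>b\<in>Basis. (1 + (\<xi> \<bullet> b)\<^sup>2) powr (- s)))"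
  using symbol_tensor_subset[OF assms, where I = Basis and 'a='a] by (simp add: power2_norm_Basis)

section \<open>Bessel potentials\<close>

lemma
  shows weighted_fourier_unit: "weighted_fourier (return borel (0::'a::euclidean_space, 1)) \<xi> = 1"
    and weighted_conv_unit: "g \<in> borel_measurable borel \<Longrightarrow> weighted_conv (return borel (0::'a, 1)) g = g"
proof -
  have [measurable]: "fst \<in> (borel :: ('a \<times> real) measure) \<rightarrow>\<^sub>M borel" "snd \<in> (borel :: ('a \<times> real) measure) \<rightarrow>\<^sub>M borel"
    unfolding borel_prod[symmetric] by measurable

  show "weighted_fourier (return borel (0::'a, 1)) \<xi> = 1"
    unfolding weighted_fourier_def by (subst integral_return) auto
  show "weighted_conv (return borel (0::'a, 1)) g = g" if [measurable]: "g \<in> borel_measurable borel"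
    unfolding weighted_conv_def[abs_def] by (subst integral_return) auto
qed

lemma bessel_weight_pos: "1 + (norm \<xi>)\<^sup>2 > (0::real)"
  by (intro add_pos_nonneg) auto

lemma bessel_weight_powr_add:
  "complex_of_real ((1 + (norm \<xi>)\<^sup>2) powr s) * of_real ((1 + (norm \<xi>)\<^sup>2) powr t) = of_real ((1 + (norm \<xi>)\<^sup>2) powr (s + t))"
  by (simp add: powr_add)

lemma bessel_weight_powr_minus:
  "complex_of_real ((1 + (norm \<xi>)\<^sup>2) powr (- s)) * of_real ((1 + (norm \<xi>)\<^sup>2) powr s) = 1"
  using bessel_weight_pos[of \<xi>] by (simp only: bessel_weight_powr_add) simp

definition bessel_potential :: "real \<Rightarrow> ('a::euclidean_space \<times> real) measure" where
  "bessel_potential \<gamma> = (SOME N. weighted_measure N \<and> (\<forall>\<xi>. weighted_fourier N \<xi> = of_real ((1 + (norm \<xi>)\<^sup>2) powr (- (\<gamma> / 2)))))"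

lemma
  assumes "\<gamma> \<ge> 0"
  shows weighted_measure_bessel_potential: "weighted_measure (bessel_potential \<gamma> :: ('a::euclidean_space \<times> real) measure)"
    and weighted_fourier_bessel_potential: "weighted_fourier (bessel_potential \<gamma>) \<xi> = of_real ((1 + (norm (\<xi>::'a))\<^sup>2) powr (- (\<gamma> / 2)))"
proof -
  obtain N where "weighted_measure N" "\<And>\<xi>::'a. weighted_fourier N \<xi> = of_real ((1 + 1 * (norm \<xi>)\<^sup>2) powr (- (\<gamma> / 2)))"
    by (rule symbolE[OF symbol_bessel_norm[where 'a='a, of "\<gamma> / 2" 1]]) (use assms in auto)
  then have "\<exists>N. weighted_measure N \<and> (\<forall>\<xi>::'a. weighted_fourier N \<xi> = of_real ((1 + (norm \<xi>)\<^sup>2) powr (- (\<gamma> / 2))))" by auto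
  from someI_ex[OF this] show "weighted_measure (bessel_potential \<gamma> :: ('a \<times> real) measure)"
    "weighted_fourier (bessel_potential \<gamma>) \<xi> = of_real ((1 + (norm (\<xi>::'a))\<^sup>2) powr (- (\<gamma> / 2)))"
    unfolding bessel_potential_def by auto
qed

lemma weighted_adj_schwartz:
  assumes N: "weighted_measure N" and \<phi>: "schwartz \<phi>"
  shows "weighted_adj N \<phi> = inv_fourier (\<lambda>\<xi>. weighted_fourier N \<xi> * fourier \<phi> \<xi>)"
proof -
  have "inv_fourier (fourier \<phi>) = \<phi>" using fourier_inversion[OF \<phi>] by (simp add: fun_eq_iff)
  then have "weighted_adj N \<phi> = weighted_adj N (inv_fourier (fourier \<phi>))" by simp
  then show ?thesis using weighted_adj_inv_fourier[OF N integrable_fourier[OF \<phi>]] by (simp add: fun_eq_iff)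
qed

lemma weighted_adj_bessel_op:
  assumes N: "weighted_measure N" and \<phi>: "schwartz \<phi>"
  shows "weighted_adj N (bessel_op \<gamma> \<phi>) = inv_fourier (\<lambda>\<xi>. weighted_fourier N \<xi> * of_real ((1 + (norm \<xi>)\<^sup>2) powr (\<gamma> / 2)) * fourier \<phi> \<xi>)"
  unfolding bessel_op_def using weighted_adj_inv_fourier[OF N integrable_fourier_schwartz[OF \<phi>]] by (simp add: fun_eq_iff mult.assoc)

lemma bounded_integrable_bessel_op:
  fixes \<phi> :: "'a::euclidean_space \<Rightarrow> complex"
  assumes \<phi>: "schwartz \<phi>"
  shows "bounded_integrable (bessel_op \<gamma> \<phi>)"
proof -
  define k where "k = nat \<lceil>\<gamma> / 2\<rceil>"
  have order: "2 * real k - \<gamma> \<ge> 0" using real_nat_ceiling_ge[of "\<gamma> / 2"] by (simp add: k_def)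
  let ?N = "bessel_potential (2 * real k - \<gamma>) :: ('a \<times> real) measure" and ?\<psi> = "(helmholtz ^^ k) \<phi>"
  have N: "weighted_measure ?N" by (rule weighted_measure_bessel_potential[OF order])
  have \<psi>: "schwartz ?\<psi>" by (rule schwartz_helmholtz_funpow[OF \<phi>])
  have "weighted_fourier ?N \<xi> * fourier ?\<psi> \<xi> = of_real ((1 + (norm \<xi>)\<^sup>2) powr (\<gamma> / 2)) * fourier \<phi> \<xi>" for \<xi>
  proof -
    have "(1 + (norm \<xi>)\<^sup>2) ^ k = (1 + (norm \<xi>)\<^sup>2) powr real k" using bessel_weight_pos[of \<xi>] by (simp add: powr_realpow)
    then show ?thesis
      unfolding weighted_fourier_bessel_potential[OF order] fourier_helmholtz_funpow[OF \<phi>]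
      by (simp only: mult.assoc[symmetric] bessel_weight_powr_add) (simp add: diff_divide_distrib)
  qed
  then have "bessel_op \<gamma> \<phi> = weighted_adj ?N ?\<psi>"
    unfolding bessel_op_def weighted_adj_schwartz[OF N \<psi>] by simp
  then show ?thesis using weighted_adj_bounded_integrable[OF N bounded_integrable_schwartz[OF \<psi>]] by simp
qed

lemma bessel_op_translate:
  assumes [measurable]: "\<phi> \<in> borel_measurable borel"
  shows "bessel_op \<gamma> (\<lambda>x. \<phi> (x + c)) x = bessel_op \<gamma> \<phi> (x + c)"
  unfolding bessel_op_def inv_fourier_cis
proof (intro Bochner_Integration.integral_cong refl)
  fix \<xi>
  have "cis (2 * pi * (c \<bullet> \<xi>)) * cis (2 * pi * (x \<bullet> \<xi>)) = cis (2 * pi * ((x + c) \<bullet> \<xi>))"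
    by (simp add: cis_mult inner_add_left algebra_simps)
  then show "of_real ((1 + (norm \<xi>)\<^sup>2) powr (\<gamma> / 2)) * fourier (\<lambda>x. \<phi> (x + c)) \<xi> * cis (2 * pi * (x \<bullet> \<xi>))
      = of_real ((1 + (norm \<xi>)\<^sup>2) powr (\<gamma> / 2)) * fourier \<phi> \<xi> * cis (2 * pi * ((x + c) \<bullet> \<xi>))"
    by (simp add: fourier_translate mult_ac)
qed

lemma bessel_op_symmetric:
  fixes \<phi> \<psi> :: "'a::euclidean_space \<Rightarrow> complex"
  assumes \<phi>: "schwartz \<phi>" and \<psi>: "schwartz \<psi>"
  shows "(LINT x|lborel. \<phi> x * bessel_op \<gamma> \<psi> x) = (LINT x|lborel. bessel_op \<gamma> \<phi> x * \<psi> x)"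
proof -
  let ?w = "\<lambda>\<xi>::'a. complex_of_real ((1 + (norm \<xi>)\<^sup>2) powr (\<gamma> / 2))"
  have pairing: "(LINT x|lborel. \<phi> x * bessel_op \<gamma> \<psi> x) = (LINT \<xi>|lborel. ?w \<xi> * fourier \<psi> \<xi> * fourier \<phi> (- \<xi>))"
    if "schwartz \<phi>" "schwartz \<psi>" for \<phi> \<psi> :: "'a \<Rightarrow> complex"
    unfolding bessel_op_def by (rule fourier_inv_fourier_pairing[OF schwartz_integrable[OF that(1)] integrable_fourier_schwartz[OF that(2)]])
  have [measurable]: "\<phi> \<in> borel_measurable borel" "\<psi> \<in> borel_measurable borel" using \<phi> \<psi> by (auto intro: schwartz_measurable)
  have "(LINT \<xi>|lborel. ?w \<xi> * fourier \<psi> \<xi> * fourier \<phi> (- \<xi>)) = (LINT \<xi>|lborel. ?w \<xi> * fourier \<phi> \<xi> * fourier \<psi> (- \<xi>))"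
    using integral_affine[of "-1" "\<lambda>\<xi>. ?w \<xi> * fourier \<phi> \<xi> * fourier \<psi> (- \<xi>)" 0] by (simp add: mult_ac)
  then show ?thesis unfolding pairing[OF \<phi> \<psi>] mult.commute[of "bessel_op \<gamma> \<phi> _"] pairing[OF \<psi> \<phi>] .
qed

lemma bessel_op_of_real:
  fixes f :: "'a::euclidean_space \<Rightarrow> real"
  assumes [measurable]: "f \<in> borel_measurable borel"
  shows "bessel_op \<gamma> (\<lambda>x. of_real (f x)) x = of_real (Re (bessel_op \<gamma> (\<lambda>x. of_real (f x)) x))"
proof -
  let ?w = "\<lambda>\<xi>::'a. complex_of_real ((1 + (norm \<xi>)\<^sup>2) powr (\<gamma> / 2))" and ?F = "fourier (\<lambda>x. complex_of_real (f x))"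
  have cnj_F: "cnj (?F \<xi>) = ?F (- \<xi>)" for \<xi>
    unfolding fourier_cis Bochner_Integration.integral_cnj[symmetric] by (simp add: cis_cnj del: Bochner_Integration.integral_cnj)
  have "cnj (bessel_op \<gamma> (\<lambda>x. of_real (f x)) x) = (LINT \<xi>|lborel. ?w \<xi> * ?F (- \<xi>) * cis (2 * pi * (x \<bullet> (- \<xi>))))"
    unfolding bessel_op_def inv_fourier_cis Bochner_Integration.integral_cnj[symmetric] by (simp add: cis_cnj cnj_F del: Bochner_Integration.integral_cnj)
  also have "\<dots> = bessel_op \<gamma> (\<lambda>x. of_real (f x)) x"
    unfolding bessel_op_def inv_fourier_cis
    using integral_affine[of "-1" "\<lambda>\<xi>. ?w \<xi> * ?F \<xi> * cis (2 * pi * (x \<bullet> \<xi>))" 0] by simp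
  finally show ?thesis by (simp add: complex_eq_iff)
qed

lemma bessel_rep_Lp: assumes "bessel_rep \<gamma> p f g" shows "Lp_fun p f" "Lp_fun p g"
  using assms by (auto simp: bessel_rep_def)

lemma Lp_fun_bounded_integrable:
  assumes p: "p > 1" and \<psi>: "bounded_integrable \<psi>" shows "Lp_fun p (\<lambda>x. Re (\<psi> x))"
proof -
  have int: "integrable lborel \<psi>" using \<psi> by (simp add: bounded_integrable_def)
  obtain C where C: "\<And>x. norm (\<psi> x) \<le> C" using \<psi> by (auto simp: bounded_integrable_def bounded_iff)
  show ?thesis
  proof (rule Lp_fun_dominated)
    show "(\<lambda>x. Re (\<psi> x)) \<in> borel_measurable borel" using int by auto
    show "integrable lborel (\<lambda>x. C powr (p - 1) * norm (\<psi> x))" using int by simp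
    have "\<bar>Re (\<psi> x)\<bar> powr p \<le> C powr (p - 1) * norm (\<psi> x)" for x
      using order_trans[OF abs_Re_le_cmod C] abs_Re_le_cmod by (rule abs_powr_le_mult[OF p])
    then show "AE x in lborel. \<bar>Re (\<psi> x)\<bar> powr p \<le> C powr (p - 1) * norm (\<psi> x)" by simp
  qed
qed

lemma bessel_rep_schwartz:
  fixes f :: "'a::euclidean_space \<Rightarrow> real"
  assumes p: "p > 1" and f: "schwartz (\<lambda>x. complex_of_real (f x))"
  shows "bessel_rep \<gamma> p f (\<lambda>x. Re (bessel_op \<gamma> (\<lambda>x. of_real (f x)) x))"
  unfolding bessel_rep_def
proof (intro conjI allI impI)
  show "Lp_fun p f" using Lp_fun_bounded_integrable[OF p bounded_integrable_schwartz[OF f]] by simp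
  show "Lp_fun p (\<lambda>x. Re (bessel_op \<gamma> (\<lambda>x. of_real (f x)) x))"
    by (rule Lp_fun_bounded_integrable[OF p bounded_integrable_bessel_op[OF f]])
  have "(\<lambda>x. Re (complex_of_real (f x))) \<in> borel_measurable borel" using schwartz_measurable[OF f] by measurable
  then have "f \<in> borel_measurable borel" by simp
  then have real_valued: "of_real (Re (bessel_op \<gamma> (\<lambda>x. of_real (f x)) x)) = bessel_op \<gamma> (\<lambda>x. of_real (f x)) x" for x
    by (rule bessel_op_of_real[symmetric])
  show "(LINT x|lborel. complex_of_real (f x) * bessel_op \<gamma> \<phi> x) = (LINT x|lborel. complex_of_real (Re (bessel_op \<gamma> (\<lambda>x. of_real (f x)) x)) * \<phi> x)"
    if "schwartz \<phi>" for \<phi>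
    unfolding real_valued by (rule bessel_op_symmetric[OF f that])
qed

lemma bessel_rep_linear:
  assumes p: "p > 1" and f: "bessel_rep \<gamma> p f\<^sub>1 g\<^sub>1" "bessel_rep \<gamma> p f\<^sub>2 g\<^sub>2"
  shows "bessel_rep \<gamma> p (\<lambda>x. c * f\<^sub>1 x + d * f\<^sub>2 x) (\<lambda>x. c * g\<^sub>1 x + d * g\<^sub>2 x)"
  unfolding bessel_rep_def
proof (intro conjI allI impI)
  note Lp = bessel_rep_Lp[OF f(1)] bessel_rep_Lp[OF f(2)]
  show "Lp_fun p (\<lambda>x. c * f\<^sub>1 x + d * f\<^sub>2 x)" "Lp_fun p (\<lambda>x. c * g\<^sub>1 x + d * g\<^sub>2 x)"
    using p by (auto intro!: Lp_fun_add Lp_fun_cmult Lp)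
  fix \<phi> :: "'a \<Rightarrow> complex" assume \<phi>: "schwartz \<phi>"
  show "(LINT x|lborel. complex_of_real (c * f\<^sub>1 x + d * f\<^sub>2 x) * bessel_op \<gamma> \<phi> x) = (LINT x|lborel. complex_of_real (c * g\<^sub>1 x + d * g\<^sub>2 x) * \<phi> x)"
    unfolding integral_Lp_mult_linear[OF Lp(1,3) p bounded_integrable_bessel_op[OF \<phi>]]
      integral_Lp_mult_linear[OF Lp(2,4) p bounded_integrable_schwartz[OF \<phi>]]
    using f \<phi> by (simp add: bessel_rep_def)
qed

lemma bessel_rep_zero: "bessel_rep \<gamma> p (\<lambda>_. 0) (\<lambda>_. 0)"
  by (simp add: bessel_rep_def)

lemma bessel_rep_cong_AE:
  assumes rep: "bessel_rep \<gamma> p f g" and [measurable]: "f' \<in> borel_measurable borel" and eq: "AE x in lborel. f x = f' x"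
  shows "bessel_rep \<gamma> p f' g"
proof -
  have [measurable]: "f \<in> borel_measurable borel" using bessel_rep_Lp[OF rep] by (simp add: Lp_fun_def)
  have "(LINT x|lborel. complex_of_real (f' x) * bessel_op \<gamma> \<phi> x) = (LINT x|lborel. complex_of_real (f x) * bessel_op \<gamma> \<phi> x)" if "schwartz \<phi>" for \<phi>
  proof (rule integral_cong_AE)
    have [measurable]: "bessel_op \<gamma> \<phi> \<in> borel_measurable borel" using bounded_integrable_bessel_op[OF that, of \<gamma>] by (auto simp: bounded_integrable_def)
    show "(\<lambda>x. complex_of_real (f' x) * bessel_op \<gamma> \<phi> x) \<in> borel_measurable lborel" by measurable
    show "(\<lambda>x. complex_of_real (f x) * bessel_op \<gamma> \<phi> x) \<in> borel_measurable lborel" by measurable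
  qed (use eq in \<open>auto elim!: eventually_mono\<close>)
  moreover have "Lp_fun p f'" by (rule Lp_fun_cong_AE[OF bessel_rep_Lp(1)[OF rep] _ eq]) measurable
  ultimately show ?thesis using rep by (simp add: bessel_rep_def)
qed

lemma bessel_rep_weighted_conv:
  assumes p: "p > 1" and N: "weighted_measure N" and M: "weighted_measure M"
    and fourier: "\<And>\<xi>. weighted_fourier N \<xi> * of_real ((1 + (norm \<xi>)\<^sup>2) powr (\<gamma> / 2)) = weighted_fourier M \<xi>" and g: "Lp_fun p g"
  shows "bessel_rep \<gamma> p (weighted_conv N g) (weighted_conv M g)"
  unfolding bessel_rep_def
proof (intro conjI allI impI weighted_conv_Lp p N M g)
  fix \<phi> :: "'a \<Rightarrow> complex" assume \<phi>: "schwartz \<phi>"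
  have adj: "weighted_adj N (bessel_op \<gamma> \<phi>) = weighted_adj M \<phi>"
    unfolding weighted_adj_bessel_op[OF N \<phi>] weighted_adj_schwartz[OF M \<phi>] fourier ..
  show "(LINT x|lborel. complex_of_real (weighted_conv N g x) * bessel_op \<gamma> \<phi> x) = (LINT x|lborel. complex_of_real (weighted_conv M g x) * \<phi> x)"
    unfolding weighted_conv_adjoint[OF g p N bounded_integrable_bessel_op[OF \<phi>]] weighted_conv_adjoint[OF g p M bounded_integrable_schwartz[OF \<phi>]] adj ..
qed

lemma bessel_rep_of_kernel:
  assumes p: "p > 1" and N: "weighted_measure N" and fourier: "\<And>\<xi>. weighted_fourier N \<xi> = of_real ((1 + (norm \<xi>)\<^sup>2) powr (- (\<gamma> / 2)))"
    and g: "Lp_fun p g"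
  shows "bessel_rep \<gamma> p (weighted_conv N g) g"
proof -
  have "bessel_rep \<gamma> p (weighted_conv N g) (weighted_conv (return borel (0, 1)) g)"
    by (rule bessel_rep_weighted_conv[OF p N weighted_measure_return _ g])
       (simp only: fourier weighted_fourier_unit bessel_weight_powr_minus)
  then show ?thesis using g by (simp add: weighted_conv_unit Lp_fun_def)
qed

lemma AE_eq_0_if_gauss_tests:
  fixes F :: "'a::euclidean_space \<Rightarrow> real"
  assumes F: "Lp_fun p F" and p: "p > 1"
    and tests: "\<And>c a. c > 0 \<Longrightarrow> (LINT x|lborel. complex_of_real (F x) * of_real (gauss ((x - a) /\<^sub>R c))) = 0"
  shows "AE x in lborel. F x = 0"
proof (rule AE_eq_0_if_kernels_vanish[OF F p integrable_gauss integral_gauss], rule AE_I2)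
  fix c :: real and a :: 'a assume c: "c > 0"
  have [measurable]: "F \<in> borel_measurable borel" using F by (simp add: Lp_fun_def)
  have "complex_of_real (LINT x|lborel. F x * gauss ((x - a) /\<^sub>R c)) = 0"
    using tests[OF c, of a] by (simp only: of_real_mult[symmetric] integral_complex_of_real)
  moreover have "(LINT z|lborel. F (c *\<^sub>R z + a) * gauss ((c *\<^sub>R z + a - a) /\<^sub>R c)) = (1 / \<bar>c\<bar> ^ DIM('a)) *\<^sub>R (LINT x|lborel. F x * gauss ((x - a) /\<^sub>R c))"
    using c by (intro integral_affine) auto
  ultimately show "(LINT z|lborel. gauss z * F (a + c *\<^sub>R z)) = 0"
    using c by (simp add: add.commute mult.commute)
qed

lemma AE_eq_if_gauss_tests:
  fixes f g :: "'a::euclidean_space \<Rightarrow> real"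
  assumes f: "Lp_fun p f" and g: "Lp_fun p g" and p: "p > 1"
    and tests: "\<And>c a. c > 0 \<Longrightarrow> (LINT x|lborel. complex_of_real (f x) * of_real (gauss ((x - a) /\<^sub>R c)))
      = (LINT x|lborel. complex_of_real (g x) * of_real (gauss ((x - a) /\<^sub>R c)))"
  shows "AE x in lborel. f x = g x"
proof -
  have "AE x in lborel. 1 * f x + (- 1) * g x = 0"
  proof (rule AE_eq_0_if_gauss_tests[OF _ p])
    show "Lp_fun p (\<lambda>x. 1 * f x + (- 1) * g x)" using p by (intro Lp_fun_add Lp_fun_cmult f g) auto
    show "(LINT x|lborel. complex_of_real (1 * f x + (- 1) * g x) * of_real (gauss ((x - a) /\<^sub>R c))) = 0" if "c > 0" for a c
      unfolding integral_Lp_mult_linear[OF f g p bounded_integrable_schwartz[OF schwartz_gauss_shift[OF that]]]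
      using tests[OF that, of a] by simp
  qed
  then show ?thesis by eventually_elim simp
qed

lemma weighted_conv_comp:
  fixes g :: "'a::euclidean_space \<Rightarrow> real"
  assumes p: "p > 1" and N: "weighted_measure N" and M: "weighted_measure M" and K: "weighted_measure K" and g: "Lp_fun p g"
    and fourier: "\<And>\<xi>. weighted_fourier N \<xi> * weighted_fourier M \<xi> = weighted_fourier K \<xi>"
  shows "AE x in lborel. weighted_conv N (weighted_conv M g) x = weighted_conv K g x"
proof (rule AE_eq_if_gauss_tests[OF _ _ p])
  have conv_M: "Lp_fun p (weighted_conv M g)" by (rule weighted_conv_Lp[OF p M g])
  then show "Lp_fun p (weighted_conv N (weighted_conv M g))" by (rule weighted_conv_Lp[OF p N])
  show "Lp_fun p (weighted_conv K g)" by (rule weighted_conv_Lp[OF p K g])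
  fix c :: real and a :: 'a assume c: "c > 0"
  let ?\<phi> = "\<lambda>x::'a. complex_of_real (gauss ((x - a) /\<^sub>R c))"
  have \<phi>: "schwartz ?\<phi>" by (rule schwartz_gauss_shift[OF c])
  note bounded = bounded_integrable_schwartz[OF \<phi>]
  have "weighted_adj M (weighted_adj N ?\<phi>) = inv_fourier (\<lambda>\<xi>. weighted_fourier M \<xi> * (weighted_fourier N \<xi> * fourier ?\<phi> \<xi>))"
    unfolding weighted_adj_schwartz[OF N \<phi>]
    using weighted_adj_inv_fourier[OF M integrable_weighted_fourier_mult[OF N integrable_fourier[OF \<phi>]]] by (simp add: fun_eq_iff)
  also have "\<dots> = weighted_adj K ?\<phi>" unfolding weighted_adj_schwartz[OF K \<phi>] fourier[symmetric] by (simp add: mult_ac)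
  finally show "(LINT x|lborel. complex_of_real (weighted_conv N (weighted_conv M g) x) * ?\<phi> x) = (LINT x|lborel. complex_of_real (weighted_conv K g x) * ?\<phi> x)"
    by (simp only: weighted_conv_adjoint[OF conv_M p N bounded] weighted_conv_adjoint[OF g p M weighted_adj_bounded_integrable[OF N bounded]]
        weighted_conv_adjoint[OF g p K bounded])
qed

lemma AE_eq_0_if_bessel_op_tests:
  fixes F :: "'a::euclidean_space \<Rightarrow> real"
  assumes F: "Lp_fun p F" and p: "p > 1" and \<gamma>: "\<gamma> \<ge> 0"
    and tests: "\<And>\<phi>. schwartz \<phi> \<Longrightarrow> (LINT x|lborel. complex_of_real (F x) * bessel_op \<gamma> \<phi> x) = 0"
  shows "AE x in lborel. F x = 0"
proof (rule AE_eq_0_if_gauss_tests[OF F p])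
  fix c :: real and a :: 'a assume c: "c > 0"
  let ?N = "bessel_potential \<gamma> :: ('a \<times> real) measure"
  have N: "weighted_measure ?N" by (rule weighted_measure_bessel_potential[OF \<gamma>])
  define \<phi> where "\<phi> = (\<lambda>x::'a. complex_of_real (gauss ((x - a) /\<^sub>R c)))"
  have \<phi>: "schwartz \<phi>" unfolding \<phi>_def by (rule schwartz_gauss_shift[OF c])
  have "weighted_adj ?N (bessel_op \<gamma> \<phi>) = inv_fourier (fourier \<phi>)"
    unfolding weighted_adj_bessel_op[OF N \<phi>] weighted_fourier_bessel_potential[OF \<gamma>] bessel_weight_powr_minus by simp
  then have adj: "weighted_adj ?N (bessel_op \<gamma> \<phi>) = \<phi>" using fourier_inversion[OF \<phi>] by (simp add: fun_eq_iff)
  have translates: "(LINT z|lborel. complex_of_real (F z) * bessel_op \<gamma> \<phi> (z - y)) = 0" for y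
  proof -
    have "schwartz (\<lambda>x. \<phi> (x + - y))"
      using schwartz_gauss_shift[OF c, of "a + y"] by (simp add: \<phi>_def algebra_simps)
    from tests[OF this] show ?thesis using bessel_op_translate[OF schwartz_measurable[OF \<phi>], of \<gamma> "- y"] by simp
  qed
  have "(LINT x|lborel. complex_of_real (F x) * \<phi> x) = 0"
    using weighted_adj_pairing[OF F p N bounded_integrable_bessel_op[OF \<phi>, of \<gamma>]] unfolding adj translates by simp
  then show "(LINT x|lborel. complex_of_real (F x) * of_real (gauss ((x - a) /\<^sub>R c))) = 0" by (simp add: \<phi>_def)
qed

lemma bessel_rep_unique:
  fixes f\<^sub>1 f\<^sub>2 :: "'a::euclidean_space \<Rightarrow> real"
  assumes p: "p > 1" and \<gamma>: "\<gamma> \<ge> 0" and f: "bessel_rep \<gamma> p f\<^sub>1 g" "bessel_rep \<gamma> p f\<^sub>2 g"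
  shows "AE x in lborel. f\<^sub>1 x = f\<^sub>2 x"
proof -
  have "bessel_rep \<gamma> p (\<lambda>x. f\<^sub>1 x - f\<^sub>2 x) (\<lambda>_. 0)" using bessel_rep_linear[OF p f, of 1 "- 1"] by simp
  then have "AE x in lborel. f\<^sub>1 x - f\<^sub>2 x = 0"
    by (intro AE_eq_0_if_bessel_op_tests[OF _ p \<gamma>]) (auto simp: bessel_rep_def)
  then show ?thesis by simp
qed

lemma bessel_rep_iff:
  fixes f g :: "'a::euclidean_space \<Rightarrow> real"
  assumes p: "p > 1" and \<gamma>: "\<gamma> \<ge> 0"
  shows "bessel_rep \<gamma> p f g \<longleftrightarrow> Lp_fun p g \<and> f \<in> borel_measurable borel \<and> (AE x in lborel. f x = weighted_conv (bessel_potential \<gamma>) g x)"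
proof -
  have potential: "bessel_rep \<gamma> p (weighted_conv (bessel_potential \<gamma>) g) g" if "Lp_fun p g"
    by (rule bessel_rep_of_kernel[OF p weighted_measure_bessel_potential[OF \<gamma>] weighted_fourier_bessel_potential[OF \<gamma>] that])
  show ?thesis
  proof
    assume rep: "bessel_rep \<gamma> p f g"
    then show "Lp_fun p g \<and> f \<in> borel_measurable borel \<and> (AE x in lborel. f x = weighted_conv (bessel_potential \<gamma>) g x)"
      using bessel_rep_unique[OF p \<gamma> rep potential] by (auto simp: bessel_rep_def Lp_fun_def)
  next
    assume "Lp_fun p g \<and> f \<in> borel_measurable borel \<and> (AE x in lborel. f x = weighted_conv (bessel_potential \<gamma>) g x)"
    then show "bessel_rep \<gamma> p f g"
      by (intro bessel_rep_cong_AE[OF potential]) (auto elim!: eventually_mono)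
  qed
qed

lemma bessel_rep_translate:
  assumes p: "p > 1" and \<gamma>: "\<gamma> \<ge> 0" and rep: "bessel_rep \<gamma> p f g"
  shows "bessel_rep \<gamma> p (\<lambda>x. f (x + t)) (\<lambda>x. g (x + t))"
proof -
  have g: "Lp_fun p g" and [measurable]: "f \<in> borel_measurable borel"
    and eq: "AE x in lborel. f x = weighted_conv (bessel_potential \<gamma>) g x"
    using rep bessel_rep_iff[OF p \<gamma>] by auto
  have "AE x in lborel. f (1 *\<^sub>R x + t) = weighted_conv (bessel_potential \<gamma>) g (1 *\<^sub>R x + t)"
    by (rule AE_affine[OF _ eq]) simp
  then have "AE x in lborel. f (x + t) = weighted_conv (bessel_potential \<gamma>) (\<lambda>x. g (x + t)) x"
    by (simp add: weighted_conv_def add_ac)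
  then show ?thesis unfolding bessel_rep_iff[OF p \<gamma>] using Lp_fun_translate[OF g] by simp
qed

lemma bessel_rep_nonzero:
  assumes p: "p > 1" and \<gamma>: "\<gamma> \<ge> 0" and rep: "bessel_rep \<gamma> p f g" and f: "\<not> (AE x in lborel. f x = 0)"
  shows "\<not> (AE x in lborel. g x = 0)"
proof
  assume "AE x in lborel. g x = 0"
  then have "AE x in lborel. weighted_conv (bessel_potential \<gamma>) g x = weighted_conv (bessel_potential \<gamma>) (\<lambda>_. 0) x"
    by (intro weighted_conv_cong_AE[OF p weighted_measure_bessel_potential[OF \<gamma>] bessel_rep_Lp(2)[OF rep]]) auto
  moreover have "AE x in lborel. f x = weighted_conv (bessel_potential \<gamma>) g x" using rep bessel_rep_iff[OF p \<gamma>] by auto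
  ultimately have "AE x in lborel. f x = 0" by eventually_elim (simp add: weighted_conv_def)
  then show False using f by simp
qed

text \<open>Density of \<open>S\<close> in the Bessel potential space means that the image of \<open>S\<close> under \<open>(1 - \<Delta>)\<^sup>\<gamma>\<^sup>/\<^sup>2\<close> is dense in \<open>L\<^sub>p\<close>.\<close>

definition bessel_images :: "real \<Rightarrow> real \<Rightarrow> ('a::euclidean_space \<Rightarrow> real) set \<Rightarrow> ('a \<Rightarrow> real) set" where
  "bessel_images \<gamma> p S = {g. \<exists>f\<in>S. bessel_rep \<gamma> p f g}"

lemma bessel_imagesI: "f \<in> S \<Longrightarrow> bessel_rep \<gamma> p f g \<Longrightarrow> g \<in> bessel_images \<gamma> p S"
  by (auto simp: bessel_images_def)

lemma bessel_imagesE: assumes "g \<in> bessel_images \<gamma> p S" obtains f where "f \<in> S" "bessel_rep \<gamma> p f g"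
  using assms by (auto simp: bessel_images_def)

lemma Lp_subspace_bessel_images:
  assumes p: "p > 1" and S: "function_subspace S" shows "Lp_subspace p (bessel_images \<gamma> p S)"
  unfolding Lp_subspace_def function_subspace_def
proof (intro conjI ballI allI)
  show "(\<lambda>_. 0) \<in> bessel_images \<gamma> p S" by (rule bessel_imagesI[OF function_subspace_zero[OF S] bessel_rep_zero])
  show "(\<lambda>x. g x + h x) \<in> bessel_images \<gamma> p S" if gh: "g \<in> bessel_images \<gamma> p S" "h \<in> bessel_images \<gamma> p S" for g h
  proof -
    obtain f\<^sub>1 f\<^sub>2 where f: "f\<^sub>1 \<in> S" "bessel_rep \<gamma> p f\<^sub>1 g" "f\<^sub>2 \<in> S" "bessel_rep \<gamma> p f\<^sub>2 h"
      using gh unfolding bessel_images_def by blast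
    show ?thesis using bessel_rep_linear[OF p f(2,4), of 1 1] by (intro bessel_imagesI[OF function_subspace_add[OF S f(1,3)]]) simp
  qed
  show "(\<lambda>x. c * g x) \<in> bessel_images \<gamma> p S" if g: "g \<in> bessel_images \<gamma> p S" for g c
  proof -
    obtain f where f: "f \<in> S" "bessel_rep \<gamma> p f g" using g by (rule bessel_imagesE)
    show ?thesis using bessel_rep_linear[OF p f(2,2), of c 0] by (intro bessel_imagesI[OF function_subspace_cmult[OF S f(1)]]) simp
  qed
  show "Lp_fun p g" if "g \<in> bessel_images \<gamma> p S" for g using that by (auto simp: bessel_images_def bessel_rep_def)
qed

lemma translation_invariant_bessel_images:
  assumes "p > 1" "\<gamma> \<ge> 0" "translation_invariant S" shows "translation_invariant (bessel_images \<gamma> p S)"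
  using assms(3) bessel_rep_translate[OF assms(1,2)] unfolding translation_invariant_def bessel_images_def by blast

lemma dilated_bessel_potential:
  fixes l :: real
  assumes \<gamma>: "\<gamma> \<ge> 0" and l: "l \<noteq> 0"
  obtains N :: "('a::euclidean_space \<times> real) measure" where "weighted_measure N"
    "\<And>\<xi>. weighted_fourier N \<xi> = of_real ((1 + 1 / l\<^sup>2 * (norm \<xi>)\<^sup>2) powr (- (\<gamma> / 2)))"
    "\<And>g x b. g \<in> borel_measurable borel \<Longrightarrow> weighted_conv N (\<lambda>x. g (l *\<^sub>R x + b)) x = weighted_conv (bessel_potential \<gamma>) g (l *\<^sub>R x + b)"
proof -
  let ?\<kappa> = "bessel_potential \<gamma> :: ('a \<times> real) measure"
  have \<kappa>: "weighted_measure ?\<kappa>" by (rule weighted_measure_bessel_potential[OF \<gamma>])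
  have [measurable_cong]: "sets ?\<kappa> = sets (borel \<Otimes>\<^sub>M borel)" by (rule weighted_measure_sets[OF \<kappa>])
  have scaled: "(\<lambda>w. fst w /\<^sub>R l) \<in> borel_measurable ?\<kappa>" by measurable
  obtain N where N: "weighted_measure N"
    and fourier_N: "\<And>\<xi>. weighted_fourier N \<xi> = (\<integral>w. of_real (snd w) * character \<xi> (fst w /\<^sub>R l) \<partial>?\<kappa>)"
    and conv_N: "\<And>g x. g \<in> borel_measurable borel \<Longrightarrow> weighted_conv N g x = (\<integral>w. snd w * g (x + fst w /\<^sub>R l) \<partial>?\<kappa>)"
    by (rule weighted_measure_exists[OF weighted_measure_integrable[OF \<kappa>] scaled]) blast
  show thesis
  proof (rule that[OF N])
    fix \<xi> :: 'a
    have "weighted_fourier N \<xi> = weighted_fourier ?\<kappa> (\<xi> /\<^sub>R l)" unfolding fourier_N by (simp add: weighted_fourier_def)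
    moreover have "(norm (\<xi> /\<^sub>R l))\<^sup>2 = 1 / l\<^sup>2 * (norm \<xi>)\<^sup>2" by (simp add: power_mult_distrib power_divide divide_inverse power_inverse)
    ultimately show "weighted_fourier N \<xi> = of_real ((1 + 1 / l\<^sup>2 * (norm \<xi>)\<^sup>2) powr (- (\<gamma> / 2)))"
      by (simp only: weighted_fourier_bessel_potential[OF \<gamma>])
  next
    fix g :: "'a \<Rightarrow> real" and x b assume [measurable]: "g \<in> borel_measurable borel"
    have scale: "l *\<^sub>R (x + y /\<^sub>R l) + b = l *\<^sub>R x + b + y" for y :: 'a using l by (simp add: scaleR_add_right add_ac)
    have "weighted_conv N (\<lambda>x. g (l *\<^sub>R x + b)) x = (\<integral>w. snd w * g (l *\<^sub>R (x + fst w /\<^sub>R l) + b) \<partial>?\<kappa>)"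
      by (rule conv_N) measurable
    then show "weighted_conv N (\<lambda>x. g (l *\<^sub>R x + b)) x = weighted_conv ?\<kappa> g (l *\<^sub>R x + b)"
      unfolding scale by (simp only: weighted_conv_def)
  qed
qed

lemma bessel_rep_affine:
  fixes f g :: "'a::euclidean_space \<Rightarrow> real"
  assumes p: "p > 1" and \<gamma>: "\<gamma> \<ge> 0" and rep: "bessel_rep \<gamma> p f g" and l: "l \<noteq> 0"
  obtains N M where "weighted_measure M" "bessel_rep \<gamma> p (\<lambda>x. f (l *\<^sub>R x + b)) (weighted_conv N (\<lambda>x. g (l *\<^sub>R x + b)))"
    "AE x in lborel. weighted_conv M (weighted_conv N (\<lambda>x. g (l *\<^sub>R x + b))) x = g (l *\<^sub>R x + b)"
proof -
  define d where "d = 1 / l\<^sup>2"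
  have d: "d > 0" using l by (simp add: d_def)
  have g: "Lp_fun p g" and [measurable]: "f \<in> borel_measurable borel" "g \<in> borel_measurable borel"
    and f_eq: "AE x in lborel. f x = weighted_conv (bessel_potential \<gamma>) g x"
    using rep bessel_rep_iff[OF p \<gamma>] by (auto simp: Lp_fun_def)
  let ?g = "\<lambda>x. g (l *\<^sub>R x + b)"
  have Lp: "Lp_fun p ?g" by (rule Lp_fun_affine[OF l g])
  have order: "\<gamma> / 2 \<ge> 0" using \<gamma> by simp
  obtain \<kappa> where \<kappa>: "weighted_measure \<kappa>" "\<And>\<xi>::'a. weighted_fourier \<kappa> \<xi> = of_real ((1 + d * (norm \<xi>)\<^sup>2) powr (- (\<gamma> / 2)))"
    "\<And>x. weighted_conv \<kappa> ?g x = weighted_conv (bessel_potential \<gamma>) g (l *\<^sub>R x + b)"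
    by (rule dilated_bessel_potential[where 'a='a, OF \<gamma> l]) (simp add: d_def)
  obtain N where N: "weighted_measure N" "\<And>\<xi>::'a. weighted_fourier N \<xi> = of_real (((1 + 1 * (norm \<xi>)\<^sup>2) / (1 + d * (norm \<xi>)\<^sup>2)) powr (\<gamma> / 2))"
    by (rule symbolE[OF symbol_ratio[where 'a='a, OF order zero_less_one d]]) blast
  obtain M where M: "weighted_measure M" "\<And>\<xi>::'a. weighted_fourier M \<xi> = of_real (((1 + d * (norm \<xi>)\<^sup>2) / (1 + 1 * (norm \<xi>)\<^sup>2)) powr (\<gamma> / 2))"
    by (rule symbolE[OF symbol_ratio[where 'a='a, OF order d zero_less_one]]) blast
  have rep_\<kappa>: "bessel_rep \<gamma> p (weighted_conv \<kappa> ?g) (weighted_conv N ?g)"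
    by (rule bessel_rep_weighted_conv[OF p \<kappa>(1) N(1) _ Lp]) (simp add: \<kappa>(2) N(2) powr_divide powr_minus_divide)
  have "AE x in lborel. weighted_conv \<kappa> ?g x = f (l *\<^sub>R x + b)"
    unfolding \<kappa>(3) using AE_affine[OF l f_eq, of b] by eventually_elim simp
  then have affine: "bessel_rep \<gamma> p (\<lambda>x. f (l *\<^sub>R x + b)) (weighted_conv N ?g)"
    by (intro bessel_rep_cong_AE[OF rep_\<kappa>]) measurable
  have "weighted_fourier M \<xi> * weighted_fourier N \<xi> = weighted_fourier (return borel (0, 1)) \<xi>" for \<xi>
  proof -
    have "1 + d * (norm \<xi>)\<^sup>2 > 0" using d by (intro add_pos_nonneg) auto
    then have "(1 + d * (norm \<xi>)\<^sup>2) / (1 + 1 * (norm \<xi>)\<^sup>2) * ((1 + 1 * (norm \<xi>)\<^sup>2) / (1 + d * (norm \<xi>)\<^sup>2)) = 1"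
      using bessel_weight_pos[of \<xi>] by simp
    then show ?thesis by (simp only: M(2) N(2) of_real_mult[symmetric] powr_mult[symmetric] weighted_fourier_unit) simp
  qed
  then have "AE x in lborel. weighted_conv M (weighted_conv N ?g) x = ?g x"
    using weighted_conv_comp[OF p M(1) N(1) weighted_measure_return Lp, of 0 1] by (simp add: weighted_conv_unit)
  with M(1) affine show thesis by (rule that)
qed

lemma affine_in_Lp_closure:
  fixes f g :: "'a::euclidean_space \<Rightarrow> real"
  assumes p: "p > 1" and \<gamma>: "\<gamma> \<ge> 0" and S: "function_subspace S" "translation_invariant S"
    and rep: "bessel_rep \<gamma> p f g" and l: "l \<noteq> 0" and f: "(\<lambda>x. f (l *\<^sub>R x + b)) \<in> S"
  shows "(\<lambda>x. g (l *\<^sub>R x + b)) \<in> Lp_closure p (bessel_images \<gamma> p S)"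
proof -
  let ?g = "\<lambda>x. g (l *\<^sub>R x + b)"
  obtain N M where M: "weighted_measure M" and affine: "bessel_rep \<gamma> p (\<lambda>x. f (l *\<^sub>R x + b)) (weighted_conv N ?g)"
    and inverse: "AE x in lborel. weighted_conv M (weighted_conv N ?g) x = ?g x"
    by (rule bessel_rep_affine[OF p \<gamma> rep l])
  have X: "Lp_subspace p (bessel_images \<gamma> p S)" "translation_invariant (bessel_images \<gamma> p S)"
    by (rule Lp_subspace_bessel_images[OF p S(1)], rule translation_invariant_bessel_images[OF p \<gamma> S(2)])
  have "weighted_conv N ?g \<in> Lp_closure p (bessel_images \<gamma> p S)"
    by (rule subset_Lp_closure[OF bessel_imagesI[OF f affine] bessel_rep_Lp(2)[OF affine]])
  then have "weighted_conv M (weighted_conv N ?g) \<in> Lp_closure p (bessel_images \<gamma> p S)"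
    by (rule weighted_conv_in_Lp_closure[OF X p M])
  then show ?thesis
    by (rule Lp_closure_cong_AE[OF X(1) _ inverse]) (use Lp_fun_affine[OF l bessel_rep_Lp(2)[OF rep]] in \<open>simp add: Lp_fun_def\<close>)
qed

section \<open>Density in dimension one\<close>

definition ray :: "real \<Rightarrow> real \<Rightarrow> real \<Rightarrow> real \<Rightarrow> complex" where
  "ray s y x l = Complex s y + of_real l * Complex 1 x"

lemma Re_ray [simp]: "Re (ray s y x l) = s + l"
  by (simp add: ray_def)

lemma ray_measurable [measurable]: "ray s y x \<in> borel_measurable borel"
  unfolding ray_def[abs_def] by measurable

lemma Complex_1_nonzero: "Complex 1 x \<noteq> 0"
  by (simp add: complex_eq_iff)

lemma ray_nonzero: "s > 0 \<Longrightarrow> l \<ge> 0 \<Longrightarrow> ray s y x l \<noteq> 0"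
  using Re_ray[of s y x l] by (metis add_pos_nonneg less_irrefl zero_complex.simps(1))

lemma norm_ray_ge: "s + l \<le> norm (ray s y x l)"
  using complex_Re_le_cmod[of "ray s y x l"] by simp

lemma norm_inverse_ray_square_le:
  assumes s: "s > 0" and l: "l \<ge> 0"
  shows "norm (1 / (ray s y x l)\<^sup>2) \<le> 1 / min 1 (s\<^sup>2) * (1 / (1 + l\<^sup>2))"
proof -
  define m where "m = min 1 (s\<^sup>2)"
  have m: "m > 0" using s by (simp add: m_def)
  have "m * (1 + l\<^sup>2) = m + m * l\<^sup>2" by (simp add: algebra_simps)
  also have "\<dots> \<le> s\<^sup>2 + 1 * l\<^sup>2" by (intro add_mono mult_right_mono) (auto simp: m_def)
  also have "\<dots> \<le> (s + l)\<^sup>2" using l s by (simp add: power2_sum)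
  also have "\<dots> \<le> (norm (ray s y x l))\<^sup>2" using norm_ray_ge l s by (intro power_mono) auto
  finally have "m * (1 + l\<^sup>2) \<le> (norm (ray s y x l))\<^sup>2" .
  moreover have "m * (1 + l\<^sup>2) > 0" using m by (intro mult_pos_pos add_pos_nonneg) auto
  ultimately have "1 / (norm (ray s y x l))\<^sup>2 \<le> 1 / (m * (1 + l\<^sup>2))" by (intro frac_le) auto
  then show ?thesis by (simp add: norm_divide norm_power m_def)
qed

lemma integrable_ray:
  assumes s: "s > 0"
  shows "integrable lborel (\<lambda>l. indicator {0<..} l *\<^sub>R (1 / (ray s y x l)\<^sup>2))"
proof (rule integrable_dominated)
  show "integrable lborel (\<lambda>l::real. 1 / min 1 (s\<^sup>2) * (1 / (1 + l\<^sup>2)))"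
    by (intro integrable_mult_right integrable_inverse_1_plus_square_real)
  fix l :: real
  have "0 \<le> 1 / min 1 (s\<^sup>2) * (1 / (1 + l\<^sup>2))" using s by simp
  then show "norm (indicator {0<..} l *\<^sub>R (1 / (ray s y x l)\<^sup>2)) \<le> 1 / min 1 (s\<^sup>2) * (1 / (1 + l\<^sup>2))"
    using norm_inverse_ray_square_le[OF s, of l y x] by (cases "l > 0") (simp_all add: indicator_def)
qed measurable

lemma inverse_ray_tendsto_0:
  assumes s: "s > 0"
  shows "((\<lambda>l. - (1 / (ray s y x l * Complex 1 x))) \<longlongrightarrow> 0) at_top"
proof (rule Lim_null_comparison)
  have "filterlim (\<lambda>l::real. s + l) at_top at_top" by (rule filterlim_tendsto_add_at_top[OF tendsto_const filterlim_ident])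
  then have "((\<lambda>l::real. 1 / (s + l)) \<longlongrightarrow> 0) at_top" by (rule tendsto_divide_0[OF tendsto_const filterlim_at_top_imp_at_infinity])
  then show "((\<lambda>l::real. 1 / (s + l) * (1 / norm (Complex 1 x))) \<longlongrightarrow> 0) at_top" by (rule tendsto_mult_left_zero)
  show "\<forall>\<^sub>F l in at_top. norm (- (1 / (ray s y x l * Complex 1 x))) \<le> 1 / (s + l) * (1 / norm (Complex 1 x))"
  proof (rule eventually_at_top_linorderI[of 0])
    fix l :: real assume "0 \<le> l"
    then have "1 / norm (ray s y x l) \<le> 1 / (s + l)" using s norm_ray_ge by (intro frac_le) auto
    then have "1 / norm (ray s y x l) * (1 / norm (Complex 1 x)) \<le> 1 / (s + l) * (1 / norm (Complex 1 x))" by (intro mult_right_mono) auto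
    then show "norm (- (1 / (ray s y x l * Complex 1 x))) \<le> 1 / (s + l) * (1 / norm (Complex 1 x))" by (simp add: norm_divide norm_mult)
  qed
qed

lemma integral_ray:
  assumes s: "s > 0"
  shows "(LINT l|lborel. indicator {0<..} l *\<^sub>R (1 / (ray s y x l)\<^sup>2)) = 1 / (Complex s y * Complex 1 x)"
proof -
  let ?F = "\<lambda>l. - (1 / (ray s y x l * Complex 1 x))"
  have "isCont ?F 0" using ray_nonzero[OF s, of 0 y x] Complex_1_nonzero unfolding ray_def by (intro continuous_intros) auto
  then have "(?F \<longlongrightarrow> ?F 0) (at_right 0)" by (simp add: continuous_at_imp_continuous_within isCont_def filterlim_at_split)
  then have lim_0: "((?F \<circ> real_of_ereal) \<longlongrightarrow> ?F 0) (at_right (ereal 0))" by (simp add: ereal_tendsto_simps)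
  have lim_inf: "((?F \<circ> real_of_ereal) \<longlongrightarrow> 0) (at_left \<infinity>)"
    using inverse_ray_tendsto_0[OF s] by (simp add: ereal_tendsto_simps)
  have "(LBINT l=ereal 0..\<infinity>. 1 / (ray s y x l)\<^sup>2) = 0 - ?F 0"
  proof (rule interval_integral_FTC_integrable)
    fix l :: real assume "ereal 0 < ereal l"
    then have nonzero: "ray s y x l \<noteq> 0" using ray_nonzero[OF s, of l] by simp
    have "((\<lambda>w. - (1 / ((Complex s y + w * Complex 1 x) * Complex 1 x))) has_field_derivative 1 / (ray s y x l)\<^sup>2) (at (of_real l))"
      using nonzero Complex_1_nonzero unfolding ray_def by (auto intro!: derivative_eq_intros simp: power2_eq_square divide_simps)
    from has_vector_derivative_real_field[OF this, of UNIV]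
    show "(?F has_vector_derivative 1 / (ray s y x l)\<^sup>2) (at l)" by (simp add: ray_def)
    show "isCont (\<lambda>l. 1 / (ray s y x l)\<^sup>2) l" using nonzero unfolding ray_def by (intro continuous_intros) auto
  next
    show "set_integrable lborel (einterval (ereal 0) \<infinity>) (\<lambda>l. 1 / (ray s y x l)\<^sup>2)"
      using integrable_ray[OF s] by (simp add: set_integrable_def einterval_eq)
  qed (use lim_0 lim_inf in simp_all)
  then show ?thesis
    by (simp add: interval_lebesgue_integral_def set_lebesgue_integral_def einterval_eq ray_def)
qed

text \<open>The kernel whose integral along every line \<open>b = v - l x\<close> of the parameter plane factorises: this is what
  extracts the Poisson kernel from superpositions of the functions \<open>g (l x + b)\<close>.\<close>

definition ray_kernel :: "real \<Rightarrow> real \<Rightarrow> real \<Rightarrow> real" where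
  "ray_kernel s l b = Re (1 / (Complex (\<bar>l\<bar> + s) (- b))\<^sup>2)"

lemma ray_kernel_measurable [measurable]:
  "(\<lambda>x. ray_kernel s (u x) (v x)) \<in> borel_measurable M" if [measurable]: "u \<in> borel_measurable M" "v \<in> borel_measurable M"
  unfolding ray_kernel_def Complex_eq by measurable

lemma abs_ray_kernel_le:
  assumes "s > 0" shows "\<bar>ray_kernel s l b\<bar> \<le> 1 / ((\<bar>l\<bar> + s)\<^sup>2 + b\<^sup>2)"
proof -
  have "\<bar>ray_kernel s l b\<bar> \<le> norm (1 / (Complex (\<bar>l\<bar> + s) (- b))\<^sup>2)" unfolding ray_kernel_def by (rule abs_Re_le_cmod)
  also have "\<dots> = 1 / ((\<bar>l\<bar> + s)\<^sup>2 + b\<^sup>2)" by (simp add: norm_divide norm_power cmod_power2)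
  finally show ?thesis .
qed

lemma inverse_Complex_1_add: "1 / Complex 1 x + 1 / Complex 1 (- x) = of_real (2 / (1 + x\<^sup>2))"
proof -
  have "Complex 1 x * Complex 1 (- x) = of_real (1 + x\<^sup>2)" "Complex 1 x + Complex 1 (- x) = 2"
    by (auto simp: complex_eq_iff power2_eq_square)
  then show ?thesis using Complex_1_nonzero[of x] Complex_1_nonzero[of "- x"] by (simp add: add_frac_eq add.commute)
qed

lemma integral_ray_kernel:
  assumes s: "s > 0"
  shows "(LINT l|lborel. ray_kernel s l (y - l * x)) = 2 / (1 + x\<^sup>2) * (s / (s\<^sup>2 + y\<^sup>2))"
proof -
  let ?f = "\<lambda>x l. indicator {0<..} l *\<^sub>R (1 / (ray s (- y) x l)\<^sup>2)"
  have int: "integrable lborel (?f x)" for x by (rule integrable_ray[OF s])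
  have reflect: "integrable lborel (\<lambda>l. ?f x (- l))" "(LINT l|lborel. ?f x (- l)) = (LINT l|lborel. ?f x l)" for x
    using integrable_affine_iff[of "-1" "?f x" 0] integral_affine[of "-1" "?f x" 0] int by auto
  have "(LINT l|lborel. ray_kernel s l (y - l * x)) = (LINT l|lborel. Re (?f x l + ?f (- x) (- l)))"
  proof (rule integral_cong_AE)
    show "AE l in lborel. ray_kernel s l (y - l * x) = Re (?f x l + ?f (- x) (- l))"
      using AE_lborel_singleton[of 0]
    proof eventually_elim
      case (elim l)
      have "Complex (\<bar>l\<bar> + s) (- (y - l * x)) = (if l > 0 then ray s (- y) x l else ray s (- y) (- x) (- l))"
        by (simp add: ray_def complex_eq_iff)
      then show ?case using elim unfolding ray_kernel_def by (cases "l > 0") auto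
    qed
  qed measurable
  also have "\<dots> = Re (LINT l|lborel. ?f x l + ?f (- x) (- l))"
    using int reflect by (subst integral_Re) auto
  also have "(LINT l|lborel. ?f x l + ?f (- x) (- l)) = 1 / Complex s (- y) * (1 / Complex 1 x + 1 / Complex 1 (- x))"
    using int reflect by (simp add: integral_ray[OF s] distrib_left)
  also have "Re (1 / Complex s (- y) * (1 / Complex 1 x + 1 / Complex 1 (- x))) = 2 / (1 + x\<^sup>2) * (s / (s\<^sup>2 + y\<^sup>2))"
  proof -
    have "Re (z * of_real a) = a * Re z" for z a by simp
    moreover have "Re (1 / Complex s (- y)) = s / (s\<^sup>2 + y\<^sup>2)" by (simp add: Re_divide)
    ultimately show ?thesis by (simp only: inverse_Complex_1_add)
  qed
  finally show ?thesis .
qed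

lemma integral_inverse_1_plus_square: "(LINT x|lborel. 1 / (1 + (x::real)\<^sup>2)) = pi"
  using LBINT_inverse_1_plus_square
  by (simp add: interval_lebesgue_integral_def set_lebesgue_integral_def inverse_eq_divide)

lemma
  fixes A c :: real assumes A: "A > 0"
  shows integrable_inverse_square_add: "integrable lborel (\<lambda>b. 1 / (A\<^sup>2 + (b - c)\<^sup>2))"
    and integral_inverse_square_add: "(LINT b|lborel. 1 / (A\<^sup>2 + (b - c)\<^sup>2)) = pi / A"
proof -
  have "A\<^sup>2 + (b - c)\<^sup>2 = A\<^sup>2 * (1 + ((1 / A) *\<^sub>R b + - (c / A))\<^sup>2)" for b using A by (simp add: field_simps power2_eq_square)
  then have scale: "1 / (A\<^sup>2 + (b - c)\<^sup>2) = 1 / A\<^sup>2 * (1 / (1 + ((1 / A) *\<^sub>R b + - (c / A))\<^sup>2))" for b by simp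
  show "integrable lborel (\<lambda>b. 1 / (A\<^sup>2 + (b - c)\<^sup>2))"
    unfolding scale using integrable_affine_iff[of "1 / A" "\<lambda>u::real. 1 / (1 + u\<^sup>2)" "- (c / A)"] integrable_inverse_1_plus_square_real A
    by (intro integrable_mult_right) simp
  have "(LINT b|lborel. 1 / (1 + ((1 / A) *\<^sub>R b + - (c / A))\<^sup>2)) = (1 / \<bar>1 / A\<bar> ^ DIM(real)) *\<^sub>R pi"
    unfolding integral_inverse_1_plus_square[symmetric] using A by (intro integral_affine) auto
  then show "(LINT b|lborel. 1 / (A\<^sup>2 + (b - c)\<^sup>2)) = pi / A"
    unfolding scale integral_mult_right_zero using A by (simp add: power2_eq_square)
qed

lemma
  assumes s: "s > 0"
  shows integrable_ray_kernel: "integrable lborel (\<lambda>b. ray_kernel s l (b - c))"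
    and L1_ray_kernel_le: "(LINT b|lborel. \<bar>ray_kernel s l (b - c)\<bar>) \<le> pi / (\<bar>l\<bar> + s)"
proof -
  have pos: "\<bar>l\<bar> + s > 0" using s by simp
  have bound: "\<bar>ray_kernel s l (b - c)\<bar> \<le> 1 / ((\<bar>l\<bar> + s)\<^sup>2 + (b - c)\<^sup>2)" for b by (rule abs_ray_kernel_le[OF s])
  show int: "integrable lborel (\<lambda>b. ray_kernel s l (b - c))"
    by (rule integrable_dominated[OF integrable_inverse_square_add[OF pos, of c]]) (use bound in auto)
  show "(LINT b|lborel. \<bar>ray_kernel s l (b - c)\<bar>) \<le> pi / (\<bar>l\<bar> + s)"
    unfolding integral_inverse_square_add[OF pos, of c, symmetric]
    using int bound by (intro integral_mono integrable_inverse_square_add[OF pos]) auto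
qed

lemma integrable_abs_powr_weight:
  assumes q: "0 < q" "q < 1" and s: "s > 0"
  shows "integrable lborel (\<lambda>l::real. 1 / (\<bar>l\<bar> + s) * \<bar>l\<bar> powr (- q))"
proof (rule integrable_dominated)
  let ?u = "\<lambda>l. 1 / s * (indicator {0..1} l * l powr (- q)) + indicator {1..} l * l powr (- 1 - q)"
  have int: "integrable lborel ?u"
    using q by (intro Bochner_Integration.integrable_add integrable_mult_right integrable_powr_from_0 integrable_powr_to_inf) auto
  then have "integrable lborel (\<lambda>l. ?u (- l))" using integrable_affine_iff[of "-1" ?u 0] by simp
  with int show "integrable lborel (\<lambda>l. ?u l + ?u (- l))" by (rule Bochner_Integration.integrable_add)
  have nonneg: "0 \<le> ?u l" for l using s by simp
  have bound: "1 / (l + s) * l powr (- q) \<le> ?u l" if l: "l > 0" for l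
  proof (cases "l \<le> 1")
    case True
    have "1 / (l + s) * l powr (- q) \<le> 1 / s * l powr (- q)" using l s by (intro mult_right_mono frac_le) auto
    also have "\<dots> \<le> ?u l" using True l by simp
    finally show ?thesis .
  next
    case False
    have "1 / (l + s) * l powr (- q) \<le> 1 / l * l powr (- q)" using l s by (intro mult_right_mono frac_le) auto
    also have "\<dots> = l powr (- 1 - q)" using l by (simp add: powr_diff powr_minus_divide)
    also have "\<dots> \<le> ?u l" using False s by simp
    finally show ?thesis .
  qed
  fix l :: real
  have "1 / (\<bar>l\<bar> + s) * \<bar>l\<bar> powr (- q) \<le> ?u l + ?u (- l)"
    using bound[of "\<bar>l\<bar>"] nonneg[of l] nonneg[of "- l"] by (cases "l = 0"; cases "l > 0") auto
  then show "norm (1 / (\<bar>l\<bar> + s) * \<bar>l\<bar> powr (- q)) \<le> ?u l + ?u (- l)" using s by simp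
qed measurable

text \<open>The value at \<open>0\<close> is irrelevant but must be nonzero for \<open>g (ray_slope \<mu> l * x + b)\<close> to be an admissible dilation.\<close>

definition ray_slope :: "real \<Rightarrow> real \<Rightarrow> real" where
  "ray_slope \<mu> l = (if l = 0 then 1 else l * \<mu>)"

lemma ray_slope_measurable [measurable]: "ray_slope \<mu> \<in> borel_measurable borel"
  unfolding ray_slope_def[abs_def] by measurable

lemma ray_slope_nonzero: "\<mu> > 0 \<Longrightarrow> ray_slope \<mu> l \<noteq> 0"
  by (simp add: ray_slope_def)

lemma integrable_ray_kernel_weight:
  assumes p: "p > 1" and s: "s > 0" and \<mu>: "\<mu> > 0"
  shows "integrable (lborel \<Otimes>\<^sub>M lborel) (\<lambda>w. ray_kernel s (fst w) (snd w - c) * \<bar>ray_slope \<mu> (fst w)\<bar> powr (- real DIM(real) / p))"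
proof -
  let ?k = "\<lambda>l. 1 / (\<bar>l\<bar> + s) * \<bar>ray_slope \<mu> l\<bar> powr (- (1 / p))"
  let ?h = "\<lambda>l b. (\<bar>l\<bar> + s) * ray_kernel s l (b - c)"
  have pos: "\<bar>l\<bar> + s > 0" for l using s by simp
  have "integrable lborel (\<lambda>l. \<mu> powr (- (1 / p)) * (1 / (\<bar>l\<bar> + s) * \<bar>l\<bar> powr (- (1 / p))))"
    using p s by (intro integrable_mult_right integrable_abs_powr_weight) auto
  moreover have "AE l in lborel. \<mu> powr (- (1 / p)) * (1 / (\<bar>l\<bar> + s) * \<bar>l\<bar> powr (- (1 / p))) = ?k l"
    using AE_lborel_singleton[of 0] by eventually_elim (use \<mu> in \<open>simp add: ray_slope_def abs_mult powr_mult\<close>)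
  ultimately have k: "integrable lborel ?k"
    by (subst integrable_cong_AE[symmetric]) auto
  have "integrable (lborel \<Otimes>\<^sub>M lborel) (\<lambda>(l, b). of_real (?k l) * ?h l b)"
  proof (rule integrable_weighted_kernel[OF sigma_finite_lborel sigma_finite_lborel _ k])
    show "integrable lborel (?h l)" for l by (intro integrable_mult_right integrable_ray_kernel s)
    have "(LINT b|lborel. norm (?h l b)) = (\<bar>l\<bar> + s) * (LINT b|lborel. \<bar>ray_kernel s l (b - c)\<bar>)" for l
      using pos[of l] by (simp add: abs_mult)
    then show "(LINT b|lborel. norm (?h l b)) \<le> pi" for l
      using L1_ray_kernel_le[OF s, of l c] pos[of l] by (simp add: field_simps)
  qed measurable
  also have "(\<lambda>(l, b). of_real (?k l) * ?h l b) = (\<lambda>w. ray_kernel s (fst w) (snd w - c) * \<bar>ray_slope \<mu> (fst w)\<bar> powr (- real DIM(real) / p))"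
    using pos by (auto simp: fun_eq_iff less_imp_neq[THEN not_sym])
  finally show ?thesis .
qed

definition poisson_integral :: "(real \<Rightarrow> real) \<Rightarrow> real \<Rightarrow> real \<Rightarrow> real" where
  "poisson_integral g s c = (LINT v|lborel. g v * (s / (s\<^sup>2 + (v - c)\<^sup>2)))"

lemma integral_ray_mixture:
  assumes s: "s > 0" and [measurable]: "g \<in> borel_measurable borel"
    and int: "integrable (lborel \<Otimes>\<^sub>M lborel) (\<lambda>w. ray_kernel s (fst w) (snd w - c) * g (ray_slope \<mu> (fst w) * x + snd w))"
  shows "(\<integral>w. ray_kernel s (fst w) (snd w - c) * g (ray_slope \<mu> (fst w) * x + snd w) \<partial>(lborel \<Otimes>\<^sub>M lborel))
    = 2 / (1 + (\<mu> * x)\<^sup>2) * poisson_integral g s c"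
proof -
  let ?F = "\<lambda>w. ray_kernel s (fst w) (snd w - c) * g (ray_slope \<mu> (fst w) * x + snd w)"
  let ?t = "\<lambda>l. ray_slope \<mu> l * x"
  let ?G = "\<lambda>(l, v). ray_kernel s l (v - ?t l - c) * g v"
  have shift: "?F (l, b) = ?G (l, b + ?t l)" for l b by (simp add: add.commute)
  have translate: "integrable lborel (\<lambda>b. ?G (l, b + ?t l)) \<longleftrightarrow> integrable lborel (\<lambda>v. ?G (l, v))"
      "(LINT b|lborel. ?G (l, b + ?t l)) = (LINT v|lborel. ?G (l, v))"
      "(LINT b|lborel. norm (?G (l, b + ?t l))) = (LINT v|lborel. norm (?G (l, v)))" for l
    using integrable_affine_iff[of 1 "\<lambda>v. ?G (l, v)" "?t l"] integral_affine[of 1 "\<lambda>v. ?G (l, v)" "?t l"]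
      integral_affine[of 1 "\<lambda>v. norm (?G (l, v))" "?t l"] by auto
  have int_G: "integrable (lborel \<Otimes>\<^sub>M lborel) ?G"
  proof (rule lborel_pair.Fubini_integrable)
    show "integrable lborel (\<lambda>l. LINT v|lborel. norm (?G (l, v)))"
      using lborel_pair.integrable_fst'[OF integrable_norm[OF int]] unfolding shift translate(3) .
    show "AE l in lborel. integrable lborel (\<lambda>v. ?G (l, v))"
      using lborel_pair.AE_integrable_fst'[OF int] unfolding shift translate(1) .
  qed measurable
  have "(\<integral>w. ?F w \<partial>(lborel \<Otimes>\<^sub>M lborel)) = (LINT l|lborel. (LINT b|lborel. ?F (l, b)))"
    using lborel_pair.integral_fst'[OF int] by simp
  also have "\<dots> = (LINT l|lborel. (LINT v|lborel. ?G (l, v)))" unfolding shift translate(2) ..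
  also have "\<dots> = (LINT v|lborel. (LINT l|lborel. ?G (l, v)))"
    using lborel_pair.Fubini_integral[OF int_G] by simp
  also have "\<dots> = (LINT v|lborel. 2 / (1 + (\<mu> * x)\<^sup>2) * (g v * (s / (s\<^sup>2 + (v - c)\<^sup>2))))"
  proof (rule Bochner_Integration.integral_cong[OF refl])
    fix v
    have "(LINT l|lborel. ray_kernel s l (v - ?t l - c)) = (LINT l|lborel. ray_kernel s l ((v - c) - l * (\<mu> * x)))"
    proof (rule integral_cong_AE)
      show "AE l in lborel. ray_kernel s l (v - ?t l - c) = ray_kernel s l ((v - c) - l * (\<mu> * x))"
        using AE_lborel_singleton[of 0] by eventually_elim (simp add: ray_slope_def algebra_simps)
    qed measurable
    then show "(LINT l|lborel. ?G (l, v)) = 2 / (1 + (\<mu> * x)\<^sup>2) * (g v * (s / (s\<^sup>2 + (v - c)\<^sup>2)))"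
      by (simp add: integral_ray_kernel[OF s])
  qed
  finally show ?thesis unfolding integral_mult_right_zero poisson_integral_def .
qed

definition ridge :: "(real \<Rightarrow> real) \<Rightarrow> (real \<times> real \<times> real) list \<Rightarrow> real \<Rightarrow> real" where
  "ridge \<sigma> ts x = (\<Sum>(a, l, b)\<leftarrow>ts. a * \<sigma> (l * x + b))"

definition ridge_class :: "(real \<Rightarrow> real) \<Rightarrow> (real \<Rightarrow> real) set" where
  "ridge_class \<sigma> = {ridge \<sigma> ts | ts. \<forall>(a, l, b)\<in>set ts. l \<noteq> 0}"

lemma ridge_classI: "(\<And>a l b. (a, l, b) \<in> set ts \<Longrightarrow> l \<noteq> 0) \<Longrightarrow> (\<And>x. f x = ridge \<sigma> ts x) \<Longrightarrow> f \<in> ridge_class \<sigma>"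
  unfolding ridge_class_def by blast

lemma ridge_append: "ridge \<sigma> (ts @ us) x = ridge \<sigma> ts x + ridge \<sigma> us x"
  by (simp add: ridge_def)

lemma ridge_scale: "ridge \<sigma> (map (\<lambda>(a, l, b). (c * a, l, b)) ts) x = c * ridge \<sigma> ts x"
  by (induction ts) (auto simp: ridge_def algebra_simps)

lemma ridge_shift: "ridge \<sigma> (map (\<lambda>(a, l, b). (a, l, l * t + b)) ts) x = ridge \<sigma> ts (x + t)"
  by (induction ts) (auto simp: ridge_def algebra_simps)

lemma function_subspace_ridge_class: "function_subspace (ridge_class \<sigma>)"
  unfolding function_subspace_def
proof (intro conjI ballI allI)
  show "(\<lambda>_. 0) \<in> ridge_class \<sigma>" by (rule ridge_classI[of "[]"]) (auto simp: ridge_def)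
next
  fix f g assume "f \<in> ridge_class \<sigma>" "g \<in> ridge_class \<sigma>"
  then obtain ts us where "f = ridge \<sigma> ts" "g = ridge \<sigma> us" "\<forall>(a, l, b)\<in>set ts. l \<noteq> 0" "\<forall>(a, l, b)\<in>set us. l \<noteq> 0"
    by (auto simp: ridge_class_def)
  then show "(\<lambda>x. f x + g x) \<in> ridge_class \<sigma>" by (intro ridge_classI[of "ts @ us"]) (auto simp: ridge_append)
next
  fix c f assume "f \<in> ridge_class \<sigma>"
  then obtain ts where "f = ridge \<sigma> ts" "\<forall>(a, l, b)\<in>set ts. l \<noteq> 0" by (auto simp: ridge_class_def)
  then show "(\<lambda>x. c * f x) \<in> ridge_class \<sigma>"
    by (intro ridge_classI[of "map (\<lambda>(a, l, b). (c * a, l, b)) ts"]) (auto simp only: ridge_scale set_map image_iff split: prod.splits)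
qed

lemma translation_invariant_ridge_class: "translation_invariant (ridge_class \<sigma>)"
  unfolding translation_invariant_def
proof (intro ballI allI)
  fix f t assume "f \<in> ridge_class \<sigma>"
  then obtain ts where "f = ridge \<sigma> ts" "\<forall>(a, l, b)\<in>set ts. l \<noteq> 0" by (auto simp: ridge_class_def)
  then show "(\<lambda>x. f (x + t)) \<in> ridge_class \<sigma>"
    by (intro ridge_classI[of "map (\<lambda>(a, l, b). (a, l, l * t + b)) ts"]) (auto simp: ridge_shift)
qed

lemma affine_in_ridge_class: "l \<noteq> 0 \<Longrightarrow> (\<lambda>x. \<sigma> (l * x + b)) \<in> ridge_class \<sigma>"
  by (rule ridge_classI[of "[(1, l, b)]"]) (auto simp: ridge_def)

lemma poisson_in_Lp_closure:
  assumes p: "p > 1" and \<gamma>: "\<gamma> \<ge> 0" and rep: "bessel_rep \<gamma> p \<sigma> g" and s: "s > 0" and \<mu>: "\<mu> > 0"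
  shows "(\<lambda>x. 2 / (1 + (\<mu> * x)\<^sup>2) * poisson_integral g s c) \<in> Lp_closure p (bessel_images \<gamma> p (ridge_class \<sigma>))"
proof -
  let ?M = "lborel \<Otimes>\<^sub>M lborel :: (real \<times> real) measure"
  let ?k = "\<lambda>w. ray_kernel s (fst w) (snd w - c)" and ?L = "\<lambda>w. ray_slope \<mu> (fst w)"
  have g: "Lp_fun p g" using rep by (rule bessel_rep_Lp)
  have [measurable]: "g \<in> borel_measurable borel" using g by (simp add: Lp_fun_def)
  have X: "Lp_subspace p (bessel_images \<gamma> p (ridge_class \<sigma>))"
    by (rule Lp_subspace_bessel_images[OF p function_subspace_ridge_class])
  have sigma_finite: "sigma_finite_measure ?M" by (simp add: lborel_prod sigma_finite_lborel)
  have meas: "?L \<in> borel_measurable ?M" "snd \<in> borel_measurable ?M" by measurable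
  note weight = integrable_ray_kernel_weight[OF p s \<mu>, of c]
  have "(\<lambda>x. \<integral>w. ?k w * g (?L w *\<^sub>R x + snd w) \<partial>?M) \<in> Lp_closure p (bessel_images \<gamma> p (ridge_class \<sigma>))"
  proof (rule affine_mixture_in_Lp_closure[OF p X g sigma_finite meas _ _ weight])
    show "?L w \<noteq> 0" for w by (rule ray_slope_nonzero[OF \<mu>])
    show "(\<lambda>x. g (?L w *\<^sub>R x + snd w)) \<in> Lp_closure p (bessel_images \<gamma> p (ridge_class \<sigma>))" for w
      by (rule affine_in_Lp_closure[OF p \<gamma> function_subspace_ridge_class translation_invariant_ridge_class rep ray_slope_nonzero[OF \<mu>]])
         (simp add: affine_in_ridge_class ray_slope_nonzero[OF \<mu>])
  qed
  moreover have "AE x in lborel. integrable ?M (\<lambda>w. ?k w * g (?L w *\<^sub>R x + snd w))"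
    by (rule AE_integrable_affine_mixture[OF p g sigma_finite meas ray_slope_nonzero[OF \<mu>] weight])
  then have "AE x in lborel. (\<integral>w. ?k w * g (?L w *\<^sub>R x + snd w) \<partial>?M) = 2 / (1 + (\<mu> * x)\<^sup>2) * poisson_integral g s c"
    by eventually_elim (use integral_ray_mixture[OF s, of g c \<mu>] in simp)
  ultimately show ?thesis by (rule Lp_closure_cong_AE[OF X]) measurable
qed

definition cauchy_kernel :: "real \<Rightarrow> real" where
  "cauchy_kernel z = 1 / pi * (1 / (1 + z\<^sup>2))"

lemma
  shows integrable_cauchy_kernel: "integrable lborel cauchy_kernel"
    and integral_cauchy_kernel: "(LINT z|lborel. cauchy_kernel z) = 1"
    and cauchy_kernel_minus: "cauchy_kernel (- z) = cauchy_kernel z"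
  unfolding cauchy_kernel_def[abs_def] integral_mult_right_zero integral_inverse_1_plus_square
  by (intro integrable_mult_right integrable_inverse_1_plus_square_real, simp_all)

lemma poisson_integral_nonzero:
  assumes g: "Lp_fun p g" and p: "p > 1" and nonzero: "\<not> (AE x in lborel. g x = 0)"
  obtains s c where "s > 0" "poisson_integral g s c \<noteq> 0"
proof (rule ccontr)
  assume "\<not> thesis"
  then have zero: "poisson_integral g s c = 0" if "s > 0" for s c using that \<open>\<And>s c. s > 0 \<Longrightarrow> poisson_integral g s c \<noteq> 0 \<Longrightarrow> thesis\<close> by blast
  have [measurable]: "g \<in> borel_measurable borel" using g by (simp add: Lp_fun_def)
  have "AE x in lborel. g x = 0"
  proof (rule AE_eq_0_if_kernels_vanish[OF g p integrable_cauchy_kernel integral_cauchy_kernel], rule AE_I2)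
    fix s x :: real assume s: "s > 0"
    let ?h = "\<lambda>v. g v * (s / (s\<^sup>2 + (v - x)\<^sup>2))"
    have scale: "cauchy_kernel z * g (x + s *\<^sub>R z) = s / pi * ?h (s *\<^sub>R z + x)" for z
    proof -
      have "s\<^sup>2 + (s * z)\<^sup>2 = s * (s * (1 + z\<^sup>2))" by (simp add: power2_eq_square algebra_simps)
      then have "s / (s\<^sup>2 + (s * z)\<^sup>2) = 1 / (s * (1 + z\<^sup>2))" using s by simp
      then show ?thesis using s by (simp add: cauchy_kernel_def add.commute)
    qed
    have "(LINT z|lborel. ?h (s *\<^sub>R z + x)) = (1 / \<bar>s\<bar> ^ DIM(real)) *\<^sub>R poisson_integral g s x"
      unfolding poisson_integral_def using s by (intro integral_affine) auto
    then show "(LINT z|lborel. cauchy_kernel z * g (x + s *\<^sub>R z)) = 0"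
      unfolding scale integral_mult_right_zero by (simp add: zero[OF s])
  qed
  then show False using nonzero by simp
qed

theorem ridge_class_dense:
  assumes p: "p > 1" and \<gamma>: "\<gamma> \<ge> 0" and rep: "bessel_rep \<gamma> p \<sigma> g\<^sub>0" and nonzero: "\<not> (AE t in lborel. \<sigma> t = 0)"
    and g: "Lp_fun p g"
  shows "g \<in> Lp_closure p (bessel_images \<gamma> p (ridge_class \<sigma>))"
proof -
  let ?X = "bessel_images \<gamma> p (ridge_class \<sigma>)"
  have X: "Lp_subspace p ?X" "translation_invariant ?X"
    by (rule Lp_subspace_bessel_images[OF p function_subspace_ridge_class],
        rule translation_invariant_bessel_images[OF p \<gamma> translation_invariant_ridge_class])
  obtain s c where s: "s > 0" and I: "poisson_integral g\<^sub>0 s c \<noteq> 0"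
    using poisson_integral_nonzero[OF bessel_rep_Lp(2)[OF rep] p bessel_rep_nonzero[OF p \<gamma> rep nonzero]] .
  show ?thesis
  proof (rule Lp_closure_if_kernels[OF X p integrable_cauchy_kernel integral_cauchy_kernel cauchy_kernel_minus _ g])
    fix r :: real assume "r > 0"
    then have "(\<lambda>x. 2 / (1 + (1 / r * x)\<^sup>2) * poisson_integral g\<^sub>0 s c) \<in> Lp_closure p ?X"
      by (intro poisson_in_Lp_closure[OF p \<gamma> rep s]) simp
    then have "(\<lambda>x. 1 / (2 * pi * poisson_integral g\<^sub>0 s c) * (2 / (1 + (1 / r * x)\<^sup>2) * poisson_integral g\<^sub>0 s c)) \<in> Lp_closure p ?X"
      by (rule Lp_closure_cmult[OF p X(1)])
    also have "(\<lambda>x. 1 / (2 * pi * poisson_integral g\<^sub>0 s c) * (2 / (1 + (1 / r * x)\<^sup>2) * poisson_integral g\<^sub>0 s c)) = (\<lambda>x. cauchy_kernel (x /\<^sub>R r))"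
    proof
      fix x
      have "x /\<^sub>R r = 1 / r * x" by (simp add: divide_inverse)
      then show "1 / (2 * pi * poisson_integral g\<^sub>0 s c) * (2 / (1 + (1 / r * x)\<^sup>2) * poisson_integral g\<^sub>0 s c) = cauchy_kernel (x /\<^sub>R r)"
        using I by (simp only: cauchy_kernel_def) simp
    qed
    finally show "(\<lambda>x. cauchy_kernel (x /\<^sub>R r)) \<in> Lp_closure p ?X" .
  qed
qed

section \<open>Tensor products\<close>

definition tensor :: "('m::finite \<Rightarrow> real \<Rightarrow> real) \<Rightarrow> real^'m \<Rightarrow> real" where
  "tensor g x = (\<Prod>i\<in>UNIV. g i (x $ i))"

lemma tensor_measurable:
  assumes [measurable]: "\<And>i. g i \<in> borel_measurable borel" shows "tensor g \<in> borel_measurable borel"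
  unfolding tensor_def[abs_def] by measurable

lemma inj_axis_one: "inj (\<lambda>i. axis i (1::real))"
  by (auto simp: inj_def axis_eq_axis)

lemma prod_Basis_vec: "(\<Prod>b\<in>(Basis :: (real^'m) set). h b) = (\<Prod>i\<in>UNIV. h (axis i 1))"
proof -
  have Basis_eq: "(Basis :: (real^'m) set) = range (\<lambda>i. axis i 1)" by (auto simp: Basis_vec_def)
  show ?thesis unfolding Basis_eq by (subst prod.reindex[OF inj_axis_one]) simp
qed

lemma gauss_tensor: "gauss (x::real^'m) = tensor (\<lambda>_. gauss) x"
  unfolding gauss_prod[of x] prod_Basis_vec by (simp add: tensor_def inner_axis)

lemma
  fixes g :: "'m::finite \<Rightarrow> real \<Rightarrow> real"
  assumes g: "\<And>i. integrable lborel (g i)"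
  shows integrable_tensor: "integrable lborel (tensor g)"
    and integral_tensor: "(LINT x|lborel. tensor g x) = (\<Prod>i\<in>UNIV. (LINT t|lborel. g i t))"
proof -
  define h where "h = (\<lambda>b::real^'m. g (inv (\<lambda>i. axis i 1) b))"
  have h_axis: "h (axis i 1) = g i" for i by (simp add: h_def inv_f_f[OF inj_axis_one])
  have int_h: "integrable lborel (h b)" for b unfolding h_def by (rule g)
  have prod_h: "(\<Prod>b\<in>Basis. h b (x \<bullet> b)) = tensor g x" for x
    unfolding prod_Basis_vec by (simp add: h_axis inner_axis tensor_def)
  show "integrable lborel (tensor g)"
    using integrable_prod_Basis[of h] int_h unfolding prod_h by simp
  show "(LINT x|lborel. tensor g x) = (\<Prod>i\<in>UNIV. (LINT t|lborel. g i t))"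
    using integral_prod_Basis[of h] int_h unfolding prod_h unfolding prod_Basis_vec by (simp add: h_axis)
qed

lemma
  fixes g :: "'m::finite \<Rightarrow> real \<Rightarrow> real"
  assumes g: "\<And>i. Lp_fun p (g i)"
  shows Lp_fun_tensor: "Lp_fun p (tensor g)"
    and Lp_pow_tensor: "Lp_pow p (tensor g) = (\<Prod>i\<in>UNIV. Lp_pow p (g i))"
proof -
  have [measurable]: "tensor g \<in> borel_measurable borel" using g by (intro tensor_measurable) (simp add: Lp_fun_def)
  have powr_tensor: "(\<lambda>x. \<bar>tensor g x\<bar> powr p) = tensor (\<lambda>i t. \<bar>g i t\<bar> powr p)"
    by (simp add: fun_eq_iff tensor_def abs_prod prod_powr_distrib)
  have int: "integrable lborel (\<lambda>t. \<bar>g i t\<bar> powr p)" for i using g by (simp add: Lp_fun_def)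
  show "Lp_fun p (tensor g)" unfolding Lp_fun_def powr_tensor using integrable_tensor[OF int] by simp
  show "Lp_pow p (tensor g) = (\<Prod>i\<in>UNIV. Lp_pow p (g i))"
    unfolding Lp_pow_def powr_tensor by (rule integral_tensor[OF int])
qed

lemma AE_coordinate:
  fixes i :: "'m::finite"
  assumes "AE t in lborel. P (t::real)"
  shows "AE x in lborel. P ((x::real^'m) $ i)"
proof -
  from assms obtain N where N: "{t. \<not> P t} \<subseteq> N" "emeasure lborel N = 0" "N \<in> sets lborel" by (auto elim!: AE_E)
  have [measurable]: "N \<in> sets borel" using N(3) by simp
  define g where "g j t = (if j = i then indicator N t * gauss t else gauss t)" for j and t :: real
  have null: "AE t in lborel. g i t = 0"
    using AE_not_in[of N lborel] N by (auto simp: g_def null_sets_def elim!: eventually_mono)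
  have int: "integrable lborel (g j)" for j
    unfolding g_def by (rule integrable_dominated[OF integrable_gauss]) (auto simp: indicator_def less_imp_le[OF gauss_pos])
  have nonneg: "AE x in lborel. 0 \<le> tensor g x"
    by (intro AE_I2) (auto simp: tensor_def g_def less_imp_le[OF gauss_pos] intro!: prod_nonneg mult_nonneg_nonneg)
  have "(LINT x|lborel. tensor g x) = 0"
    unfolding integral_tensor[OF int] using integral_eq_zero_AE[OF null] by (intro prod_zero) auto
  then have "AE x in lborel. tensor g x = 0"
    using integral_nonneg_eq_0_iff_AE[OF integrable_tensor[OF int] nonneg] by simp
  then show ?thesis
  proof eventually_elim
    case (elim x)
    then have "x $ i \<notin> N" by (auto simp: tensor_def g_def gauss_pos less_imp_neq[THEN not_sym] split: if_splits)
    then show ?case using N(1) by auto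
  qed
qed

lemma AE_all_coordinates:
  assumes "\<And>i. AE t in lborel. P i (t::real)"
  shows "AE x in lborel. \<forall>i. P i ((x::real^'m) $ i)"
  using AE_coordinate[OF assms] by (intro AE_finite_allI[of UNIV, simplified]) auto

lemma tensor_split: "tensor g x = g j (x $ j) * (\<Prod>i\<in>UNIV - {j}. g i (x $ i))"
  unfolding tensor_def by (rule prod.remove) auto

lemma axis_weighted_measure:
  fixes j :: "'m::finite" and \<kappa> :: "(real \<times> real) measure"
  assumes \<kappa>: "weighted_measure \<kappa>"
  obtains M :: "((real^'m) \<times> real) measure" where "weighted_measure M"
    "\<And>\<xi>. weighted_fourier M \<xi> = weighted_fourier \<kappa> (\<xi> $ j)"
    "\<And>g x. (\<And>i. g i \<in> borel_measurable borel) \<Longrightarrow> weighted_conv M (tensor g) x = tensor (g(j := weighted_conv \<kappa> (g j))) x"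
proof -
  have [measurable_cong]: "sets \<kappa> = sets (borel \<Otimes>\<^sub>M borel)" by (rule weighted_measure_sets[OF \<kappa>])
  have embedded: "(\<lambda>w. fst w *\<^sub>R axis j 1 :: real^'m) \<in> borel_measurable \<kappa>" by measurable
  obtain M where M: "weighted_measure M"
    and fourier_M: "\<And>\<xi>::real^'m. weighted_fourier M \<xi> = (\<integral>w. of_real (snd w) * character \<xi> (fst w *\<^sub>R axis j 1) \<partial>\<kappa>)"
    and conv_M: "\<And>g x. g \<in> borel_measurable borel \<Longrightarrow> weighted_conv M g x = (\<integral>w. snd w * g (x + fst w *\<^sub>R axis j 1) \<partial>\<kappa>)"
    by (rule weighted_measure_exists[OF weighted_measure_integrable[OF \<kappa>] embedded]) blast
  show thesis
  proof (rule that[OF M])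
    show "weighted_fourier M \<xi> = weighted_fourier \<kappa> (\<xi> $ j)" for \<xi>
      unfolding fourier_M by (simp add: weighted_fourier_def inner_axis')
    fix g :: "'m \<Rightarrow> real \<Rightarrow> real" and x assume g: "\<And>i. g i \<in> borel_measurable borel"
    let ?rest = "\<Prod>i\<in>UNIV - {j}. g i (x $ i)"
    have "tensor g (x + y *\<^sub>R axis j 1) = ?rest * g j (x $ j + y)" for y
      unfolding tensor_split[of g _ j] by (simp add: axis_def mult.commute)
    then have "weighted_conv M (tensor g) x = (\<integral>w. ?rest * (snd w * g j (x $ j + fst w)) \<partial>\<kappa>)"
      unfolding conv_M[OF tensor_measurable[OF g]] by (simp add: mult_ac)
    also have "\<dots> = ?rest * weighted_conv \<kappa> (g j) (x $ j)"
      unfolding weighted_conv_def by (rule integral_mult_right_zero)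
    also have "\<dots> = tensor (g(j := weighted_conv \<kappa> (g j))) x"
      by (simp add: tensor_split[of _ x j] mult.commute)
    finally show "weighted_conv M (tensor g) x = tensor (g(j := weighted_conv \<kappa> (g j))) x" .
  qed
qed

lemma tensor_weighted_conv:
  fixes \<kappa> :: "(real \<times> real) measure" and I :: "'m::finite set"
  assumes p: "p > 1" and \<kappa>: "weighted_measure \<kappa>" and fourier_\<kappa>: "\<And>t. weighted_fourier \<kappa> t = of_real (m t)"
  shows "\<exists>N :: ((real^'m) \<times> real) measure. weighted_measure N \<and> (\<forall>\<xi>. weighted_fourier N \<xi> = of_real (\<Prod>i\<in>I. m (\<xi> $ i)))
    \<and> (\<forall>g. (\<forall>i. Lp_fun p (g i)) \<longrightarrow> (AE x in lborel. tensor (\<lambda>i. if i \<in> I then weighted_conv \<kappa> (g i) else g i) x = weighted_conv N (tensor g) x))"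
  using finite[of I]
proof (induction I rule: finite_induct)
  case empty
  have "tensor g \<in> borel_measurable borel" if "\<forall>i. Lp_fun p (g i)" for g :: "'m \<Rightarrow> real \<Rightarrow> real"
    using that by (intro tensor_measurable) (simp add: Lp_fun_def)
  then show ?case
    by (intro exI[of _ "return borel (0, 1)"]) (auto simp: weighted_measure_return weighted_fourier_unit weighted_conv_unit)
next
  case (insert j I)
  then obtain N :: "((real^'m) \<times> real) measure" where N: "weighted_measure N" "\<And>\<xi>. weighted_fourier N \<xi> = of_real (\<Prod>i\<in>I. m (\<xi> $ i))"
    and conv_N: "\<And>g. \<forall>i. Lp_fun p (g i) \<Longrightarrow> AE x in lborel. tensor (\<lambda>i. if i \<in> I then weighted_conv \<kappa> (g i) else g i) x = weighted_conv N (tensor g) x"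
    by blast
  obtain M :: "((real^'m) \<times> real) measure" where M: "weighted_measure M" "\<And>\<xi>. weighted_fourier M \<xi> = weighted_fourier \<kappa> (\<xi> $ j)"
    and conv_M: "\<And>g x. (\<And>i. g i \<in> borel_measurable borel) \<Longrightarrow> weighted_conv M (tensor g) x = tensor (g(j := weighted_conv \<kappa> (g j))) x"
    using axis_weighted_measure[OF \<kappa>, of j] by blast
  have "symbol (\<lambda>\<xi>::real^'m. m (\<xi> $ j) * (\<Prod>i\<in>I. m (\<xi> $ i)))"
    by (rule symbol_mult) (use M N fourier_\<kappa> in \<open>auto simp: symbol_def\<close>)
  then obtain K where K: "weighted_measure K" "\<And>\<xi>::real^'m. weighted_fourier K \<xi> = of_real (m (\<xi> $ j) * (\<Prod>i\<in>I. m (\<xi> $ i)))"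
    by (rule symbolE) blast
  show ?case
  proof (intro exI[of _ K] conjI allI impI)
    show "weighted_fourier K \<xi> = of_real (\<Prod>i\<in>insert j I. m (\<xi> $ i))" for \<xi>
      unfolding K(2) using insert.hyps by simp
    fix g :: "'m \<Rightarrow> real \<Rightarrow> real" assume g: "\<forall>i. Lp_fun p (g i)"
    define f where "f i = (if i \<in> I then weighted_conv \<kappa> (g i) else g i)" for i
    have f: "Lp_fun p (f i)" for i using g weighted_conv_Lp[OF p \<kappa>] by (auto simp: f_def)
    have Lp_g: "Lp_fun p (tensor g)" using Lp_fun_tensor[of p g] g by simp
    have "f(j := weighted_conv \<kappa> (f j)) = (\<lambda>i. if i \<in> insert j I then weighted_conv \<kappa> (g i) else g i)"
      using insert.hyps by (auto simp: f_def fun_eq_iff)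
    then have step: "weighted_conv M (tensor f) x = tensor (\<lambda>i. if i \<in> insert j I then weighted_conv \<kappa> (g i) else g i) x" for x
      using conv_M[of f] f by (simp add: Lp_fun_def)
    have "AE x in lborel. tensor f x = weighted_conv N (tensor g) x"
      using conv_N[OF g] by (simp add: f_def[abs_def])
    then have "AE x in lborel. weighted_conv M (tensor f) x = weighted_conv M (weighted_conv N (tensor g)) x"
      by (rule weighted_conv_cong_AE[OF p M(1) Lp_fun_tensor[OF f] weighted_conv_Lp[OF p N(1) Lp_g]])
    moreover have "AE x in lborel. weighted_conv M (weighted_conv N (tensor g)) x = weighted_conv K (tensor g) x"
      by (rule weighted_conv_comp[OF p M(1) N(1) K(1) Lp_g]) (simp add: M(2) N(2) K(2) fourier_\<kappa>)
    ultimately show "AE x in lborel. tensor (\<lambda>i. if i \<in> insert j I then weighted_conv \<kappa> (g i) else g i) x = weighted_conv K (tensor g) x"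
      unfolding step by eventually_elim simp
  qed (rule K(1))
qed

definition bessel_pow_le :: "real \<Rightarrow> real \<Rightarrow> ('a::euclidean_space \<Rightarrow> real) \<Rightarrow> real \<Rightarrow> bool" where
  "bessel_pow_le \<gamma> p f C \<longleftrightarrow> (\<exists>g. bessel_rep \<gamma> p f g \<and> Lp_pow p g \<le> C)"

lemma bessel_pow_leI: "bessel_rep \<gamma> p f g \<Longrightarrow> Lp_pow p g \<le> C \<Longrightarrow> bessel_pow_le \<gamma> p f C"
  by (auto simp: bessel_pow_le_def)

lemma bessel_pow_leE: assumes "bessel_pow_le \<gamma> p f C" obtains g where "bessel_rep \<gamma> p f g" "Lp_pow p g \<le> C"
  using assms by (auto simp: bessel_pow_le_def)

lemma bessel_pow_le_mono: "bessel_pow_le \<gamma> p f C \<Longrightarrow> C \<le> D \<Longrightarrow> bessel_pow_le \<gamma> p f D"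
  unfolding bessel_pow_le_def by (meson order_trans)

lemma bessel_pow_le_sum:
  assumes p: "p > 1" and "finite S" and C: "C \<ge> 0" and "\<And>B. B \<in> S \<Longrightarrow> bessel_pow_le \<gamma> p (f B) C"
  shows "bessel_pow_le \<gamma> p (\<lambda>x. \<Sum>B\<in>S. f B x) ((2 * 2 powr p) ^ card S * C)"
  using assms(2,4)
proof (induction rule: finite_induct)
  case empty
  show ?case using bessel_pow_leI[OF bessel_rep_zero] C by simp
next
  case (insert B S)
  let ?K = "(2 * 2 powr p) ^ card S * C"
  obtain g where g: "bessel_rep \<gamma> p (\<lambda>x. \<Sum>B\<in>S. f B x) g" "Lp_pow p g \<le> ?K"
    using insert.IH insert.prems by (blast elim: bessel_pow_leE)
  obtain h where h: "bessel_rep \<gamma> p (f B) h" "Lp_pow p h \<le> C" using insert.prems by (blast elim: bessel_pow_leE)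
  have "1 \<le> 2 powr p" using p by (intro ge_one_powr_ge_zero) auto
  then have "1 \<le> (2 * 2 powr p) ^ card S" by (intro one_le_power) simp
  then have "Lp_pow p h \<le> ?K" using h(2) C mult_right_mono[of 1 "(2 * 2 powr p) ^ card S" C] by simp
  then have sum_le: "2 powr p * (Lp_pow p h + Lp_pow p g) \<le> 2 powr p * (?K + ?K)"
    using g(2) by (intro mult_left_mono add_mono) auto
  have "Lp_pow p (\<lambda>x. h x + g x) \<le> 2 powr p * (Lp_pow p h + Lp_pow p g)"
    using p by (intro Lp_pow_add_le bessel_rep_Lp(2)[OF h(1)] bessel_rep_Lp(2)[OF g(1)]) auto
  also note sum_le
  also have "2 powr p * (?K + ?K) = (2 * 2 powr p) ^ card (insert B S) * C" using insert.hyps by simp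
  finally have "Lp_pow p (\<lambda>x. h x + g x) \<le> (2 * 2 powr p) ^ card (insert B S) * C" .
  moreover have "bessel_rep \<gamma> p (\<lambda>x. \<Sum>B\<in>insert B S. f B x) (\<lambda>x. h x + g x)"
    using bessel_rep_linear[OF p h(1) g(1), of 1 1] insert.hyps by simp
  ultimately show ?case by (intro bessel_pow_leI)
qed

theorem tensor_bessel_pow_le:
  assumes p: "p > 1" and \<gamma>: "\<gamma> \<ge> 0"
  obtains C where "C \<ge> 0" "\<And>f g. (\<And>i::'m::finite. bessel_rep \<gamma> p (f i) (g i)) \<Longrightarrow> bessel_pow_le \<gamma> p (tensor f) (C * (\<Prod>i\<in>UNIV. Lp_pow p (g i)))"
proof -
  let ?\<kappa> = "bessel_potential \<gamma> :: (real \<times> real) measure"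
  have \<kappa>: "weighted_measure ?\<kappa>" "\<And>t. weighted_fourier ?\<kappa> t = of_real ((1 + t\<^sup>2) powr (- (\<gamma> / 2)))"
    using weighted_measure_bessel_potential[OF \<gamma>] weighted_fourier_bessel_potential[OF \<gamma>, where 'a=real] by simp_all
  obtain N :: "((real^'m) \<times> real) measure" where N: "weighted_measure N"
    and fourier_N: "\<And>\<xi>. weighted_fourier N \<xi> = of_real (\<Prod>i\<in>UNIV. (1 + (\<xi> $ i)\<^sup>2) powr (- (\<gamma> / 2)))"
    and conv_N: "\<And>g. \<forall>i. Lp_fun p (g i) \<Longrightarrow> AE x in lborel. tensor (\<lambda>i. weighted_conv ?\<kappa> (g i)) x = weighted_conv N (tensor g) x"
    using tensor_weighted_conv[OF p \<kappa>, of "UNIV :: 'm set"] by auto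
  obtain M where M: "weighted_measure M"
    and fourier_M: "\<And>\<xi>::real^'m. weighted_fourier M \<xi> = of_real ((1 + (norm \<xi>)\<^sup>2) powr (\<gamma> / 2) * (\<Prod>b\<in>Basis. (1 + (\<xi> \<bullet> b)\<^sup>2) powr (- (\<gamma> / 2))))"
    by (rule symbolE[OF symbol_tensor[where 'a="real^'m", of "\<gamma> / 2"]]) (use \<gamma> in auto)
  have fourier: "weighted_fourier N \<xi> * of_real ((1 + (norm \<xi>)\<^sup>2) powr (\<gamma> / 2)) = weighted_fourier M \<xi>" for \<xi>
    unfolding fourier_N fourier_M prod_Basis_vec by (simp add: inner_axis mult.commute)
  show thesis
  proof (rule that)
    show "(\<integral>w. \<bar>snd w\<bar> \<partial>M) powr p \<ge> 0" by simp
    fix f g :: "'m \<Rightarrow> real \<Rightarrow> real" assume "\<And>i. bessel_rep \<gamma> p (f i) (g i)"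
    then have g: "Lp_fun p (g i)" and f: "f i \<in> borel_measurable borel" and f_eq: "AE x in lborel. f i x = weighted_conv ?\<kappa> (g i) x" for i
      using bessel_rep_iff[OF p \<gamma>] by auto
    have "AE x in lborel. tensor (\<lambda>i. weighted_conv ?\<kappa> (g i)) x = weighted_conv N (tensor g) x" using conv_N g by blast
    with AE_all_coordinates[of "\<lambda>i t. f i t = weighted_conv ?\<kappa> (g i) t", OF f_eq] have "AE x in lborel. weighted_conv N (tensor g) x = tensor f x"
      by eventually_elim (simp add: tensor_def)
    then have "bessel_rep \<gamma> p (tensor f) (weighted_conv M (tensor g))"
      by (rule bessel_rep_cong_AE[OF bessel_rep_weighted_conv[OF p N M fourier Lp_fun_tensor[OF g]] tensor_measurable[OF f]])
    moreover have "Lp_pow p (weighted_conv M (tensor g)) \<le> (\<integral>w. \<bar>snd w\<bar> \<partial>M) powr p * (\<Prod>i\<in>UNIV. Lp_pow p (g i))"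
      using weighted_conv_Lp_pow[OF p M Lp_fun_tensor[OF g]] by (simp add: Lp_pow_tensor[OF g])
    ultimately show "bessel_pow_le \<gamma> p (tensor f) ((\<integral>w. \<bar>snd w\<bar> \<partial>M) powr p * (\<Prod>i\<in>UNIV. Lp_pow p (g i)))" by (rule bessel_pow_leI)
  qed
qed

lemma tensor_add: "tensor (\<lambda>i t. h i t + d i t) x = (\<Sum>B\<in>UNIV. tensor (\<lambda>i. if i \<in> B then d i else h i) x)"
proof -
  have "tensor (\<lambda>i t. h i t + d i t) x = (\<Prod>i\<in>UNIV. d i (x $ i) + h i (x $ i))" by (simp add: tensor_def add.commute)
  also have "\<dots> = (\<Sum>B\<in>Pow UNIV. (\<Prod>i\<in>B. d i (x $ i)) * (\<Prod>i\<in>UNIV - B. h i (x $ i)))" by (rule prod_add) simp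
  also have "\<dots> = (\<Sum>B\<in>UNIV. tensor (\<lambda>i. if i \<in> B then d i else h i) x)"
  proof (intro sum.cong)
    fix B :: "'a set"
    have "tensor (\<lambda>i. if i \<in> B then d i else h i) x = (\<Prod>i\<in>UNIV. if i \<in> B then d i (x $ i) else h i (x $ i))"
      unfolding tensor_def by (intro prod.cong) auto
    then show "(\<Prod>i\<in>B. d i (x $ i)) * (\<Prod>i\<in>UNIV - B. h i (x $ i)) = tensor (\<lambda>i. if i \<in> B then d i else h i) x"
      by (simp add: prod.If_cases Compl_eq_Diff_UNIV)
  qed simp
  finally show ?thesis .
qed

lemma tensor_perturbation:
  fixes k :: "real \<Rightarrow> real"
  assumes p: "p > 1" and \<gamma>: "\<gamma> \<ge> 0" and h: "bessel_rep \<gamma> p h k"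
  obtains A where "A \<ge> 0" "\<And>d r \<delta>. bessel_rep \<gamma> p d r \<Longrightarrow> Lp_pow p r \<le> \<delta> \<Longrightarrow> \<delta> \<le> 1 \<Longrightarrow>
    bessel_pow_le \<gamma> p (\<lambda>x::real^'m. tensor (\<lambda>_ t. h t + d t) x - tensor (\<lambda>_. h) x) (A * \<delta>)"
proof -
  obtain C where C: "C \<ge> 0" and tensor_le: "\<And>f g. (\<And>i::'m. bessel_rep \<gamma> p (f i) (g i)) \<Longrightarrow> bessel_pow_le \<gamma> p (tensor f) (C * (\<Prod>i\<in>UNIV. Lp_pow p (g i)))"
    by (rule tensor_bessel_pow_le[OF p \<gamma>]) blast
  define D where "D = max 1 (Lp_pow p k)"
  have D: "D \<ge> 1" "Lp_pow p k \<le> D" by (auto simp: D_def)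
  define S where "S = UNIV - {{} :: 'm set}"
  show thesis
  proof (rule that)
    show "(2 * 2 powr p) ^ card S * (C * D ^ CARD('m)) \<ge> 0" using C D by simp
    fix d r :: "real \<Rightarrow> real" and \<delta> assume d: "bessel_rep \<gamma> p d r" "Lp_pow p r \<le> \<delta>" and "\<delta> \<le> 1"
    let ?f = "\<lambda>B (i::'m). if i \<in> B then d else h" and ?g = "\<lambda>B (i::'m). if i \<in> B then r else k"
    have \<delta>: "0 \<le> \<delta>" using d(2) Lp_pow_nonneg[of p r] by linarith
    have "bessel_pow_le \<gamma> p (tensor (?f B)) (C * D ^ CARD('m) * \<delta>)" if "B \<in> S" for B
    proof (rule bessel_pow_le_mono[OF tensor_le[of "?f B" "?g B"]])
      show "bessel_rep \<gamma> p (?f B i) (?g B i)" for i using d(1) h by simp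
      obtain j where j: "j \<in> B" using \<open>B \<in> S\<close> by (auto simp: S_def)
      have "(\<Prod>i\<in>UNIV. Lp_pow p (?g B i)) = Lp_pow p (?g B j) * (\<Prod>i\<in>UNIV - {j}. Lp_pow p (?g B i))" by (rule prod.remove) auto
      also have "\<dots> \<le> \<delta> * (\<Prod>i\<in>UNIV - {j}. D)"
        using j d(2) D \<delta> \<open>\<delta> \<le> 1\<close> by (intro mult_mono prod_mono prod_nonneg) (auto intro: order_trans)
      also have "\<dots> \<le> \<delta> * D ^ CARD('m)" using D \<delta> by (auto intro!: mult_left_mono power_increasing)
      finally show "C * (\<Prod>i\<in>UNIV. Lp_pow p (?g B i)) \<le> C * D ^ CARD('m) * \<delta>"
        using mult_left_mono[OF _ C] by (fastforce simp: mult_ac)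
    qed
    then have "bessel_pow_le \<gamma> p (\<lambda>x. \<Sum>B\<in>S. tensor (?f B) x) ((2 * 2 powr p) ^ card S * (C * D ^ CARD('m) * \<delta>))"
      using C D \<delta> by (intro bessel_pow_le_sum[OF p]) (auto simp: S_def)
    moreover have "tensor (\<lambda>_ t. h t + d t) x - tensor (\<lambda>_. h) x = (\<Sum>B\<in>S. tensor (?f B) x)" for x :: "real^'m"
      unfolding tensor_add S_def by (subst sum.remove[of UNIV "{}"]) (auto simp: if_distrib)
    ultimately show "bessel_pow_le \<gamma> p (\<lambda>x::real^'m. tensor (\<lambda>_ t. h t + d t) x - tensor (\<lambda>_. h) x) ((2 * 2 powr p) ^ card S * (C * D ^ CARD('m)) * \<delta>)"
      by (simp add: mult.assoc)
  qed
qed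

section \<open>Density in dimension $m$\<close>

lemma nn_classI:
  fixes n :: nat and w :: "'m::finite \<Rightarrow> nat \<Rightarrow> real^'m"
  assumes "n \<ge> 1" "\<And>j. j \<in> {1..n} \<Longrightarrow> invertible (\<chi> i. w i j)"
    "\<And>x. F x = (\<Sum>j=1..n. \<alpha> j * (\<Prod>i\<in>UNIV. \<sigma> (w i j \<bullet> x + b i j)))"
  shows "F \<in> nn_class \<sigma>"
  unfolding nn_class_def mem_Collect_eq using assms by (intro exI[of _ n] exI[of _ \<alpha>] exI[of _ w] exI[of _ b]) auto

lemma nn_classE:
  fixes F :: "real^'m \<Rightarrow> real"
  assumes "F \<in> nn_class \<sigma>"
  obtains n :: nat and \<alpha> :: "nat \<Rightarrow> real" and w :: "'m \<Rightarrow> nat \<Rightarrow> real^'m" and b :: "'m \<Rightarrow> nat \<Rightarrow> real"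
  where "n \<ge> 1" "\<And>j. j \<in> {1..n} \<Longrightarrow> invertible (\<chi> i. w i j)"
    "\<And>x. F x = (\<Sum>j=1..n. \<alpha> j * (\<Prod>i\<in>UNIV. \<sigma> (w i j \<bullet> x + b i j)))"
  using assms unfolding nn_class_def mem_Collect_eq by (elim exE conjE) (rule that, auto)

lemma nn_class_diag:
  fixes l b :: "'m::finite \<Rightarrow> real"
  assumes l: "\<And>i. l i \<noteq> 0"
  shows "(\<lambda>x::real^'m. a * (\<Prod>i\<in>UNIV. \<sigma> (l i * x $ i + b i))) \<in> nn_class \<sigma>"
proof -
  let ?A = "(\<chi> i. l i *\<^sub>R axis i 1) :: real^'m^'m" and ?B = "(\<chi> i. (1 / l i) *\<^sub>R axis i 1) :: real^'m^'m"
  have "?A ** ?B = mat 1" "?B ** ?A = mat 1"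
    using l by (auto simp: matrix_matrix_mult_def mat_def vec_eq_iff axis_def if_distrib[of "\<lambda>x. x * _"] if_distrib[of "\<lambda>x. _ * x"] cong: if_cong)
  then have "invertible ?A" unfolding invertible_def by blast
  then show ?thesis
    by (intro nn_classI[of 1 "\<lambda>i j. l i *\<^sub>R axis i 1" _ "\<lambda>_. a" \<sigma> "\<lambda>i j. b i"]) (simp_all add: inner_axis')
qed

lemma nn_class_add:
  fixes F G :: "real^'m \<Rightarrow> real"
  assumes "F \<in> nn_class \<sigma>" "G \<in> nn_class \<sigma>" shows "(\<lambda>x. F x + G x) \<in> nn_class \<sigma>"
proof -
  obtain n :: nat and \<alpha> and w :: "'m \<Rightarrow> nat \<Rightarrow> real^'m" and b where n: "n \<ge> 1" and w: "\<And>j. j \<in> {1..n} \<Longrightarrow> invertible (\<chi> i. w i j)"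
    and F: "\<And>x. F x = (\<Sum>j=1..n. \<alpha> j * (\<Prod>i\<in>UNIV. \<sigma> (w i j \<bullet> x + b i j)))" by (rule nn_classE[OF assms(1)]) blast
  obtain k :: nat and \<beta> and v :: "'m \<Rightarrow> nat \<Rightarrow> real^'m" and c where v: "\<And>j. j \<in> {1..k} \<Longrightarrow> invertible (\<chi> i. v i j)"
    and G: "\<And>x. G x = (\<Sum>j=1..k. \<beta> j * (\<Prod>i\<in>UNIV. \<sigma> (v i j \<bullet> x + c i j)))" by (rule nn_classE[OF assms(2)]) blast
  let ?\<alpha> = "\<lambda>j. if j \<le> n then \<alpha> j else \<beta> (j - n)"
  let ?w = "\<lambda>i j. if j \<le> n then w i j else v i (j - n)"
  let ?b = "\<lambda>i j. if j \<le> n then b i j else c i (j - n)"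
  let ?t = "\<lambda>x j. ?\<alpha> j * (\<Prod>i\<in>UNIV. \<sigma> (?w i j \<bullet> x + ?b i j))"
  have sum: "F x + G x = (\<Sum>j=1..n + k. ?t x j)" for x
  proof -
    have "(\<Sum>j=1..n + k. ?t x j) = (\<Sum>j=1..n. ?t x j) + (\<Sum>j=n + 1..n + k. ?t x j)"
      using n by (intro sum.ub_add_nat) auto
    also have "(\<Sum>j=1..n. ?t x j) = F x" unfolding F by (intro sum.cong) auto
    also have "(\<Sum>j=n + 1..n + k. ?t x j) = (\<Sum>j=1..k. ?t x (j + n))"
      using sum.shift_bounds_cl_nat_ivl[of "?t x" 1 n k] by (simp add: add.commute)
    also have "\<dots> = G x" unfolding G by (intro sum.cong) auto
    finally show ?thesis ..
  qed
  have "invertible (\<chi> i. ?w i j)" if "j \<in> {1..n + k}" for j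
    using w[of j] v[of "j - n"] that by (cases "j \<le> n") (auto simp: le_diff_conv)
  then show ?thesis using n by (intro nn_classI[OF _ _ sum]) auto
qed

lemma function_subspace_nn_class: "function_subspace (nn_class \<sigma> :: (real^'m \<Rightarrow> real) set)"
  unfolding function_subspace_def
proof (intro conjI ballI allI nn_class_add)
  show "(\<lambda>_. 0) \<in> nn_class \<sigma>" using nn_class_diag[of "\<lambda>_. 1" 0 \<sigma> "\<lambda>_. 0"] by simp
  fix F :: "real^'m \<Rightarrow> real" and c assume "F \<in> nn_class \<sigma>"
  then obtain n :: nat and \<alpha> and w :: "'m \<Rightarrow> nat \<Rightarrow> real^'m" and b where nw: "n \<ge> 1" "\<And>j. j \<in> {1..n} \<Longrightarrow> invertible (\<chi> i. w i j)"
    and F: "\<And>x. F x = (\<Sum>j=1..n. \<alpha> j * (\<Prod>i\<in>UNIV. \<sigma> (w i j \<bullet> x + b i j)))" by (rule nn_classE) blast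
  show "(\<lambda>x. c * F x) \<in> nn_class \<sigma>"
    by (rule nn_classI[OF nw, where \<alpha> = "\<lambda>j. c * \<alpha> j" and b = b]) (simp_all add: F sum_distrib_left mult.assoc)
qed

lemma translation_invariant_nn_class: "translation_invariant (nn_class \<sigma> :: (real^'m \<Rightarrow> real) set)"
  unfolding translation_invariant_def
proof (intro ballI allI)
  fix F :: "real^'m \<Rightarrow> real" and t assume "F \<in> nn_class \<sigma>"
  then obtain n :: nat and \<alpha> and w :: "'m \<Rightarrow> nat \<Rightarrow> real^'m" and b where nw: "n \<ge> 1" "\<And>j. j \<in> {1..n} \<Longrightarrow> invertible (\<chi> i. w i j)"
    and F: "\<And>x. F x = (\<Sum>j=1..n. \<alpha> j * (\<Prod>i\<in>UNIV. \<sigma> (w i j \<bullet> x + b i j)))" by (rule nn_classE) blast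
  show "(\<lambda>x. F (x + t)) \<in> nn_class \<sigma>"
    by (rule nn_classI[OF nw, where \<alpha> = \<alpha> and b = "\<lambda>i j. w i j \<bullet> t + b i j"]) (simp_all add: F inner_add_right add.assoc)
qed

lemma tensor_ridge_in_nn_class:
  assumes "f \<in> ridge_class \<sigma>"
  shows "(tensor (\<lambda>_. f) :: real^'m \<Rightarrow> real) \<in> nn_class \<sigma>"
proof -
  obtain ts where f: "f = ridge \<sigma> ts" and ts: "\<forall>(a, l, b)\<in>set ts. l \<noteq> 0" using assms by (auto simp: ridge_class_def)
  define n where "n = length ts"
  define a l b where components: "a k = fst (ts ! k)" "l k = fst (snd (ts ! k))" "b k = snd (snd (ts ! k))" for k
  have ridge_sum: "f t = (\<Sum>k<n. a k * \<sigma> (l k * t + b k))" for t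
    unfolding f ridge_def by (simp add: sum_list_sum_nth n_def components case_prod_beta atLeast0LessThan)
  have l: "l k \<noteq> 0" if "k < n" for k using ts nth_mem[of k ts] that unfolding components n_def by (auto simp: case_prod_beta)
  have "tensor (\<lambda>_. f) = (\<lambda>x::real^'m. \<Sum>c\<in>PiE UNIV (\<lambda>_. {..<n}). (\<Prod>i\<in>UNIV. a (c i)) * (\<Prod>i\<in>UNIV. \<sigma> (l (c i) * x $ i + b (c i))))"
    unfolding tensor_def[abs_def] ridge_sum by (subst prod_sum_PiE) (auto simp: prod.distrib)
  moreover have "(\<lambda>x::real^'m. \<Sum>c\<in>PiE UNIV (\<lambda>_. {..<n}). (\<Prod>i\<in>UNIV. a (c i)) * (\<Prod>i\<in>UNIV. \<sigma> (l (c i) * x $ i + b (c i)))) \<in> nn_class \<sigma>"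
    by (intro function_subspace_sum[OF function_subspace_nn_class] nn_class_diag finite_PiE) (auto intro!: l)
  ultimately show ?thesis by simp
qed

lemma tensor_in_Lp_closure:
  fixes h k :: "real \<Rightarrow> real"
  assumes p: "p > 1" and \<gamma>: "\<gamma> \<ge> 0" and h: "bessel_rep \<gamma> p h k" and k: "k \<in> Lp_closure p (bessel_images \<gamma> p (ridge_class \<sigma>))"
  shows "(tensor (\<lambda>_. h) :: real^'m \<Rightarrow> real) \<in> Lp_closure p (bessel_images \<gamma> p (nn_class \<sigma>))"
proof -
  let ?H = "tensor (\<lambda>_. h) :: real^'m \<Rightarrow> real" and ?X = "bessel_images \<gamma> p (nn_class \<sigma>) :: (real^'m \<Rightarrow> real) set"
  have X: "Lp_subspace p ?X" "translation_invariant ?X"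
    by (rule Lp_subspace_bessel_images[OF p function_subspace_nn_class],
        rule translation_invariant_bessel_images[OF p \<gamma> translation_invariant_nn_class])
  obtain A where A: "A \<ge> 0" and perturb: "\<And>d r \<delta>. bessel_rep \<gamma> p d r \<Longrightarrow> Lp_pow p r \<le> \<delta> \<Longrightarrow> \<delta> \<le> 1 \<Longrightarrow>
      bessel_pow_le \<gamma> p (\<lambda>x::real^'m. tensor (\<lambda>_ t. h t + d t) x - ?H x) (A * \<delta>)"
    by (rule tensor_perturbation[OF p \<gamma> h]) blast
  obtain C where tensor_le: "\<And>f g. (\<And>i::'m. bessel_rep \<gamma> p (f i) (g i)) \<Longrightarrow> bessel_pow_le \<gamma> p (tensor f) (C * (\<Prod>i\<in>UNIV. Lp_pow p (g i)))"
    by (rule tensor_bessel_pow_le[OF p \<gamma>]) blast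
  obtain G where G: "bessel_rep \<gamma> p ?H G" using tensor_le[of "\<lambda>_. h" "\<lambda>_. k"] h by (auto elim: bessel_pow_leE)
  have "G \<in> Lp_closure p ?X"
    unfolding Lp_closure_def
  proof (intro CollectI conjI allI impI)
    show "Lp_fun p G" by (rule bessel_rep_Lp(2)[OF G])
    fix e :: real assume e: "e > 0"
    define \<delta> where "\<delta> = min 1 (e / (A + 1))"
    have \<delta>: "\<delta> > 0" "\<delta> \<le> 1" using e A by (auto simp: \<delta>_def)
    have "A * \<delta> < (A + 1) * \<delta>" using \<delta> by simp
    also have "\<dots> \<le> (A + 1) * (e / (A + 1))" unfolding \<delta>_def using A by (intro mult_left_mono) auto
    also have "\<dots> = e" using A by simp
    finally have small: "A * \<delta> < e" .
    obtain r where r: "r \<in> bessel_images \<gamma> p (ridge_class \<sigma>)" "Lp_pow p (\<lambda>x. k x - r x) < \<delta>"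
      using k \<delta>(1) unfolding Lp_closure_def by blast
    obtain f where f: "f \<in> ridge_class \<sigma>" "bessel_rep \<gamma> p f r" using r(1) by (rule bessel_imagesE)
    have "bessel_rep \<gamma> p (\<lambda>x. f x - h x) (\<lambda>x. r x - k x)" using bessel_rep_linear[OF p f(2) h, of 1 "-1"] by simp
    then have "bessel_pow_le \<gamma> p (\<lambda>x. tensor (\<lambda>_. f) x - ?H x) (A * \<delta>)"
      using perturb[of "\<lambda>x. f x - h x" "\<lambda>x. r x - k x" \<delta>] r(2) \<delta>(2) Lp_pow_minus_commute[of p r k] by simp
    then obtain E where E: "bessel_rep \<gamma> p (\<lambda>x. tensor (\<lambda>_. f) x - ?H x) E" "Lp_pow p E \<le> A * \<delta>" by (rule bessel_pow_leE)
    have "bessel_rep \<gamma> p (tensor (\<lambda>_. f)) (\<lambda>x. G x + E x)" using bessel_rep_linear[OF p G E(1), of 1 1] by simp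
    then have "(\<lambda>x. G x + E x) \<in> ?X" by (rule bessel_imagesI[OF tensor_ridge_in_nn_class[OF f(1)]])
    moreover have "Lp_pow p (\<lambda>x. G x - (G x + E x)) < e" using E(2) small by (simp add: Lp_pow_def)
    ultimately show "\<exists>h\<in>?X. Lp_pow p (\<lambda>x. G x - h x) < e" by (intro bexI[where x = "\<lambda>x. G x + E x"])
  qed
  then have "weighted_conv (bessel_potential \<gamma>) G \<in> Lp_closure p ?X"
    by (rule weighted_conv_in_Lp_closure[OF X p weighted_measure_bessel_potential[OF \<gamma>]])
  then show ?thesis
    by (rule Lp_closure_cong_AE[OF X(1)]) (use bessel_rep_iff[OF p \<gamma>, of ?H G] G in \<open>auto elim!: eventually_mono\<close>)
qed

theorem nn_class_dense:
  fixes \<sigma> :: "real \<Rightarrow> real" and g :: "real^'m \<Rightarrow> real"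
  assumes p: "p > 1" and \<gamma>: "\<gamma> \<ge> 0" and \<sigma>: "bessel_rep \<gamma> p \<sigma> g\<^sub>0" and nonzero: "\<not> (AE t in lborel. \<sigma> t = 0)"
    and g: "Lp_fun p g"
  shows "g \<in> Lp_closure p (bessel_images \<gamma> p (nn_class \<sigma>))"
proof (rule Lp_closure_if_kernels[OF Lp_subspace_bessel_images[OF p function_subspace_nn_class]
      translation_invariant_bessel_images[OF p \<gamma> translation_invariant_nn_class] p integrable_gauss integral_gauss gauss_minus _ g])
  fix c :: real assume c: "c > 0"
  let ?h = "\<lambda>t::real. gauss (t /\<^sub>R c)"
  have "schwartz (\<lambda>t. complex_of_real (?h t))" using schwartz_gauss_shift[OF c, of "0::real"] by simp
  from bessel_rep_schwartz[OF p this, of \<gamma>] obtain k where k: "bessel_rep \<gamma> p ?h k" by blast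
  have "tensor (\<lambda>_. ?h) \<in> Lp_closure p (bessel_images \<gamma> p (nn_class \<sigma>) :: (real^'m \<Rightarrow> real) set)"
    by (rule tensor_in_Lp_closure[OF p \<gamma> k ridge_class_dense[OF p \<gamma> \<sigma> nonzero bessel_rep_Lp(2)[OF k]]])
  also have "tensor (\<lambda>_. ?h) = (\<lambda>x::real^'m. gauss (x /\<^sub>R c))"
    by (simp add: fun_eq_iff gauss_tensor tensor_def)
  finally show "(\<lambda>x::real^'m. gauss (x /\<^sub>R c)) \<in> Lp_closure p (bessel_images \<gamma> p (nn_class \<sigma>))" .
qed

section \<open>Zygmund norms of mixtures\<close>

lemma differentiable_remainder_le:
  fixes f :: "'a::real_normed_vector \<Rightarrow> 'b::real_normed_vector"
  assumes derivative: "\<And>x. x \<in> ball x\<^sub>0 \<delta> \<Longrightarrow> (f has_derivative D x) (at x)"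
    and G: "G \<ge> 0" and D_le: "\<And>x h. x \<in> ball x\<^sub>0 \<delta> \<Longrightarrow> norm (D x h) \<le> G * norm h" and h: "norm h < \<delta>"
  shows "norm (f (x\<^sub>0 + h) - f x\<^sub>0 - D x\<^sub>0 h) \<le> 2 * G * norm h"
proof -
  have "0 < \<delta>" using h norm_ge_zero[of h] by linarith
  then have x\<^sub>0: "x\<^sub>0 \<in> ball x\<^sub>0 \<delta>" by simp
  have "norm (f (x\<^sub>0 + h) - f x\<^sub>0) \<le> G * norm (x\<^sub>0 + h - x\<^sub>0)"
  proof (rule differentiable_bound[of "ball x\<^sub>0 \<delta>" f D])
    show "(f has_derivative D x) (at x within ball x\<^sub>0 \<delta>)" if "x \<in> ball x\<^sub>0 \<delta>" for x
      using derivative[OF that] by (rule has_derivative_at_withinI)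
    show "onorm (D x) \<le> G" if "x \<in> ball x\<^sub>0 \<delta>" for x by (rule onorm_bound[OF G D_le[OF that]])
  qed (use h x\<^sub>0 in \<open>auto simp: dist_norm\<close>)
  moreover have "norm (D x\<^sub>0 h) \<le> G * norm h" by (rule D_le[OF x\<^sub>0])
  ultimately show ?thesis using norm_triangle_ineq4[of "f (x\<^sub>0 + h) - f x\<^sub>0" "D x\<^sub>0 h"] by simp
qed

lemma
  fixes D :: "'w \<Rightarrow> 'a::real_normed_vector \<Rightarrow> 'b::{banach, second_countable_topology}"
  assumes linear: "\<And>w. linear (D w)" and D: "\<And>h. (\<lambda>w. D w h) \<in> borel_measurable M"
    and G: "integrable M G" and D_le: "\<And>w h. norm (D w h) \<le> G w * norm h"
  shows integrable_linear_dominated: "integrable M (\<lambda>w. D w h)"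
    and bounded_linear_integral_dominated: "bounded_linear (\<lambda>h. \<integral>w. D w h \<partial>M)"
proof -
  show int: "integrable M (\<lambda>w. D w h)" for h
    by (rule integrable_dominated[OF integrable_mult_left[OF G, of "norm h"] D D_le])
  show "bounded_linear (\<lambda>h. \<integral>w. D w h \<partial>M)"
  proof (rule bounded_linear_intro)
    show "(\<integral>w. D w (h + k) \<partial>M) = (\<integral>w. D w h \<partial>M) + (\<integral>w. D w k \<partial>M)" for h k
      by (simp add: linear_add[OF linear] int)
    show "(\<integral>w. D w (c *\<^sub>R h) \<partial>M) = c *\<^sub>R (\<integral>w. D w h \<partial>M)" for c h
      by (simp add: linear_scale[OF linear])
    show "norm (\<integral>w. D w h \<partial>M) \<le> norm h * (\<integral>w. G w \<partial>M)" for h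
      using order_trans[OF integral_norm_bound integral_mono[OF integrable_norm[OF int] integrable_mult_left[OF G] D_le], of h]
      by (simp add: mult.commute)
  qed
qed

lemma has_derivative_integral:
  fixes K :: "'w \<Rightarrow> 'a::real_normed_vector \<Rightarrow> 'b::{banach, second_countable_topology}"
  assumes \<delta>: "\<delta> > 0" and K: "\<And>x. integrable M (\<lambda>w. K w x)"
    and derivative: "\<And>w x. x \<in> ball x\<^sub>0 \<delta> \<Longrightarrow> (K w has_derivative D w x) (at x)"
    and D[measurable]: "\<And>h. (\<lambda>w. D w x\<^sub>0 h) \<in> borel_measurable M"
    and G: "integrable M G" and D_le: "\<And>w x h. x \<in> ball x\<^sub>0 \<delta> \<Longrightarrow> norm (D w x h) \<le> G w * norm h"
  shows "((\<lambda>x. \<integral>w. K w x \<partial>M) has_derivative (\<lambda>h. \<integral>w. D w x\<^sub>0 h \<partial>M)) (at x\<^sub>0)"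
  unfolding has_derivative_at tendsto_at_iff_sequentially
proof (intro conjI allI impI)
  have x\<^sub>0: "x\<^sub>0 \<in> ball x\<^sub>0 \<delta>" using \<delta> by simp
  have [measurable]: "(\<lambda>w. K w x) \<in> borel_measurable M" for x by (rule borel_measurable_integrable[OF K])
  note dominated = has_derivative_linear[OF derivative[OF x\<^sub>0]] D G D_le[OF x\<^sub>0]
  show "bounded_linear (\<lambda>h. \<integral>w. D w x\<^sub>0 h \<partial>M)" by (rule bounded_linear_integral_dominated[OF dominated])
  fix X :: "nat \<Rightarrow> 'a" assume nonzero: "\<forall>i. X i \<in> UNIV - {0}" and X: "X \<longlonglongrightarrow> 0"
  define q where "q = (\<lambda>n w. if norm (X n) < \<delta> then (K w (x\<^sub>0 + X n) - K w x\<^sub>0 - D w x\<^sub>0 (X n)) /\<^sub>R norm (X n) else 0)"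
  have "(\<lambda>n. \<integral>w. q n w \<partial>M) \<longlonglongrightarrow> (\<integral>w. 0 \<partial>M)"
  proof (rule tendsto_integral_dominated[where B="\<lambda>w. 2 * G w"])
    show "integrable M (\<lambda>w. 2 * G w)" using G by simp
    show "q n \<in> borel_measurable M" for n unfolding q_def by measurable
    show "(\<lambda>n. q n w) \<longlonglongrightarrow> 0" for w
    proof -
      have "((\<lambda>h. norm (K w (x\<^sub>0 + h) - K w x\<^sub>0 - D w x\<^sub>0 h) / norm h) \<circ> X) \<longlonglongrightarrow> 0"
        using derivative[OF x\<^sub>0, of w] nonzero X unfolding has_derivative_at tendsto_at_iff_sequentially by blast
      then show ?thesis by (rule Lim_null_comparison[rotated]) (auto simp: q_def divide_inverse mult.commute)
    qed
    show "norm (q n w) \<le> 2 * G w" for n w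
    proof -
      have pos: "norm (X n) > 0" using nonzero by auto
      have "0 \<le> G w * norm (X n)" by (rule order_trans[OF norm_ge_zero D_le[OF x\<^sub>0]])
      then have G_nonneg: "0 \<le> G w" using pos by (simp add: zero_le_mult_iff)
      have "norm (K w (x\<^sub>0 + X n) - K w x\<^sub>0 - D w x\<^sub>0 (X n)) \<le> 2 * G w * norm (X n)" if "norm (X n) < \<delta>"
        by (rule differentiable_remainder_le[OF derivative G_nonneg D_le that])
      then show ?thesis using G_nonneg pos by (simp add: q_def divide_inverse[symmetric] mult.commute[of "inverse _"] divide_le_eq)
    qed
  qed
  then have lim: "(\<lambda>n. norm (\<integral>w. q n w \<partial>M)) \<longlonglongrightarrow> 0" using tendsto_norm_zero by fastforce
  have "eventually (\<lambda>n. norm (X n) < \<delta>) sequentially"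
    using X \<delta> by (simp add: tendsto_iff dist_norm)
  then have "eventually (\<lambda>n. norm (\<integral>w. q n w \<partial>M) =
    norm ((\<integral>w. K w (x\<^sub>0 + X n) \<partial>M) - (\<integral>w. K w x\<^sub>0 \<partial>M) - (\<integral>w. D w x\<^sub>0 (X n) \<partial>M)) / norm (X n)) sequentially"
    by eventually_elim (simp add: q_def K integrable_linear_dominated[OF dominated] divide_inverse mult.commute)
  with lim show "((\<lambda>h. norm ((\<integral>w. K w (x\<^sub>0 + h) \<partial>M) - (\<integral>w. K w x\<^sub>0 \<partial>M) - (\<integral>w. D w x\<^sub>0 h \<partial>M)) / norm h) \<circ> X) \<longlonglongrightarrow> 0"
    unfolding comp_def by (rule Lim_transform_eventually)
qed

lemma continuous_on_integral_dominated:
  fixes K :: "'w \<Rightarrow> 'a::metric_space \<Rightarrow> 'b::{banach, second_countable_topology}"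
  assumes continuous: "\<And>w. continuous_on S (K w)" and measurable: "\<And>x. x \<in> S \<Longrightarrow> (\<lambda>w. K w x) \<in> borel_measurable M"
    and G: "integrable M G" and K_le: "\<And>w x. x \<in> S \<Longrightarrow> norm (K w x) \<le> G w"
  shows "continuous_on S (\<lambda>x. \<integral>w. K w x \<partial>M)"
  unfolding continuous_on_sequentially comp_def
proof (intro allI ballI impI, elim conjE)
  fix X x assume "x \<in> S" "\<forall>n. X n \<in> S" "X \<longlonglongrightarrow> x"
  then show "(\<lambda>n. \<integral>w. K w (X n) \<partial>M) \<longlonglongrightarrow> (\<integral>w. K w x \<partial>M)"
    using continuous measurable K_le
    by (intro tendsto_integral_dominated[OF G]) (auto simp: continuous_on_sequentially comp_def)
qed

lemma sum_Basis_mult_le: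
  fixes h :: "'a::euclidean_space"
  assumes "\<And>b. b \<in> Basis \<Longrightarrow> \<bar>u b\<bar> \<le> B"
  shows "\<bar>\<Sum>b\<in>Basis. (h \<bullet> b) * u b\<bar> \<le> (real DIM('a) * B) * norm h"
proof -
  have "\<bar>\<Sum>b\<in>Basis. (h \<bullet> b) * u b\<bar> \<le> (\<Sum>b\<in>(Basis::'a set). norm h * B)"
    using assms by (intro sum_norm_le[where f="\<lambda>b. (h \<bullet> b) * u b", simplified]) (simp add: abs_mult Basis_le_norm mult_mono)
  then show ?thesis by (simp add: mult_ac)
qed

lemma second_difference_le:
  fixes f :: "'a::euclidean_space \<Rightarrow> real"
  assumes f: "\<And>x. (f has_derivative (\<lambda>h. \<Sum>b\<in>Basis. (h \<bullet> b) * f' b x)) (at x)"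
    and f': "\<And>b x. b \<in> Basis \<Longrightarrow> (f' b has_derivative (\<lambda>h. \<Sum>c\<in>Basis. (h \<bullet> c) * f'' c b x)) (at x)"
    and f''_le: "\<And>b c x. b \<in> Basis \<Longrightarrow> c \<in> Basis \<Longrightarrow> \<bar>f'' c b x\<bar> \<le> B"
  shows "\<bar>f (x + h) + f (x - h) - 2 * f x\<bar> \<le> (real DIM('a))\<^sup>2 * B * (norm h)\<^sup>2"
proof -
  have f'_lipschitz: "\<bar>f' b y - f' b z\<bar> \<le> real DIM('a) * B * norm (y - z)" if b: "b \<in> Basis" for b y z
  proof -
    have "norm (f' b y - f' b z) \<le> real DIM('a) * B * norm (y - z)"
      by (rule differentiable_bound[OF convex_UNIV has_derivative_at_withinI[OF f'[OF b]]])
         (auto intro!: onorm_le sum_Basis_mult_le f''_le b simp: real_norm_def)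
    then show ?thesis by simp
  qed
  define g where "g = (\<lambda>y. f (y + h) - f y)"
  have g': "(g has_derivative (\<lambda>u. \<Sum>b\<in>Basis. (u \<bullet> b) * (f' b (y + h) - f' b y))) (at y)" for y
  proof -
    have "((\<lambda>y. f (y + h)) has_derivative (\<lambda>u. \<Sum>b\<in>Basis. (u \<bullet> b) * f' b (y + h))) (at y)"
      by (rule has_derivative_compose[OF _ f, of "\<lambda>y. y + h" "\<lambda>u. u", simplified]) (auto intro!: derivative_eq_intros)
    from has_derivative_diff[OF this f[of y]] show ?thesis
      unfolding g_def by (simp add: right_diff_distrib sum_subtractf)
  qed
  have "norm (g x - g (x - h)) \<le> real DIM('a) * (real DIM('a) * B * norm h) * norm (x - (x - h))"
    by (rule differentiable_bound[OF convex_UNIV has_derivative_at_withinI[OF g']])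
       (use f'_lipschitz[of _ "y + h" y for y] in \<open>auto intro!: onorm_le sum_Basis_mult_le simp: real_norm_def\<close>)
  then show ?thesis by (simp add: g_def power2_eq_square algebra_simps)
qed

lemma zyg_k_less: "s > 0 \<Longrightarrow> real (zyg_k s) < s"
  and zyg_alpha_pos: "s > 0 \<Longrightarrow> zyg_alpha s > 0"
  and zyg_alpha_le_1: "s > 0 \<Longrightarrow> zyg_alpha s \<le> 1"
  unfolding zyg_alpha_def zyg_k_def by linarith+

lemma multi_idx_nonempty: "multi_idx j \<noteq> ({} :: 'a::euclidean_space list set)"
proof -
  obtain b :: 'a where "b \<in> Basis" using nonempty_Basis by blast
  then have "replicate j b \<in> multi_idx j" by (auto simp: multi_idx_def)
  then show ?thesis by blast
qed

lemma zyg_norm_le: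
  fixes f :: "'a::euclidean_space \<Rightarrow> real"
  assumes pdiff_le: "\<And>j bs x. j \<le> zyg_k s \<Longrightarrow> bs \<in> multi_idx j \<Longrightarrow> \<bar>iter_pdiff bs f x\<bar> \<le> a j"
    and diff2_le: "\<And>bs x h. bs \<in> multi_idx (zyg_k s) \<Longrightarrow> h \<noteq> 0 \<Longrightarrow> zyg_diff2 s f bs x h \<le> b"
  shows "zyg_norm s f \<le> (\<Sum>j\<le>zyg_k s. a j) + b"
  unfolding zyg_norm_def
proof (intro add_mono sum_mono cSup_least)
  obtain h :: 'a where "h \<noteq> 0" using nonempty_Basis nonzero_Basis by blast
  then show "{zyg_diff2 s f bs x h |bs x h. bs \<in> multi_idx (zyg_k s) \<and> h \<noteq> 0} \<noteq> {}"
    using multi_idx_nonempty[of "zyg_k s"] by blast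
  show "{\<bar>iter_pdiff bs f x\<bar> |bs x. bs \<in> multi_idx j} \<noteq> {}" for j using multi_idx_nonempty[of j] by blast
qed (use assms in blast)+

lemma min_one_le_exp: fixes y :: real assumes "y \<ge> 0" shows "min y 1 \<le> 2 * (1 - exp (- y))"
proof -
  have "exp (- y) \<le> 1 / (1 + y)" using exp_ge_add_one_self[of y] assms by (simp add: exp_minus field_simps)
  moreover have "min y 1 \<le> 2 * (1 - 1 / (1 + y))" using assms mult_left_le[of y y] by (auto simp: min_def field_simps)
  ultimately show ?thesis by argo
qed

lemma powr_plus_mult_min_le:
  assumes "c > 0" shows "powr_plus (- 1 - s) t * min t c \<le> 2 * c * levy_kernel s (1 / c) t"
proof (cases "t > 0")
  case True
  have "min t c = c * min (t / c) 1" using assms by (auto simp: min_def field_simps)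
  also have "\<dots> \<le> c * (2 * (1 - exp (- (1 / c * t))))"
    using min_one_le_exp[of "t / c"] assms True by (intro mult_left_mono) auto
  finally have "powr_plus (- 1 - s) t * min t c \<le> powr_plus (- 1 - s) t * (c * (2 * (1 - exp (- (1 / c * t)))))"
    by (rule mult_left_mono) simp
  then show ?thesis by (simp only: levy_kernel_def mult_ac)
qed (simp add: levy_kernel_def powr_plus_def)

definition gamma_weight :: "real \<Rightarrow> real \<Rightarrow> real" where
  "gamma_weight s t = powr_plus (s / 2 - 1) t * exp (- t)"

lemma gamma_weight_nonneg [simp]: "gamma_weight s t \<ge> 0"
  by (simp add: gamma_weight_def)

lemma
  assumes "s > 0"
  shows integrable_gamma_weight: "integrable lborel (gamma_weight s)"
    and integral_gamma_weight: "(LINT t|lborel. gamma_weight s t) = Gamma (s / 2)"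
  using integrable_gamma[of "s / 2" 1] integral_gamma[of "s / 2" 1] assms by (simp_all add: gamma_weight_def[abs_def])

lemma gamma_weight_le: "gamma_weight s t \<le> powr_plus (s / 2 - 1) t"
  by (auto simp: gamma_weight_def powr_plus_def mult_left_le)

definition zyg_mixture_const :: "real \<Rightarrow> real \<Rightarrow> real" where
  "zyg_mixture_const s d = (4 + d\<^sup>2) * 2 * frac_powr_const (1 - zyg_alpha s / 2)"

locale zyg_mixture =
  fixes s A :: real and W :: "'a::euclidean_space list \<Rightarrow> real \<Rightarrow> 'a \<Rightarrow> real"
  assumes s: "s > 0" and A: "A \<ge> 0"
    and W_measurable [measurable]: "\<And>bs x. (\<lambda>t. W bs t x) \<in> borel_measurable borel"
    and W_derivative: "\<And>bs t x. set bs \<subseteq> Basis \<Longrightarrow> (W bs t has_derivative (\<lambda>h. \<Sum>b\<in>Basis. (h \<bullet> b) * W (b # bs) t x)) (at x)"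
    and W_le: "\<And>bs t x. set bs \<subseteq> Basis \<Longrightarrow> length bs \<le> zyg_k s + 2 \<Longrightarrow> \<bar>W bs t x\<bar> \<le> A * gamma_weight (s - real (length bs)) t"
begin

definition mixture :: "'a list \<Rightarrow> 'a \<Rightarrow> real" where
  "mixture bs x = (LINT t|lborel. W bs t x)"

lemma
  assumes "j \<le> zyg_k s"
  shows integrable_weight: "integrable lborel (\<lambda>t. A * gamma_weight (s - real j) t)"
    and integral_weight: "(LINT t|lborel. A * gamma_weight (s - real j) t) = A * Gamma ((s - real j) / 2)"
  using integrable_gamma_weight[of "s - real j"] integral_gamma_weight[of "s - real j"] zyg_k_less[OF s] assms by simp_all

lemma
  assumes "set bs \<subseteq> Basis" "length bs \<le> zyg_k s"
  shows integrable_W: "integrable lborel (\<lambda>t. W bs t x)"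
    and mixture_le: "\<bar>mixture bs x\<bar> \<le> A * Gamma ((s - real (length bs)) / 2)"
    and continuous_mixture: "continuous_on UNIV (mixture bs)"
proof -
  have W_le_weight: "norm (W bs t x) \<le> A * gamma_weight (s - real (length bs)) t" for t x using W_le[of bs t x] assms by simp
  show int: "integrable lborel (\<lambda>t. W bs t x)"
    by (rule integrable_dominated[OF integrable_weight[OF assms(2)] _ W_le_weight]) simp
  show "\<bar>mixture bs x\<bar> \<le> A * Gamma ((s - real (length bs)) / 2)"
    using Bochner_Integration.integral_norm_bound_integral[OF int integrable_weight[OF assms(2)] W_le_weight]
    by (simp only: integral_weight[OF assms(2)] mixture_def real_norm_def)
  show "continuous_on UNIV (mixture bs)"
    unfolding mixture_def[abs_def]
  proof (rule continuous_on_integral_dominated[OF _ _ integrable_weight[OF assms(2)] W_le_weight])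
    show "continuous_on UNIV (W bs t)" for t
      using W_derivative[OF assms(1)] by (intro continuous_at_imp_continuous_on ballI has_derivative_continuous) blast
  qed simp
qed

lemma mixture_has_derivative:
  assumes bs: "set bs \<subseteq> Basis" "length bs < zyg_k s"
  shows "(mixture bs has_derivative (\<lambda>h. \<Sum>b\<in>Basis. (h \<bullet> b) * mixture (b # bs) x)) (at x)"
proof -
  let ?D = "\<lambda>t x h. \<Sum>b\<in>Basis. (h \<bullet> b) * W (b # bs) t x"
  let ?G = "\<lambda>t. real DIM('a) * (A * gamma_weight (s - real (Suc (length bs))) t)"
  have "((\<lambda>x. LINT t|lborel. W bs t x) has_derivative (\<lambda>h. LINT t|lborel. ?D t x h)) (at x)"
  proof (rule has_derivative_integral[where D="?D" and G="?G" and \<delta>=1])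
    show "integrable lborel (\<lambda>t. W bs t x)" for x using bs by (intro integrable_W) auto
    show "integrable lborel ?G" using bs by (intro integrable_mult_right integrable_weight) auto
    show "norm (?D t x h) \<le> ?G t * norm h" for t x and h :: 'a
      unfolding real_norm_def by (rule sum_Basis_mult_le) (use W_le[of "b # bs" t x for b] bs in auto)
  qed (use W_derivative[OF bs(1)] in auto)
  moreover have "(LINT t|lborel. ?D t x h) = (\<Sum>b\<in>Basis. (h \<bullet> b) * mixture (b # bs) x)" for h
    unfolding mixture_def using bs integrable_W[of "b # bs" x for b] by (subst Bochner_Integration.integral_sum) auto
  ultimately show ?thesis by (simp add: mixture_def[abs_def])
qed

lemma iter_pdiff_mixture:
  "set bs \<subseteq> Basis \<Longrightarrow> length bs \<le> zyg_k s \<Longrightarrow> iter_pdiff bs (mixture []) = mixture bs"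
proof (induction bs)
  case (Cons b bs)
  have "pdiff b (mixture bs) x = mixture (b # bs) x" for x
  proof -
    have "pdiff b (mixture bs) x = (\<Sum>c\<in>Basis. (b \<bullet> c) * mixture (c # bs) x)"
      unfolding pdiff_def using frechet_derivative_at[OF mixture_has_derivative[of bs x]] Cons.prems by (auto simp: fun_eq_iff)
    also have "\<dots> = (\<Sum>c\<in>Basis. if c = b then mixture (c # bs) x else 0)"
      using Cons.prems by (intro sum.cong) (auto simp: inner_Basis)
    finally show ?thesis using Cons.prems by simp
  qed
  then have "pdiff b (mixture bs) = mixture (b # bs)" by blast
  then show ?case using Cons by simp
qed simp

text \<open>A second difference of \<open>W bs t\<close> is bounded both by its size and by its second derivative; the former bound
  is better for \<open>t \<le> (norm h)\<^sup>2\<close> and the latter for larger \<open>t\<close>, and the integral of their minimum over \<open>t\<close> is a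
  multiple of \<open>norm h powr zyg_alpha s\<close>.\<close>

lemma W_second_difference_le:
  fixes h :: 'a
  assumes bs: "bs \<in> multi_idx (zyg_k s)" and h: "h \<noteq> 0"
  shows "\<bar>W bs t (x + h) + W bs t (x - h) - 2 * W bs t x\<bar>
    \<le> (4 + (real DIM('a))\<^sup>2) * A * (2 * (norm h)\<^sup>2 * levy_kernel (1 - zyg_alpha s / 2) (1 / (norm h)\<^sup>2) t)"
proof -
  let ?v = "powr_plus (- 1 - (1 - zyg_alpha s / 2)) t" and ?d = "W bs t (x + h) + W bs t (x - h) - 2 * W bs t x"
  have bs: "set bs \<subseteq> Basis" "length bs = zyg_k s" using bs by (auto simp: multi_idx_def)
  have "gamma_weight (s - real (length bs)) t \<le> ?v * t"
  proof (cases "t > 0")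
    case True
    then have "t powr (zyg_alpha s / 2 - 1) = t powr (- 1 - (1 - zyg_alpha s / 2)) * t powr 1" by (simp only: powr_add[symmetric]) simp
    then show ?thesis using gamma_weight_le[of "zyg_alpha s" t] True bs(2) by (simp add: powr_plus_def zyg_alpha_def)
  qed (simp add: gamma_weight_def powr_plus_def)
  then have "\<bar>W bs t y\<bar> \<le> A * (?v * t)" for y using bs by (intro order_trans[OF W_le mult_left_mono[OF _ A]]) auto
  from this[of "x + h"] this[of "x - h"] this[of x] have small: "\<bar>?d\<bar> \<le> 4 * A * (?v * t)" by simp
  have "\<bar>?d\<bar> \<le> (real DIM('a))\<^sup>2 * (A * ?v) * (norm h)\<^sup>2"
  proof (rule second_difference_le[where f'="\<lambda>b. W (b # bs) t" and f''="\<lambda>c b. W (c # b # bs) t"])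
    have "gamma_weight (zyg_alpha s - 2) t \<le> ?v" using gamma_weight_le[of "zyg_alpha s - 2" t] by (simp add: diff_divide_distrib)
    moreover have "s - real (length (c # b # bs)) = zyg_alpha s - 2" for b c using bs(2) by (simp add: zyg_alpha_def)
    ultimately have "gamma_weight (s - real (length (c # b # bs))) t \<le> ?v" for b c by (simp only:)
    then show "\<bar>W (c # b # bs) t y\<bar> \<le> A * ?v" if "b \<in> Basis" "c \<in> Basis" for b c y
      using bs that by (intro order_trans[OF W_le mult_left_mono[OF _ A]]) auto
  qed (use W_derivative bs in auto)
  then have large: "\<bar>?d\<bar> \<le> (real DIM('a))\<^sup>2 * A * (?v * (norm h)\<^sup>2)" by (simp only: mult_ac)
  have "\<bar>?d\<bar> \<le> (4 + (real DIM('a))\<^sup>2) * A * (?v * min t ((norm h)\<^sup>2))"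
  proof (cases "t \<le> (norm h)\<^sup>2")
    case True
    have "?v * t \<ge> 0" by (simp add: powr_plus_def)
    then have "0 \<le> (real DIM('a))\<^sup>2 * A * (?v * t)" using A by simp
    then show ?thesis unfolding min_absorb1[OF True] distrib_right using small by linarith
  next
    case False
    have "0 \<le> 4 * A * (?v * (norm h)\<^sup>2)" using A by simp
    moreover have "min t ((norm h)\<^sup>2) = (norm h)\<^sup>2" using False by simp
    ultimately show ?thesis unfolding distrib_right using large by (simp only:)
  qed
  also have "\<dots> \<le> (4 + (real DIM('a))\<^sup>2) * A * (2 * (norm h)\<^sup>2 * levy_kernel (1 - zyg_alpha s / 2) (1 / (norm h)\<^sup>2) t)"
    using A h by (intro mult_left_mono powr_plus_mult_min_le) auto
  finally show ?thesis .
qed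

lemma zyg_diff2_mixture_le:
  fixes h :: 'a
  assumes bs: "bs \<in> multi_idx (zyg_k s)" and h: "h \<noteq> 0"
  shows "zyg_diff2 s (mixture []) bs x h \<le> A * zyg_mixture_const s (real DIM('a))"
proof -
  define \<alpha> where "\<alpha> = zyg_alpha s"
  have \<alpha>: "0 < 1 - \<alpha> / 2" "1 - \<alpha> / 2 < 1" using zyg_alpha_pos[OF s] zyg_alpha_le_1[OF s] by (auto simp: \<alpha>_def)
  define c where "c = (norm h)\<^sup>2"
  have c: "1 / c > 0" using h by (simp add: c_def)
  have [simp]: "iter_pdiff bs (mixture []) = mixture bs" using bs by (intro iter_pdiff_mixture) (auto simp: multi_idx_def)
  have int: "integrable lborel (\<lambda>t. W bs t y)" for y using bs by (intro integrable_W) (auto simp: multi_idx_def)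
  have "c * (1 / c) powr (1 - \<alpha> / 2) = c powr (\<alpha> / 2)"
    using c by (simp add: powr_divide powr_diff)
  also have "\<dots> = norm h powr \<alpha>" using h by (simp add: c_def powr_powr flip: powr_numeral)
  finally have scale: "c * (1 / c) powr (1 - \<alpha> / 2) = norm h powr \<alpha>" .
  have "\<bar>mixture bs (x + h) + mixture bs (x - h) - 2 * mixture bs x\<bar>
      = norm (LINT t|lborel. W bs t (x + h) + W bs t (x - h) - 2 * W bs t x)"
    unfolding mixture_def using int by simp
  also have "\<dots> \<le> (LINT t|lborel. (4 + (real DIM('a))\<^sup>2) * A * (2 * c * levy_kernel (1 - \<alpha> / 2) (1 / c) t))"
  proof (rule Bochner_Integration.integral_norm_bound_integral)
    show "norm (W bs t (x + h) + W bs t (x - h) - 2 * W bs t x) \<le> (4 + (real DIM('a))\<^sup>2) * A * (2 * c * levy_kernel (1 - \<alpha> / 2) (1 / c) t)" for t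
      unfolding c_def \<alpha>_def real_norm_def by (rule W_second_difference_le[OF bs h])
  qed (use int integrable_levy_kernel[OF \<alpha> c] in \<open>auto intro!: integrable_mult_right\<close>)
  also have "\<dots> = (4 + (real DIM('a))\<^sup>2) * A * (2 * c * (frac_powr_const (1 - \<alpha> / 2) * (1 / c) powr (1 - \<alpha> / 2)))"
    by (simp only: integral_mult_right_zero integral_levy_kernel[OF \<alpha> c])
  also have "\<dots> = A * zyg_mixture_const s (real DIM('a)) * (c * (1 / c) powr (1 - \<alpha> / 2))"
    by (simp only: zyg_mixture_const_def \<alpha>_def mult_ac)
  finally show ?thesis using h unfolding scale by (simp add: zyg_diff2_def \<alpha>_def divide_le_eq)
qed

lemma zygmund_mixture: "zygmund s (mixture [])"
  unfolding zygmund_def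
proof (intro conjI allI impI)
  fix bs :: "'a list" assume bs: "set bs \<subseteq> Basis"
  show "iter_pdiff bs (mixture []) differentiable at x" if "length bs < zyg_k s" for x
    using mixture_has_derivative[OF bs that, of x] iter_pdiff_mixture[OF bs] that by (auto simp: differentiable_def)
  assume length: "length bs \<le> zyg_k s"
  show "continuous_on UNIV (iter_pdiff bs (mixture []))" "bounded (range (iter_pdiff bs (mixture [])))"
    using continuous_mixture[OF bs length] mixture_le[OF bs length] by (auto simp: iter_pdiff_mixture[OF bs length] bounded_iff)
qed (auto intro!: bdd_aboveI zyg_diff2_mixture_le)

lemma zyg_norm_mixture_le:
  "zyg_norm s (mixture []) \<le> A * ((\<Sum>j\<le>zyg_k s. Gamma ((s - real j) / 2)) + zyg_mixture_const s (real DIM('a)))"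
proof -
  have "zyg_norm s (mixture []) \<le> (\<Sum>j\<le>zyg_k s. A * Gamma ((s - real j) / 2)) + A * zyg_mixture_const s (real DIM('a))"
  proof (rule zyg_norm_le[OF _ zyg_diff2_mixture_le])
    show "\<bar>iter_pdiff bs (mixture []) x\<bar> \<le> A * Gamma ((s - real j) / 2)" if "j \<le> zyg_k s" "bs \<in> multi_idx j" for j bs x
      using that mixture_le[of bs x] by (auto simp: multi_idx_def iter_pdiff_mixture)
  qed
  then show ?thesis by (simp add: distrib_left sum_distrib_left)
qed

end

section \<open>The heat representation of Bessel potentials\<close>

lemma
  fixes g K :: "'a::euclidean_space \<Rightarrow> real"
  assumes p: "p > 1" and g: "Lp_fun p g" and K: "integrable lborel K" and K_le: "\<And>v. \<bar>K v\<bar> \<le> S"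
  shows integrable_bounded_kernel: "integrable lborel (\<lambda>v. K v * g v)"
    and bounded_kernel_le: "\<bar>LINT v|lborel. K v * g v\<bar> \<le> (LINT v|lborel. \<bar>K v\<bar>) powr (1 - 1 / p) * S powr (1 / p) * Lp_norm p g"
proof -
  let ?I = "LINT v|lborel. \<bar>K v\<bar>"
  have [measurable]: "g \<in> borel_measurable borel" "K \<in> borel_measurable borel" using g K by (auto simp: Lp_fun_def)
  have S: "S \<ge> 0" using order_trans[OF abs_ge_zero K_le[of 0]] .
  have g_powr: "integrable lborel (\<lambda>v. S * \<bar>g v\<bar> powr p)" using g by (simp add: Lp_fun_def)
  have Kg: "integrable lborel (\<lambda>v. \<bar>K v\<bar> * \<bar>g v\<bar> powr p)"
    by (rule integrable_dominated[OF g_powr]) (auto simp: K_le mult_right_mono)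
  show "integrable lborel (\<lambda>v. K v * g v)" by (rule integrable_mult_if_powr[OF p K _ Kg]) simp
  have "\<bar>LINT v|lborel. K v * g v\<bar> powr p \<le> ?I powr (p - 1) * (LINT v|lborel. \<bar>K v\<bar> * \<bar>g v\<bar> powr p)"
    by (rule abs_integral_powr_le[OF p K _ Kg]) simp
  also have "(LINT v|lborel. \<bar>K v\<bar> * \<bar>g v\<bar> powr p) \<le> (LINT v|lborel. S * \<bar>g v\<bar> powr p)"
    by (rule integral_mono[OF Kg g_powr]) (simp add: K_le mult_right_mono)
  also have "(LINT v|lborel. S * \<bar>g v\<bar> powr p) = S * Lp_pow p g" by (simp add: Lp_pow_def)
  finally have "\<bar>LINT v|lborel. K v * g v\<bar> powr p \<le> ?I powr (p - 1) * (S * Lp_pow p g)" by (simp add: mult_left_mono)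
  then have "(\<bar>LINT v|lborel. K v * g v\<bar> powr p) powr (1 / p) \<le> (?I powr (p - 1) * (S * Lp_pow p g)) powr (1 / p)"
    using p by (intro powr_mono2) auto
  then show "\<bar>LINT v|lborel. K v * g v\<bar> \<le> ?I powr (1 - 1 / p) * S powr (1 / p) * Lp_norm p g"
    using S p by (simp add: powr_mult powr_powr diff_divide_distrib Lp_norm_Lp_pow)
qed

lemma poly_gauss_measurable: "poly_gauss \<kappa> a f \<Longrightarrow> f \<in> borel_measurable borel"
  by (intro borel_measurable_continuous_onI continuous_at_imp_continuous_on ballI differentiable_imp_continuous_within)
     (rule poly_gauss_differentiable)

lemma poly_gauss_le_decay:
  fixes f :: "'a::euclidean_space \<Rightarrow> real"
  assumes "poly_gauss \<kappa> a f" "\<kappa> > 0"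
  obtains C where "C \<ge> 0" "\<And>x. \<bar>f x\<bar> \<le> C * decay x"
proof -
  obtain C where C: "\<And>x. \<bar>f x\<bar> \<le> C * decay x" unfolding le_decay_iff using poly_gauss_decay[OF assms] by blast
  have "0 \<le> C * decay (0::'a)" by (rule order_trans[OF abs_ge_zero C])
  then have "C \<ge> 0" using decay_pos[of "0::'a"] by (simp add: zero_le_mult_iff)
  then show thesis using C by (rule that)
qed

lemma poly_gauss_bounded:
  fixes f :: "'a::euclidean_space \<Rightarrow> real"
  assumes "poly_gauss \<kappa> a f" "\<kappa> > 0"
  obtains C where "\<And>x. \<bar>f x\<bar> \<le> C"
proof -
  obtain C where C: "C \<ge> 0" "\<And>x. \<bar>f x\<bar> \<le> C * decay x" by (rule poly_gauss_le_decay[OF assms]) blast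
  show thesis by (rule that[of C]) (rule order_trans[OF C(2) mult_left_le[OF decay_le_1 C(1)]])
qed

lemma poly_gauss_integrable:
  assumes "poly_gauss \<kappa> a f" "\<kappa> > 0" shows "integrable lborel f"
proof -
  obtain C where "\<And>x. \<bar>f x\<bar> \<le> C * decay x" using poly_gauss_le_decay[OF assms] by blast
  then show ?thesis
    using poly_gauss_measurable[OF assms(1)] by (intro integrable_dominated[OF integrable_mult_right[OF integrable_decay, of C]]) auto
qed

lemma
  fixes f :: "'a::euclidean_space \<Rightarrow> 'b::{banach, second_countable_topology}"
  assumes f: "integrable lborel f" and r: "r > 0"
  shows integrable_scaled_reflection: "integrable lborel (\<lambda>v. f (r *\<^sub>R (x - v)))"
    and integral_scaled_reflection: "(LINT v|lborel. f (r *\<^sub>R (x - v))) = (1 / r ^ DIM('a)) *\<^sub>R (LINT v|lborel. f v)"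
proof -
  have affine: "r *\<^sub>R (x - v) = (- r) *\<^sub>R v + r *\<^sub>R x" for v by (simp add: algebra_simps)
  have [measurable]: "f \<in> borel_measurable borel" using f by auto
  show "integrable lborel (\<lambda>v. f (r *\<^sub>R (x - v)))"
    unfolding affine using f r by (subst integrable_affine_iff) auto
  show "(LINT v|lborel. f (r *\<^sub>R (x - v))) = (1 / r ^ DIM('a)) *\<^sub>R (LINT v|lborel. f v)"
    unfolding affine using r by (subst integral_affine) auto
qed

definition scaled_conv :: "('a::euclidean_space \<Rightarrow> real) \<Rightarrow> real \<Rightarrow> ('a \<Rightarrow> real) \<Rightarrow> 'a \<Rightarrow> real" where
  "scaled_conv \<psi> r g x = (LINT v|lborel. \<psi> (r *\<^sub>R (x - v)) * g v)"

lemma integrable_scaled_conv: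
  fixes \<psi> :: "'a::euclidean_space \<Rightarrow> real"
  assumes p: "p > 1" and \<psi>: "integrable lborel \<psi>" "\<And>v. \<bar>\<psi> v\<bar> \<le> S" and r: "r > 0" and g: "Lp_fun p g"
  shows "integrable lborel (\<lambda>v. \<psi> (r *\<^sub>R (x - v)) * g v)"
  by (rule integrable_bounded_kernel[OF p g integrable_scaled_reflection[OF \<psi>(1) r] \<psi>(2)])

lemma scaled_conv_le:
  fixes \<psi> :: "'a::euclidean_space \<Rightarrow> real"
  assumes p: "p > 1" and \<psi>: "integrable lborel \<psi>" "\<And>v. \<bar>\<psi> v\<bar> \<le> S" and r: "r > 0" and g: "Lp_fun p g"
  shows "\<bar>scaled_conv \<psi> r g x\<bar>
    \<le> (LINT v|lborel. \<bar>\<psi> v\<bar>) powr (1 - 1 / p) * S powr (1 / p) * r powr (real DIM('a) / p - real DIM('a)) * Lp_norm p g"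
proof -
  let ?I = "LINT v|lborel. \<bar>\<psi> v\<bar>"
  have "(LINT v|lborel. \<bar>\<psi> (r *\<^sub>R (x - v))\<bar>) = r powr (- real DIM('a)) * ?I"
    using integral_scaled_reflection[OF integrable_abs[OF \<psi>(1)] r] r by (simp add: powr_minus_divide powr_realpow)
  then have "(LINT v|lborel. \<bar>\<psi> (r *\<^sub>R (x - v))\<bar>) powr (1 - 1 / p) = ?I powr (1 - 1 / p) * r powr (real DIM('a) / p - real DIM('a))"
    by (simp add: powr_mult powr_powr algebra_simps)
  then show ?thesis
    using bounded_kernel_le[OF p g integrable_scaled_reflection[OF \<psi>(1) r, of x] \<psi>(2)] by (simp add: scaled_conv_def mult_ac)
qed

lemma poly_gauss_has_derivative_Basis:
  assumes "poly_gauss \<kappa> a f"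
  shows "(f has_derivative (\<lambda>h. \<Sum>b\<in>Basis. (h \<bullet> b) * pdiff b f x)) (at x)"
proof -
  have derivative: "(f has_derivative (\<lambda>h. pdiff h f x)) (at x)" by (rule poly_gauss_has_derivative[OF assms])
  have "pdiff h f x = (\<Sum>b\<in>Basis. (h \<bullet> b) * pdiff b f x)" for h
    using Linear_Algebra.linear_componentwise[OF has_derivative_linear[OF derivative], of h 1] by simp
  then have "(\<lambda>h. pdiff h f x) = (\<lambda>h. \<Sum>b\<in>Basis. (h \<bullet> b) * pdiff b f x)" by blast
  then show ?thesis using derivative by (simp only:)
qed

lemma poly_gauss_pdiff_le_decay:
  fixes \<psi> :: "'a::euclidean_space \<Rightarrow> real"
  assumes "poly_gauss \<kappa> a \<psi>" "\<kappa> > 0"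
  obtains B where "B \<ge> 0" "\<And>b y. b \<in> Basis \<Longrightarrow> \<bar>pdiff b \<psi> y\<bar> \<le> B * decay y"
proof -
  have "\<exists>C\<ge>0. \<forall>y. \<bar>pdiff b \<psi> y\<bar> \<le> C * decay y" for b
    using poly_gauss_le_decay[OF poly_gauss_pdiff[OF assms(1)] assms(2)] by metis
  then obtain C where C: "\<And>b. C b \<ge> 0" "\<And>b y. \<bar>pdiff b \<psi> y\<bar> \<le> C b * decay y" by metis
  show thesis
  proof (rule that[of "\<Sum>b\<in>Basis. C b"])
    show "(\<Sum>b\<in>Basis. C b) \<ge> 0" using C(1) by (simp add: sum_nonneg)
    fix b y :: 'a assume "b \<in> Basis"
    then have "C b \<le> (\<Sum>b\<in>Basis. C b)" using C(1) by (intro member_le_sum) auto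
    then show "\<bar>pdiff b \<psi> y\<bar> \<le> (\<Sum>b\<in>Basis. C b) * decay y"
      using decay_pos[of y] by (intro order_trans[OF C(2)] mult_right_mono) auto
  qed
qed

lemma decay_scaled_le:
  fixes x y v :: "'a::euclidean_space"
  assumes "r > 0" "y \<in> ball x 1"
  shows "decay (r *\<^sub>R (y - v)) \<le> (1 + r) ^ (2 * DIM('a)) * decay (r *\<^sub>R (x - v))"
proof -
  have "r *\<^sub>R (x - v) - r *\<^sub>R (y - v) = r *\<^sub>R (x - y)" by (simp add: algebra_simps)
  then have "norm (r *\<^sub>R (x - v) - r *\<^sub>R (y - v)) \<le> r" using assms by (simp add: dist_norm mult_left_le)
  then have "(1 + norm (r *\<^sub>R (x - v) - r *\<^sub>R (y - v))) ^ (2 * DIM('a)) \<le> (1 + r) ^ (2 * DIM('a))"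
    by (intro power_mono) auto
  then show ?thesis
    using decay_pos[of "r *\<^sub>R (x - v)"] by (intro order_trans[OF decay_translate_le mult_right_mono]) auto
qed

lemma scaled_conv_has_derivative:
  fixes \<psi> :: "'a::euclidean_space \<Rightarrow> real"
  assumes p: "p > 1" and \<psi>: "poly_gauss \<kappa> a \<psi>" "\<kappa> > 0" and r: "r > 0" and g: "Lp_fun p g"
  shows "(scaled_conv \<psi> r g has_derivative (\<lambda>h. \<Sum>b\<in>Basis. (h \<bullet> b) * (r * scaled_conv (pdiff b \<psi>) r g x))) (at x)"
proof -
  have [measurable]: "g \<in> borel_measurable borel" using g by (simp add: Lp_fun_def)
  have [measurable]: "pdiff b \<psi> \<in> borel_measurable borel" for b by (rule poly_gauss_measurable[OF poly_gauss_pdiff[OF \<psi>(1)]])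
  obtain B where B: "B \<ge> 0" "\<And>b y. b \<in> Basis \<Longrightarrow> \<bar>pdiff b \<psi> y\<bar> \<le> B * decay y"
    by (rule poly_gauss_pdiff_le_decay[OF \<psi>]) blast
  have int: "integrable lborel (\<lambda>v. \<phi> (r *\<^sub>R (y - v)) * g v)" if \<phi>: "poly_gauss \<kappa> a \<phi>" for \<phi> and y :: 'a
    by (rule poly_gauss_bounded[OF \<phi> \<psi>(2)]) (rule integrable_scaled_conv[OF p poly_gauss_integrable[OF \<phi> \<psi>(2)] _ r g])
  let ?D = "\<lambda>v y h. \<Sum>b\<in>Basis. (h \<bullet> b) * (r * (pdiff b \<psi> (r *\<^sub>R (y - v)) * g v))"
  let ?G = "\<lambda>v. r * (B * ((1 + r) ^ (2 * DIM('a)) * decay (r *\<^sub>R (x - v))) * \<bar>g v\<bar>)"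
  have "(scaled_conv \<psi> r g has_derivative (\<lambda>h. LINT v|lborel. ?D v x h)) (at x)"
    unfolding scaled_conv_def[abs_def]
  proof (rule has_derivative_integral[where \<delta>=1 and D="?D" and G="\<lambda>v. real DIM('a) * ?G v"])
    show "integrable lborel (\<lambda>v. \<psi> (r *\<^sub>R (x - v)) * g v)" for x by (rule int[OF \<psi>(1)])
    show "((\<lambda>x. \<psi> (r *\<^sub>R (x - v)) * g v) has_derivative ?D v y) (at y)" for v y
    proof -
      have "((\<lambda>x. r *\<^sub>R (x - v)) has_derivative (\<lambda>h. r *\<^sub>R h)) (at y)" by (auto intro!: derivative_eq_intros)
      from has_derivative_mult_left[OF has_derivative_compose[OF this poly_gauss_has_derivative_Basis[OF \<psi>(1)]], of "g v"]
      show ?thesis by (simp add: sum_distrib_right sum_distrib_left mult_ac)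
    qed
    have "integrable lborel (\<lambda>v. decay (r *\<^sub>R (x - v)) * \<bar>g v\<bar>)"
      using integrable_abs[OF integrable_scaled_conv[OF p integrable_decay _ r g, of 1 x]]
      by (simp add: abs_mult abs_of_pos decay_pos decay_le_1)
    from integrable_mult_right[OF this, of "real DIM('a) * r * B * (1 + r) ^ (2 * DIM('a))"]
    show "integrable lborel (\<lambda>v. real DIM('a) * ?G v)" by (simp only: mult_ac)
    show "norm (?D v y h) \<le> real DIM('a) * ?G v * norm h" if y: "y \<in> ball x 1" for v y h
      unfolding real_norm_def
    proof (rule sum_Basis_mult_le)
      fix b :: 'a assume b: "b \<in> Basis"
      have "\<bar>pdiff b \<psi> (r *\<^sub>R (y - v))\<bar> \<le> B * ((1 + r) ^ (2 * DIM('a)) * decay (r *\<^sub>R (x - v)))"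
        by (rule order_trans[OF B(2)[OF b] mult_left_mono[OF decay_scaled_le[OF r y] B(1)]])
      then show "\<bar>r * (pdiff b \<psi> (r *\<^sub>R (y - v)) * g v)\<bar> \<le> ?G v"
        unfolding abs_mult abs_of_pos[OF r] using r by (intro mult_left_mono mult_right_mono) auto
    qed
  qed simp_all
  moreover have "(LINT v|lborel. ?D v x h) = (\<Sum>b\<in>Basis. (h \<bullet> b) * (r * scaled_conv (pdiff b \<psi>) r g x))" for h
    unfolding scaled_conv_def using int[OF poly_gauss_pdiff[OF \<psi>(1)]] by (subst Bochner_Integration.integral_sum) auto
  ultimately show ?thesis by simp
qed

definition heat_layer :: "real \<Rightarrow> ('a::euclidean_space \<Rightarrow> real) \<Rightarrow> 'a list \<Rightarrow> real \<Rightarrow> 'a \<Rightarrow> real" where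
  "heat_layer \<gamma> g bs t x = gamma_weight \<gamma> t / Gamma (\<gamma> / 2) * sqrt (pi / t) ^ (DIM('a) + length bs)
     * scaled_conv (iter_pdiff bs gauss) (sqrt (pi / t)) g x"

lemma heat_layer_eq_0: "t \<le> 0 \<Longrightarrow> heat_layer \<gamma> g bs t x = 0"
  by (simp add: heat_layer_def gamma_weight_def powr_plus_def)

lemma heat_layer_measurable:
  fixes g :: "'a::euclidean_space \<Rightarrow> real"
  assumes [measurable]: "g \<in> borel_measurable borel"
  shows "(\<lambda>t. heat_layer \<gamma> g bs t x) \<in> borel_measurable borel"
proof -
  have [measurable]: "iter_pdiff bs (gauss :: 'a \<Rightarrow> real) \<in> borel_measurable borel"
    by (rule poly_gauss_measurable[OF poly_gauss_iter_pdiff[OF poly_gauss_gauss]])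
  show ?thesis unfolding heat_layer_def scaled_conv_def gamma_weight_def by measurable
qed

lemma heat_layer_has_derivative:
  fixes g :: "'a::euclidean_space \<Rightarrow> real"
  assumes p: "p > 1" and g: "Lp_fun p g"
  shows "(heat_layer \<gamma> g bs t has_derivative (\<lambda>h. \<Sum>b\<in>Basis. (h \<bullet> b) * heat_layer \<gamma> g (b # bs) t x)) (at x)"
proof (cases "t > 0")
  case True
  define r where "r = sqrt (pi / t)"
  have r: "r > 0" using True by (simp add: r_def)
  have "poly_gauss pi 0 (iter_pdiff bs (gauss :: 'a \<Rightarrow> real))" by (rule poly_gauss_iter_pdiff[OF poly_gauss_gauss])
  from has_derivative_mult_right[OF scaled_conv_has_derivative[OF p this pi_gt_zero r g],
      of "gamma_weight \<gamma> t / Gamma (\<gamma> / 2) * r ^ (DIM('a) + length bs)"]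
  show ?thesis unfolding heat_layer_def[abs_def] r_def[symmetric] by (simp add: sum_distrib_left sum_divide_distrib mult_ac)
next
  case False
  then have "heat_layer \<gamma> g cs t = (\<lambda>_. 0)" for cs by (simp add: heat_layer_eq_0 fun_eq_iff)
  then show ?thesis by simp
qed

lemma gamma_weight_mult_powr:
  "gamma_weight \<gamma> t * sqrt (pi / t) powr a = pi powr (a / 2) * gamma_weight (\<gamma> - a) t"
proof (cases "t > 0")
  case True
  have "sqrt (pi / t) powr a = ((pi / t) powr (1 / 2)) powr a" using True by (simp add: powr_half_sqrt)
  also have "\<dots> = pi powr (a / 2) * t powr (- (a / 2))" using True by (simp add: powr_powr powr_divide powr_minus_divide)
  finally have "gamma_weight \<gamma> t * sqrt (pi / t) powr a = pi powr (a / 2) * ((t powr (\<gamma> / 2 - 1) * t powr (- (a / 2))) * exp (- t))"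
    using True by (simp add: gamma_weight_def powr_plus_def)
  also have "t powr (\<gamma> / 2 - 1) * t powr (- (a / 2)) = t powr ((\<gamma> - a) / 2 - 1)"
    unfolding powr_add[symmetric] by (rule arg_cong[where f="(powr) t"]) (simp add: field_simps)
  finally show ?thesis using True by (simp add: gamma_weight_def powr_plus_def)
qed (simp add: gamma_weight_def powr_plus_def)

lemma heat_layer_le:
  fixes bs :: "'a::euclidean_space list"
  assumes p: "p > 1" and \<gamma>: "\<gamma> > 0"
  obtains C where "C \<ge> 0"
    "\<And>g t x. Lp_fun p g \<Longrightarrow> \<bar>heat_layer \<gamma> g bs t x\<bar> \<le> C * Lp_norm p g * gamma_weight (\<gamma> - real DIM('a) / p - real (length bs)) t"
proof -
  define \<psi> where "\<psi> = iter_pdiff bs (gauss :: 'a \<Rightarrow> real)"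
  have \<psi>: "poly_gauss pi 0 \<psi>" unfolding \<psi>_def by (rule poly_gauss_iter_pdiff[OF poly_gauss_gauss])
  obtain S where \<psi>_le: "\<And>x. \<bar>\<psi> x\<bar> \<le> S" by (rule poly_gauss_bounded[OF \<psi> pi_gt_zero]) blast
  define C where "C = (LINT v|lborel. \<bar>\<psi> v\<bar>) powr (1 - 1 / p) * S powr (1 / p)"
  define m where "m = real DIM('a)"
  define j where "j = real (length bs)"
  have Gamma: "Gamma (\<gamma> / 2) > 0" using \<gamma> by (intro Gamma_real_pos) simp
  show thesis
  proof (rule that[of "C * pi powr ((j + m / p) / 2) / Gamma (\<gamma> / 2)"])
    show "C * pi powr ((j + m / p) / 2) / Gamma (\<gamma> / 2) \<ge> 0" using Gamma by (simp add: C_def)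
    fix g :: "'a \<Rightarrow> real" and t x assume g: "Lp_fun p g"
    define r where "r = sqrt (pi / t)"
    have "\<bar>heat_layer \<gamma> g bs t x\<bar> \<le> C / Gamma (\<gamma> / 2) * Lp_norm p g * (gamma_weight \<gamma> t * r powr (j + m / p))"
    proof (cases "t > 0")
      case True
      have r: "r > 0" using True by (simp add: r_def)
      have "\<bar>heat_layer \<gamma> g bs t x\<bar> = gamma_weight \<gamma> t / Gamma (\<gamma> / 2) * r powr (m + j) * \<bar>scaled_conv \<psi> r g x\<bar>"
        using Gamma r powr_realpow[OF r, of "DIM('a) + length bs"]
        by (simp add: heat_layer_def r_def[symmetric] \<psi>_def[symmetric] abs_mult m_def j_def)
      also have "\<dots> \<le> gamma_weight \<gamma> t / Gamma (\<gamma> / 2) * r powr (m + j) * (C * r powr (m / p - m) * Lp_norm p g)"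
        using scaled_conv_le[OF p poly_gauss_integrable[OF \<psi> pi_gt_zero] \<psi>_le r g] Gamma
        unfolding C_def m_def by (intro mult_left_mono) auto
      also have "\<dots> = C / Gamma (\<gamma> / 2) * Lp_norm p g * (gamma_weight \<gamma> t * (r powr (m + j) * r powr (m / p - m)))" by simp
      also have "r powr (m + j) * r powr (m / p - m) = r powr (j + m / p)"
        unfolding powr_add[symmetric] by (simp add: algebra_simps)
      finally show ?thesis .
    qed (simp add: heat_layer_eq_0 gamma_weight_def powr_plus_def)
    then show "\<bar>heat_layer \<gamma> g bs t x\<bar>
        \<le> C * pi powr ((j + m / p) / 2) / Gamma (\<gamma> / 2) * Lp_norm p g * gamma_weight (\<gamma> - real DIM('a) / p - real (length bs)) t"
      unfolding r_def gamma_weight_mult_powr by (simp add: m_def j_def algebra_simps)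
  qed
qed

lemma heat_layer_le_uniform:
  assumes p: "p > 1" and \<gamma>: "\<gamma> > 0"
  obtains B where "B \<ge> 0"
    "\<And>(bs :: 'a::euclidean_space list) g t x. set bs \<subseteq> Basis \<Longrightarrow> length bs \<le> n \<Longrightarrow> Lp_fun p g \<Longrightarrow>
      \<bar>heat_layer \<gamma> g bs t x\<bar> \<le> B * Lp_norm p g * gamma_weight (\<gamma> - real DIM('a) / p - real (length bs)) t"
proof -
  let ?bound = "\<lambda>C bs. \<forall>g t x. Lp_fun p g \<longrightarrow>
    \<bar>heat_layer \<gamma> g bs t x\<bar> \<le> C * Lp_norm p g * gamma_weight (\<gamma> - real DIM('a) / p - real (length (bs :: 'a list))) t"
  have "\<exists>C\<ge>0. ?bound C bs" for bs by (rule heat_layer_le[OF p \<gamma>]) blast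
  then obtain C where C: "\<And>bs. C bs \<ge> 0" "\<And>bs. ?bound (C bs) bs" by metis
  define L where "L = {bs::'a list. set bs \<subseteq> Basis \<and> length bs \<le> n}"
  have L: "finite L" unfolding L_def by (rule finite_lists_length_le) simp
  show thesis
  proof (rule that[of "\<Sum>bs\<in>L. C bs"])
    show "(\<Sum>bs\<in>L. C bs) \<ge> 0" using C(1) by (simp add: sum_nonneg)
    fix bs :: "'a list" and g :: "'a \<Rightarrow> real" and t x
    assume "set bs \<subseteq> Basis" "length bs \<le> n" and g: "Lp_fun p g"
    then have "C bs \<le> (\<Sum>bs\<in>L. C bs)" using C(1) L by (intro member_le_sum) (auto simp: L_def)
    then have "C bs * Lp_norm p g * gamma_weight (\<gamma> - real DIM('a) / p - real (length bs)) t
        \<le> (\<Sum>bs\<in>L. C bs) * Lp_norm p g * gamma_weight (\<gamma> - real DIM('a) / p - real (length bs)) t"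
      by (intro mult_right_mono) (auto simp: Lp_norm_Lp_pow)
    with C(2) g show "\<bar>heat_layer \<gamma> g bs t x\<bar>
        \<le> (\<Sum>bs\<in>L. C bs) * Lp_norm p g * gamma_weight (\<gamma> - real DIM('a) / p - real (length bs)) t"
      by (blast intro: order_trans)
  qed
qed

lemma heat_layer_gauss_mixture:
  fixes g :: "'a::euclidean_space \<Rightarrow> real"
  assumes [measurable]: "g \<in> borel_measurable borel"
  shows "(LINT z|lborel. (1 / Gamma (\<gamma> / 2) * (powr_plus (\<gamma> / 2 - 1) t * exp (- (1 * t))) * gauss z) * g (x + diag_scale (\<lambda>_. max 0 t) z))
    = heat_layer \<gamma> g [] t x"
proof (cases "t > 0")
  case True
  define c where "c = sqrt (t / pi)"
  have c: "c > 0" using True by (simp add: c_def)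
  have scale: "sqrt (pi / t) = 1 / c" by (simp add: c_def real_sqrt_divide)
  let ?k = "gamma_weight \<gamma> t / Gamma (\<gamma> / 2)"
  have "(LINT z|lborel. (1 / Gamma (\<gamma> / 2) * (powr_plus (\<gamma> / 2 - 1) t * exp (- (1 * t))) * gauss z) * g (x + diag_scale (\<lambda>_. max 0 t) z))
      = (LINT z|lborel. ?k * (gauss ((1 / c) *\<^sub>R (x - (c *\<^sub>R z + x))) * g (c *\<^sub>R z + x)))"
    using c True by (simp add: gamma_weight_def diag_scale_const c_def[symmetric] mult.assoc add.commute gauss_minus)
  also have "\<dots> = ?k * ((1 / \<bar>c\<bar> ^ DIM('a)) *\<^sub>R scaled_conv gauss (1 / c) g x)"
    using integral_affine[of c "\<lambda>v. gauss ((1 / c) *\<^sub>R (x - v)) * g v" x] c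
    unfolding integral_mult_right_zero scaled_conv_def by simp
  also have "\<dots> = heat_layer \<gamma> g [] t x"
    unfolding heat_layer_def scale using c by (simp add: power_one_over)
  finally show ?thesis .
qed (simp add: heat_layer_eq_0 powr_plus_def)

lemma bessel_rep_heat_layer:
  fixes g :: "'a::euclidean_space \<Rightarrow> real"
  assumes p: "p > 1" and \<gamma>: "\<gamma> > 0" and g: "Lp_fun p g"
    and measurable: "(\<lambda>x. LINT t|lborel. heat_layer \<gamma> g [] t x) \<in> borel_measurable borel"
  shows "bessel_rep \<gamma> p (\<lambda>x. LINT t|lborel. heat_layer \<gamma> g [] t x) g"
proof -
  have [measurable]: "g \<in> borel_measurable borel" using g by (simp add: Lp_fun_def)
  let ?k = "\<lambda>t. 1 / Gamma (\<gamma> / 2) * (powr_plus (\<gamma> / 2 - 1) t * exp (- (1 * t)))"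
  let ?M = "lborel \<Otimes>\<^sub>M (lborel :: 'a measure) :: (real \<times> 'a) measure"
  let ?w = "\<lambda>(t, z::'a). ?k t * gauss z" and ?Y = "\<lambda>(t, z::'a). diag_scale (\<lambda>_. 1 * max 0 t) z"
  have k: "integrable lborel ?k" using \<gamma> by (intro integrable_mult_right integrable_gamma) auto
  have w: "integrable ?M ?w"
    by (rule integrable_gauss_mixture[OF sigma_finite_lborel k, where c="\<lambda>t b. 1 * max 0 t"]) auto
  have Y: "?Y \<in> borel_measurable ?M"
    by (rule diag_scale_measurable[OF sigma_finite_lborel k, where c="\<lambda>t b. 1 * max 0 t"]) auto
  obtain N where N: "weighted_measure N" "\<And>\<xi>. weighted_fourier N \<xi> = (\<integral>w. of_real (?w w) * character \<xi> (?Y w) \<partial>?M)"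
    "\<And>x. weighted_conv N g x = (\<integral>w. ?w w * g (x + ?Y w) \<partial>?M)"
    by (rule weighted_measure_exists[OF w Y]) (use \<open>g \<in> borel_measurable borel\<close> in blast)
  have "weighted_fourier N \<xi> = of_real (LINT t|lborel. ?k t * exp (- diag_form (\<lambda>b. 1 * max 0 t) \<xi>))" for \<xi>
    unfolding N(2) by (rule fourier_gauss_mixture[OF sigma_finite_lborel k, where c="\<lambda>t b. 1 * max 0 t"]) auto
  also have "(LINT t|lborel. ?k t * exp (- diag_form (\<lambda>b. 1 * max 0 t) \<xi>)) = (1 + (norm \<xi>)\<^sup>2) powr (- (\<gamma> / 2))" for \<xi> :: 'a
    using integral_gauss_mixture_gamma[of "\<gamma> / 2" "\<lambda>_. 1"] \<gamma> by (simp add: diag_form_const)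
  finally have rep: "bessel_rep \<gamma> p (weighted_conv N g) g" by (rule bessel_rep_of_kernel[OF p N(1) _ g])
  have "AE x in lborel. integrable ?M (\<lambda>w. ?w w * g (x + ?Y w))"
  proof (rule AE_integrable_mixture[OF p lborel_pair.sigma_finite_measure_axioms _ w])
    note [measurable] = Y
    show "(\<lambda>(w, x). g (x + ?Y w)) \<in> borel_measurable (?M \<Otimes>\<^sub>M borel)" by measurable
    show "Lp_fun p (\<lambda>x. g (x + ?Y w))" for w by (rule Lp_fun_translate[OF g])
    show "integrable ?M (\<lambda>w. \<bar>?w w\<bar> * Lp_pow p (\<lambda>x. g (x + ?Y w)))" using w by (simp add: Lp_pow_translate[OF g])
  qed
  then have "AE x in lborel. weighted_conv N g x = (LINT t|lborel. heat_layer \<gamma> g [] t x)"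
  proof eventually_elim
    case (elim x)
    have "weighted_conv N g x = (LINT t|lborel. (LINT z|lborel. ?w (t, z) * g (x + ?Y (t, z))))"
      unfolding N(3) using lborel_pair.integral_fst'[OF elim] by simp
    then show ?case by (simp add: heat_layer_gauss_mixture[simplified])
  qed
  then show ?thesis by (rule bessel_rep_cong_AE[OF rep measurable])
qed

theorem zygmund_embedding:
  fixes p \<gamma> :: real
  assumes p: "p > 1" and s_pos: "\<gamma> - real DIM('a::euclidean_space) / p > 0"
  obtains C where "C \<ge> 0"
    "\<And>g :: 'a \<Rightarrow> real. Lp_fun p g \<Longrightarrow> \<exists>f. bessel_rep \<gamma> p f g \<and> zygmund (\<gamma> - real DIM('a) / p) f \<and>
      zyg_norm (\<gamma> - real DIM('a) / p) f \<le> C * Lp_norm p g"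
proof -
  define s where "s = \<gamma> - real DIM('a) / p"
  have "real DIM('a) / p > 0" using p by simp
  then have \<gamma>: "\<gamma> > 0" using s_pos by linarith
  obtain B where B: "B \<ge> 0" "\<And>(bs :: 'a list) g t x. set bs \<subseteq> Basis \<Longrightarrow> length bs \<le> zyg_k s + 2 \<Longrightarrow> Lp_fun p g \<Longrightarrow>
      \<bar>heat_layer \<gamma> g bs t x\<bar> \<le> B * Lp_norm p g * gamma_weight (s - real (length bs)) t"
    unfolding s_def by (rule heat_layer_le_uniform[OF p \<gamma>]) blast
  define D where "D = (\<Sum>j\<le>zyg_k s. Gamma ((s - real j) / 2)) + zyg_mixture_const s (real DIM('a))"
  show thesis
  proof (rule that[of "B * \<bar>D\<bar>"], unfold s_def[symmetric])
    show "B * \<bar>D\<bar> \<ge> 0" using B(1) by simp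
    fix g :: "'a \<Rightarrow> real" assume g: "Lp_fun p g"
    interpret zyg_mixture s "B * Lp_norm p g" "heat_layer \<gamma> g"
    proof
      show "(\<lambda>t. heat_layer \<gamma> g bs t x) \<in> borel_measurable borel" for bs x
        using g by (intro heat_layer_measurable) (simp add: Lp_fun_def)
    qed (use s_pos B g heat_layer_has_derivative[OF p g] in \<open>auto simp: s_def Lp_norm_Lp_pow\<close>)
    have "mixture [] \<in> borel_measurable borel" by (intro borel_measurable_continuous_onI continuous_mixture) auto
    then have "bessel_rep \<gamma> p (mixture []) g" unfolding mixture_def[abs_def] by (rule bessel_rep_heat_layer[OF p \<gamma> g])
    moreover have "B * Lp_norm p g * D \<le> B * Lp_norm p g * \<bar>D\<bar>" using A by (intro mult_left_mono) auto
    then have "zyg_norm s (mixture []) \<le> B * \<bar>D\<bar> * Lp_norm p g"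
      using zyg_norm_mixture_le unfolding D_def by (simp add: mult_ac)
    ultimately show "\<exists>f. bessel_rep \<gamma> p f g \<and> zygmund s f \<and> zyg_norm s f \<le> B * \<bar>D\<bar> * Lp_norm p g"
      using zygmund_mixture by blast
  qed
qed

section \<open>Density of the network class\<close>

lemma nn_class_approx:
  fixes f :: "real^'m \<Rightarrow> real"
  assumes p: "p > 1" and \<gamma>: "\<gamma> \<ge> 0" and \<sigma>: "bessel_space \<gamma> p \<sigma>" "\<not> (AE t in lborel. \<sigma> t = 0)"
    and f: "bessel_rep \<gamma> p f g" and \<epsilon>: "\<epsilon> > 0"
  obtains F e where "F \<in> nn_class \<sigma>" "bessel_rep \<gamma> p (\<lambda>x. F x - f x) e" "Lp_norm p e \<le> \<epsilon>"
proof -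
  obtain g\<^sub>0 where g\<^sub>0: "bessel_rep \<gamma> p \<sigma> g\<^sub>0" using \<sigma>(1) by (auto simp: bessel_space_def)
  have "g \<in> Lp_closure p (bessel_images \<gamma> p (nn_class \<sigma>))" by (rule nn_class_dense[OF p \<gamma> g\<^sub>0 \<sigma>(2) bessel_rep_Lp(2)[OF f]])
  moreover have "\<epsilon> powr p > 0" using \<epsilon> by simp
  ultimately obtain F h where F: "F \<in> nn_class \<sigma>" "bessel_rep \<gamma> p F h" and near: "Lp_pow p (\<lambda>x. g x - h x) < \<epsilon> powr p"
    unfolding Lp_closure_def bessel_images_def by blast
  have "Lp_pow p (\<lambda>x. h x - g x) powr (1 / p) \<le> (\<epsilon> powr p) powr (1 / p)"
    using near p by (intro powr_mono2) (auto simp: Lp_pow_minus_commute[of p h g])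
  also have "\<dots> = \<epsilon>" using \<epsilon> p by (simp add: powr_powr)
  finally have "Lp_norm p (\<lambda>x. h x - g x) \<le> \<epsilon>" by (simp add: Lp_norm_Lp_pow)
  moreover have "bessel_rep \<gamma> p (\<lambda>x. F x - f x) (\<lambda>x. h x - g x)" using bessel_rep_linear[OF p F(2) f, of 1 "-1"] by simp
  ultimately show thesis using F(1) that by blast
qed

lemma nn_class_zygmund_approx:
  fixes f :: "real^'m \<Rightarrow> real"
  assumes p: "p > 1" and \<gamma>: "\<gamma> \<ge> 0" and \<sigma>: "bessel_space \<gamma> p \<sigma>" "\<not> (AE t in lborel. \<sigma> t = 0)"
    and f: "bessel_rep \<gamma> p f g" and s: "\<gamma> - real CARD('m) / p > 0"
  obtains f\<^sub>0 where "AE x in lborel. f\<^sub>0 x = f x" "zygmund (\<gamma> - real CARD('m) / p) f\<^sub>0"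
    "\<And>\<epsilon>. \<epsilon> > 0 \<Longrightarrow> \<exists>F\<in>nn_class \<sigma>. \<exists>h. (AE x in lborel. h x = F x - f\<^sub>0 x) \<and>
      zygmund (\<gamma> - real CARD('m) / p) h \<and> zyg_norm (\<gamma> - real CARD('m) / p) h \<le> \<epsilon>"
proof -
  obtain C where C: "C \<ge> 0" and embedding: "\<And>g::real^'m \<Rightarrow> real. Lp_fun p g \<Longrightarrow> \<exists>f. bessel_rep \<gamma> p f g \<and>
      zygmund (\<gamma> - real CARD('m) / p) f \<and> zyg_norm (\<gamma> - real CARD('m) / p) f \<le> C * Lp_norm p g"
    using zygmund_embedding[OF p, where 'a="real^'m", of \<gamma>] s by auto
  obtain f\<^sub>0 where f\<^sub>0: "bessel_rep \<gamma> p f\<^sub>0 g" "zygmund (\<gamma> - real CARD('m) / p) f\<^sub>0" using embedding[OF bessel_rep_Lp(2)[OF f]] by blast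
  have f\<^sub>0_eq: "AE x in lborel. f\<^sub>0 x = f x" by (rule bessel_rep_unique[OF p \<gamma> f\<^sub>0(1) f])
  show thesis
  proof (rule that[OF f\<^sub>0_eq f\<^sub>0(2)])
    fix \<epsilon> :: real assume "\<epsilon> > 0"
    then have \<epsilon>: "\<epsilon> / (C + 1) > 0" using C by simp
    obtain F e where F: "F \<in> nn_class \<sigma>" and e: "bessel_rep \<gamma> p (\<lambda>x. F x - f x) e" "Lp_norm p e \<le> \<epsilon> / (C + 1)"
      by (rule nn_class_approx[OF p \<gamma> \<sigma> f \<epsilon>])
    obtain h where h: "bessel_rep \<gamma> p h e" "zygmund (\<gamma> - real CARD('m) / p) h" "zyg_norm (\<gamma> - real CARD('m) / p) h \<le> C * Lp_norm p e"
      using embedding[OF bessel_rep_Lp(2)[OF e(1)]] by blast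
    have "C * Lp_norm p e \<le> (C + 1) * (\<epsilon> / (C + 1))" using e(2) C by (intro mult_mono) (auto simp: Lp_norm_Lp_pow)
    also have "\<dots> = \<epsilon>" using C by simp
    finally have "zyg_norm (\<gamma> - real CARD('m) / p) h \<le> \<epsilon>" using h(3) by simp
    moreover have "AE x in lborel. h x = F x - f\<^sub>0 x"
      using bessel_rep_unique[OF p \<gamma> h(1) e(1)] f\<^sub>0_eq by eventually_elim simp
    ultimately show "\<exists>F\<in>nn_class \<sigma>. \<exists>h. (AE x in lborel. h x = F x - f\<^sub>0 x) \<and>
        zygmund (\<gamma> - real CARD('m) / p) h \<and> zyg_norm (\<gamma> - real CARD('m) / p) h \<le> \<epsilon>" using F h(2) by blast
  qed
qed

theorem theorem1p8:
  fixes \<gamma> p :: real and \<sigma> :: "real \<Rightarrow> real" and f :: "real^'m \<Rightarrow> real"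
  assumes "\<gamma> \<ge> 0" and "p > 1"
    and "\<not> (AE t in lborel. \<sigma> t = 0)"
    and "bessel_space \<gamma> p \<sigma>"
    and "bessel_space \<gamma> p f"
  shows "(\<forall>\<epsilon>>0. \<exists>F\<in>nn_class \<sigma>. \<exists>g. bessel_rep \<gamma> p (\<lambda>x. F x - f x) g \<and> Lp_norm p g \<le> \<epsilon>)
    \<and> (\<gamma> - real CARD('m) / p > 0 \<longrightarrow>
        (\<exists>f0. (AE x in lborel. f0 x = f x) \<and> zygmund (\<gamma> - real CARD('m) / p) f0 \<and>
           (\<forall>\<epsilon>>0. \<exists>F\<in>nn_class \<sigma>. \<exists>h. (AE x in lborel. h x = F x - f0 x) \<and>
              zygmund (\<gamma> - real CARD('m) / p) h \<and> zyg_norm (\<gamma> - real CARD('m) / p) h \<le> \<epsilon>)))"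
proof -
  obtain g where f: "bessel_rep \<gamma> p f g" using assms(5) by (auto simp: bessel_space_def)
  note approx = nn_class_approx[OF assms(2,1,4,3) f] and zygmund_approx = nn_class_zygmund_approx[OF assms(2,1,4,3) f]
  show ?thesis
  proof (intro conjI allI impI)
    show "\<exists>F\<in>nn_class \<sigma>. \<exists>g. bessel_rep \<gamma> p (\<lambda>x. F x - f x) g \<and> Lp_norm p g \<le> \<epsilon>" if "\<epsilon> > 0" for \<epsilon>
      by (rule approx[OF that]) blast
    show "\<exists>f0. (AE x in lborel. f0 x = f x) \<and> zygmund (\<gamma> - real CARD('m) / p) f0 \<and>
        (\<forall>\<epsilon>>0. \<exists>F\<in>nn_class \<sigma>. \<exists>h. (AE x in lborel. h x = F x - f0 x) \<and>
          zygmund (\<gamma> - real CARD('m) / p) h \<and> zyg_norm (\<gamma> - real CARD('m) / p) h \<le> \<epsilon>)"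
      if "\<gamma> - real CARD('m) / p > 0"
      by (rule zygmund_approx[OF that]) blast
  qed
qed

end
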